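(* Let the observations obey $y_{i_1,i_2,i_3}=f_{n_1,n_2,n_3}(i_1\tau_1,i_2\tau_2,i_3\tau_3)+\varepsilon_{i_1,i_2,i_3}$ for $1\le i_j\le n_j$, $j=1,2,3$, with the local alternative $$f_{n_1,n_2,n_3}(t,r_2,r_3)-f_0(t,r_2,r_3)=\frac{\delta(t,r_2,r_3)}{n_1^{1/2}n_2^{1/2}n_3^{1/2}},$$ where $\delta$ is a nonzero deterministic function on $[0,\overline\tau_1]\times[0,\overline\tau_2]\times[0,\overline\tau_3]$. Suppose the noise random field $\{\varepsilon_{i_1,i_2,i_3}\}$ is weakly stationary with mean zero and satisfies $$(n_1n_2n_3)^{-1/2}\sum_{i_1=1}^{\lfloor n_1v_1\rfloor}\sum_{i_2=1}^{\lfloor n_2v_2\rfloor}\sum_{i_3=1}^{\lfloor n_3v_3\rfloor}\varepsilon_{i_1,i_2,i_3}\Rightarrow\sigma B(v_1,v_2,v_3)\quad\text{in } D[0,1]^3$$ as $\min_{1\le i\le 3}n_i\to\infty$, for some constant $\sigma^2\in(0,\infty)$, where $B$ is the standard Brownian motion on $[0,1]^3$. Suppose that either (a) $\delta$ is continuous and $n_j\tau_j\to\overline\tau_j$, $j=1,2,3$, as $\min_{1\le i\le 3}n_i\to\infty$; or (b) $\delta$ is of bounded variation in the sense of Hardy and Krause and $n_j\tau_j=\overline\tau_j$, $j=1,2,3$. Then the process $$\mathcal{F}_n(s,t,r_2,r_3)=\sqrt{\tau_1\tau_2\tau_3}\sum_{l_1=1}^{\lfloor n_1s\rfloor}\sum_{l_2=1}^{n_2}\sum_{l_3=1}^{n_3}\left[y_{l_1,l_2,l_3}-f_0(l_1\tau_1,l_2\tau_2,l_3\tau_3)\right]\varphi(t-l_1\tau_1,r_2-l_2\tau_2,r_3-l_3\tau_3)$$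 satisfies $\mathcal{F}_n(s,t,r_2,r_3)\Rightarrow\mathcal{F}^{\delta}(s,t,r_2,r_3)$ as $\min_{1\le i\le 3}n_i\to\infty$, as processes indexed by $(s,t,r_2,r_3)\in[s_0,1]\times[0,\overline{\tau}_1]\times[0,\overline{\tau}_2]\times[0,\overline{\tau}_3]$ (weak convergence in the Skorohod space on this box), where $$\mathcal{F}^{\delta}(s,t,r_2,r_3):=\mathcal{F}(s,t,r_2,r_3)+\frac{1}{\sqrt{\overline{\tau}_1\overline{\tau}_2\overline{\tau}_3}}\int_0^{s\overline{\tau}_1}\int_0^{\overline{\tau}_2}\int_0^{\overline{\tau}_3}\varphi(t-z_1,r_2-z_2,r_3-z_3)\,\delta(z_1,z_2,z_3)\,\mathrm{d}z_3\mathrm{d}z_2\mathrm{d}z_1$$ and $$\mathcal{F}(s,t,r_2,r_3):=\sqrt{\overline{\tau}_1\overline{\tau}_2\overline{\tau}_3}\,\sigma\int_0^s\int_0^1\int_0^1\varphi(t-\overline{\tau}_1z_1,r_2-\overline{\tau}_2z_2,r_3-\overline{\tau}_3z_3)\,\mathrm{d}B(z_1,z_2,z_3).$$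
   Context: Setting. Constants $s_0\in(0,1)$, $\Omega_1,\Omega_2,\Omega_3\in(0,\infty)$ and $\overline\tau_1,\overline\tau_2,\overline\tau_3\in(0,\infty)$ are fixed. For sample sizes $n_1,n_2,n_3\in\mathbb N$ there are sampling periods $\tau_j=\tau_{n_j}>0$; the sampling points $(i_1\tau_1,i_2\tau_2,i_3\tau_3)$, $1\le i_j\le n_j$, lie in $[0,\overline\tau_1]\times[0,\overline\tau_2]\times[0,\overline\tau_3]$ (so that $\delta$ is defined there). $f_0$ is a given reference signal. The subscript $n$ stands for dependence on $(n_1,n_2,n_3)$. Kernel. $\varphi(t,r_2,r_3)=\frac{\sin(\Omega_1t)}{\pi t}\frac{\sin(\Omega_2r_2)}{\pi r_2}\frac{\sin(\Omega_3r_3)}{\pi r_3}$, each factor being set equal to $\Omega_j/\pi$ at argument $0$. Notation. For $u\subseteq\{1,\dots,q\}$, $-u$ denotes its complement and $x_u$ the subvector of $x\in\mathbb R^q$ with indices in $u$; for disjoint $u,v$, $x_u:z_v$ is the point with coordinates $x_j$ ($j\in u$) and $z_j$ ($j\in v$). The $q$-fold alternating sum is $[f]_a^b=\sum_{v\subseteq\{1,\dots,q\}}(-1)^{|v|}f(a_v:b_{-v})$. Variation. The Vitali variation $V_{[a,b]}(f)$ is the supremum, over all product partitions (ladders) of $[a,b]$, of the sum over the cells $[y,y^+]$ of $|[f]_y^{y^+}|$. The variation in the sense of Hardy and Krause is $V_{HK}(f)=\sum_{\emptyset\ne u\subseteq\{1,\dots,q\}}V_{[a_u,b_u]}\big(f(x_u:b_{-u})\big)$,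 where $f(x_u:b_{-u})$ is viewed as a function of $x_u$; $f$ is of bounded variation in the sense of Hardy and Krause if $V_{HK}(f)<\infty$. Brownian motion. The standard Brownian motion $B$ on $[0,1]^q$ is the process with a.s. continuous paths, vanishing when some coordinate is $0$, whose increments $B(W)=[B]_s^t$ over pairwise disjoint blocks $W=\prod_j(s_j,t_j]$ are independent normal with mean zero and variance equal to the Lebesgue measure of $W$. Skorohod space. For a box $I\subset\mathbb R^q$, $D(I)$ (written $D[0,1]^q$ for $I=[0,1]^q$) is the space of functions $f:I\to\mathbb R$ such that at each $t\in I$ the limit of $f$ exists along each of the $2^q$ quadrants $\{s\in I: s_pR_pt_p,\ 1\le p\le q\}$, $R_p\in\{<,\ge\}$, and $f(t)$ equals the limit along the quadrant with all $R_p$ equal to $\ge$. It carries the usual multiparameter Skorohod topology (Straf; Bickel–Wichura): $f_n\to f$ iff there are coordinatewise time changes $\lambda_n$ of $I$ (each coordinate an increasing homeomorphism) with $\sup|\lambda_n-\mathrm{id}|\to0$ and $\sup|f_n-f\circ\lambda_n|\to0$. "$\Rightarrow$" is weak convergence. Stochastic integral. The integral with respect to $B$ is a pathwise multivariate Riemann–Stieltjes integral defined through integration by parts. For functions $g,h$ on $[a,b]\subset\mathbb R^q$, $\int_a^b h\,\mathrm dg$ is the limit, as the mesh tends to $0$, of sums over the cells $[y,y^+]$ of product partitions of $h(\tilde y)[g]_{y}^{y^+}$, $\tilde y\in[y,y^+]$. When $h$ is not of bounded variation (here $h=B$), one puts $$\int_a^b g\,\mathrm dh:=[hg]_a^b+(-1)^q\int_a^b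 h\,\mathrm dg+\sum_{v\subseteq\{1,\dots,q\},\,1\le|v|\le q-1}(-1)^{|v|}\int_{a_v}^{b_v}[h\,\mathrm dg]_{a_{-v}}^{b_{-v}},$$ where $\int_{a_v}^{b_v}[h\,\mathrm dg]_{a_{-v}}^{b_{-v}}=\sum_{w\subseteq -v}(-1)^{|w|}\int_{a_v}^{b_v}h\,\mathrm dg$ with the variables in $w$ fixed at $a_w$, those in $(-v)\setminus w$ fixed at $b$, and integration over the variables in $v$. The constant $\sigma^2$ is the long-run variance of the noise: $\sigma^2=\lim\mathrm{Var}\big((n_1n_2n_3)^{-1/2}\sum_{i_1\le n_1}\sum_{i_2\le n_2}\sum_{i_3\le n_3}\varepsilon_{i_1,i_2,i_3}\big)=\sum_{k\in\mathbb Z^3}\mathbb E(\varepsilon_{0}\varepsilon_{k})$. *)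

theory Defs
  imports "HOL-Probability.Probability"
begin

section \<open>Boxes, alternating sums and ladders\<close>

text \<open>
  The coordinate indices \<open>1, \<dots>, q\<close> are the elements of \<^term>\<open>Basis\<close>, so index sets are
  subsets \<open>u \<subseteq> Basis\<close>, and the complement \<open>-u\<close> is \<^term>\<open>Basis - u\<close>. A subvector
  \<open>x\<^sub>u\<close> is always used together with values for the remaining coordinates, so functions
  of \<open>x\<^sub>u\<close> are functions of the full vector whose coordinates outside \<open>u\<close> are frozen.
\<close>

definition glue :: "'a set \<Rightarrow> 'a \<Rightarrow> 'a \<Rightarrow> 'a::euclidean_space" where
  "glue u x z = (\<Sum>i\<in>Basis. (if i \<in> u then x \<bullet> i else z \<bullet> i) *\<^sub>R i)"

text \<open>The alternating sum \<open>[f]\<^sub>a\<^sup>b\<close> in the coordinates \<open>u\<close>; the other coordinates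
  are those of \<open>b\<close>.\<close>

definition alt_sum :: "'a set \<Rightarrow> ('a \<Rightarrow> real) \<Rightarrow> 'a \<Rightarrow> 'a::euclidean_space \<Rightarrow> real" where
  "alt_sum u f a b = (\<Sum>v\<in>Pow u. (-1) ^ card v * f (glue v a b))"

text \<open>A ladder divides \<open>[a\<^sub>i, b\<^sub>i]\<close>, for each \<open>i \<in> u\<close>, by the points
  \<open>p i 0 < \<dots> < p i (m i)\<close>. The cells of the product partition are indexed by \<open>k\<close> with
  \<open>k i < m i\<close>; cell \<open>k\<close> has lower corner \<open>corner u p k c\<close> and upper corner
  \<open>corner u p (\<lambda>i. Suc (k i)) c\<close>, where \<open>c\<close> supplies the frozen coordinates.\<close>

definition ladder ::
  "'a set \<Rightarrow> 'a \<Rightarrow> 'a \<Rightarrow> ('a \<Rightarrow> nat) \<Rightarrow> ('a::euclidean_space \<Rightarrow> nat \<Rightarrow> real) \<Rightarrow> bool" where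
  "ladder u a b m p \<longleftrightarrow>
     (\<forall>i\<in>u. p i 0 = a \<bullet> i \<and> p i (m i) = b \<bullet> i \<and> (\<forall>k<m i. p i k < p i (Suc k)))"

definition cells :: "'a set \<Rightarrow> ('a \<Rightarrow> nat) \<Rightarrow> ('a::euclidean_space \<Rightarrow> nat) set" where
  "cells u m = (\<Pi>\<^sub>E i\<in>u. {..<m i})"

definition corner ::
  "'a set \<Rightarrow> ('a \<Rightarrow> nat \<Rightarrow> real) \<Rightarrow> ('a \<Rightarrow> nat) \<Rightarrow> 'a \<Rightarrow> 'a::euclidean_space" where
  "corner u p k c = (\<Sum>i\<in>Basis. (if i \<in> u then p i (k i) else c \<bullet> i) *\<^sub>R i)"


section \<open>Variation in the sense of Vitali and of Hardy and Krause\<close>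

definition vitali_variation ::
  "'a set \<Rightarrow> 'a \<Rightarrow> 'a \<Rightarrow> 'a \<Rightarrow> ('a::euclidean_space \<Rightarrow> real) \<Rightarrow> ennreal" where
  "vitali_variation u a b c f =
     (SUP (m, p) \<in> {(m, p). ladder u a b m p}.
        ennreal (\<Sum>k\<in>cells u m. \<bar>alt_sum u f (corner u p k c) (corner u p (\<lambda>i. Suc (k i)) c)\<bar>))"

definition hardy_krause_variation ::
  "'a \<Rightarrow> 'a \<Rightarrow> ('a::euclidean_space \<Rightarrow> real) \<Rightarrow> ennreal" where
  "hardy_krause_variation a b f = (\<Sum>u\<in>Pow Basis - {{}}. vitali_variation u a b b f)"

definition bounded_variation_hk :: "'a \<Rightarrow> 'a \<Rightarrow> ('a::euclidean_space \<Rightarrow> real) \<Rightarrow> bool" where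
  "bounded_variation_hk a b f \<longleftrightarrow> hardy_krause_variation a b f < \<infinity>"


section \<open>Multivariate Riemann--Stieltjes integrals\<close>

text \<open>\<open>\<integral> h dg\<close> over \<open>[a\<^sub>u, b\<^sub>u]\<close>, the coordinates outside \<open>u\<close> of both \<open>h\<close> and \<open>g\<close>
  being fixed at those of \<open>c\<close>. Upper and lower corners agree outside \<open>u\<close>, so the tags
  have these coordinates as well.\<close>

definition has_rs_integral ::
  "'a set \<Rightarrow> 'a \<Rightarrow> 'a \<Rightarrow> 'a \<Rightarrow> ('a \<Rightarrow> real) \<Rightarrow> ('a::euclidean_space \<Rightarrow> real) \<Rightarrow> real \<Rightarrow> bool" where
  "has_rs_integral u a b c h g I \<longleftrightarrow>
     (\<forall>\<epsilon>>0. \<exists>\<eta>>0. \<forall>m p \<xi>.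
        ladder u a b m p \<and>
        (\<forall>i\<in>u. \<forall>k<m i. p i (Suc k) - p i k < \<eta>) \<and>
        (\<forall>k\<in>cells u m. \<xi> k \<in> cbox (corner u p k c) (corner u p (\<lambda>i. Suc (k i)) c))
        \<longrightarrow> \<bar>(\<Sum>k\<in>cells u m. h (\<xi> k) *
                alt_sum u g (corner u p k c) (corner u p (\<lambda>i. Suc (k i)) c)) - I\<bar> < \<epsilon>)"

definition rs_integral ::
  "'a set \<Rightarrow> 'a \<Rightarrow> 'a \<Rightarrow> 'a \<Rightarrow> ('a \<Rightarrow> real) \<Rightarrow> ('a::euclidean_space \<Rightarrow> real) \<Rightarrow> real" where
  "rs_integral u a b c h g = (THE I. has_rs_integral u a b c h g I)"

text \<open>\<open>\<integral>\<^sub>a\<^sup>b g dh\<close> for an integrator \<open>h\<close> that need not be of bounded variation.\<close>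

definition parts_integral ::
  "'a \<Rightarrow> 'a \<Rightarrow> ('a \<Rightarrow> real) \<Rightarrow> ('a::euclidean_space \<Rightarrow> real) \<Rightarrow> real" where
  "parts_integral a b g h =
     alt_sum Basis (\<lambda>x. h x * g x) a b
     + (-1) ^ DIM('a) * rs_integral Basis a b b h g
     + (\<Sum>v | v \<subseteq> Basis \<and> 1 \<le> card v \<and> card v \<le> DIM('a) - 1.
          (-1) ^ card v *
          (\<Sum>w\<in>Pow (Basis - v). (-1) ^ card w * rs_integral v a b (glue w a b) h g))"


section \<open>The multiparameter Skorohod space\<close>

text \<open>The quadrant at \<open>t\<close> with \<open>R\<^sub>p\<close> equal to \<open><\<close> for \<open>p \<in> u\<close> and to \<open>\<ge>\<close> otherwise.\<close>

definition quadrant :: "'a \<Rightarrow> 'a \<Rightarrow> 'a set \<Rightarrow> 'a \<Rightarrow> 'a::euclidean_space set" where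
  "quadrant a b u t =
     {s \<in> cbox a b. \<forall>i\<in>Basis. if i \<in> u then s \<bullet> i < t \<bullet> i else s \<bullet> i \<ge> t \<bullet> i}"

text \<open>A function on the box is represented by a function that is \<^const>\<open>undefined\<close> off the box.
  A limit along a quadrant that does not accumulate at \<open>t\<close> imposes no condition.\<close>

definition skorohod_space :: "'a \<Rightarrow> 'a \<Rightarrow> ('a::euclidean_space \<Rightarrow> real) set" where
  "skorohod_space a b =
     {f \<in> extensional (cbox a b). \<forall>t\<in>cbox a b.
        (\<forall>u\<subseteq>Basis. \<exists>L. (f \<longlongrightarrow> L) (at t within quadrant a b u t)) \<and>
        (f \<longlongrightarrow> f t) (at t within quadrant a b {} t)}"

definition time_change :: "'a \<Rightarrow> 'a \<Rightarrow> ('a \<Rightarrow> 'a::euclidean_space) \<Rightarrow> bool" where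
  "time_change a b \<theta> \<longleftrightarrow>
     (\<exists>\<mu> \<nu>. (\<forall>i\<in>Basis. strict_mono_on {a \<bullet> i..b \<bullet> i} (\<mu> i) \<and>
                     homeomorphism {a \<bullet> i..b \<bullet> i} {a \<bullet> i..b \<bullet> i} (\<mu> i) (\<nu> i)) \<and>
            (\<forall>t\<in>cbox a b. \<theta> t = (\<Sum>i\<in>Basis. \<mu> i (t \<bullet> i) *\<^sub>R i)))"

definition skorohod_near ::
  "'a \<Rightarrow> 'a \<Rightarrow> real \<Rightarrow> ('a \<Rightarrow> real) \<Rightarrow> ('a::euclidean_space \<Rightarrow> real) \<Rightarrow> bool" where
  "skorohod_near a b \<epsilon> f g \<longleftrightarrow>
     (\<exists>\<theta>. time_change a b \<theta> \<and>
        (\<forall>t\<in>cbox a b. norm (\<theta> t - t) < \<epsilon> \<and> \<bar>g t - f (\<theta> t)\<bar> < \<epsilon>))"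

text \<open>The topology in which the sets \<open>{g. skorohod_near a b \<epsilon> f g}\<close> are a neighbourhood base
  at \<open>f\<close>. Lemma \<open>limitin_skorohod_iff\<close> below shows that its convergent sequences are
  the usual ones.\<close>

definition skorohod_topology :: "'a \<Rightarrow> 'a \<Rightarrow> ('a::euclidean_space \<Rightarrow> real) topology" where
  "skorohod_topology a b = topology (\<lambda>U. U \<subseteq> skorohod_space a b \<and>
     (\<forall>f\<in>U. \<exists>\<epsilon>>0. \<forall>g\<in>skorohod_space a b. skorohod_near a b \<epsilon> f g \<longrightarrow> g \<in> U))"

definition skorohod_borel :: "'a \<Rightarrow> 'a \<Rightarrow> ('a::euclidean_space \<Rightarrow> real) measure" where
  "skorohod_borel a b = sigma (skorohod_space a b) {U. openin (skorohod_topology a b) U}"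

lemma skorohod_near_mono:
  assumes "skorohod_near a b d f g" "d \<le> e"
  shows "skorohod_near a b e f g"
  using assms unfolding skorohod_near_def by (meson order_less_le_trans)

lemma openin_skorohod_topology:
  "openin (skorohod_topology a b) U \<longleftrightarrow> U \<subseteq> skorohod_space a b \<and>
     (\<forall>f\<in>U. \<exists>\<epsilon>>0. \<forall>g\<in>skorohod_space a b. skorohod_near a b \<epsilon> f g \<longrightarrow> g \<in> U)"
proof -
  let ?P = "\<lambda>U. U \<subseteq> skorohod_space a b \<and>
     (\<forall>f\<in>U. \<exists>\<epsilon>>0. \<forall>g\<in>skorohod_space a b. skorohod_near a b \<epsilon> f g \<longrightarrow> g \<in> U)"
  have "istopology ?P"
    unfolding istopology_def
  proof (intro conjI allI impI ballI)
    fix S T f assume S: "?P S" and T: "?P T" and f: "f \<in> S \<inter> T"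
    obtain d where d: "d > 0" "\<forall>g\<in>skorohod_space a b. skorohod_near a b d f g \<longrightarrow> g \<in> S"
      using S f by blast
    obtain e where e: "e > 0" "\<forall>g\<in>skorohod_space a b. skorohod_near a b e f g \<longrightarrow> g \<in> T"
      using T f by blast
    have "g \<in> S \<inter> T" if "g \<in> skorohod_space a b" "skorohod_near a b (min d e) f g" for g
      using d(2) e(2) that skorohod_near_mono[OF that(2) min.cobounded1]
        skorohod_near_mono[OF that(2) min.cobounded2] by blast
    moreover have "0 < min d e" using d(1) e(1) by simp
    ultimately show "\<exists>\<epsilon>>0. \<forall>g\<in>skorohod_space a b. skorohod_near a b \<epsilon> f g \<longrightarrow> g \<in> S \<inter> T"
      by blast
  next
    fix K f assume K: "\<forall>S\<in>K. ?P S" and f: "f \<in> \<Union>K"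
    then obtain S where S: "S \<in> K" "f \<in> S" by blast
    then have "\<exists>\<epsilon>>0. \<forall>g\<in>skorohod_space a b. skorohod_near a b \<epsilon> f g \<longrightarrow> g \<in> S"
      using K by blast
    then show "\<exists>\<epsilon>>0. \<forall>g\<in>skorohod_space a b. skorohod_near a b \<epsilon> f g \<longrightarrow> g \<in> \<Union>K"
      using S by blast
  qed blast+
  then show ?thesis
    unfolding skorohod_topology_def by (simp add: topology_inverse')
qed

lemma topspace_skorohod_topology [simp]:
  "topspace (skorohod_topology a b) = skorohod_space a b"
proof
  show "topspace (skorohod_topology a b) \<subseteq> skorohod_space a b"
    using openin_topspace[of "skorohod_topology a b"] unfolding openin_skorohod_topology by (rule conjunct1)
  have "openin (skorohod_topology a b) (skorohod_space a b)"
    unfolding openin_skorohod_topology by (auto intro: exI[of _ 1])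
  then show "skorohod_space a b \<subseteq> topspace (skorohod_topology a b)"
    by (rule openin_subset)
qed

lemma time_change_in_cbox:
  assumes "time_change a b \<mu>" "t \<in> cbox a b"
  shows "\<mu> t \<in> cbox a b"
proof -
  obtain m n where mn: "\<And>i. i \<in> Basis \<Longrightarrow> homeomorphism {a \<bullet> i..b \<bullet> i} {a \<bullet> i..b \<bullet> i} (m i) (n i)"
    "\<mu> t = (\<Sum>i\<in>Basis. m i (t \<bullet> i) *\<^sub>R i)"
    using assms unfolding time_change_def by blast
  have "m i (t \<bullet> i) \<in> {a \<bullet> i..b \<bullet> i}" if "i \<in> Basis" for i
    using mn(1)[OF that] assms(2) that unfolding homeomorphism_def mem_box by auto
  then show ?thesis
    unfolding mem_box by (simp add: mn(2))
qed

lemma time_change_compose: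
  assumes "time_change a b \<kappa>" "time_change a b \<mu>"
  shows "time_change a b (\<kappa> \<circ> \<mu>)"
proof -
  obtain k k' where k: "\<forall>i\<in>Basis. strict_mono_on {a \<bullet> i..b \<bullet> i} (k i) \<and>
        homeomorphism {a \<bullet> i..b \<bullet> i} {a \<bullet> i..b \<bullet> i} (k i) (k' i)"
      "\<forall>t\<in>cbox a b. \<kappa> t = (\<Sum>i\<in>Basis. k i (t \<bullet> i) *\<^sub>R i)"
    using assms(1) unfolding time_change_def by blast
  obtain m m' where m: "\<forall>i\<in>Basis. strict_mono_on {a \<bullet> i..b \<bullet> i} (m i) \<and>
        homeomorphism {a \<bullet> i..b \<bullet> i} {a \<bullet> i..b \<bullet> i} (m i) (m' i)"
      "\<forall>t\<in>cbox a b. \<mu> t = (\<Sum>i\<in>Basis. m i (t \<bullet> i) *\<^sub>R i)"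
    using assms(2) unfolding time_change_def by blast
  have "strict_mono_on {a \<bullet> i..b \<bullet> i} (k i \<circ> m i) \<and>
      homeomorphism {a \<bullet> i..b \<bullet> i} {a \<bullet> i..b \<bullet> i} (k i \<circ> m i) (m' i \<circ> k' i)" if i: "i \<in> Basis" for i
  proof
    show "homeomorphism {a \<bullet> i..b \<bullet> i} {a \<bullet> i..b \<bullet> i} (k i \<circ> m i) (m' i \<circ> k' i)"
      using k m i by (blast intro: homeomorphism_compose)
    have "m i x \<in> {a \<bullet> i..b \<bullet> i}" if "x \<in> {a \<bullet> i..b \<bullet> i}" for x
      using m i that unfolding homeomorphism_def by blast
    then show "strict_mono_on {a \<bullet> i..b \<bullet> i} (k i \<circ> m i)"
      using k(1) m(1) i by (simp add: monotone_on_def)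
  qed
  moreover have "(\<kappa> \<circ> \<mu>) t = (\<Sum>i\<in>Basis. (k i \<circ> m i) (t \<bullet> i) *\<^sub>R i)" if t: "t \<in> cbox a b" for t
  proof -
    have "(\<kappa> \<circ> \<mu>) t = (\<Sum>i\<in>Basis. k i (\<mu> t \<bullet> i) *\<^sub>R i)"
      using k(2) time_change_in_cbox[OF assms(2) t] by simp
    also have "\<dots> = (\<Sum>i\<in>Basis. (k i \<circ> m i) (t \<bullet> i) *\<^sub>R i)"
      using m(2) t by (intro sum.cong) auto
    finally show ?thesis .
  qed
  ultimately show ?thesis
    unfolding time_change_def
    by (intro exI[of _ "\<lambda>i. k i \<circ> m i"] exI[of _ "\<lambda>i. m' i \<circ> k' i"]) auto
qed

lemma time_change_id: "time_change a b (\<lambda>t. t)"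
  unfolding time_change_def
  by (intro exI[of _ "\<lambda>i x. x"])
    (simp add: monotone_on_def euclidean_representation homeomorphism_def)

lemma skorohod_near_trans:
  assumes "skorohod_near a b d f g" "skorohod_near a b e g h"
  shows "skorohod_near a b (d + e) f h"
proof -
  obtain k where k: "time_change a b k" "\<And>t. t \<in> cbox a b \<Longrightarrow> norm (k t - t) < d \<and> \<bar>g t - f (k t)\<bar> < d"
    using assms(1) unfolding skorohod_near_def by blast
  obtain m where m: "time_change a b m" "\<And>t. t \<in> cbox a b \<Longrightarrow> norm (m t - t) < e \<and> \<bar>h t - g (m t)\<bar> < e"
    using assms(2) unfolding skorohod_near_def by blast
  have "norm ((k \<circ> m) t - t) < d + e \<and> \<bar>h t - f ((k \<circ> m) t)\<bar> < d + e" if t: "t \<in> cbox a b" for t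
  proof -
    have *: "norm (k (m t) - m t) < d" "\<bar>g (m t) - f (k (m t))\<bar> < d"
      using k(2)[OF time_change_in_cbox[OF m(1) t]] by auto
    have "norm (k (m t) - t) \<le> norm (k (m t) - m t) + norm (m t - t)"
      using norm_triangle_ineq[of "k (m t) - m t" "m t - t"] by simp
    then show ?thesis
      using * m(2)[OF t] by auto
  qed
  then show ?thesis
    unfolding skorohod_near_def using time_change_compose[OF k(1) m(1)] by blast
qed

lemma limitin_skorohod_near_iff:
  assumes "f \<in> skorohod_space a b" "\<And>n. X n \<in> skorohod_space a b"
  shows "limitin (skorohod_topology a b) X f F \<longleftrightarrow>
    (\<forall>\<epsilon>>0. eventually (\<lambda>n. skorohod_near a b \<epsilon> f (X n)) F)"
proof
  assume lim: "limitin (skorohod_topology a b) X f F"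
  show "\<forall>\<epsilon>>0. eventually (\<lambda>n. skorohod_near a b \<epsilon> f (X n)) F"
  proof (intro allI impI)
    fix e :: real assume e: "e > 0"
    define V where "V = {g \<in> skorohod_space a b. \<exists>d<e. skorohod_near a b d f g}"
    have "openin (skorohod_topology a b) V"
      unfolding openin_skorohod_topology
    proof (intro conjI ballI)
      fix g assume "g \<in> V"
      then obtain d where d: "d < e" "skorohod_near a b d f g" unfolding V_def by blast
      have "h \<in> V" if "h \<in> skorohod_space a b" "skorohod_near a b ((e - d) / 2) g h" for h
      proof -
        have "skorohod_near a b (d + (e - d) / 2) f h"
          by (rule skorohod_near_trans[OF d(2) that(2)])
        moreover have "d + (e - d) / 2 < e" using d(1) by (simp add: field_simps)
        ultimately show ?thesis using that(1) unfolding V_def by blast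
      qed
      then show "\<exists>\<epsilon>>0. \<forall>h\<in>skorohod_space a b. skorohod_near a b \<epsilon> g h \<longrightarrow> h \<in> V"
        using d(1) by (intro exI[of _ "(e - d) / 2"]) auto
    qed (auto simp: V_def)
    moreover have "skorohod_near a b (e / 2) f f"
      unfolding skorohod_near_def using time_change_id e by (intro exI[of _ "\<lambda>t. t"]) auto
    then have "f \<in> V"
      using assms(1) e unfolding V_def by (auto intro!: exI[of _ "e / 2"])
    ultimately have "eventually (\<lambda>n. X n \<in> V) F"
      using lim unfolding limitin_def by blast
    then show "eventually (\<lambda>n. skorohod_near a b e f (X n)) F"
      by (rule eventually_mono) (auto simp: V_def intro: skorohod_near_mono)
  qed
next
  assume near: "\<forall>\<epsilon>>0. eventually (\<lambda>n. skorohod_near a b \<epsilon> f (X n)) F"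
  show "limitin (skorohod_topology a b) X f F"
    unfolding limitin_def
  proof (intro conjI allI impI)
    fix U assume U: "openin (skorohod_topology a b) U \<and> f \<in> U"
    then obtain e where e: "e > 0" "\<forall>g\<in>skorohod_space a b. skorohod_near a b e f g \<longrightarrow> g \<in> U"
      unfolding openin_skorohod_topology by blast
    show "eventually (\<lambda>n. X n \<in> U) F"
      using near[rule_format, OF e(1)] by (rule eventually_mono) (use e(2) assms(2) in auto)
  qed (use assms(1) in simp)
qed

lemma limitin_skorohod_iff:
  assumes "f \<in> skorohod_space a b" "\<And>n. X n \<in> skorohod_space a b"
  shows "limitin (skorohod_topology a b) X f sequentially \<longleftrightarrow>
    (\<exists>\<theta>. (\<forall>n. time_change a b (\<theta> n)) \<and>
       uniform_limit (cbox a b) \<theta> (\<lambda>t. t) sequentially \<and>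
       uniform_limit (cbox a b) (\<lambda>n t. X n t - f (\<theta> n t)) (\<lambda>t. 0) sequentially)"
  (is "_ \<longleftrightarrow> ?R")
  unfolding limitin_skorohod_near_iff[OF assms]
proof
  assume near: "\<forall>\<epsilon>>0. \<forall>\<^sub>F n in sequentially. skorohod_near a b \<epsilon> f (X n)"
  define E where "E = (\<lambda>n. {e. e > 0 \<and> skorohod_near a b e f (X n)})"
  have bdd: "bdd_below (E n)" for n unfolding E_def by (rule bdd_belowI[of _ 0]) auto
  have "\<exists>l. time_change a b l \<and> (E n \<noteq> {} \<longrightarrow> (\<forall>t\<in>cbox a b.
     norm (l t - t) < Inf (E n) + 1 / Suc n \<and> \<bar>X n t - f (l t)\<bar> < Inf (E n) + 1 / Suc n))" for n
  proof (cases "E n = {}")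
    case True
    then show ?thesis using time_change_id by blast
  next
    case False
    have "Inf (E n) < Inf (E n) + 1 / Suc n" by simp
    then obtain e where "e \<in> E n" "e < Inf (E n) + 1 / Suc n"
      using cInf_less_iff[OF False bdd] by blast
    then have "skorohod_near a b (Inf (E n) + 1 / Suc n) f (X n)"
      unfolding E_def by (auto intro: skorohod_near_mono)
    then show ?thesis unfolding skorohod_near_def by blast
  qed
  then have "\<exists>l. \<forall>n. time_change a b (l n) \<and> (E n \<noteq> {} \<longrightarrow> (\<forall>t\<in>cbox a b.
     norm (l n t - t) < Inf (E n) + 1 / Suc n \<and> \<bar>X n t - f (l n t)\<bar> < Inf (E n) + 1 / Suc n))"
    by (intro choice allI)
  then obtain l where l: "\<And>n. time_change a b (l n) \<and> (E n \<noteq> {} \<longrightarrow> (\<forall>t\<in>cbox a b.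
     norm (l n t - t) < Inf (E n) + 1 / Suc n \<and> \<bar>X n t - f (l n t)\<bar> < Inf (E n) + 1 / Suc n))"
    by blast
  have ev: "\<forall>\<^sub>F n in sequentially. \<forall>t\<in>cbox a b. norm (l n t - t) < e \<and> \<bar>X n t - f (l n t)\<bar> < e"
    if e: "e > 0" for e
  proof -
    have "\<forall>\<^sub>F n in sequentially. skorohod_near a b (e / 2) f (X n)" using near e by simp
    moreover have "\<forall>\<^sub>F n in sequentially. 1 / real (Suc n) < e / 2"
      using e LIMSEQ_inverse_real_of_nat order_tendstoD(2)[of "\<lambda>n. inverse (real (Suc n))" 0 _ "e / 2"]
      by (simp add: inverse_eq_divide)
    ultimately show ?thesis
    proof eventually_elim
      case (elim n)
      have mem: "e / 2 \<in> E n" using elim(1) e unfolding E_def by simp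
      then have "E n \<noteq> {}" by blast
      have "Inf (E n) \<le> e / 2" by (rule cInf_lower[OF mem bdd])
      then have "Inf (E n) + 1 / Suc n < e" using elim(2) by linarith
      then show ?case using l[of n] \<open>E n \<noteq> {}\<close> by (meson order_less_trans)
    qed
  qed
  show ?R
  proof (intro exI[of _ l] conjI allI)
    show "uniform_limit (cbox a b) l (\<lambda>t. t) sequentially"
      unfolding uniform_limit_iff dist_norm using eventually_mono[OF ev] by simp
    show "uniform_limit (cbox a b) (\<lambda>n t. X n t - f (l n t)) (\<lambda>t. 0) sequentially"
      unfolding uniform_limit_iff dist_norm using eventually_mono[OF ev] by simp
  qed (use l in blast)
next
  assume ?R
  then obtain l where l: "\<And>n. time_change a b (l n)"
    "uniform_limit (cbox a b) l (\<lambda>t. t) sequentially"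
    "uniform_limit (cbox a b) (\<lambda>n t. X n t - f (l n t)) (\<lambda>t. 0) sequentially"
    by blast
  show "\<forall>\<epsilon>>0. \<forall>\<^sub>F n in sequentially. skorohod_near a b \<epsilon> f (X n)"
  proof (intro allI impI)
    fix e :: real assume "e > 0"
    then have "\<forall>\<^sub>F n in sequentially. \<forall>t\<in>cbox a b. dist (l n t) t < e"
      "\<forall>\<^sub>F n in sequentially. \<forall>t\<in>cbox a b. dist (X n t - f (l n t)) 0 < e"
      using l(2,3) unfolding uniform_limit_iff by auto
    then show "\<forall>\<^sub>F n in sequentially. skorohod_near a b e f (X n)"
    proof eventually_elim
      case (elim n)
      then show ?case
        unfolding skorohod_near_def using l(1) by (intro exI[of _ "l n"]) (auto simp: dist_norm)
    qed
  qed
qed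


section \<open>Weak convergence of processes\<close>

definition weak_conv_measures ::
  "'b topology \<Rightarrow> ('n \<Rightarrow> 'b measure) \<Rightarrow> 'b measure \<Rightarrow> 'n filter \<Rightarrow> bool" where
  "weak_conv_measures T \<mu> \<nu> F \<longleftrightarrow>
     (\<forall>H :: 'b \<Rightarrow> real. continuous_map T euclideanreal H \<and> bounded (H ` topspace T) \<longrightarrow>
        ((\<lambda>n. \<integral>x. H x \<partial>\<mu> n) \<longlongrightarrow> (\<integral>x. H x \<partial>\<nu>)) F)"

text \<open>Limit processes such as Brownian motion are only almost surely continuous, and pathwise
  integrals with respect to them are only almost surely defined. The law of a process \<open>X\<close> on
  the Skorohod space is therefore that of a Borel random element almost surely equal to
  \<open>X\<close> on the box; it does not depend on the choice of this random element.\<close>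

definition skorohod_version ::
  "'m measure \<Rightarrow> 'a \<Rightarrow> 'a \<Rightarrow> ('m \<Rightarrow> 'a \<Rightarrow> real) \<Rightarrow> ('m \<Rightarrow> 'a::euclidean_space \<Rightarrow> real) \<Rightarrow> bool" where
  "skorohod_version M a b X X' \<longleftrightarrow>
     X' \<in> measurable M (skorohod_borel a b) \<and> (AE \<omega> in M. X' \<omega> = restrict (X \<omega>) (cbox a b))"

definition weak_conv_skorohod ::
  "'a \<Rightarrow> 'a \<Rightarrow> 'm measure \<Rightarrow> ('n \<Rightarrow> 'm \<Rightarrow> 'a \<Rightarrow> real) \<Rightarrow>
   'w measure \<Rightarrow> ('w \<Rightarrow> 'a::euclidean_space \<Rightarrow> real) \<Rightarrow> 'n filter \<Rightarrow> bool" where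
  "weak_conv_skorohod a b M X N Y F \<longleftrightarrow>
     (\<exists>X' Y'. (\<forall>n. skorohod_version M a b (X n) (X' n)) \<and> skorohod_version N a b Y Y' \<and>
        weak_conv_measures (skorohod_topology a b)
          (\<lambda>n. distr M (skorohod_borel a b) (X' n)) (distr N (skorohod_borel a b) Y') F)"


section \<open>Brownian motion and weakly stationary random fields\<close>

definition block :: "'a \<Rightarrow> 'a \<Rightarrow> 'a::euclidean_space set" where
  "block s t = {x. \<forall>i\<in>Basis. s \<bullet> i < x \<bullet> i \<and> x \<bullet> i \<le> t \<bullet> i}"

text \<open>Blocks are given by pairs of corners, and only nonempty blocks are considered; the
  increment over an empty block is \<open>0\<close>.\<close>

definition standard_brownian_motion ::
  "'w measure \<Rightarrow> ('w \<Rightarrow> 'a::euclidean_space \<Rightarrow> real) \<Rightarrow> bool" where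
  "standard_brownian_motion N B \<longleftrightarrow>
     prob_space N \<and>
     (\<forall>t\<in>cbox 0 One. (\<lambda>\<omega>. B \<omega> t) \<in> borel_measurable N) \<and>
     (AE \<omega> in N. continuous_on (cbox 0 One) (B \<omega>)) \<and>
     (AE \<omega> in N. \<forall>t\<in>cbox 0 One. (\<exists>i\<in>Basis. t \<bullet> i = 0) \<longrightarrow> B \<omega> t = 0) \<and>
     (\<forall>P. finite P \<and>
          (\<forall>(s, t)\<in>P. s \<in> cbox 0 One \<and> t \<in> cbox 0 One \<and> (\<forall>i\<in>Basis. s \<bullet> i < t \<bullet> i)) \<and>
          disjoint_family_on (\<lambda>(s, t). block s t) P \<longrightarrow>
        prob_space.indep_vars N (\<lambda>_. borel) (\<lambda>(s, t) \<omega>. alt_sum Basis (B \<omega>) s t) P \<and>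
        (\<forall>(s, t)\<in>P. distributed N lborel (\<lambda>\<omega>. alt_sum Basis (B \<omega>) s t)
           (normal_density 0 (sqrt (measure lborel (block s t))))))"

definition covariance :: "'m measure \<Rightarrow> ('m \<Rightarrow> real) \<Rightarrow> ('m \<Rightarrow> real) \<Rightarrow> real" where
  "covariance M X Y =
     (\<integral>\<omega>. (X \<omega> - (\<integral>x. X x \<partial>M)) * (Y \<omega> - (\<integral>x. Y x \<partial>M)) \<partial>M)"

definition weakly_stationary :: "'m measure \<Rightarrow> ('i::ab_group_add \<Rightarrow> 'm \<Rightarrow> real) \<Rightarrow> bool" where
  "weakly_stationary M \<epsilon> \<longleftrightarrow>
     (\<forall>i. \<epsilon> i \<in> borel_measurable M \<and> integrable M (\<lambda>\<omega>. (\<epsilon> i \<omega>)\<^sup>2)) \<and>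
     (\<forall>i j. (\<integral>\<omega>. \<epsilon> i \<omega> \<partial>M) = (\<integral>\<omega>. \<epsilon> j \<omega> \<partial>M)) \<and>
     (\<forall>i j h. covariance M (\<epsilon> (i + h)) (\<epsilon> (j + h)) = covariance M (\<epsilon> i) (\<epsilon> j))"


section \<open>The kernel and the asymptotic regime\<close>

definition sinc_factor :: "real \<Rightarrow> real \<Rightarrow> real" where
  "sinc_factor \<Omega> x = (if x = 0 then \<Omega> / pi else sin (\<Omega> * x) / (pi * x))"

definition sinc_kernel ::
  "real \<Rightarrow> real \<Rightarrow> real \<Rightarrow> real \<Rightarrow> real \<Rightarrow> real \<Rightarrow> real" where
  "sinc_kernel \<Omega>1 \<Omega>2 \<Omega>3 t r2 r3 = sinc_factor \<Omega>1 t * sinc_factor \<Omega>2 r2 * sinc_factor \<Omega>3 r3"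

text \<open>The filter expressing \<open>min {n\<^sub>1, n\<^sub>2, n\<^sub>3} \<rightarrow> \<infinity>\<close>.\<close>

definition min_at_top :: "(nat \<times> nat \<times> nat) filter" where
  "min_at_top = filtercomap (\<lambda>(n1, n2, n3). min n1 (min n2 n3)) at_top"

end

theory Submission
  imports Defs
begin

text \<open>
  The process is a functional \<open>\<Psi>\<^sub>n\<close> of the partial sum process plus a deterministic drift. Summation
  by parts in each coordinate turns the noise term into a functional that only sees the values of
  the path at the nodes. Since the kernels are smooth, \<open>\<Psi>\<^sub>n(y)\<close> converges to the integral defined by
  parts against \<open>h\<close>, uniformly in \<open>(s, t, r\<^sub>2, r\<^sub>3)\<close>, whenever \<open>y\<close> is uniformly close to a continuous
  \<open>h\<close>; the multivariate statement is a threefold application of a one-dimensional estimate. Brownian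
  paths are continuous, so Skorohod closeness to them is uniform closeness, and an extended continuous
  mapping theorem applies; it follows from the Lipschitz envelopes of the functionals for the Skorohod
  metric, without a representation by almost surely convergent copies.

  The drift is a Riemann sum. Its convergence is uniform in the parameters because the oscillation of
  \<open>\<delta>\<close> along a line, summed over the cells of a uniform grid, is \<open>o(n)\<close> uniformly over all lines: by
  uniform continuity in case (a), and in case (b) because the variation of the one-dimensional
  sections is bounded by the Hardy--Krause variation.
\<close>

section \<open>The Skorohod metric\<close>

text \<open>The limit functional makes sense only on continuous paths and the discrete functionals
  change with the sample sizes, so the mapping theorem for one fixed functional does not apply; the
  discrete functionals are defined on all paths and compared with the limit near a continuous one.
  Random elements must be Borel for the Skorohod topology, in which addition is not continuous;
  measurability comes from finite sums with real random coefficients and from uniform limits, among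
  them the limit process along the diagonal \<open>(k, k, k)\<close>. The integral by parts is given
  through Riemann-Stieltjes limits over all faces. Since the kernel is a product, cell increments
  factor, every such limit is an iterated integral against derivatives, and the defining sum is
  nested one-dimensional integration by parts; this uses boxes with positive edges, which
  \<open>s0 > 0\<close> guarantees. The band-limited form of the sinc factors bounds kernel,
  derivative and the Lipschitz constant of the derivative on the whole line, so that all estimates
  are uniform in \<open>t\<close>, \<open>r2\<close> and \<open>r3\<close>.\<close>

lemma time_change_right_inverse:
  assumes "time_change a b \<theta>"
  obtains \<kappa> where "time_change a b \<kappa>" "\<And>t. t \<in> cbox a b \<Longrightarrow> \<theta> (\<kappa> t) = t"
proof -
  obtain k k' where kk: "\<forall>i\<in>Basis. strict_mono_on {a \<bullet> i..b \<bullet> i} (k i) \<and>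
        homeomorphism {a \<bullet> i..b \<bullet> i} {a \<bullet> i..b \<bullet> i} (k i) (k' i)"
      "\<forall>t\<in>cbox a b. \<theta> t = (\<Sum>i\<in>Basis. k i (t \<bullet> i) *\<^sub>R i)"
    using assms(1) unfolding time_change_def by blast
  then have k: "\<And>i. i \<in> Basis \<Longrightarrow> strict_mono_on {a \<bullet> i..b \<bullet> i} (k i)"
      "\<And>i. i \<in> Basis \<Longrightarrow> homeomorphism {a \<bullet> i..b \<bullet> i} {a \<bullet> i..b \<bullet> i} (k i) (k' i)"
      "\<And>t. t \<in> cbox a b \<Longrightarrow> \<theta> t = (\<Sum>i\<in>Basis. k i (t \<bullet> i) *\<^sub>R i)"
    by auto
  define \<kappa> where "\<kappa> t = (\<Sum>i\<in>Basis. k' i (t \<bullet> i) *\<^sub>R i)" for t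
  have mem: "k' i x \<in> {a \<bullet> i..b \<bullet> i}" and inv: "k i (k' i x) = x"
    if "i \<in> Basis" "x \<in> {a \<bullet> i..b \<bullet> i}" for i x
    using homeomorphism_apply2[OF k(2)] homeomorphism_image2[OF k(2)] that by blast+
  have sm: "strict_mono_on {a \<bullet> i..b \<bullet> i} (k' i)" if i: "i \<in> Basis" for i
  proof (rule strict_mono_onI)
    fix x y assume xy: "x \<in> {a \<bullet> i..b \<bullet> i}" "y \<in> {a \<bullet> i..b \<bullet> i}" "x < y"
    show "k' i x < k' i y"
    proof (rule ccontr)
      assume "\<not> k' i x < k' i y"
      then have "k i (k' i y) \<le> k i (k' i x)"
        using strict_mono_on_leD[OF k(1)[OF i] mem[OF i xy(2)] mem[OF i xy(1)]] by simp
      then show False using inv[OF i] xy by simp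
    qed
  qed
  have tc: "time_change a b \<kappa>"
    unfolding time_change_def \<kappa>_def using sm homeomorphism_symD[OF k(2)] by blast
  have "\<theta> (\<kappa> t) = t" if t: "t \<in> cbox a b" for t
  proof -
    have "\<theta> (\<kappa> t) = (\<Sum>i\<in>Basis. k i (\<kappa> t \<bullet> i) *\<^sub>R i)"
      using k(3) time_change_in_cbox[OF tc t] by simp
    also have "\<dots> = (\<Sum>i\<in>Basis. (t \<bullet> i) *\<^sub>R i)"
      using t inv by (intro sum.cong) (auto simp: \<kappa>_def mem_box)
    finally show ?thesis by (simp add: euclidean_representation)
  qed
  then show ?thesis using that tc by blast
qed

text \<open>Substituting \<open>\<kappa> t\<close> for \<open>t\<close>, where
  \<open>\<kappa>\<close> inverts the time change, exchanges the two functions and leaves both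
  errors unchanged.\<close>

lemma skorohod_near_sym:
  assumes "skorohod_near a b e f g"
  shows "skorohod_near a b e g f"
proof -
  obtain \<theta> where \<theta>: "time_change a b \<theta>"
    "\<And>t. t \<in> cbox a b \<Longrightarrow> norm (\<theta> t - t) < e \<and> \<bar>g t - f (\<theta> t)\<bar> < e"
    using assms unfolding skorohod_near_def by blast
  obtain \<kappa> where \<kappa>: "time_change a b \<kappa>" "\<And>t. t \<in> cbox a b \<Longrightarrow> \<theta> (\<kappa> t) = t"
    using time_change_right_inverse[OF \<theta>(1)] by blast
  have "norm (\<kappa> t - t) < e \<and> \<bar>f t - g (\<kappa> t)\<bar> < e" if "t \<in> cbox a b" for t
    using \<theta>(2)[OF time_change_in_cbox[OF \<kappa>(1) that]] \<kappa>(2)[OF that]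
    by (simp add: norm_minus_commute abs_minus_commute)
  then show ?thesis unfolding skorohod_near_def using \<kappa>(1) by blast
qed

lemma skorohod_near_uniform:
  assumes "0 < e" "\<And>t. t \<in> cbox a b \<Longrightarrow> \<bar>g t - f t\<bar> < e"
  shows "skorohod_near a b e f g"
  unfolding skorohod_near_def using time_change_id assms by (intro exI[of _ "\<lambda>t. t"]) auto

text \<open>Truncating at \<open>1\<close> keeps the infimum from being taken over the empty set.\<close>

definition skorohod_dist :: "'a \<Rightarrow> 'a \<Rightarrow> ('a \<Rightarrow> real) \<Rightarrow> ('a::euclidean_space \<Rightarrow> real) \<Rightarrow> real" where
  "skorohod_dist a b f g = Inf (insert 1 {e. 0 < e \<and> skorohod_near a b e f g})"

lemma skorohod_dist_bdd: "bdd_below (insert 1 {e. 0 < e \<and> skorohod_near a b e f g})"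
  by (rule bdd_belowI[of _ 0]) auto

lemma skorohod_dist_nonneg: "0 \<le> skorohod_dist a b f g"
  unfolding skorohod_dist_def by (rule cInf_greatest) auto

lemma skorohod_dist_le_1: "skorohod_dist a b f g \<le> 1"
  unfolding skorohod_dist_def by (rule cInf_lower[OF _ skorohod_dist_bdd]) auto

lemma skorohod_dist_le: "0 < e \<Longrightarrow> skorohod_near a b e f g \<Longrightarrow> skorohod_dist a b f g \<le> e"
  unfolding skorohod_dist_def by (rule cInf_lower[OF _ skorohod_dist_bdd]) auto

text \<open>For \<open>e \<le> 1\<close> the infimum can fall below \<open>e\<close> only through a
  genuine nearness radius, never through the truncation value \<open>1\<close>.\<close>

lemma skorohod_dist_less:
  assumes "skorohod_dist a b f g < e" "e \<le> 1"
  shows "skorohod_near a b e f g"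
proof -
  obtain d where "d \<in> insert 1 {e. 0 < e \<and> skorohod_near a b e f g}" "d < e"
    using assms(1) unfolding skorohod_dist_def
    by (subst (asm) cInf_less_iff[OF _ skorohod_dist_bdd]) auto
  then show ?thesis using assms(2) skorohod_near_mono[of a b d f g e] by auto
qed

lemma skorohod_dist_refl: "skorohod_dist a b f f = 0"
proof (rule antisym[OF field_le_epsilon skorohod_dist_nonneg])
  fix e :: real assume "0 < e"
  then show "skorohod_dist a b f f \<le> 0 + e"
    using skorohod_dist_le[OF _ skorohod_near_uniform, of e a b f f] by simp
qed

lemma skorohod_dist_sym: "skorohod_dist a b f g = skorohod_dist a b g f"
  unfolding skorohod_dist_def using skorohod_near_sym by metis

lemma skorohod_dist_triangle:
  "skorohod_dist a b f h \<le> skorohod_dist a b f g + skorohod_dist a b g h"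
proof (rule field_le_epsilon)
  fix e :: real assume e: "0 < e"
  let ?u = "skorohod_dist a b f g + e / 2" and ?v = "skorohod_dist a b g h + e / 2"
  note nn = skorohod_dist_nonneg[of a b f g] skorohod_dist_nonneg[of a b g h]
  show "skorohod_dist a b f h \<le> skorohod_dist a b f g + skorohod_dist a b g h + e"
  \<comment> \<open>Nearness can be read off the distance only up to radius \<open>1\<close>. If one
    enlarged distance exceeds \<open>1\<close>, the claim is trivial because the left side is at
    most \<open>1\<close>.\<close>
  proof (cases "?u \<le> 1 \<and> ?v \<le> 1")
    case True
    then have "skorohod_near a b (?u + ?v) f h"
      using e by (intro skorohod_near_trans[of a b _ f g] skorohod_dist_less) auto
    then have "skorohod_dist a b f h \<le> ?u + ?v"
      using e nn by (intro skorohod_dist_le) auto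
    then show ?thesis by simp
  next
    case False
    then show ?thesis using nn e skorohod_dist_le_1[of a b f h] by auto
  qed
qed

lemma continuous_map_skorohod_near:
  assumes "continuous_map (skorohod_topology a b) euclideanreal H" "f \<in> skorohod_space a b" "0 < \<eta>"
  obtains e where "0 < e" "\<And>g. g \<in> skorohod_space a b \<Longrightarrow> skorohod_near a b e f g \<Longrightarrow> \<bar>H g - H f\<bar> < \<eta>"
proof -
  let ?U = "{g \<in> skorohod_space a b. H g \<in> ball (H f) \<eta>}"
  have "openin (skorohod_topology a b) ?U"
    using openin_continuous_map_preimage[OF assms(1), of "ball (H f) \<eta>"] by simp
  moreover have "f \<in> ?U" using assms by simp
  ultimately obtain e where "0 < e" "\<forall>g\<in>skorohod_space a b. skorohod_near a b e f g \<longrightarrow> g \<in> ?U"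
    unfolding openin_skorohod_topology by blast
  then show ?thesis
    using that by (auto simp: dist_real_def abs_minus_commute)
qed

text \<open>A one-sided bound suffices, because exchanging \<open>f\<close> and \<open>g\<close>
  gives the other half by symmetry of the distance.\<close>

lemma continuous_map_skorohod_lipschitz:
  assumes "\<And>f g. f \<in> skorohod_space a b \<Longrightarrow> g \<in> skorohod_space a b \<Longrightarrow>
    H f \<le> H g + c * skorohod_dist a b f g" "0 \<le> c"
  shows "continuous_map (skorohod_topology a b) euclideanreal H"
  unfolding continuous_map openin_skorohod_topology topspace_skorohod_topology
proof (intro conjI allI impI ballI)
  fix U :: "real set" and f
  assume U: "openin euclideanreal U" and f: "f \<in> {x \<in> skorohod_space a b. H x \<in> U}"
  then obtain r where r: "r > 0" "ball (H f) r \<subseteq> U"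
    using open_contains_ball[of U] by auto
  \<comment> \<open>Dividing by \<open>c + 1\<close> covers \<open>c = 0\<close> and makes
    \<open>c * ?e < r\<close> strict.\<close>
  let ?e = "r / (c + 1)"
  show "\<exists>\<epsilon>>0. \<forall>g\<in>skorohod_space a b. skorohod_near a b \<epsilon> f g \<longrightarrow> g \<in> {x \<in> skorohod_space a b. H x \<in> U}"
  proof (intro exI[of _ ?e] conjI ballI impI)
    show e: "0 < ?e" using r assms(2) by simp
    fix g assume g: "g \<in> skorohod_space a b" "skorohod_near a b ?e f g"
    have "c * skorohod_dist a b f g \<le> c * ?e"
      using skorohod_dist_le[OF e g(2)] assms(2) by (rule mult_left_mono)
    also have "\<dots> < r" using r assms(2) by (simp add: field_simps)
    finally have "\<bar>H g - H f\<bar> < r"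
      using assms(1)[of f g] assms(1)[of g f] f g(1) skorohod_dist_sym[of a b f g] by (simp add: abs_if)
    then show "g \<in> {x \<in> skorohod_space a b. H x \<in> U}"
      using r(2) g(1) by (auto simp: dist_real_def abs_minus_commute subset_iff)
  qed
qed auto

section \<open>Borel measurability for the Skorohod topology\<close>

lemma space_skorohod_borel [simp]: "space (skorohod_borel a b) = skorohod_space a b"
  unfolding skorohod_borel_def
  by (rule space_measure_of) (auto simp: openin_skorohod_topology)

lemma sets_skorohod_borel:
  "sets (skorohod_borel a b) = sigma_sets (skorohod_space a b) {U. openin (skorohod_topology a b) U}"
  unfolding skorohod_borel_def
  by (rule sets_measure_of) (auto simp: openin_skorohod_topology)

lemma borel_measurable_skorohod_continuous:
  assumes "continuous_map (skorohod_topology a b) euclideanreal H"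
  shows "H \<in> borel_measurable (skorohod_borel a b)"
proof (rule borel_measurableI)
  fix S :: "real set" assume "open S"
  then have "openin (skorohod_topology a b) {x \<in> skorohod_space a b. H x \<in> S}"
    using openin_continuous_map_preimage[OF assms, of S] by simp
  moreover have "H -` S \<inter> space (skorohod_borel a b) = {x \<in> skorohod_space a b. H x \<in> S}"
    by auto
  ultimately show "H -` S \<inter> space (skorohod_borel a b) \<in> sets (skorohod_borel a b)"
    unfolding sets_skorohod_borel by (simp add: sigma_sets.Basic)
qed

text \<open>The distance to the complement of an open set detects membership, which reduces
  limits of random elements to limits of real random variables.\<close>

lemma measurable_skorohod_limit:
  assumes G: "\<And>k. G k \<in> measurable M (skorohod_borel a b)"
    and X: "\<And>\<omega>. \<omega> \<in> space M \<Longrightarrow> X \<omega> \<in> skorohod_space a b"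
    and lim: "\<And>\<omega> e. \<omega> \<in> space M \<Longrightarrow> 0 < e \<Longrightarrow>
      \<forall>\<^sub>F k in sequentially. \<forall>t\<in>cbox a b. \<bar>G k \<omega> t - X \<omega> t\<bar> < e"
  shows "X \<in> measurable M (skorohod_borel a b)"
  unfolding skorohod_borel_def
proof (rule measurable_measure_of)
  show "{U. openin (skorohod_topology a b) U} \<subseteq> Pow (skorohod_space a b)"
    by (auto simp: openin_skorohod_topology)
  show "X \<in> space M \<rightarrow> skorohod_space a b" using X by auto
  fix U assume "U \<in> {U. openin (skorohod_topology a b) U}"
  then have U: "openin (skorohod_topology a b) U" by simp
  let ?D = "skorohod_space a b"
  show "X -` U \<inter> space M \<in> sets M"
  \<comment> \<open>If \<open>U\<close> is the whole space its complement is empty, and the infimum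
    defining \<open>d\<close> would carry no information.\<close>
  proof (cases "?D \<subseteq> U")
    case True
    then have "X -` U \<inter> space M = space M" using X by auto
    then show ?thesis by simp
  next
    case False
    define d where "d f = Inf (skorohod_dist a b f ` (?D - U))" for f
    have ne: "skorohod_dist a b f ` (?D - U) \<noteq> {}" for f using False by auto
    have bdd: "bdd_below (skorohod_dist a b f ` (?D - U))" for f
      by (rule bdd_belowI[of _ 0]) (auto simp: skorohod_dist_nonneg)
    have lip: "d f \<le> d g + 1 * skorohod_dist a b f g" for f g
    proof -
      have "d f - skorohod_dist a b f g \<le> d g"
        unfolding d_def[of g]
      proof (rule cInf_greatest[OF ne])
        fix x assume "x \<in> skorohod_dist a b g ` (?D - U)"
        then obtain h where h: "h \<in> ?D - U" "x = skorohod_dist a b g h" by auto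
        have "d f \<le> skorohod_dist a b f h"
          unfolding d_def using h by (intro cInf_lower[OF _ bdd]) auto
        then show "d f - skorohod_dist a b f g \<le> x"
          using skorohod_dist_triangle[of a b f h g] h by simp
      qed
      then show ?thesis by simp
    qed
    have cont: "continuous_map (skorohod_topology a b) euclideanreal d"
      by (rule continuous_map_skorohod_lipschitz[of _ _ _ 1]) (use lip in auto)
    have "(\<lambda>\<omega>. d (X \<omega>)) \<in> borel_measurable M"
    proof (rule borel_measurable_LIMSEQ_real)
      show "(\<lambda>\<omega>. d (G k \<omega>)) \<in> borel_measurable M" for k
        using measurable_compose[OF G borel_measurable_skorohod_continuous[OF cont]] .
      fix \<omega> assume \<omega>: "\<omega> \<in> space M"
      show "(\<lambda>k. d (G k \<omega>)) \<longlonglongrightarrow> d (X \<omega>)"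
      proof (rule tendstoI)
        fix e :: real assume e: "0 < e"
        then have "\<forall>\<^sub>F k in sequentially. \<forall>t\<in>cbox a b. \<bar>G k \<omega> t - X \<omega> t\<bar> < e / 2"
          using lim[OF \<omega>, of "e / 2"] by simp
        then show "\<forall>\<^sub>F k in sequentially. dist (d (G k \<omega>)) (d (X \<omega>)) < e"
        proof eventually_elim
          case (elim k)
          have "skorohod_dist a b (X \<omega>) (G k \<omega>) \<le> e / 2"
            using elim e by (intro skorohod_dist_le skorohod_near_uniform) auto
          then show ?case
            using lip[of "X \<omega>" "G k \<omega>"] lip[of "G k \<omega>" "X \<omega>"] e
            unfolding dist_real_def skorohod_dist_sym[of a b "G k \<omega>"] by simp
        qed
      qed
    qed
    moreover have "X -` U \<inter> space M = {\<omega> \<in> space M. 0 < d (X \<omega>)}"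
    proof (intro equalityI subsetI)
      fix \<omega> assume "\<omega> \<in> X -` U \<inter> space M"
      then have \<omega>: "X \<omega> \<in> U" "\<omega> \<in> space M" by auto
      then obtain e where e: "e > 0" "\<And>g. g \<in> ?D \<Longrightarrow> skorohod_near a b e (X \<omega>) g \<Longrightarrow> g \<in> U"
        using U unfolding openin_skorohod_topology by blast
      \<comment> \<open>The distance is capped at \<open>1\<close>, so a ball of radius
        \<open>e\<close> inside \<open>U\<close> only yields the lower bound
        \<open>min e 1\<close>.\<close>
      have "min e 1 \<le> d (X \<omega>)"
        unfolding d_def
      proof (rule cInf_greatest[OF ne])
        fix x assume "x \<in> skorohod_dist a b (X \<omega>) ` (?D - U)"
        then obtain h where h: "h \<in> ?D" "h \<notin> U" "x = skorohod_dist a b (X \<omega>) h" by auto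
        show "min e 1 \<le> x"
          using skorohod_dist_less[of a b "X \<omega>" h "min e 1"] e(2)[OF h(1)] h
            skorohod_near_mono[of a b "min e 1" "X \<omega>" h e] by force
      qed
      then show "\<omega> \<in> {\<omega> \<in> space M. 0 < d (X \<omega>)}" using e(1) \<omega> by auto
    next
      fix \<omega> assume \<omega>: "\<omega> \<in> {\<omega> \<in> space M. 0 < d (X \<omega>)}"
      have "X \<omega> \<in> U"
      proof (rule ccontr)
        assume "X \<omega> \<notin> U"
        then have "d (X \<omega>) \<le> skorohod_dist a b (X \<omega>) (X \<omega>)"
          unfolding d_def using X \<omega> by (intro cInf_lower[OF _ bdd]) auto
        then show False using \<omega> skorohod_dist_refl[of a b "X \<omega>"] by auto
      qed
      then show "\<omega> \<in> X -` U \<inter> space M" using \<omega> by auto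
    qed
    ultimately show ?thesis by simp
  qed
qed

section \<open>Closure properties of the Skorohod space\<close>

lemma skorohod_spaceI:
  assumes "f \<in> extensional (cbox a b)"
    and "\<And>t u. t \<in> cbox a b \<Longrightarrow> u \<subseteq> Basis \<Longrightarrow> \<exists>L. (f \<longlongrightarrow> L) (at t within quadrant a b u t)"
    and "\<And>t. t \<in> cbox a b \<Longrightarrow> (f \<longlongrightarrow> f t) (at t within quadrant a b {} t)"
  shows "f \<in> skorohod_space a b"
  using assms unfolding skorohod_space_def by blast

lemma skorohod_spaceD:
  assumes "f \<in> skorohod_space a b"
  shows "f \<in> extensional (cbox a b)"
    and "t \<in> cbox a b \<Longrightarrow> u \<subseteq> Basis \<Longrightarrow> \<exists>L. (f \<longlongrightarrow> L) (at t within quadrant a b u t)"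
    and "t \<in> cbox a b \<Longrightarrow> (f \<longlongrightarrow> f t) (at t within quadrant a b {} t)"
  using assms unfolding skorohod_space_def by blast+

lemma quadrant_subset: "quadrant a b u t \<subseteq> cbox a b"
  unfolding quadrant_def by auto

lemma tendsto_restrict_quadrant:
  "((restrict f (cbox a b)) \<longlongrightarrow> L) (at t within quadrant a b u t) \<longleftrightarrow>
   (f \<longlongrightarrow> L) (at t within quadrant a b u t)"
  using quadrant_subset[of a b u t]
  by (intro tendsto_cong) (auto simp: eventually_at_filter intro!: always_eventually)

lemma skorohod_space_continuous:
  assumes "continuous_on (cbox a b) f"
  shows "restrict f (cbox a b) \<in> skorohod_space a b"
proof (rule skorohod_spaceI)
  have "(f \<longlongrightarrow> f t) (at t within quadrant a b u t)" if "t \<in> cbox a b" for t u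
    using assms that tendsto_within_subset[OF _ quadrant_subset] unfolding continuous_on_def by blast
  then show "t \<in> cbox a b \<Longrightarrow> \<exists>L. (restrict f (cbox a b) \<longlongrightarrow> L) (at t within quadrant a b u t)"
    "t \<in> cbox a b \<Longrightarrow> (restrict f (cbox a b) \<longlongrightarrow> restrict f (cbox a b) t) (at t within quadrant a b {} t)" for t u
    unfolding tendsto_restrict_quadrant by auto
qed auto

lemma skorohod_space_add:
  assumes "restrict f (cbox a b) \<in> skorohod_space a b" "restrict g (cbox a b) \<in> skorohod_space a b"
  shows "restrict (\<lambda>x. f x + g x) (cbox a b) \<in> skorohod_space a b"
proof (rule skorohod_spaceI)
  show "\<exists>L. (restrict (\<lambda>x. f x + g x) (cbox a b) \<longlongrightarrow> L) (at t within quadrant a b u t)"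
    if "t \<in> cbox a b" "u \<subseteq> Basis" for t u
    using skorohod_spaceD(2)[OF assms(1) that] skorohod_spaceD(2)[OF assms(2) that] tendsto_add
    unfolding tendsto_restrict_quadrant by blast
  show "(restrict (\<lambda>x. f x + g x) (cbox a b) \<longlongrightarrow> restrict (\<lambda>x. f x + g x) (cbox a b) t)
      (at t within quadrant a b {} t)" if "t \<in> cbox a b" for t
    using tendsto_add[OF skorohod_spaceD(3)[OF assms(1) that, unfolded tendsto_restrict_quadrant]
        skorohod_spaceD(3)[OF assms(2) that, unfolded tendsto_restrict_quadrant]] that
    unfolding tendsto_restrict_quadrant by simp
qed auto

lemma skorohod_space_mult:
  assumes "restrict f (cbox a b) \<in> skorohod_space a b" "restrict g (cbox a b) \<in> skorohod_space a b"
  shows "restrict (\<lambda>x. f x * g x) (cbox a b) \<in> skorohod_space a b"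
proof (rule skorohod_spaceI)
  show "\<exists>L. (restrict (\<lambda>x. f x * g x) (cbox a b) \<longlongrightarrow> L) (at t within quadrant a b u t)"
    if "t \<in> cbox a b" "u \<subseteq> Basis" for t u
    using skorohod_spaceD(2)[OF assms(1) that] skorohod_spaceD(2)[OF assms(2) that] tendsto_mult
    unfolding tendsto_restrict_quadrant by blast
  show "(restrict (\<lambda>x. f x * g x) (cbox a b) \<longlongrightarrow> restrict (\<lambda>x. f x * g x) (cbox a b) t)
      (at t within quadrant a b {} t)" if "t \<in> cbox a b" for t
    using tendsto_mult[OF skorohod_spaceD(3)[OF assms(1) that, unfolded tendsto_restrict_quadrant]
        skorohod_spaceD(3)[OF assms(2) that, unfolded tendsto_restrict_quadrant]] that
    unfolding tendsto_restrict_quadrant by simp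
qed auto

lemma skorohod_space_sum:
  assumes "\<And>j. j \<in> J \<Longrightarrow> restrict (f j) (cbox a b) \<in> skorohod_space a b"
  shows "restrict (\<lambda>x. \<Sum>j\<in>J. f j x) (cbox a b) \<in> skorohod_space a b"
  using assms
proof (induction J rule: infinite_finite_induct)
  case (insert j J)
  then show ?case using skorohod_space_add[of "f j" a b "\<lambda>x. \<Sum>j\<in>J. f j x"]
    by (simp del: restrict_apply)
qed (simp_all add: skorohod_space_continuous)

text \<open>The sampled process jumps only in \<open>s\<close>, at the nodes. The closed inequality
  \<open>c \<le> x \<bullet> i\<close> puts the jump on the side of the quadrants with
  \<open>\<ge>\<close>, as the continuity requirement of the space demands.\<close>

lemma skorohod_space_indicator_ge:
  assumes i: "i \<in> Basis"
  shows "restrict (\<lambda>x. if c \<le> x \<bullet> i then 1 else 0) (cbox a b) \<in> skorohod_space a b" (is "restrict ?f _ \<in> _")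
proof (rule skorohod_spaceI)
  have less: "eventually (\<lambda>x. x \<bullet> i < c) (at t within S)" if "t \<bullet> i < c" for t :: 'a and S
    by (rule order_tendstoD(2)[OF _ that]) (intro tendsto_intros)
  have greater: "eventually (\<lambda>x. x \<bullet> i > c) (at t within S)" if "t \<bullet> i > c" for t :: 'a and S
    by (rule order_tendstoD(1)[OF _ that]) (intro tendsto_intros)
  have ge: "eventually (\<lambda>x. x \<bullet> i \<ge> t \<bullet> i) (at t within quadrant a b u t)" if "i \<notin> u" for t u
    unfolding eventually_at_filter using i that by (auto simp: quadrant_def intro!: always_eventually)
  have lt: "eventually (\<lambda>x. x \<bullet> i < t \<bullet> i) (at t within quadrant a b u t)" if "i \<in> u" for t u
    unfolding eventually_at_filter using i that by (auto simp: quadrant_def intro!: always_eventually)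
  have right: "(?f \<longlongrightarrow> ?f t) (at t within quadrant a b u t)" if "i \<notin> u" for t u
  proof (cases "t \<bullet> i < c")
    case True
    show ?thesis by (rule tendsto_eventually) (rule eventually_mono[OF less[OF True]], use True in auto)
  next
    case False
    show ?thesis by (rule tendsto_eventually) (rule eventually_mono[OF ge[OF that]], use False in auto)
  qed
  have left: "\<exists>L. (?f \<longlongrightarrow> L) (at t within quadrant a b u t)" if "i \<in> u" for t u
  \<comment> \<open>On this quadrant \<open>x \<bullet> i < t \<bullet> i\<close> strictly, so the
    indicator vanishes there also when \<open>t \<bullet> i = c\<close>.\<close>
  proof (cases "t \<bullet> i \<le> c")
    case True
    have "(?f \<longlongrightarrow> 0) (at t within quadrant a b u t)"
      by (rule tendsto_eventually) (rule eventually_mono[OF lt[OF that]], use True in auto)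
    then show ?thesis by blast
  next
    case False
    have "(?f \<longlongrightarrow> 1) (at t within quadrant a b u t)"
      by (rule tendsto_eventually) (rule eventually_mono[OF greater], use False in auto)
    then show ?thesis by blast
  qed
  show "\<exists>L. (restrict ?f (cbox a b) \<longlongrightarrow> L) (at t within quadrant a b u t)"
    for t u unfolding tendsto_restrict_quadrant using left right by (cases "i \<in> u") blast+
  show "(restrict ?f (cbox a b) \<longlongrightarrow> restrict ?f (cbox a b) t) (at t within quadrant a b {} t)"
    if "t \<in> cbox a b" for t
    unfolding tendsto_restrict_quadrant using right[of "{}" t] that by simp
qed auto

text \<open>Interchange of limits in the manner of Moore and Osgood: the limits of the
  \<open>f n\<close> form a Cauchy sequence, whose limit is the limit of \<open>h\<close>. The
  trivial filter is split off because a quadrant need not accumulate at its corner.\<close>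

lemma uniform_limit_has_limit:
  fixes f :: "nat \<Rightarrow> 'b \<Rightarrow> real"
  assumes ul: "uniform_limit S f h sequentially" and ev: "\<forall>\<^sub>F x in G. x \<in> S"
    and lim: "\<And>n. \<exists>L. (f n \<longlongrightarrow> L) G"
  shows "\<exists>L. (h \<longlongrightarrow> L) G"
proof (cases "G = bot")
  case False
  obtain g where g: "\<And>n. (f n \<longlongrightarrow> g n) G" using lim by metis
  have "Cauchy g"
  proof (rule metric_CauchyI)
    fix e :: real assume e: "0 < e"
    have "\<forall>\<^sub>F n in sequentially. \<forall>x\<in>S. dist (f n x) (h x) < e / 3"
      using e by (intro uniform_limitD[OF ul]) simp
    then obtain K where K: "\<And>n x. n \<ge> K \<Longrightarrow> x \<in> S \<Longrightarrow> dist (f n x) (h x) < e / 3"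
      unfolding eventually_sequentially by blast
    have "dist (g m) (g n) < e" if "m \<ge> K" "n \<ge> K" for m n
    proof -
      have "((\<lambda>x. dist (f m x) (f n x)) \<longlongrightarrow> dist (g m) (g n)) G"
        by (intro tendsto_dist g)
      moreover have "\<forall>\<^sub>F x in G. dist (f m x) (f n x) \<le> 2 * e / 3"
        using ev
      proof eventually_elim
        case (elim x)
        then show ?case
          using K[OF that(1) elim] K[OF that(2) elim] dist_triangle2[of "f m x" "f n x" "h x"] by simp
      qed
      ultimately have "dist (g m) (g n) \<le> 2 * e / 3"
        using False by (rule tendsto_upperbound)
      then show ?thesis using e by simp
    qed
    then show "\<exists>M. \<forall>m\<ge>M. \<forall>n\<ge>M. dist (g m) (g n) < e" by blast
  qed
  then obtain l where "g \<longlonglongrightarrow> l" using Cauchy_convergent_iff convergent_def by blast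
  then show ?thesis
    using swap_uniform_limit'[OF always_eventually[OF allI[OF g]] _ ul ev] by auto
qed simp

text \<open>Serves to recognize the limit process as an element of the space: on a continuous path
  it is a uniform limit of its discretizations.\<close>

lemma skorohod_space_uniform_limit:
  assumes f: "\<And>n. restrict (f n) (cbox a b) \<in> skorohod_space a b"
    and ul: "uniform_limit (cbox a b) f h sequentially"
  shows "restrict h (cbox a b) \<in> skorohod_space a b"
proof (rule skorohod_spaceI)
  have ev: "\<forall>\<^sub>F x in at t within quadrant a b u t. x \<in> cbox a b" for t u
    unfolding eventually_at_filter using quadrant_subset[of a b u t] by (auto intro!: always_eventually)
  show "\<exists>L. (restrict h (cbox a b) \<longlongrightarrow> L) (at t within quadrant a b u t)"
    if "t \<in> cbox a b" "u \<subseteq> Basis" for t u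
    unfolding tendsto_restrict_quadrant
    by (rule uniform_limit_has_limit[OF ul ev])
      (use skorohod_spaceD(2)[OF f that] in \<open>simp add: tendsto_restrict_quadrant\<close>)
  show "(restrict h (cbox a b) \<longlongrightarrow> restrict h (cbox a b) t) (at t within quadrant a b {} t)"
    if t: "t \<in> cbox a b" for t
  proof -
    have "(f n \<longlongrightarrow> f n t) (at t within quadrant a b {} t)" for n
      using skorohod_spaceD(3)[OF f t, of n] t unfolding tendsto_restrict_quadrant by simp
    then have "(h \<longlongrightarrow> h t) (at t within quadrant a b {} t)"
      by (intro swap_uniform_limit'[OF always_eventually[OF allI] tendsto_uniform_limitI[OF ul t] ul ev]) auto
    then show ?thesis unfolding tendsto_restrict_quadrant using t by simp
  qed
qed auto

text \<open>Sums of Borel random elements cannot be treated through continuity of addition. Here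
  only the coefficients are random: rounding one coefficient to a dyadic grid cuts the sample space
  into countably many pieces, and letting the grid shrink recovers the coefficient, uniformly on the
  box because \<open>c j\<close> is bounded.\<close>

lemma measurable_skorohod_affine:
  assumes "finite J"
    and \<xi>: "\<And>j. j \<in> J \<Longrightarrow> \<xi> j \<in> borel_measurable M"
    and c: "\<And>j. j \<in> J \<Longrightarrow> restrict (c j) (cbox a b) \<in> skorohod_space a b"
    and bd: "\<And>j x. j \<in> J \<Longrightarrow> x \<in> cbox a b \<Longrightarrow> \<bar>c j x\<bar> \<le> K"
    and d: "restrict d (cbox a b) \<in> skorohod_space a b"
  shows "(\<lambda>\<omega>. restrict (\<lambda>x. (\<Sum>j\<in>J. \<xi> j \<omega> * c j x) + d x) (cbox a b)) \<in> measurable M (skorohod_borel a b)"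
  using assms(1) \<xi> c bd d
proof (induction J arbitrary: d rule: finite_induct)
  case (insert j J)
  have const: "restrict (\<lambda>x. r :: real) (cbox a b) \<in> skorohod_space a b" for r
    by (intro skorohod_space_continuous continuous_intros)
  define q where "q k \<omega> = (\<lfloor>2 ^ k * \<xi> j \<omega>\<rfloor> :: int)" for k :: nat and \<omega>
  define G where "G k \<omega> = restrict (\<lambda>x. (\<Sum>i\<in>J. \<xi> i \<omega> * c i x)
      + (d x + of_int (q k \<omega>) / 2 ^ k * c j x)) (cbox a b)" for k \<omega>
  have G: "G k \<in> measurable M (skorohod_borel a b)" for k
    unfolding G_def
  \<comment> \<open>Where \<open>q k\<close> takes the integer value \<open>i\<close>, the term of
    index \<open>j\<close> is a deterministic function; the induction hypothesis absorbs it into the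
    offset \<open>d\<close>, which is why \<open>d\<close> is kept arbitrary in the
    induction.\<close>
  proof (rule measurable_compose_countable[where g = "q k" and
        f = "\<lambda>i \<omega>. restrict (\<lambda>x. (\<Sum>i\<in>J. \<xi> i \<omega> * c i x) + (d x + of_int i / 2 ^ k * c j x)) (cbox a b)"])
    have [measurable]: "\<xi> j \<in> borel_measurable M" using insert.prems by simp
    show "q k \<in> measurable M (count_space UNIV)" unfolding q_def by measurable
    show "(\<lambda>\<omega>. restrict (\<lambda>x. (\<Sum>i\<in>J. \<xi> i \<omega> * c i x) + (d x + of_int i / 2 ^ k * c j x)) (cbox a b))
      \<in> measurable M (skorohod_borel a b)" for i :: int
      using insert.prems by (intro insert.IH skorohod_space_add skorohod_space_mult const) (simp_all del: restrict_apply)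
  qed
  show ?case
  proof (rule measurable_skorohod_limit[of G])
    show "G k \<in> measurable M (skorohod_borel a b)" for k by (rule G)
    show "restrict (\<lambda>x. (\<Sum>j\<in>insert j J. \<xi> j \<omega> * c j x) + d x) (cbox a b) \<in> skorohod_space a b" for \<omega>
      by (intro skorohod_space_add skorohod_space_sum skorohod_space_mult const insert.prems)
    fix \<omega> and e :: real assume e: "0 < e"
    have K: "0 \<le> \<bar>K\<bar>" by simp
    have "(\<lambda>k. (\<bar>K\<bar> + 1) * inverse 2 ^ k) \<longlonglongrightarrow> (\<bar>K\<bar> + 1) * 0"
      by (intro tendsto_intros LIMSEQ_power_zero) simp
    then have "\<forall>\<^sub>F k in sequentially. (\<bar>K\<bar> + 1) * inverse 2 ^ k < e"
      using e by (intro order_tendstoD(2)[of _ 0]) auto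
    then show "\<forall>\<^sub>F k in sequentially. \<forall>t\<in>cbox a b. \<bar>G k \<omega> t -
        restrict (\<lambda>x. (\<Sum>j\<in>insert j J. \<xi> j \<omega> * c j x) + d x) (cbox a b) t\<bar> < e"
    proof eventually_elim
      case (elim k)
      show ?case
      proof
        fix t assume t: "t \<in> cbox a b"
        have "of_int (q k \<omega>) \<le> 2 ^ k * \<xi> j \<omega>" "2 ^ k * \<xi> j \<omega> < of_int (q k \<omega>) + 1"
          unfolding q_def by linarith+
        then have "\<bar>(of_int (q k \<omega>) - 2 ^ k * \<xi> j \<omega>) / 2 ^ k\<bar> \<le> 1 / 2 ^ k"
          unfolding abs_divide by (intro frac_le) auto
        then have *: "\<bar>of_int (q k \<omega>) / 2 ^ k - \<xi> j \<omega>\<bar> \<le> inverse 2 ^ k"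
          by (simp add: diff_divide_distrib power_one_over inverse_eq_divide)
        have "\<bar>G k \<omega> t - restrict (\<lambda>x. (\<Sum>j\<in>insert j J. \<xi> j \<omega> * c j x) + d x) (cbox a b) t\<bar>
            = \<bar>(of_int (q k \<omega>) / 2 ^ k - \<xi> j \<omega>) * c j t\<bar>"
          using t insert.hyps by (simp add: G_def algebra_simps)
        also have "\<dots> \<le> inverse 2 ^ k * (\<bar>K\<bar> + 1)"
          unfolding abs_mult using * insert.prems(3)[of j t] t by (intro mult_mono) auto
        also have "\<dots> < e" using elim by (simp add: mult.commute)
        finally show "\<bar>G k \<omega> t - restrict (\<lambda>x. (\<Sum>j\<in>insert j J. \<xi> j \<omega> * c j x) + d x) (cbox a b) t\<bar> < e" .
      qed
    qed
  qed
qed simp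

text \<open>The lower bound of the mapping theorem: the Lipschitz envelopes
  \<open>inf {K n y + m d(x, y) | n \<in> A m}\<close> are continuous, lie below \<open>K n\<close>, and increase to the
  limit functional at the paths of the limit process.\<close>

lemma weak_conv_mapping_lower:
  fixes K :: "'n \<Rightarrow> ('a::euclidean_space \<Rightarrow> real) \<Rightarrow> real"
  assumes M: "prob_space M" and N: "prob_space N"
    and X: "\<And>n. X n \<in> measurable M (skorohod_borel a b)"
    and Y: "Y \<in> measurable N (skorohod_borel a b)"
    and conv: "weak_conv_measures (skorohod_topology a b)
        (\<lambda>n. distr M (skorohod_borel a b) (X n)) (distr N (skorohod_borel a b) Y) F"
    and A: "\<And>m :: nat. eventually (\<lambda>n. n \<in> A m) F" "\<And>m. A m \<noteq> {}" "decseq A"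
    and bd: "\<And>n y. \<bar>K n y\<bar> \<le> c"
    and U: "\<And>n. U n \<in> borel_measurable M" "\<And>n. AE \<omega> in M. U n \<omega> = K n (X n \<omega>)"
    and V: "V \<in> borel_measurable N"
    and lim: "AE \<omega> in N. \<forall>\<eta>>0. \<exists>e>0. \<exists>m. \<forall>n\<in>A m. \<forall>y\<in>skorohod_space a b.
        skorohod_near a b e (Y \<omega>) y \<longrightarrow> \<bar>K n y - V \<omega>\<bar> < \<eta>"
    and e: "0 < e"
  shows "\<forall>\<^sub>F n in F. (\<integral>\<omega>. V \<omega> \<partial>N) - e < (\<integral>\<omega>. U n \<omega> \<partial>M)"
proof -
  interpret M: prob_space M by fact
  interpret N: prob_space N by fact
  let ?D = "skorohod_space a b"
  have c0: "0 \<le> c" using bd[of undefined undefined] by linarith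
  have Xsp: "X n \<omega> \<in> ?D" if "\<omega> \<in> space M" for n \<omega> using measurable_space[OF X that] by simp
  have Ysp: "Y \<omega> \<in> ?D" if "\<omega> \<in> space N" for \<omega> using measurable_space[OF Y that] by simp
  \<comment> \<open>Letting \<open>n\<close> range over all of \<open>A m\<close> makes one
    continuous functional a lower bound for every late \<open>K n\<close> at once.\<close>
  define E where "E m x = (\<lambda>(n, y). K n y + real m * skorohod_dist a b x y) ` (A m \<times> ?D)" for m x
  define L where "L m x = Inf (E m x)" for m x
  have Eb: "- c \<le> z" if z: "z \<in> E m x" for z m x
  proof -
    obtain n y where "z = K n y + real m * skorohod_dist a b x y" using z unfolding E_def by auto
    then show ?thesis
      using bd[of n y] mult_nonneg_nonneg[OF of_nat_0_le_iff skorohod_dist_nonneg, of m a b x y] by linarith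
  qed
  have bdd: "bdd_below (E m x)" for m x using Eb by (rule bdd_belowI)
  have Ene: "E m x \<noteq> {}" if "x \<in> ?D" for m x using that A(2)[of m] unfolding E_def by auto
  have Lle: "L m x \<le> K n x" if "n \<in> A m" "x \<in> ?D" for m n x
  proof -
    have "K n x + real m * skorohod_dist a b x x \<in> E m x" using that unfolding E_def by auto
    then show ?thesis unfolding L_def skorohod_dist_refl using cInf_lower[OF _ bdd] by force
  qed
  have Lge: "- c \<le> L m x" if "x \<in> ?D" for m x
    unfolding L_def using Eb by (rule cInf_greatest[OF Ene[OF that]])
  have Labs: "\<bar>L m x\<bar> \<le> c" if "x \<in> ?D" for m x
  proof -
    obtain n where "n \<in> A m" using A(2) by blast
    then show ?thesis using Lle[of n m x] Lge[of x m] bd[of n x] that by (simp add: abs_le_iff)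
  qed
  have Lip: "L m f \<le> L m g + real m * skorohod_dist a b f g" if "f \<in> ?D" "g \<in> ?D" for m f g
  proof -
    have "L m f - real m * skorohod_dist a b f g \<le> L m g"
      unfolding L_def[of m g]
    proof (rule cInf_greatest[OF Ene[OF that(2)]])
      fix z assume "z \<in> E m g"
      then obtain n y where z: "n \<in> A m" "y \<in> ?D" "z = K n y + real m * skorohod_dist a b g y"
        unfolding E_def by auto
      have "L m f \<le> K n y + real m * skorohod_dist a b f y"
        unfolding L_def using z by (intro cInf_lower[OF _ bdd]) (auto simp: E_def)
      also have "\<dots> \<le> K n y + real m * (skorohod_dist a b f g + skorohod_dist a b g y)"
        by (intro add_left_mono mult_left_mono skorohod_dist_triangle) simp
      finally show "L m f - real m * skorohod_dist a b f g \<le> z"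
        using z by (simp add: algebra_simps)
    qed
    then show ?thesis by simp
  qed
  have Lc: "continuous_map (skorohod_topology a b) euclideanreal (L m)" for m
    by (rule continuous_map_skorohod_lipschitz[of _ _ _ "real m"]) (use Lip in auto)
  have Lm: "L m \<in> borel_measurable (skorohod_borel a b)" for m
    by (rule borel_measurable_skorohod_continuous[OF Lc])
  have LX: "(\<lambda>\<omega>. L m (X n \<omega>)) \<in> borel_measurable M" for m n
    using measurable_compose[OF X Lm] .
  have LY: "(\<lambda>\<omega>. L m (Y \<omega>)) \<in> borel_measurable N" for m
    using measurable_compose[OF Y Lm] .
  have convL: "((\<lambda>n. \<integral>\<omega>. L m (X n \<omega>) \<partial>M) \<longlongrightarrow> (\<integral>\<omega>. L m (Y \<omega>) \<partial>N)) F" for m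
  proof -
    have "bounded (L m ` topspace (skorohod_topology a b))"
      unfolding bounded_iff using Labs by auto
    then have "((\<lambda>n. \<integral>x. L m x \<partial>distr M (skorohod_borel a b) (X n)) \<longlongrightarrow>
        (\<integral>x. L m x \<partial>distr N (skorohod_borel a b) Y)) F"
      using conv Lc unfolding weak_conv_measures_def by blast
    then show ?thesis by (simp add: integral_distr[OF X Lm] integral_distr[OF Y Lm])
  qed
  have AEconv: "AE \<omega> in N. (\<lambda>m. L m (Y \<omega>)) \<longlonglongrightarrow> V \<omega>"
    using lim AE_space
  proof eventually_elim
    case (elim \<omega>)
    show ?case
    proof (rule tendstoI)
      fix \<eta> :: real assume \<eta>: "0 < \<eta>"
      obtain d m0 where d: "d > 0" and
        near: "\<And>n y. n \<in> A m0 \<Longrightarrow> y \<in> ?D \<Longrightarrow> skorohod_near a b d (Y \<omega>) y \<Longrightarrow> \<bar>K n y - V \<omega>\<bar> < \<eta> / 2"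
        using elim(1) \<eta> by (meson half_gt_zero)
      \<comment> \<open>Distances translate back into nearness only for radii at most
        \<open>1\<close>.\<close>
      define d' where "d' = min d 1"
      have d': "d' > 0" "d' \<le> 1" "d' \<le> d" using d unfolding d'_def by auto
      have self: "skorohod_near a b d (Y \<omega>) (Y \<omega>)" by (rule skorohod_near_uniform) (use d in auto)
      have "dist (L m (Y \<omega>)) (V \<omega>) < \<eta>" if m: "m \<ge> m0" "real m \<ge> 2 * c / d'" for m
      proof -
        have sub: "A m \<subseteq> A m0" using A(3) m(1) by (simp add: decseqD)
        obtain n where n: "n \<in> A m" using A(2) by blast
        have nr: "\<bar>K n (Y \<omega>) - V \<omega>\<bar> < \<eta> / 2"
          using n sub by (intro near self Ysp[OF elim(2)]) auto
        have up: "L m (Y \<omega>) < V \<omega> + \<eta> / 2"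
          using Lle[OF n Ysp[OF elim(2)]] nr by linarith
        have Vle: "V \<omega> - \<eta> / 2 \<le> c"
          using nr bd[of n "Y \<omega>"] by linarith
        have "V \<omega> - \<eta> / 2 \<le> L m (Y \<omega>)"
          unfolding L_def
        proof (rule cInf_greatest[OF Ene[OF Ysp[OF elim(2)]]])
          fix z assume "z \<in> E m (Y \<omega>)"
          then obtain k y where z: "k \<in> A m" "y \<in> ?D" "z = K k y + real m * skorohod_dist a b (Y \<omega>) y"
            unfolding E_def by auto
          show "V \<omega> - \<eta> / 2 \<le> z"
          proof (cases "skorohod_dist a b (Y \<omega>) y < d'")
            case True
            then have "skorohod_near a b d (Y \<omega>) y"
              using skorohod_dist_less[OF True d'(2)] d'(3) skorohod_near_mono by blast
            then have "\<bar>K k y - V \<omega>\<bar> < \<eta> / 2" using z sub by (intro near) auto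
            then have "V \<omega> - \<eta> / 2 \<le> K k y" by linarith
            also have "\<dots> \<le> z" using z skorohod_dist_nonneg[of a b "Y \<omega>" y] by simp
            finally show ?thesis .
          next
            case False
            \<comment> \<open>Paths far from \<open>Y \<omega>\<close> are penalized by at least
              \<open>2 * c\<close>, which outweighs the lower bound \<open>- c\<close> for
              \<open>K\<close> since the target \<open>V \<omega> - \<eta> / 2\<close> is at most
              \<open>c\<close>.\<close>
            have "2 * c \<le> real m * d'" using m(2) d' by (simp add: field_simps)
            also have "\<dots> \<le> real m * skorohod_dist a b (Y \<omega>) y" using False by (intro mult_left_mono) auto
            finally show ?thesis using z Vle bd[of k y] by (simp add: abs_le_iff)
          qed
        qed
        then show ?thesis using up \<eta> unfolding dist_real_def by simp
      qed
      moreover have "\<forall>\<^sub>F m in sequentially. m \<ge> m0 \<and> real m \<ge> 2 * c / d'"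
        using eventually_ge_at_top[of "max m0 (nat \<lceil>2 * c / d'\<rceil>)"] by eventually_elim linarith
      ultimately show "\<forall>\<^sub>F m in sequentially. dist (L m (Y \<omega>)) (V \<omega>) < \<eta>"
        by (blast intro: eventually_mono)
    qed
  qed
  \<comment> \<open>The order of the limits matters: dominated convergence first fixes one envelope
    index \<open>m\<close>, and only then does \<open>n\<close> move, by weak convergence tested on
    the bounded continuous functional \<open>L m\<close>.\<close>
  have "(\<lambda>m. \<integral>\<omega>. L m (Y \<omega>) \<partial>N) \<longlonglongrightarrow> (\<integral>\<omega>. V \<omega> \<partial>N)"
  proof (rule integral_dominated_convergence[where w = "\<lambda>_. c"])
    show "AE \<omega> in N. norm (L m (Y \<omega>)) \<le> c" for m using Labs Ysp by auto
  qed (use AEconv LY V in auto)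
  then have "\<forall>\<^sub>F m in sequentially. (\<integral>\<omega>. V \<omega> \<partial>N) - e < (\<integral>\<omega>. L m (Y \<omega>) \<partial>N)"
    using e by (intro order_tendstoD(1)) auto
  then obtain m where m: "(\<integral>\<omega>. V \<omega> \<partial>N) - e < (\<integral>\<omega>. L m (Y \<omega>) \<partial>N)"
    by (auto simp: eventually_sequentially)
  have "\<forall>\<^sub>F n in F. (\<integral>\<omega>. V \<omega> \<partial>N) - e < (\<integral>\<omega>. L m (X n \<omega>) \<partial>M)"
    using order_tendstoD(1)[OF convL m] .
  with A(1)[of m] show ?thesis
  proof eventually_elim
    case (elim n)
    have Uc: "AE \<omega> in M. norm (U n \<omega>) \<le> c"
      using U(2)[of n] by eventually_elim (simp add: bd)
    have "(\<integral>\<omega>. L m (X n \<omega>) \<partial>M) \<le> (\<integral>\<omega>. U n \<omega> \<partial>M)"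
    proof (rule integral_mono_AE)
      show "integrable M (\<lambda>\<omega>. L m (X n \<omega>))"
        using LX Labs Xsp by (intro M.integrable_const_bound[where B = c]) auto
      show "integrable M (U n)"
        using Uc U(1) by (rule M.integrable_const_bound)
      show "AE \<omega> in M. L m (X n \<omega>) \<le> U n \<omega>"
        using U(2)[of n] AE_space by eventually_elim (use Lle[OF elim(1)] Xsp in auto)
    qed
    then show ?case using elim(2) by linarith
  qed
qed

text \<open>The upper half is the lower half for \<open>- K\<close>, \<open>- U\<close> and
  \<open>- V\<close>. Measurability is asked of \<open>U n\<close>, which matches
  \<open>K n (X n \<omega>)\<close> almost surely, since \<open>K n\<close> itself is evaluated on
  arbitrary nearby paths.\<close>

lemma weak_conv_extended_mapping:
  fixes K :: "'n \<Rightarrow> ('a::euclidean_space \<Rightarrow> real) \<Rightarrow> real"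
  assumes M: "prob_space M" and N: "prob_space N"
    and X: "\<And>n. X n \<in> measurable M (skorohod_borel a b)"
    and Y: "Y \<in> measurable N (skorohod_borel a b)"
    and conv: "weak_conv_measures (skorohod_topology a b)
        (\<lambda>n. distr M (skorohod_borel a b) (X n)) (distr N (skorohod_borel a b) Y) F"
    and A: "\<And>m :: nat. eventually (\<lambda>n. n \<in> A m) F" "\<And>m. A m \<noteq> {}" "decseq A"
    and bd: "\<And>n y. \<bar>K n y\<bar> \<le> c"
    and U: "\<And>n. U n \<in> borel_measurable M" "\<And>n. AE \<omega> in M. U n \<omega> = K n (X n \<omega>)"
    and V: "V \<in> borel_measurable N"
    and lim: "AE \<omega> in N. \<forall>\<eta>>0. \<exists>e>0. \<exists>m. \<forall>n\<in>A m. \<forall>y\<in>skorohod_space a b.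
        skorohod_near a b e (Y \<omega>) y \<longrightarrow> \<bar>K n y - V \<omega>\<bar> < \<eta>"
  shows "((\<lambda>n. \<integral>\<omega>. U n \<omega> \<partial>M) \<longlongrightarrow> (\<integral>\<omega>. V \<omega> \<partial>N)) F"
proof (rule tendstoI)
  fix e :: real assume e: "0 < e"
  have "\<forall>\<^sub>F n in F. (\<integral>\<omega>. V \<omega> \<partial>N) - e < (\<integral>\<omega>. U n \<omega> \<partial>M)"
    using assms e by (rule weak_conv_mapping_lower)
  moreover have "\<forall>\<^sub>F n in F. (\<integral>\<omega>. - V \<omega> \<partial>N) - e < (\<integral>\<omega>. - U n \<omega> \<partial>M)"
  proof (rule weak_conv_mapping_lower[OF M N X Y conv A, where K = "\<lambda>n y. - K n y" and c = c])
    show "\<And>n. AE \<omega> in M. - U n \<omega> = - K n (X n \<omega>)" using U(2) by simp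
    show "AE \<omega> in N. \<forall>\<eta>>0. \<exists>e>0. \<exists>m. \<forall>n\<in>A m. \<forall>y\<in>skorohod_space a b.
        skorohod_near a b e (Y \<omega>) y \<longrightarrow> \<bar>- K n y - - V \<omega>\<bar> < \<eta>"
      using lim by (simp add: abs_minus_commute)
  qed (use bd U V e in auto)
  ultimately show "\<forall>\<^sub>F n in F. dist (\<integral>\<omega>. U n \<omega> \<partial>M) (\<integral>\<omega>. V \<omega> \<partial>N) < e"
    by eventually_elim (simp add: dist_real_def abs_less_iff)
qed

section \<open>The sinc kernel\<close>

text \<open>The sinc factor is \<open>1 / pi\<close> times the integral of
  \<open>cos (x * u)\<close> over the frequency band \<open>{0..\<Omega>}\<close>. Differentiating
  under the integral removes the case distinction at \<open>x = 0\<close> and makes global bounds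
  immediate.\<close>

definition sinc_factor_deriv :: "real \<Rightarrow> real \<Rightarrow> real" where
  "sinc_factor_deriv \<Omega> x = integral {0..\<Omega>} (\<lambda>u. - (u * sin (x * u))) / pi"

lemma sinc_factor_eq_integral:
  assumes "0 < \<Omega>"
  shows "sinc_factor \<Omega> x = integral {0..\<Omega>} (\<lambda>u. cos (x * u)) / pi"
proof (cases "x = 0")
  case False
  have "((\<lambda>u. cos (x * u)) has_integral (sin (x * \<Omega>) / x - sin (x * 0) / x)) {0..\<Omega>}"
    using assms False
    by (intro fundamental_theorem_of_calculus)
      (auto intro!: derivative_eq_intros simp flip: has_real_derivative_iff_has_vector_derivative)
  then show ?thesis
    using False by (simp add: sinc_factor_def integral_unique mult.commute)
qed (use assms in \<open>simp add: sinc_factor_def\<close>)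

lemma sinc_factor_has_derivative:
  assumes "0 < \<Omega>"
  shows "(sinc_factor \<Omega> has_real_derivative sinc_factor_deriv \<Omega> x) (at x)"
proof -
  have "((\<lambda>x. integral (cbox 0 \<Omega>) (\<lambda>u. cos (x * u))) has_real_derivative
      integral (cbox 0 \<Omega>) (\<lambda>u. - (u * sin (x * u)))) (at x within UNIV)"
    by (rule leibniz_rule_field_derivative[where fx = "\<lambda>x u. - (u * sin (x * u))"])
      (auto intro!: derivative_eq_intros continuous_intros integrable_continuous_real
        simp: case_prod_unfold)
  from DERIV_cdivide[OF this, of pi] show ?thesis
    unfolding sinc_factor_eq_integral[OF assms, abs_def] sinc_factor_deriv_def by simp
qed

lemma abs_sin_diff_le: "\<bar>sin x - sin y\<bar> \<le> \<bar>x - y\<bar>" for x y :: real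
proof -
  have "\<bar>sin x - sin y\<bar> = 2 * (\<bar>sin ((x - y) / 2)\<bar> * \<bar>cos ((x + y) / 2)\<bar>)"
    by (simp add: sin_diff_sin abs_mult)
  also have "\<dots> \<le> 2 * (\<bar>(x - y) / 2\<bar> * 1)"
    by (intro mult_left_mono mult_mono abs_sin_x_le_abs_x) auto
  finally show ?thesis by simp
qed

text \<open>One factor \<open>\<Omega>\<close> is the length of the frequency band; the others bound
  the integrand, which is at most \<open>1\<close>, \<open>u\<close>, and
  \<open>u\<^sup>2 * \<bar>x - y\<bar>\<close> respectively.\<close>

lemma sinc_factor_bounds:
  assumes "0 < \<Omega>"
  shows "\<bar>sinc_factor \<Omega> x\<bar> \<le> \<Omega> / pi"
    and "\<bar>sinc_factor_deriv \<Omega> x\<bar> \<le> \<Omega>\<^sup>2 / pi"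
    and "\<bar>sinc_factor_deriv \<Omega> x - sinc_factor_deriv \<Omega> y\<bar> \<le> \<Omega> ^ 3 / pi * \<bar>x - y\<bar>"
proof -
  have "norm (integral {0..\<Omega>} (\<lambda>u. cos (x * u))) \<le> 1 * (\<Omega> - 0)"
    using assms by (intro integral_bound continuous_intros) auto
  then show "\<bar>sinc_factor \<Omega> x\<bar> \<le> \<Omega> / pi"
    unfolding sinc_factor_eq_integral[OF assms] by (simp add: divide_right_mono)
  have "norm (integral {0..\<Omega>} (\<lambda>u. - (u * sin (x * u)))) \<le> (\<Omega> * 1) * (\<Omega> - 0)"
    using assms by (intro integral_bound continuous_intros) (auto simp: abs_mult intro!: mult_mono[of _ \<Omega> _ 1, simplified])
  then show "\<bar>sinc_factor_deriv \<Omega> x\<bar> \<le> \<Omega>\<^sup>2 / pi"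
    unfolding sinc_factor_deriv_def by (simp add: divide_right_mono power2_eq_square)
  have "norm (integral {0..\<Omega>} (\<lambda>u. - (u * sin (x * u)) - - (u * sin (y * u))))
      \<le> (\<Omega> * (\<Omega> * \<bar>x - y\<bar>)) * (\<Omega> - 0)"
  proof (intro integral_bound continuous_intros)
    fix u assume u: "u \<in> {0..\<Omega>}"
    have "\<bar>sin (y * u) - sin (x * u)\<bar> \<le> \<bar>y * u - x * u\<bar>" by (rule abs_sin_diff_le)
    also have "\<dots> = u * \<bar>x - y\<bar>"
      using u by (simp add: left_diff_distrib[symmetric] abs_mult abs_minus_commute)
    also have "\<dots> \<le> \<Omega> * \<bar>x - y\<bar>" using u by (intro mult_right_mono) auto
    finally have "u * \<bar>sin (y * u) - sin (x * u)\<bar> \<le> \<Omega> * (\<Omega> * \<bar>x - y\<bar>)"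
      using u assms by (intro mult_mono) auto
    moreover have "- (u * sin (x * u)) - - (u * sin (y * u)) = u * (sin (y * u) - sin (x * u))"
      by (simp add: algebra_simps)
    ultimately show "norm (- (u * sin (x * u)) - - (u * sin (y * u))) \<le> \<Omega> * (\<Omega> * \<bar>x - y\<bar>)"
      using u by (simp add: abs_mult)
  qed (use assms in auto)
  also have "integral {0..\<Omega>} (\<lambda>u. - (u * sin (x * u)) - - (u * sin (y * u))) =
      integral {0..\<Omega>} (\<lambda>u. - (u * sin (x * u))) - integral {0..\<Omega>} (\<lambda>u. - (u * sin (y * u)))"
    by (intro integral_diff integrable_continuous_real continuous_intros)
  finally show "\<bar>sinc_factor_deriv \<Omega> x - sinc_factor_deriv \<Omega> y\<bar> \<le> \<Omega> ^ 3 / pi * \<bar>x - y\<bar>"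
    unfolding sinc_factor_deriv_def
    by (simp add: diff_divide_distrib[symmetric] divide_right_mono power3_eq_cube mult_ac)
qed

section \<open>One-dimensional integration by parts and its discretization\<close>

text \<open>A single constant for the kernel and its derivative keeps the bounds of nested estimates
  down to powers of \<open>C\<close>.\<close>

definition c1_bound :: "real \<Rightarrow> (real \<Rightarrow> real) \<Rightarrow> (real \<Rightarrow> real) \<Rightarrow> bool" where
  "c1_bound C g g' \<longleftrightarrow> continuous_on {0..1} g' \<and>
     (\<forall>z\<in>{0..1}. (g has_real_derivative g' z) (at z within {0..1}) \<and> \<bar>g z\<bar> \<le> C \<and> \<bar>g' z\<bar> \<le> C)"

text \<open>This is the Stieltjes integral of \<open>g\<close> against \<open>x\<close> over
  \<open>[0, s]\<close> with the integration by parts already carried out, hence meaningful for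
  every continuous path \<open>x\<close>.\<close>

definition parts1 :: "(real \<Rightarrow> real) \<Rightarrow> (real \<Rightarrow> real) \<Rightarrow> real \<Rightarrow> (real \<Rightarrow> real) \<Rightarrow> real" where
  "parts1 g g' s x = g s * x s - g 0 * x 0 - integral {0..s} (\<lambda>z. x z * g' z)"

text \<open>The Stieltjes sum for the same integral on the grid of step \<open>1 / n\<close>, with
  the kernel taken at right endpoints, where the sampling points lie.\<close>

definition disc1 :: "nat \<Rightarrow> nat \<Rightarrow> (real \<Rightarrow> real) \<Rightarrow> (real \<Rightarrow> real) \<Rightarrow> real" where
  "disc1 n m g x = (\<Sum>k = 1..m. g (real k / real n) * (x (real k / real n) - x (real (k - 1) / real n)))"

lemma c1_boundD:
  assumes "c1_bound C g g'" "z \<in> {0..1}"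
  shows "(g has_real_derivative g' z) (at z within {0..1})" "\<bar>g z\<bar> \<le> C" "\<bar>g' z\<bar> \<le> C" "0 \<le> C"
  using assms unfolding c1_bound_def by force+

lemma c1_bound_ftc:
  assumes "c1_bound C g g'" "0 \<le> u" "u \<le> v" "v \<le> 1"
  shows "(g' has_integral (g v - g u)) {u..v}"
proof (rule fundamental_theorem_of_calculus)
  fix z assume z: "z \<in> {u..v}"
  have "(g has_real_derivative g' z) (at z within {u..v})"
    using c1_boundD(1)[OF assms(1), of z] assms z
    by (auto intro: has_field_derivative_subset)
  then show "(g has_vector_derivative g' z) (at z within {u..v})"
    by (simp add: has_real_derivative_iff_has_vector_derivative)
qed (rule assms)

lemma c1_bound_continuous:
  assumes "c1_bound C g g'"
  shows "continuous_on {0..1} g" "continuous_on {0..1} g'"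
  using assms DERIV_continuous_on[of "{0..1}" g g'] unfolding c1_bound_def by auto

lemma c1_bound_incr:
  assumes g: "c1_bound C g g'" and uv: "0 \<le> u" "u \<le> v" "v \<le> 1"
  shows "\<bar>g v - g u\<bar> \<le> C * (v - u)"
proof -
  have "norm (integral {u..v} g') \<le> C * (v - u)"
    using uv c1_boundD(3)[OF g]
    by (intro integral_bound continuous_on_subset[OF c1_bound_continuous(2)[OF g]]) auto
  then show ?thesis using integral_unique[OF c1_bound_ftc[OF g uv]] by simp
qed

text \<open>With the path frozen at a constant the integral of \<open>g'\<close> is exact by the
  fundamental theorem of calculus; what remains is oscillation times derivative bound times
  length.\<close>

lemma c1_bound_freeze:
  assumes g: "c1_bound C g g'" and uv: "0 \<le> u" "u \<le> v" "v \<le> 1"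
    and x: "continuous_on {0..1} x" "\<And>z. z \<in> {u..v} \<Longrightarrow> \<bar>x z - c\<bar> \<le> w"
  shows "\<bar>integral {u..v} (\<lambda>z. x z * g' z) - c * (g v - g u)\<bar> \<le> w * C * (v - u)"
proof -
  have sub: "{u..v} \<subseteq> {0..1}" using uv by auto
  note c = continuous_on_subset[OF c1_bound_continuous(2)[OF g] sub] continuous_on_subset[OF x(1) sub]
  have "integral {u..v} (\<lambda>z. x z * g' z) - c * (g v - g u) = integral {u..v} (\<lambda>z. x z * g' z - c * g' z)"
    unfolding integral_unique[OF c1_bound_ftc[OF g uv], symmetric] integral_mult_right[symmetric]
    by (intro integral_diff[symmetric] integrable_continuous_real continuous_intros c)
  also have "norm \<dots> \<le> w * C * (v - u)"
  proof (intro integral_bound continuous_intros c)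
    fix z assume z: "z \<in> {u..v}"
    have "\<bar>x z - c\<bar> * \<bar>g' z\<bar> \<le> w * C"
      using x(2)[OF z] c1_boundD(3)[OF g, of z] z sub by (intro mult_mono) auto
    then show "norm (x z * g' z - c * g' z) \<le> w * C" by (simp add: left_diff_distrib[symmetric] abs_mult)
  qed (rule uv)
  finally show ?thesis by simp
qed

lemma parts1_split:
  assumes g: "c1_bound C g g'" and x: "continuous_on {0..1} x" and "0 \<le> u" "u \<le> v" "v \<le> 1"
  shows "parts1 g g' v x - parts1 g g' u x = g v * x v - g u * x u - integral {u..v} (\<lambda>z. x z * g' z)"
proof -
  have "integral {0..u} (\<lambda>z. x z * g' z) + integral {u..v} (\<lambda>z. x z * g' z) = integral {0..v} (\<lambda>z. x z * g' z)"
    using assms by (intro Henstock_Kurzweil_Integration.integral_combine integrable_continuous_real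
      continuous_intros continuous_on_subset[OF c1_bound_continuous(2)[OF g]] continuous_on_subset[OF x]) auto
  then show ?thesis unfolding parts1_def by simp
qed

lemma parts1_0: "parts1 g g' 0 x = 0"
  unfolding parts1_def by simp

text \<open>On the cell \<open>[u, v]\<close> the summand \<open>g v * (x v - x u)\<close> differs
  from the increment of \<open>parts1\<close> exactly by the error of freezing \<open>x\<close> at
  the left endpoint. These errors add up to \<open>C * w\<close> times the covered length.\<close>

lemma disc1_parts1_nodes:
  assumes g: "c1_bound C g g'" and x: "continuous_on {0..1} x" and n: "1 \<le> n" "m \<le> n"
    and w: "\<And>z z'. z \<in> {0..1} \<Longrightarrow> z' \<in> {0..1} \<Longrightarrow> \<bar>z - z'\<bar> \<le> 1 / real n \<Longrightarrow> \<bar>x z - x z'\<bar> \<le> w"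
  shows "\<bar>disc1 n m g x - parts1 g g' (real m / real n) x\<bar> \<le> C * w * (real m / real n)"
  using n(2)
proof (induction m)
  case 0
  then show ?case by (simp add: disc1_def parts1_0)
next
  case (Suc m)
  define u v where uv_def: "u = real m / real n" "v = real (Suc m) / real n"
  have uv: "0 \<le> u" "u \<le> v" "v \<le> 1" "v - u = 1 / real n"
    using n Suc.prems by (auto simp: uv_def field_simps)
  have "\<bar>x z - x u\<bar> \<le> w" if "z \<in> {u..v}" for z
    using uv that unfolding atLeastAtMost_iff by (intro w) (unfold atLeastAtMost_iff, linarith+)
  then have "\<bar>integral {u..v} (\<lambda>z. x z * g' z) - x u * (g v - g u)\<bar> \<le> w * C * (v - u)"
    using uv by (intro c1_bound_freeze[OF g] x) auto
  moreover have "disc1 n (Suc m) g x = disc1 n m g x + g v * (x v - x u)"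
    by (simp add: disc1_def uv_def)
  moreover have "parts1 g g' v x = parts1 g g' u x + (g v * x v - g u * x u - integral {u..v} (\<lambda>z. x z * g' z))"
    using parts1_split[OF g x uv(1-3)] by simp
  moreover have "\<bar>disc1 n m g x - parts1 g g' u x\<bar> \<le> C * w * u" using Suc by (simp add: uv_def)
  moreover have "C * w * v = C * w * u + w * C * (v - u)" by (simp add: algebra_simps)
  ultimately have "\<bar>disc1 n (Suc m) g x - parts1 g g' v x\<bar> \<le> C * w * v"
    by (simp add: algebra_simps)
  then show ?case by (simp add: uv_def)
qed

text \<open>The constant \<open>3\<close> collects one \<open>C * w\<close> from the nodes and two
  from the incomplete last cell between \<open>m / n\<close> and \<open>s\<close>: the freezing
  error and \<open>g ?u * (x s - x ?u)\<close>.\<close>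

lemma disc1_parts1:
  assumes g: "c1_bound C g g'" and x: "continuous_on {0..1} x" and n: "1 \<le> n" and s: "s \<in> {0..1}"
    and m: "m = nat \<lfloor>real n * s\<rfloor>"
    and w: "\<And>z z'. z \<in> {0..1} \<Longrightarrow> z' \<in> {0..1} \<Longrightarrow> \<bar>z - z'\<bar> \<le> 1 / real n \<Longrightarrow> \<bar>x z - x z'\<bar> \<le> w"
  shows "\<bar>disc1 n m g x - parts1 g g' s x\<bar> \<le> 3 * C * w"
proof -
  let ?u = "real m / real n"
  have m': "real m \<le> real n * s" "real n * s < real m + 1"
    using s m by (auto simp: of_nat_floor)
  have u1: "0 \<le> ?u" "?u \<le> s" "s \<le> 1"
    using m' n s by (auto simp: field_simps)
  have "s \<le> (real m + 1) / real n" using m' n by (simp add: field_simps)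
  then have u: "0 \<le> ?u" "?u \<le> s" "s - ?u \<le> 1 / real n" "s \<le> 1" "?u \<le> 1"
    using u1 by (auto simp: add_divide_distrib)
  then have mn: "m \<le> n" using n by (simp add: field_simps)
  have C0: "0 \<le> C" using c1_boundD(4)[OF g s] .
  have w0: "0 \<le> w" using w[OF s s] by simp
  have "\<bar>disc1 n m g x - parts1 g g' ?u x\<bar> \<le> C * w * ?u"
    by (rule disc1_parts1_nodes[OF g x n mn w])
  also have "\<dots> \<le> C * w * 1" using u C0 w0 by (intro mult_left_mono) auto
  finally have 1: "\<bar>disc1 n m g x - parts1 g g' ?u x\<bar> \<le> C * w" by simp
  have 2: "\<bar>integral {?u..s} (\<lambda>z. x z * g' z) - x s * (g s - g ?u)\<bar> \<le> w * C * (s - ?u)"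
  proof (intro c1_bound_freeze[OF g] x)
    show "\<bar>x z - x s\<bar> \<le> w" if "z \<in> {?u..s}" for z
      using u that unfolding atLeastAtMost_iff by (intro w) (unfold atLeastAtMost_iff, linarith+)
  qed (use u in auto)
  have 3: "w * C * (s - ?u) \<le> w * C * 1"
    using u w0 C0 by (intro mult_left_mono) (linarith, simp)
  have "parts1 g g' s x - parts1 g g' ?u x
      = g ?u * (x s - x ?u) - (integral {?u..s} (\<lambda>z. x z * g' z) - x s * (g s - g ?u))"
    using parts1_split[OF g x u(1,2,4)] by (simp add: algebra_simps)
  moreover have "\<bar>g ?u * (x s - x ?u)\<bar> \<le> C * w"
    unfolding abs_mult using u s c1_boundD(2)[OF g, of ?u] by (intro mult_mono w C0) auto
  ultimately show ?thesis using 1 2 3 by (simp add: mult.commute[of w C])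
qed

text \<open>Abel summation moves the differences from the path, whose variation is uncontrolled, to
  the kernel, whose increments are of order \<open>1 / n\<close>. This makes \<open>disc1\<close>
  stable under uniform perturbations of the path, uniformly in \<open>n\<close>.\<close>

lemma disc1_by_parts:
  "disc1 n m g x = g (real m / real n) * x (real m / real n) - g 0 * x 0
    - (\<Sum>k = 1..m. x (real (k - 1) / real n) * (g (real k / real n) - g (real (k - 1) / real n)))"
  by (induction m) (simp_all add: disc1_def algebra_simps)

lemma disc1_bound:
  assumes g: "c1_bound C g g'" and n: "1 \<le> n" "m \<le> n" and x: "\<And>z. z \<in> {0..1} \<Longrightarrow> \<bar>x z\<bar> \<le> e"
  shows "\<bar>disc1 n m g x\<bar> \<le> 3 * C * e"
proof -
  have nd: "real k / real n \<in> {0..1}" if "k \<le> m" for k using that n by (simp add: field_simps)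
  have C0: "0 \<le> C" using c1_boundD(4)[OF g, of 0] by simp
  have e0: "0 \<le> e" using x[of 0] by simp
  have "\<bar>\<Sum>k = 1..m. x (real (k - 1) / real n) * (g (real k / real n) - g (real (k - 1) / real n))\<bar>
      \<le> (\<Sum>k = 1..m. e * (C * (1 / real n)))"
  proof (intro order.trans[OF sum_abs] sum_mono)
    fix k assume k: "k \<in> {1..m}"
    have "\<bar>g (real k / real n) - g (real (k - 1) / real n)\<bar> \<le> C * (real k / real n - real (k - 1) / real n)"
      using nd[of k] nd[of "k - 1"] k by (intro c1_bound_incr[OF g]) (auto simp: divide_right_mono)
    also have "\<dots> = C * (1 / real n)" using k by (simp add: of_nat_diff diff_divide_distrib)
    finally show "\<bar>x (real (k - 1) / real n) * (g (real k / real n) - g (real (k - 1) / real n))\<bar> \<le> e * (C * (1 / real n))"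
      unfolding abs_mult using nd[of "k - 1"] k x e0 by (intro mult_mono) auto
  qed
  also have "\<dots> = e * C * (real m / real n)" by simp
  also have "\<dots> \<le> e * C * 1" using nd[of m] C0 e0 by (intro mult_left_mono) auto
  finally have 1: "\<bar>\<Sum>k = 1..m. x (real (k - 1) / real n) * (g (real k / real n) - g (real (k - 1) / real n))\<bar> \<le> C * e"
    by (simp add: mult.commute)
  have 2: "\<bar>g (real m / real n) * x (real m / real n)\<bar> \<le> C * e" "\<bar>g 0 * x 0\<bar> \<le> C * e"
    unfolding abs_mult using c1_boundD(2)[OF g nd[of m]] c1_boundD(2)[OF g nd[of 0]] x[OF nd[of m]] x[of 0]
    by (intro mult_mono C0; simp)+
  show ?thesis unfolding disc1_by_parts using 1 2 by linarith
qed

text \<open>Stated with bare bounds instead of \<open>c1_bound\<close>, so that it applies directly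
  to the difference of two kernels with their closeness \<open>\<kappa>\<close> as the
  constant.\<close>

lemma parts1_bound:
  assumes g: "\<bar>g s\<bar> \<le> C" "\<bar>g 0\<bar> \<le> C" "continuous_on {0..s} g'" "\<And>z. z \<in> {0..s} \<Longrightarrow> \<bar>g' z\<bar> \<le> C"
    and s: "s \<in> {0..1}" and x: "continuous_on {0..1} x" "\<And>z. z \<in> {0..1} \<Longrightarrow> \<bar>x z\<bar> \<le> K"
  shows "\<bar>parts1 g g' s x\<bar> \<le> 3 * C * K"
proof -
  have C0: "0 \<le> C" using g(1) by simp
  have K0: "0 \<le> K" using x(2)[OF s] by simp
  have sub: "{0..s} \<subseteq> {0..1}" using s by auto
  have "norm (integral {0..s} (\<lambda>z. x z * g' z)) \<le> (K * C) * (s - 0)"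
  proof (intro integral_bound continuous_intros g continuous_on_subset[OF x(1) sub])
    fix z assume z: "z \<in> {0..s}"
    then have "z \<in> {0..1}" using s by auto
    then show "norm (x z * g' z) \<le> K * C"
      unfolding real_norm_def abs_mult using x g(4)[OF z] K0 by (intro mult_mono) auto
  qed (use s in auto)
  also have "\<dots> \<le> K * C * 1" using s C0 K0 by (intro mult_left_mono) auto
  finally have 1: "\<bar>integral {0..s} (\<lambda>z. x z * g' z)\<bar> \<le> C * K" by (simp add: mult.commute)
  have 2: "\<bar>g s * x s\<bar> \<le> C * K" "\<bar>g 0 * x 0\<bar> \<le> C * K"
    unfolding abs_mult using g(1,2) x(2)[OF s] x(2)[of 0] by (intro mult_mono C0; simp)+
  show ?thesis unfolding parts1_def using 1 2 by linarith
qed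

lemma parts1_c1_bound:
  assumes g: "c1_bound C g g'" and s: "s \<in> {0..1}"
    and x: "continuous_on {0..1} x" "\<And>z. z \<in> {0..1} \<Longrightarrow> \<bar>x z\<bar> \<le> K"
  shows "\<bar>parts1 g g' s x\<bar> \<le> 3 * C * K"
  using s c1_boundD(2,3)[OF g]
  by (intro parts1_bound[OF _ _ _ _ s x] continuous_on_subset[OF c1_bound_continuous(2)[OF g]]) auto

lemma parts1_diff:
  assumes g: "c1_bound C g g'" and s: "s \<in> {0..1}"
    and x: "continuous_on {0..1} x" "continuous_on {0..1} y"
  shows "parts1 g g' s (\<lambda>z. x z - y z) = parts1 g g' s x - parts1 g g' s y"
proof -
  have sub: "{0..s} \<subseteq> {0..1}" using s by auto
  note c = continuous_on_subset[OF c1_bound_continuous(2)[OF g] sub] x[THEN continuous_on_subset, OF sub]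
  have "integral {0..s} (\<lambda>z. x z * g' z - y z * g' z) =
      integral {0..s} (\<lambda>z. x z * g' z) - integral {0..s} (\<lambda>z. y z * g' z)"
    by (intro integral_diff integrable_continuous_real continuous_intros c)
  then show ?thesis unfolding parts1_def by (simp add: algebra_simps)
qed

lemma parts1_kernel_diff:
  assumes g: "c1_bound C g g'" and h: "c1_bound C h h'" and s: "s \<in> {0..1}"
    and x: "continuous_on {0..1} x" "\<And>z. z \<in> {0..1} \<Longrightarrow> \<bar>x z\<bar> \<le> K"
    and close: "\<And>z. z \<in> {0..1} \<Longrightarrow> \<bar>g z - h z\<bar> \<le> \<kappa> \<and> \<bar>g' z - h' z\<bar> \<le> \<kappa>"
  shows "\<bar>parts1 g g' s x - parts1 h h' s x\<bar> \<le> 3 * \<kappa> * K"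
proof -
  have sub: "{0..s} \<subseteq> {0..1}" using s by auto
  note c = continuous_on_subset[OF c1_bound_continuous(2)[OF g] sub]
    continuous_on_subset[OF c1_bound_continuous(2)[OF h] sub] continuous_on_subset[OF x(1) sub]
  have "integral {0..s} (\<lambda>z. x z * g' z - x z * h' z) =
      integral {0..s} (\<lambda>z. x z * g' z) - integral {0..s} (\<lambda>z. x z * h' z)"
    by (intro integral_diff integrable_continuous_real continuous_intros c)
  then have "parts1 g g' s x - parts1 h h' s x = parts1 (\<lambda>z. g z - h z) (\<lambda>z. g' z - h' z) s x"
    unfolding parts1_def by (simp add: algebra_simps)
  also have "\<bar>\<dots>\<bar> \<le> 3 * \<kappa> * K"
    using close s by (intro parts1_bound s x continuous_intros c) auto
  finally show ?thesis .
qed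

text \<open>Three replacements, one per error term: the path \<open>y\<close> by \<open>x\<close>
  inside the sum, the sum by the integral, and the kernel \<open>g\<close> by
  \<open>h\<close>.\<close>

lemma disc1_parts1_step:
  assumes g: "c1_bound C g g'" and h: "c1_bound C h h'" and n: "1 \<le> n" and s: "s \<in> {0..1}"
    and m: "m = nat \<lfloor>real n * s\<rfloor>"
    and close: "\<And>z. z \<in> {0..1} \<Longrightarrow> \<bar>g z - h z\<bar> \<le> \<kappa> \<and> \<bar>g' z - h' z\<bar> \<le> \<kappa>"
    and x: "continuous_on {0..1} x" "\<And>z. z \<in> {0..1} \<Longrightarrow> \<bar>x z\<bar> \<le> K"
    and w: "\<And>z z'. z \<in> {0..1} \<Longrightarrow> z' \<in> {0..1} \<Longrightarrow> \<bar>z - z'\<bar> \<le> 1 / real n \<Longrightarrow> \<bar>x z - x z'\<bar> \<le> w"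
    and y: "\<And>z. z \<in> {0..1} \<Longrightarrow> \<bar>y z - x z\<bar> \<le> e"
  shows "\<bar>disc1 n m g y - parts1 h h' s x\<bar> \<le> 3 * C * e + 3 * C * w + 3 * \<kappa> * K"
proof -
  have "real m \<le> real n * s" using s m by (auto simp: of_nat_floor)
  also have "\<dots> \<le> real n" using s by (simp add: mult_left_le)
  finally have mn: "m \<le> n" by simp
  have "disc1 n m g y = disc1 n m g (\<lambda>z. y z - x z) + disc1 n m g x"
    unfolding disc1_def by (simp add: algebra_simps sum.distrib[symmetric])
  moreover have "\<bar>disc1 n m g (\<lambda>z. y z - x z)\<bar> \<le> 3 * C * e" by (rule disc1_bound[OF g n mn y])
  moreover have "\<bar>disc1 n m g x - parts1 g g' s x\<bar> \<le> 3 * C * w"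
    by (rule disc1_parts1[OF g x(1) n s m w])
  moreover have "\<bar>parts1 g g' s x - parts1 h h' s x\<bar> \<le> 3 * \<kappa> * K"
    by (rule parts1_kernel_diff[OF g h s x close])
  ultimately show ?thesis by linarith
qed

section \<open>Iteration of the one-dimensional estimate over three coordinates\<close>

definition parts3 :: "(real \<Rightarrow> real) \<times> (real \<Rightarrow> real) \<Rightarrow> (real \<Rightarrow> real) \<times> (real \<Rightarrow> real) \<Rightarrow>
    (real \<Rightarrow> real) \<times> (real \<Rightarrow> real) \<Rightarrow> real \<Rightarrow> (real \<times> real \<times> real \<Rightarrow> real) \<Rightarrow> real" where
  "parts3 g1 g2 g3 s h = parts1 (fst g1) (snd g1) s (\<lambda>z1. parts1 (fst g2) (snd g2) 1
     (\<lambda>z2. parts1 (fst g3) (snd g3) 1 (\<lambda>z3. h (z1, z2, z3))))"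

definition disc3 :: "nat \<times> nat \<times> nat \<Rightarrow> nat \<Rightarrow> (real \<Rightarrow> real) \<Rightarrow> (real \<Rightarrow> real) \<Rightarrow> (real \<Rightarrow> real) \<Rightarrow>
    (real \<times> real \<times> real \<Rightarrow> real) \<Rightarrow> real" where
  "disc3 n m g1 g2 g3 y = disc1 (fst n) m g1 (\<lambda>z1. disc1 (fst (snd n)) (fst (snd n)) g2
     (\<lambda>z2. disc1 (snd (snd n)) (snd (snd n)) g3 (\<lambda>z3. y (z1, z2, z3))))"

text \<open>Feeds the iteration: the functional of the inner coordinate is, as a function of the
  outer ones, again a continuous path.\<close>

lemma continuous_on_parts1_param:
  fixes h :: "'b::topological_space \<times> real \<Rightarrow> real"
  assumes g: "c1_bound C g g'" and s: "s \<in> {0..1}" and h: "continuous_on (S \<times> {0..1}) h"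
  shows "continuous_on S (\<lambda>x. parts1 g g' s (\<lambda>z. h (x, z)))"
proof -
  have "continuous_on (S \<times> cbox 0 s) (\<lambda>(x, z). h (x, z) * g' z)"
    unfolding case_prod_unfold using s
    by (intro continuous_on_mult continuous_on_compose2[OF h] continuous_on_compose2[OF c1_bound_continuous(2)[OF g]]
        continuous_intros) auto
  then have "continuous_on S (\<lambda>x. integral (cbox 0 s) (\<lambda>z. h (x, z) * g' z))"
    by (rule integral_continuous_on_param)
  then show ?thesis
    unfolding parts1_def using s by (intro continuous_intros continuous_on_compose2[OF h]) auto
qed

lemma parts1_modulus:
  assumes g: "c1_bound C g g'" and s: "s \<in> {0..1}"
    and x: "continuous_on {0..1} x" "continuous_on {0..1} y" "\<And>z. z \<in> {0..1} \<Longrightarrow> \<bar>x z - y z\<bar> \<le> w"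
  shows "\<bar>parts1 g g' s x - parts1 g g' s y\<bar> \<le> 3 * C * w"
  unfolding parts1_diff[OF g s x(1,2), symmetric]
  by (intro parts1_c1_bound[OF g s] continuous_intros x)

text \<open>The discretization is applied from the innermost coordinate outwards. At each level the
  sup bound and the modulus of the path grow by the factor \<open>3 * C\<close>, and the error of
  the level below plays the part of the distance between the two paths.\<close>

lemma disc3_parts3:
  fixes h y :: "real \<times> real \<times> real \<Rightarrow> real"
  assumes C: "1 \<le> C" and n: "1 \<le> n1" "1 \<le> n2" "1 \<le> n3" and s: "s \<in> {0..1}"
    and m: "m = nat \<lfloor>real n1 * s\<rfloor>"
    and g: "c1_bound C g1 g1'" "c1_bound C g2 g2'" "c1_bound C g3 g3'"
    and k: "c1_bound C k1 k1'" "c1_bound C k2 k2'" "c1_bound C k3 k3'"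
    and close: "\<And>z. z \<in> {0..1} \<Longrightarrow> \<bar>g1 z - k1 z\<bar> \<le> \<kappa> \<and> \<bar>g1' z - k1' z\<bar> \<le> \<kappa>"
      "\<And>z. z \<in> {0..1} \<Longrightarrow> \<bar>g2 z - k2 z\<bar> \<le> \<kappa> \<and> \<bar>g2' z - k2' z\<bar> \<le> \<kappa>"
      "\<And>z. z \<in> {0..1} \<Longrightarrow> \<bar>g3 z - k3 z\<bar> \<le> \<kappa> \<and> \<bar>g3' z - k3' z\<bar> \<le> \<kappa>"
    and h: "continuous_on ({0..1} \<times> {0..1} \<times> {0..1}) h"
    and hK: "\<And>z1 z2 z3. z1 \<in> {0..1} \<Longrightarrow> z2 \<in> {0..1} \<Longrightarrow> z3 \<in> {0..1} \<Longrightarrow> \<bar>h (z1, z2, z3)\<bar> \<le> K"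
    and w1: "\<And>z z' z2 z3. z \<in> {0..1} \<Longrightarrow> z' \<in> {0..1} \<Longrightarrow> z2 \<in> {0..1} \<Longrightarrow> z3 \<in> {0..1} \<Longrightarrow>
      \<bar>z - z'\<bar> \<le> 1 / real n1 \<Longrightarrow> \<bar>h (z, z2, z3) - h (z', z2, z3)\<bar> \<le> w"
    and w2: "\<And>z z' z1 z3. z \<in> {0..1} \<Longrightarrow> z' \<in> {0..1} \<Longrightarrow> z1 \<in> {0..1} \<Longrightarrow> z3 \<in> {0..1} \<Longrightarrow>
      \<bar>z - z'\<bar> \<le> 1 / real n2 \<Longrightarrow> \<bar>h (z1, z, z3) - h (z1, z', z3)\<bar> \<le> w"
    and w3: "\<And>z z' z1 z2. z \<in> {0..1} \<Longrightarrow> z' \<in> {0..1} \<Longrightarrow> z1 \<in> {0..1} \<Longrightarrow> z2 \<in> {0..1} \<Longrightarrow>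
      \<bar>z - z'\<bar> \<le> 1 / real n3 \<Longrightarrow> \<bar>h (z1, z2, z) - h (z1, z2, z')\<bar> \<le> w"
    and y: "\<And>z1 z2 z3. z1 \<in> {0..1} \<Longrightarrow> z2 \<in> {0..1} \<Longrightarrow> z3 \<in> {0..1} \<Longrightarrow> \<bar>y (z1, z2, z3) - h (z1, z2, z3)\<bar> \<le> e"
  shows "\<bar>disc3 (n1, n2, n3) m g1 g2 g3 y - parts3 (k1, k1') (k2, k2') (k3, k3') s h\<bar>
    \<le> 81 * C ^ 3 * (e + w + \<kappa> * K)"
proof -
  let ?I = "{0..1::real}"
  have one: "(1::real) \<in> ?I" by simp
  have C0: "0 \<le> C" using C by simp
  have K0: "0 \<le> K" using hK[OF s s s] by simp
  have e0: "0 \<le> e" using y[OF s s s] by simp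
  have w0: "0 \<le> w" using w1[OF s s s s] by simp
  have \<kappa>0: "0 \<le> \<kappa>" using order_trans[OF abs_ge_zero conjunct1[OF close(1)[OF s]]] .
  define X3 where "X3 = (\<lambda>(z1, z2). parts1 k3 k3' 1 (\<lambda>z3. h (z1, z2, z3)))"
  define X2 where "X2 z1 = parts1 k2 k2' 1 (\<lambda>z2. X3 (z1, z2))" for z1
  have ch: "continuous_on ((?I \<times> ?I) \<times> ?I) (\<lambda>((z1, z2), z3). h (z1, z2, z3))"
    unfolding case_prod_unfold by (intro continuous_on_compose2[OF h] continuous_intros) auto
  have c3: "continuous_on ?I (\<lambda>z. h (z1, z2, z))" if "z1 \<in> ?I" "z2 \<in> ?I" for z1 z2
    using that by (intro continuous_on_compose2[OF h] continuous_intros) auto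
  have cX3: "continuous_on (?I \<times> ?I) X3"
    using continuous_on_parts1_param[OF k(3) one ch] by (simp add: X3_def case_prod_unfold)
  have c2: "continuous_on ?I (\<lambda>z. X3 (z1, z))" if "z1 \<in> ?I" for z1
    using that by (intro continuous_on_compose2[OF cX3] continuous_intros) auto
  have cX2: "continuous_on ?I X2"
    unfolding X2_def using continuous_on_parts1_param[OF k(2) one cX3] .
  have bX3: "\<bar>X3 (z1, z2)\<bar> \<le> 3 * C * K" if "z1 \<in> ?I" "z2 \<in> ?I" for z1 z2
    unfolding X3_def prod.case using that by (intro parts1_c1_bound[OF k(3) one] c3 hK)
  have bX2: "\<bar>X2 z1\<bar> \<le> 3 * C * (3 * C * K)" if "z1 \<in> ?I" for z1
    unfolding X2_def using that by (intro parts1_c1_bound[OF k(2) one] c2 bX3)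
  have wX3: "\<bar>X3 (z1, z) - X3 (z1, z')\<bar> \<le> 3 * C * w" if "z \<in> ?I" "z' \<in> ?I" "z1 \<in> ?I" "\<bar>z - z'\<bar> \<le> 1 / real n2" for z z' z1
    unfolding X3_def prod.case using that by (intro parts1_modulus[OF k(3) one] c3 w2)
  have wX3': "\<bar>X3 (z, z2) - X3 (z', z2)\<bar> \<le> 3 * C * w" if "z \<in> ?I" "z' \<in> ?I" "z2 \<in> ?I" "\<bar>z - z'\<bar> \<le> 1 / real n1" for z z' z2
    unfolding X3_def prod.case using that by (intro parts1_modulus[OF k(3) one] c3 w1)
  have wX2: "\<bar>X2 z - X2 z'\<bar> \<le> 3 * C * (3 * C * w)" if "z \<in> ?I" "z' \<in> ?I" "\<bar>z - z'\<bar> \<le> 1 / real n1" for z z'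
    unfolding X2_def using that by (intro parts1_modulus[OF k(2) one] c2 wX3')
  define Y3 where "Y3 z1 z2 = disc1 n3 n3 g3 (\<lambda>z3. y (z1, z2, z3))" for z1 z2
  define Y2 where "Y2 z1 = disc1 n2 n2 g2 (Y3 z1)" for z1
  define e3 where "e3 = 3 * C * e + 3 * C * w + 3 * \<kappa> * K"
  define e2 where "e2 = 3 * C * e3 + 3 * C * (3 * C * w) + 3 * \<kappa> * (3 * C * K)"
  define e1 where "e1 = 3 * C * e2 + 3 * C * (3 * C * (3 * C * w)) + 3 * \<kappa> * (3 * C * (3 * C * K))"
  have 3: "\<bar>Y3 z1 z2 - X3 (z1, z2)\<bar> \<le> e3" if z: "z1 \<in> ?I" "z2 \<in> ?I" for z1 z2
    unfolding e3_def Y3_def X3_def prod.case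
    by (rule disc1_parts1_step[OF g(3) k(3) n(3) one _ close(3) c3[OF z]]) (use z hK w3 y in auto)
  have 2: "\<bar>Y2 z1 - X2 z1\<bar> \<le> e2" if z: "z1 \<in> ?I" for z1
    unfolding e2_def Y2_def X2_def
    by (rule disc1_parts1_step[OF g(2) k(2) n(2) one _ close(2) c2[OF z]]) (use z bX3 wX3 3 in auto)
  have 1: "\<bar>disc1 n1 m g1 Y2 - parts1 k1 k1' s X2\<bar> \<le> e1"
    unfolding e1_def
    by (rule disc1_parts1_step[OF g(1) k(1) n(1) s m close(1) cX2]) (use bX2 wX2 2 in auto)
  define \<rho> where "\<rho> = \<kappa> * K"
  have \<rho>0: "0 \<le> \<rho>" using \<kappa>0 K0 by (simp add: \<rho>_def)
  \<comment> \<open>Each of the three levels contributes \<open>27\<close> to the terms in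
    \<open>w\<close> and in \<open>\<rho>\<close>, hence \<open>81\<close>; \<open>1 \<le> C\<close>
    then raises \<open>C ^ 2\<close> to \<open>C ^ 3\<close>.\<close>
  have "e1 = 27 * (C ^ 3 * e) + 81 * (C ^ 3 * w) + 81 * (C ^ 2 * \<rho>)"
    unfolding e1_def e2_def e3_def \<rho>_def by (simp add: power3_eq_cube power2_eq_square algebra_simps)
  also have "\<dots> \<le> 81 * (C ^ 3 * e) + 81 * (C ^ 3 * w) + 81 * (C ^ 3 * \<rho>)"
    using C e0 \<rho>0 by (intro add_mono mult_left_mono mult_right_mono power_increasing) auto
  also have "\<dots> = 81 * C ^ 3 * (e + w + \<kappa> * K)" unfolding \<rho>_def by (simp add: algebra_simps)
  finally show ?thesis
    using 1 unfolding disc3_def parts3_def Y2_def Y3_def X2_def X3_def by simp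
qed

section \<open>Riemann--Stieltjes integrals with product integrators\<close>

text \<open>The values \<open>y k\<close> only approximate \<open>x (p k)\<close>: in the induction
  over coordinates they are cell sums over the remaining coordinates, known up to an error
  \<open>e\<close>.\<close>

lemma ladder_sum_parts:
  assumes g: "c1_bound C g g'" and x: "continuous_on {0..1} x"
    and p: "0 \<le> p 0" "p m \<le> 1" "\<And>k. k < m \<Longrightarrow> p k < p (Suc k)"
    and w: "\<And>k z. k < m \<Longrightarrow> z \<in> {p k..p (Suc k)} \<Longrightarrow> \<bar>x z - x (p k)\<bar> \<le> w"
    and y: "\<And>k. k < m \<Longrightarrow> \<bar>y k - x (p k)\<bar> \<le> e"
  shows "\<bar>(\<Sum>k<m. y k * (g (p (Suc k)) - g (p k))) - integral {p 0..p m} (\<lambda>z. x z * g' z)\<bar>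
    \<le> C * (p m - p 0) * (e + w)"
  using p w y
proof (induction m)
  case (Suc m)
  have mono: "p 0 \<le> p k" if "k \<le> m" for k
    using that
  proof (induction k)
    case (Suc k)
    then show ?case using Suc.prems less_imp_le[OF \<open>\<And>k. k < Suc m \<Longrightarrow> p k < p (Suc k)\<close>[of k]] by auto
  qed simp
  have pm: "p 0 \<le> p m" "p m \<le> p (Suc m)" "p (Suc m) \<le> 1" "0 \<le> p m" "p m \<le> 1"
    using mono[of m] Suc.prems(1,2) Suc.prems(3)[of m] by auto
  have IH: "\<bar>(\<Sum>k<m. y k * (g (p (Suc k)) - g (p k))) - integral {p 0..p m} (\<lambda>z. x z * g' z)\<bar>
    \<le> C * (p m - p 0) * (e + w)"
    using Suc.prems pm by (intro Suc.IH) auto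
  have sub: "{p 0..p (Suc m)} \<subseteq> {0..1}" using pm Suc.prems(1) by auto
  have "integral {p 0..p (Suc m)} (\<lambda>z. x z * g' z) =
      integral {p 0..p m} (\<lambda>z. x z * g' z) + integral {p m..p (Suc m)} (\<lambda>z. x z * g' z)"
    using pm sub
    by (intro Henstock_Kurzweil_Integration.integral_combine[symmetric] integrable_continuous_real
      continuous_intros continuous_on_subset[OF c1_bound_continuous(2)[OF g]] continuous_on_subset[OF x]) auto
  moreover have "\<bar>integral {p m..p (Suc m)} (\<lambda>z. x z * g' z) - x (p m) * (g (p (Suc m)) - g (p m))\<bar>
      \<le> w * C * (p (Suc m) - p m)"
    using pm Suc.prems(4)[of m] by (intro c1_bound_freeze[OF g] x) auto
  moreover have "\<bar>(y m - x (p m)) * (g (p (Suc m)) - g (p m))\<bar> \<le> e * (C * (p (Suc m) - p m))"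
    unfolding abs_mult
    using pm Suc.prems(5)[of m] by (intro mult_mono c1_bound_incr[OF g]) auto
  ultimately show ?case using IH by (simp add: algebra_simps)
qed simp

definition upd :: "'a \<Rightarrow> 'a \<Rightarrow> real \<Rightarrow> 'a::euclidean_space" where
  "upd i c z = c + (z - c \<bullet> i) *\<^sub>R i"

lemma upd_inner: "i \<in> Basis \<Longrightarrow> j \<in> Basis \<Longrightarrow> upd i c z \<bullet> j = (if j = i then z else c \<bullet> j)"
  unfolding upd_def by (simp add: inner_simps inner_Basis)

lemma upd_in_cbox:
  "i \<in> Basis \<Longrightarrow> c \<in> cbox a b \<Longrightarrow> z \<in> {a \<bullet> i..b \<bullet> i} \<Longrightarrow> upd i c z \<in> cbox a b"
  by (auto simp: mem_box upd_inner)

lemma corner_inner: "i \<in> Basis \<Longrightarrow> corner u p k c \<bullet> i = (if i \<in> u then p i (k i) else c \<bullet> i)"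
  unfolding corner_def by simp

lemma glue_inner: "i \<in> Basis \<Longrightarrow> glue u x z \<bullet> i = (if i \<in> u then x \<bullet> i else z \<bullet> i)"
  unfolding glue_def by simp

lemma sum_cells_insert:
  assumes "finite u" "i \<notin> u"
  shows "(\<Sum>k\<in>cells (insert i u) m. f k) = (\<Sum>\<kappa><m i. \<Sum>k\<in>cells u m. f (k(i := \<kappa>)))"
proof -
  have "(\<Sum>k\<in>cells (insert i u) m. f k)
      = (\<Sum>k\<in>(\<lambda>(y, g). g(i := y)) ` ({..<m i} \<times> cells u m). f k)"
    unfolding cells_def PiE_insert_eq ..
  also have "\<dots> = (\<Sum>(\<kappa>, k)\<in>{..<m i} \<times> cells u m. f (k(i := \<kappa>)))"
    by (subst sum.reindex)
      (use assms inj_combinator[of i u "\<lambda>i. {..<m i}"] in \<open>auto simp: cells_def case_prod_unfold\<close>)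
  finally show ?thesis by (simp add: sum.cartesian_product)
qed

lemma finite_cells: "finite u \<Longrightarrow> finite (cells u m)"
  unfolding cells_def by (rule finite_PiE) auto

lemma corner_insert:
  assumes "i \<in> Basis" "i \<notin> u"
  shows "corner (insert i u) p (k(i := \<kappa>)) c = corner u p k (upd i c (p i \<kappa>))"
  by (rule euclidean_eqI) (use assms in \<open>auto simp: corner_inner upd_inner\<close>)

text \<open>Iterated integrals over the coordinates in a list, against \<open>\<Prod>i. G' i\<close>.\<close>

fun iter_integral :: "('a \<Rightarrow> real \<Rightarrow> real) \<Rightarrow> 'a \<Rightarrow> 'a \<Rightarrow> 'a list \<Rightarrow> ('a \<Rightarrow> real) \<Rightarrow> 'a::euclidean_space \<Rightarrow> real" where
  "iter_integral G' a b [] h c = h c"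
| "iter_integral G' a b (i # l) h c =
     integral {a \<bullet> i..b \<bullet> i} (\<lambda>z. iter_integral G' a b l h (upd i c z) * G' i z)"

section \<open>Integrators that are products of smooth one-dimensional functions, on boxes inside
  the unit cube\<close>

context
  fixes a b :: "'a::euclidean_space" and G G' :: "'a \<Rightarrow> real \<Rightarrow> real" and C :: real and h :: "'a \<Rightarrow> real"
  assumes C: "1 \<le> C"
    and ab: "\<And>i. i \<in> Basis \<Longrightarrow> 0 \<le> a \<bullet> i \<and> a \<bullet> i < b \<bullet> i \<and> b \<bullet> i \<le> 1"
    and G: "\<And>i. i \<in> Basis \<Longrightarrow> c1_bound C (G i) (G' i)"
    and h: "continuous_on (cbox a b) h"
begin

lemma iter_integral_continuous:
  assumes "set l \<subseteq> Basis"
  shows "continuous_on (cbox a b) (iter_integral G' a b l h)"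
  using assms
proof (induction l)
  case Nil
  then show ?case using h by (simp add: continuous_on_eq)
next
  case (Cons i l)
  have i: "i \<in> Basis" and IH: "continuous_on (cbox a b) (iter_integral G' a b l h)"
    using Cons by auto
  have "continuous_on (cbox a b \<times> cbox (a \<bullet> i) (b \<bullet> i))
      (\<lambda>(c, z). iter_integral G' a b l h (upd i c z) * G' i z)"
    unfolding case_prod_unfold upd_def using ab[OF i] upd_in_cbox[OF i, of _ a b, unfolded upd_def]
    by (intro continuous_on_mult continuous_on_compose2[OF IH] continuous_intros
      continuous_on_compose2[OF c1_bound_continuous(2)[OF G[OF i]]]) auto
  then have "continuous_on (cbox a b) (\<lambda>c. integral (cbox (a \<bullet> i) (b \<bullet> i))
      (\<lambda>z. iter_integral G' a b l h (upd i c z) * G' i z))"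
    by (rule integral_continuous_on_param)
  then show ?case by simp
qed

lemma iter_integral_continuous_upd:
  assumes "set l \<subseteq> Basis" "i \<in> Basis" "c \<in> cbox a b"
  shows "continuous_on {a \<bullet> i..b \<bullet> i} (\<lambda>z. iter_integral G' a b l h (upd i c z))"
  using upd_in_cbox[OF assms(2,3)] unfolding upd_def
  by (intro continuous_on_compose2[OF iter_integral_continuous[OF assms(1)]] continuous_intros) auto

text \<open>Every integration costs one factor \<open>C\<close> for the derivative
  \<open>G' i\<close>; the edge lengths are at most \<open>1\<close> and disappear.\<close>

lemma iter_integral_modulus:
  assumes "set l \<subseteq> Basis"
    and w: "\<And>x y. x \<in> cbox a b \<Longrightarrow> y \<in> cbox a b \<Longrightarrow> (\<And>i. i \<in> Basis \<Longrightarrow> \<bar>x \<bullet> i - y \<bullet> i\<bar> \<le> \<eta>) \<Longrightarrow> \<bar>h x - h y\<bar> \<le> w"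
    and xy: "x \<in> cbox a b" "y \<in> cbox a b" "\<And>i. i \<in> Basis \<Longrightarrow> \<bar>x \<bullet> i - y \<bullet> i\<bar> \<le> \<eta>"
  shows "\<bar>iter_integral G' a b l h x - iter_integral G' a b l h y\<bar> \<le> C ^ length l * w"
  using assms(1) xy
proof (induction l arbitrary: x y)
  case Nil
  then show ?case using w by simp
next
  case (Cons i l)
  have i: "i \<in> Basis" and l: "set l \<subseteq> Basis" using Cons.prems by auto
  have w0: "0 \<le> w" using w[OF Cons.prems(2) Cons.prems(2)] order_trans[OF abs_ge_zero Cons.prems(4)[OF i]] by simp
  have \<eta>0: "0 \<le> \<eta>" using order_trans[OF abs_ge_zero Cons.prems(4)[OF i]] .
  have cG: "continuous_on {a \<bullet> i..b \<bullet> i} (G' i)"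
    using ab[OF i] by (intro continuous_on_subset[OF c1_bound_continuous(2)[OF G[OF i]]]) auto
  note cc = iter_integral_continuous_upd[OF l i]
  have "iter_integral G' a b (i # l) h x - iter_integral G' a b (i # l) h y =
      integral {a \<bullet> i..b \<bullet> i} (\<lambda>z. iter_integral G' a b l h (upd i x z) * G' i z
        - iter_integral G' a b l h (upd i y z) * G' i z)"
    unfolding iter_integral.simps
    by (intro integral_diff[symmetric] integrable_continuous_real continuous_intros cc cG Cons.prems)
  also have "norm \<dots> \<le> ((C ^ length l * w) * C) * (b \<bullet> i - a \<bullet> i)"
  proof (intro integral_bound continuous_intros cc cG Cons.prems)
    fix z assume z: "z \<in> {a \<bullet> i..b \<bullet> i}"
    have "\<bar>iter_integral G' a b l h (upd i x z) - iter_integral G' a b l h (upd i y z)\<bar> \<le> C ^ length l * w"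
      using Cons.prems z i l \<eta>0 by (intro Cons.IH upd_in_cbox) (auto simp: upd_inner)
    then have "\<bar>iter_integral G' a b l h (upd i x z) - iter_integral G' a b l h (upd i y z)\<bar> * \<bar>G' i z\<bar>
      \<le> (C ^ length l * w) * C"
      using z ab[OF i] order_trans[OF zero_le_one C] w0 by (intro mult_mono c1_boundD(3)[OF G[OF i]]) auto
    then show "norm (iter_integral G' a b l h (upd i x z) * G' i z
        - iter_integral G' a b l h (upd i y z) * G' i z) \<le> (C ^ length l * w) * C"
      by (simp add: abs_mult left_diff_distrib[symmetric])
  qed (use ab[OF i] in simp)
  also have "\<dots> \<le> ((C ^ length l * w) * C) * 1"
    using ab[OF i] order_trans[OF zero_le_one C] w0 by (intro mult_left_mono) auto
  finally show ?case by (simp add: mult_ac)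
qed

lemma ladder_mem:
  assumes "ladder u a b m p" "i \<in> u" "k \<le> m i"
  shows "p i k \<in> {a \<bullet> i..b \<bullet> i}"
proof -
  have lt: "\<And>k. k < m i \<Longrightarrow> p i k < p i (Suc k)" and e: "p i 0 = a \<bullet> i" "p i (m i) = b \<bullet> i"
    using assms unfolding ladder_def by auto
  have "p i 0 \<le> p i j" if "j \<le> m i" for j
    using that
  proof (induction j)
    case (Suc j)
    then show ?case using lt[of j] by simp
  qed simp
  moreover have "p i (m i - j) \<le> p i (m i)" if "j \<le> m i" for j
    using that
  proof (induction j)
    case (Suc j)
    then show ?case using lt[of "m i - Suc j"] by (simp add: Suc_diff_Suc)
  qed simp
  from this[of "m i - k"] have "p i k \<le> p i (m i)" using assms(3) by simp
  ultimately show ?thesis using assms(3) e by simp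
qed

text \<open>Separating the coordinate \<open>i\<close> turns the cell sum into a one-dimensional
  ladder sum whose values are the cell sums over \<open>l\<close>. Each coordinate adds one freezing
  error, whence the factor \<open>length l\<close>.\<close>

lemma cell_sum_iter_integral:
  assumes l: "set l \<subseteq> Basis" "distinct l" and p: "ladder (set l) a b m p"
    and mesh: "\<And>i k. i \<in> set l \<Longrightarrow> k < m i \<Longrightarrow> p i (Suc k) - p i k \<le> \<eta>"
    and w: "\<And>x y. x \<in> cbox a b \<Longrightarrow> y \<in> cbox a b \<Longrightarrow> (\<And>i. i \<in> Basis \<Longrightarrow> \<bar>x \<bullet> i - y \<bullet> i\<bar> \<le> \<eta>) \<Longrightarrow> \<bar>h x - h y\<bar> \<le> w"
    and \<eta>: "0 \<le> \<eta>" and c: "c \<in> cbox a b"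
  shows "\<bar>(\<Sum>k\<in>cells (set l) m. h (corner (set l) p k c) *
      (\<Prod>i\<in>set l. G i (p i (Suc (k i))) - G i (p i (k i)))) - iter_integral G' a b l h c\<bar>
    \<le> real (length l) * C ^ length l * w"
  using l p mesh c
proof (induction l arbitrary: c)
  case Nil
  have "corner {} p k c = c" for k
    unfolding corner_def by (simp add: euclidean_representation)
  then show ?case by (simp add: cells_def)
next
  case (Cons i l)
  have i: "i \<in> Basis" "i \<notin> set l" and l: "set l \<subseteq> Basis" "distinct l" using Cons.prems by auto
  have lad: "ladder (set l) a b m p" using Cons.prems(3) unfolding ladder_def by auto
  have li: "p i 0 = a \<bullet> i" "p i (m i) = b \<bullet> i" "\<And>k. k < m i \<Longrightarrow> p i k < p i (Suc k)"
    using Cons.prems(3) unfolding ladder_def by auto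
  have pm: "p i k \<in> {a \<bullet> i..b \<bullet> i}" if "k \<le> m i" for k
    using ladder_mem[OF Cons.prems(3) _ that] by simp
  have w0: "0 \<le> w" using w[OF Cons.prems(5) Cons.prems(5)] \<eta> by simp
  define S where "S c = (\<Sum>k\<in>cells (set l) m. h (corner (set l) p k c) *
      (\<Prod>i\<in>set l. G i (p i (Suc (k i))) - G i (p i (k i))))" for c
  define x where "x z = iter_integral G' a b l h (upd i c z)" for z
  have IH: "\<bar>S c - iter_integral G' a b l h c\<bar> \<le> real (length l) * C ^ length l * w" if "c \<in> cbox a b" for c
    unfolding S_def using Cons.prems(4) that by (intro Cons.IH l lad) auto
  have prod: "(\<Prod>j\<in>set l. G j (p j (Suc ((k(i := \<kappa>)) j))) - G j (p j ((k(i := \<kappa>)) j))) =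
      (\<Prod>j\<in>set l. G j (p j (Suc (k j))) - G j (p j (k j)))" for k \<kappa>
    using i by (intro prod.cong) auto
  have "(\<Sum>k\<in>cells (set (i # l)) m. h (corner (set (i # l)) p k c) *
      (\<Prod>i\<in>set (i # l). G i (p i (Suc (k i))) - G i (p i (k i))))
    = (\<Sum>\<kappa><m i. S (upd i c (p i \<kappa>)) * (G i (p i (Suc \<kappa>)) - G i (p i \<kappa>)))"
    using i unfolding list.set(2)
    by (subst sum_cells_insert)
      (simp_all add: corner_insert prod S_def sum_distrib_right mult_ac del: fun_upd_apply,
       simp_all add: sum_distrib_left mult_ac)
  \<comment> \<open>The clamp extends the inner iterated integral from
    \<open>{a \<bullet> i..b \<bullet> i}\<close> to a continuous function on \<open>{0..1}\<close>,
    the domain expected by \<open>ladder_sum_parts\<close>; it leaves the integral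
    unchanged.\<close>
  moreover have "\<bar>(\<Sum>\<kappa><m i. S (upd i c (p i \<kappa>)) * (G i (p i (Suc \<kappa>)) - G i (p i \<kappa>)))
      - integral {p i 0..p i (m i)} (\<lambda>z. x (max (a \<bullet> i) (min (b \<bullet> i) z)) * G' i z)\<bar>
    \<le> C * (p i (m i) - p i 0) * (real (length l) * C ^ length l * w + C ^ length l * w)"
  proof (rule ladder_sum_parts[OF G[OF i(1)]])
    show "continuous_on {0..1} (\<lambda>z. x (max (a \<bullet> i) (min (b \<bullet> i) z)))"
      unfolding x_def using ab[OF i(1)]
      by (intro continuous_on_compose2[OF iter_integral_continuous_upd[OF l(1) i(1) Cons.prems(5)]]
        continuous_intros) auto
    show "0 \<le> p i 0" "p i (m i) \<le> 1" using li ab[OF i(1)] by auto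
    show "p i k < p i (Suc k)" if "k < m i" for k using li(3) that .
    fix k assume k: "k < m i"
    have m1: "p i k \<in> {a \<bullet> i..b \<bullet> i}" "p i (Suc k) \<in> {a \<bullet> i..b \<bullet> i}" using pm[of k] pm[of "Suc k"] k by auto
    have e: "max (a \<bullet> i) (min (b \<bullet> i) z) = z" if "z \<in> {a \<bullet> i..b \<bullet> i}" for z using that by auto
    show "\<bar>S (upd i c (p i k)) - x (max (a \<bullet> i) (min (b \<bullet> i) (p i k)))\<bar> \<le> real (length l) * C ^ length l * w"
      unfolding e[OF m1(1)] x_def by (intro IH upd_in_cbox i Cons.prems m1)
    fix z assume z: "z \<in> {p i k..p i (Suc k)}"
    then have z': "z \<in> {a \<bullet> i..b \<bullet> i}" using m1 by auto
    have "\<bar>z - p i k\<bar> \<le> \<eta>" using z Cons.prems(4)[of i k] k by auto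
    then show "\<bar>x (max (a \<bullet> i) (min (b \<bullet> i) z)) - x (max (a \<bullet> i) (min (b \<bullet> i) (p i k)))\<bar> \<le> C ^ length l * w"
      unfolding e[OF m1(1)] e[OF z'] x_def using i(1) \<eta>
      by (intro iter_integral_modulus[OF l(1) w] upd_in_cbox Cons.prems(5) z' m1) (auto simp: upd_inner)
  qed
  moreover have "integral {p i 0..p i (m i)} (\<lambda>z. x (max (a \<bullet> i) (min (b \<bullet> i) z)) * G' i z)
      = iter_integral G' a b (i # l) h c"
    unfolding li(1,2) iter_integral.simps x_def by (rule integral_cong) auto
  moreover have "C * (p i (m i) - p i 0) * (real (length l) * C ^ length l * w + C ^ length l * w)
      \<le> C * 1 * (real (length l) * C ^ length l * w + C ^ length l * w)"
    unfolding li(1,2) using ab[OF i(1)] order_trans[OF zero_le_one C] w0 by (intro mult_right_mono mult_left_mono) auto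
  ultimately show ?case by (simp add: algebra_simps)
qed

lemma alt_sum_prod:
  assumes u: "u \<subseteq> Basis"
  shows "alt_sum u (\<lambda>x. \<Prod>i\<in>Basis. G i (x \<bullet> i)) (corner u p k c) (corner u p (\<lambda>i. Suc (k i)) c)
    = (\<Prod>i\<in>u. G i (p i (Suc (k i))) - G i (p i (k i))) * (\<Prod>i\<in>Basis - u. G i (c \<bullet> i))"
proof -
  have fin: "finite u" using u finite_subset finite_Basis by blast
  have "(\<Prod>i\<in>Basis. G i (glue v (corner u p k c) (corner u p (\<lambda>i. Suc (k i)) c) \<bullet> i)) =
      (\<Prod>i\<in>v. G i (p i (k i))) * (\<Prod>i\<in>u - v. G i (p i (Suc (k i)))) * (\<Prod>i\<in>Basis - u. G i (c \<bullet> i))"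
    if v: "v \<subseteq> u" for v
  proof -
    have e: "Basis = v \<union> ((u - v) \<union> (Basis - u))" using u v by auto
    have f: "finite v" "finite (u - v)" using fin v finite_subset by auto
    let ?F = "\<lambda>i. G i (glue v (corner u p k c) (corner u p (\<lambda>i. Suc (k i)) c) \<bullet> i)"
    have "prod ?F Basis = prod ?F v * (prod ?F (u - v) * prod ?F (Basis - u))"
      by (subst e, subst prod.union_disjoint, (use f v in auto)[3], subst prod.union_disjoint)
        (use f v in auto)
    moreover have "prod ?F v = (\<Prod>i\<in>v. G i (p i (k i)))"
      "prod ?F (u - v) = (\<Prod>i\<in>u - v. G i (p i (Suc (k i))))"
      "prod ?F (Basis - u) = (\<Prod>i\<in>Basis - u. G i (c \<bullet> i))"
      using u v by (auto intro!: prod.cong simp: glue_inner corner_inner subset_iff)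
    ultimately show ?thesis by (simp add: mult_ac)
  qed
  then show ?thesis
    unfolding alt_sum_def prod_diff_conv_sum[OF fin] sum_distrib_right
    by (intro sum.cong) (auto simp: mult_ac)
qed

text \<open>The sum over a product partition factors into one-dimensional variations, each at most
  \<open>C\<close> times an edge length and hence at most \<open>C\<close>.\<close>

lemma sum_abs_increments:
  assumes u: "u \<subseteq> Basis" and p: "ladder u a b m p"
  shows "(\<Sum>k\<in>cells u m. \<bar>\<Prod>i\<in>u. G i (p i (Suc (k i))) - G i (p i (k i))\<bar>) \<le> C ^ card u"
proof -
  have fin: "finite u" using u finite_subset finite_Basis by blast
  have "(\<Sum>k\<in>cells u m. \<bar>\<Prod>i\<in>u. G i (p i (Suc (k i))) - G i (p i (k i))\<bar>)
      = (\<Prod>i\<in>u. \<Sum>\<kappa><m i. \<bar>G i (p i (Suc \<kappa>)) - G i (p i \<kappa>)\<bar>)"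
    unfolding abs_prod cells_def using fin by (subst prod_sum_PiE) auto
  also have "\<dots> \<le> (\<Prod>i\<in>u. C)"
  proof (rule prod_mono, safe)
    fix i assume i: "i \<in> u"
    then have iB: "i \<in> Basis" using u by auto
    have "(\<Sum>\<kappa><m i. \<bar>G i (p i (Suc \<kappa>)) - G i (p i \<kappa>)\<bar>) \<le> (\<Sum>\<kappa><m i. C * (p i (Suc \<kappa>) - p i \<kappa>))"
    proof (rule sum_mono)
      fix \<kappa> assume \<kappa>: "\<kappa> \<in> {..<m i}"
      have "p i \<kappa> < p i (Suc \<kappa>)" using p i \<kappa> unfolding ladder_def by auto
      then show "\<bar>G i (p i (Suc \<kappa>)) - G i (p i \<kappa>)\<bar> \<le> C * (p i (Suc \<kappa>) - p i \<kappa>)"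
        using ladder_mem[OF p i, of \<kappa>] ladder_mem[OF p i, of "Suc \<kappa>"] \<kappa> ab[OF iB]
        by (intro c1_bound_incr[OF G[OF iB]]) auto
    qed
    also have "\<dots> = C * (p i (m i) - p i 0)"
      by (simp add: sum_distrib_left[symmetric] sum_lessThan_telescope)
    also have "\<dots> \<le> C * 1"
      using p i ab[OF iB] order_trans[OF zero_le_one C] unfolding ladder_def by (intro mult_left_mono) auto
    finally show "(\<Sum>\<kappa><m i. \<bar>G i (p i (Suc \<kappa>)) - G i (p i \<kappa>)\<bar>) \<le> C" by simp
  qed
  finally show ?thesis by simp
qed

text \<open>There are two errors. Moving each tag to the lower corner costs the modulus of
  \<open>h\<close> times the total variation of the integrator; comparing the corner sum with the
  iterated integral is \<open>cell_sum_iter_integral\<close>.\<close>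

lemma has_rs_integral_prod:
  assumes l: "set l \<subseteq> Basis" "distinct l" and c: "c \<in> cbox a b"
  shows "has_rs_integral (set l) a b c h (\<lambda>x. \<Prod>i\<in>Basis. G i (x \<bullet> i))
    (iter_integral G' a b l h c * (\<Prod>i\<in>Basis - set l. G i (c \<bullet> i)))"
  unfolding has_rs_integral_def
proof (intro allI impI)
  fix \<epsilon> :: real assume \<epsilon>: "0 < \<epsilon>"
  define R where "R = (\<Prod>i\<in>Basis - set l. G i (c \<bullet> i))"
  define A where "A = (C ^ card (set l) + real (length l) * C ^ length l + 1) * (\<bar>R\<bar> + 1)"
  have A: "0 < A" unfolding A_def using order_trans[OF zero_le_one C] by (intro mult_pos_pos add_nonneg_pos add_nonneg_nonneg) auto
  define w where "w = \<epsilon> / (2 * A)"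
  have w: "0 < w" using \<epsilon> A by (simp add: w_def)
  obtain d where d: "d > 0" and dh: "\<And>x y. x \<in> cbox a b \<Longrightarrow> y \<in> cbox a b \<Longrightarrow> dist y x < d \<Longrightarrow> dist (h y) (h x) < w"
    using compact_uniformly_continuous[OF h compact_cbox] w unfolding uniformly_continuous_on_def by metis
  \<comment> \<open>A coordinatewise bound \<open>\<eta>\<close> gives distance at most
    \<open>d / 2\<close>, since the norm is at most the sum of the coordinates.\<close>
  define \<eta> where "\<eta> = d / (2 * real DIM('a))"
  have \<eta>: "0 < \<eta>" using d by (simp add: \<eta>_def)
  have hw: "\<bar>h x - h y\<bar> \<le> w" if "x \<in> cbox a b" "y \<in> cbox a b" "\<And>i. i \<in> Basis \<Longrightarrow> \<bar>x \<bullet> i - y \<bullet> i\<bar> \<le> \<eta>" for x y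
  proof -
    have "dist x y \<le> (\<Sum>i\<in>Basis. \<bar>(x - y) \<bullet> i\<bar>)" unfolding dist_norm by (rule norm_le_l1)
    also have "\<dots> \<le> (\<Sum>i\<in>(Basis :: 'a set). \<eta>)" using that(3) by (intro sum_mono) (simp add: inner_diff_left)
    also have "\<dots> < d" using d by (simp add: \<eta>_def)
    finally show ?thesis using dh[OF that(2,1)] by (simp add: dist_real_def)
  qed
  let ?g = "\<lambda>x. \<Prod>i\<in>Basis. G i (x \<bullet> i)"
  show "\<exists>\<eta>>0. \<forall>m p \<xi>. ladder (set l) a b m p \<and> (\<forall>i\<in>set l. \<forall>k<m i. p i (Suc k) - p i k < \<eta>) \<and>
      (\<forall>k\<in>cells (set l) m. \<xi> k \<in> cbox (corner (set l) p k c) (corner (set l) p (\<lambda>i. Suc (k i)) c)) \<longrightarrow>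
      \<bar>(\<Sum>k\<in>cells (set l) m. h (\<xi> k) * alt_sum (set l) ?g (corner (set l) p k c) (corner (set l) p (\<lambda>i. Suc (k i)) c))
        - iter_integral G' a b l h c * (\<Prod>i\<in>Basis - set l. G i (c \<bullet> i))\<bar> < \<epsilon>"
  proof (intro exI[of _ \<eta>] conjI allI impI \<eta>)
    fix m p \<xi>
    assume asm: "ladder (set l) a b m p \<and> (\<forall>i\<in>set l. \<forall>k<m i. p i (Suc k) - p i k < \<eta>) \<and>
      (\<forall>k\<in>cells (set l) m. \<xi> k \<in> cbox (corner (set l) p k c) (corner (set l) p (\<lambda>i. Suc (k i)) c))"
    then have lad: "ladder (set l) a b m p" and mesh: "\<And>i k. i \<in> set l \<Longrightarrow> k < m i \<Longrightarrow> p i (Suc k) - p i k < \<eta>"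
      and tag: "\<And>k. k \<in> cells (set l) m \<Longrightarrow> \<xi> k \<in> cbox (corner (set l) p k c) (corner (set l) p (\<lambda>i. Suc (k i)) c)"
      by auto
    define D where "D k = (\<Prod>i\<in>set l. G i (p i (Suc (k i))) - G i (p i (k i)))" for k
    have near: "\<bar>h (\<xi> k) - h (corner (set l) p k c)\<bar> \<le> w" if k: "k \<in> cells (set l) m" for k
    proof (rule hw)
      have lt: "k i < m i" if "i \<in> set l" for i using k that unfolding cells_def by auto
      have mem: "p i (k i) \<in> {a \<bullet> i..b \<bullet> i}" "p i (Suc (k i)) \<in> {a \<bullet> i..b \<bullet> i}" if "i \<in> set l" for i
        using ladder_mem[OF lad that] lt[OF that] by auto
      show "corner (set l) p k c \<in> cbox a b"
        using c mem by (auto simp: mem_box corner_inner)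
      have tg: "corner (set l) p k c \<bullet> i \<le> \<xi> k \<bullet> i" "\<xi> k \<bullet> i \<le> corner (set l) p (\<lambda>i. Suc (k i)) c \<bullet> i"
        if "i \<in> Basis" for i using tag[OF k] that by (auto simp: mem_box)
      show "\<xi> k \<in> cbox a b"
        unfolding mem_box
      proof
        fix i :: 'a assume i: "i \<in> Basis"
        show "a \<bullet> i \<le> \<xi> k \<bullet> i \<and> \<xi> k \<bullet> i \<le> b \<bullet> i"
          using tg[OF i] mem[of i] c i by (cases "i \<in> set l") (auto simp: corner_inner mem_box)
      qed
      show "\<bar>\<xi> k \<bullet> i - corner (set l) p k c \<bullet> i\<bar> \<le> \<eta>" if i: "i \<in> Basis" for i
        using tg[OF i] mesh[of i "k i"] lt[of i] \<eta> i by (cases "i \<in> set l") (auto simp: corner_inner)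
    qed
    have "\<bar>(\<Sum>k\<in>cells (set l) m. h (\<xi> k) * D k) - (\<Sum>k\<in>cells (set l) m. h (corner (set l) p k c) * D k)\<bar>
        \<le> (\<Sum>k\<in>cells (set l) m. w * \<bar>D k\<bar>)"
      unfolding sum_subtractf[symmetric] left_diff_distrib[symmetric]
      by (rule order_trans[OF sum_abs]) (auto intro!: sum_mono mult_right_mono near simp: abs_mult)
    also have "\<dots> \<le> w * C ^ card (set l)"
      unfolding sum_distrib_left[symmetric] D_def using w by (intro mult_left_mono sum_abs_increments l lad) auto
    finally have 1: "\<bar>(\<Sum>k\<in>cells (set l) m. h (\<xi> k) * D k) - (\<Sum>k\<in>cells (set l) m. h (corner (set l) p k c) * D k)\<bar>
        \<le> w * C ^ card (set l)" .
    have 2: "\<bar>(\<Sum>k\<in>cells (set l) m. h (corner (set l) p k c) * D k) - iter_integral G' a b l h c\<bar>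
        \<le> real (length l) * C ^ length l * w"
      unfolding D_def using mesh \<eta> by (intro cell_sum_iter_integral[OF l lad _ hw _ c]) (auto intro: less_imp_le)
    have "\<bar>(\<Sum>k\<in>cells (set l) m. h (\<xi> k) * D k) - iter_integral G' a b l h c\<bar>
        \<le> w * C ^ card (set l) + real (length l) * C ^ length l * w"
      using 1 2 by linarith
    also have "\<dots> \<le> w * (C ^ card (set l) + real (length l) * C ^ length l + 1)"
      using w by (simp add: algebra_simps)
    finally have "\<bar>(\<Sum>k\<in>cells (set l) m. h (\<xi> k) * D k) - iter_integral G' a b l h c\<bar> * \<bar>R\<bar>
        \<le> w * (C ^ card (set l) + real (length l) * C ^ length l + 1) * (\<bar>R\<bar> + 1)"
      using w order_trans[OF zero_le_one C] by (intro mult_mono) auto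
    also have "\<dots> = w * A" by (simp add: A_def mult.assoc)
    also have "\<dots> = \<epsilon> / 2" using A by (simp add: w_def)
    finally have "\<bar>(\<Sum>k\<in>cells (set l) m. h (\<xi> k) * D k) - iter_integral G' a b l h c\<bar> * \<bar>R\<bar> < \<epsilon>"
      using \<epsilon> by simp
    then show "\<bar>(\<Sum>k\<in>cells (set l) m. h (\<xi> k) * alt_sum (set l) ?g (corner (set l) p k c) (corner (set l) p (\<lambda>i. Suc (k i)) c))
        - iter_integral G' a b l h c * (\<Prod>i\<in>Basis - set l. G i (c \<bullet> i))\<bar> < \<epsilon>"
      unfolding alt_sum_prod[OF l(1)] R_def[symmetric] D_def[symmetric] mult.assoc[symmetric]
        sum_distrib_right[symmetric] left_diff_distrib[symmetric] abs_mult .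
  qed
qed

text \<open>Edges of positive length admit strictly increasing uniform ladders of arbitrarily small
  mesh. One tagged sum over such a ladder would lie within half of \<open>\<bar>I - I'\<bar>\<close>
  of both candidate limits.\<close>

lemma has_rs_integral_unique:
  assumes u: "u \<subseteq> Basis" and I: "has_rs_integral u a b c f g I" "has_rs_integral u a b c f g I'"
  shows "I = I'"
proof (rule ccontr)
  assume "I \<noteq> I'"
  then have e: "\<bar>I - I'\<bar> / 2 > 0" by simp
  obtain d d' where d: "d > 0" "d' > 0" and
    D: "\<And>m p \<xi>. ladder u a b m p \<and> (\<forall>i\<in>u. \<forall>k<m i. p i (Suc k) - p i k < d) \<and>
        (\<forall>k\<in>cells u m. \<xi> k \<in> cbox (corner u p k c) (corner u p (\<lambda>i. Suc (k i)) c)) \<Longrightarrow>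
      \<bar>(\<Sum>k\<in>cells u m. f (\<xi> k) * alt_sum u g (corner u p k c) (corner u p (\<lambda>i. Suc (k i)) c)) - I\<bar> < \<bar>I - I'\<bar> / 2" and
    D': "\<And>m p \<xi>. ladder u a b m p \<and> (\<forall>i\<in>u. \<forall>k<m i. p i (Suc k) - p i k < d') \<and>
        (\<forall>k\<in>cells u m. \<xi> k \<in> cbox (corner u p k c) (corner u p (\<lambda>i. Suc (k i)) c)) \<Longrightarrow>
      \<bar>(\<Sum>k\<in>cells u m. f (\<xi> k) * alt_sum u g (corner u p k c) (corner u p (\<lambda>i. Suc (k i)) c)) - I'\<bar> < \<bar>I - I'\<bar> / 2"
    using I[unfolded has_rs_integral_def, rule_format, OF e] by blast
  obtain n :: nat where n: "1 / min d d' < real n" using reals_Archimedean2 by blast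
  then have n0: "0 < real n" using d by (meson less_trans divide_pos_pos min_less_iff_conj zero_less_one)
  have "0 < min d d'" using d by simp
  then have nd: "1 / real n < min d d'"
    using n unfolding pos_divide_less_eq[OF n0] by (simp add: pos_divide_less_eq mult.commute)
  define p where "p i k = a \<bullet> i + real k * ((b \<bullet> i - a \<bullet> i) / real n)" for i k
  have step: "p i (Suc k) - p i k = (b \<bullet> i - a \<bullet> i) / real n" for i k
    unfolding p_def by (simp add: distrib_right del: times_divide_eq_right)
  have pos: "0 < (b \<bullet> i - a \<bullet> i) / real n" "(b \<bullet> i - a \<bullet> i) / real n \<le> 1 / real n" if "i \<in> u" for i
    using ab[of i] that u n0 by (auto intro!: divide_right_mono)
  have lad: "ladder u a b (\<lambda>_. n) p"
    unfolding ladder_def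
  proof (intro ballI conjI allI impI)
    show "p i 0 = a \<bullet> i" "p i n = b \<bullet> i" for i using n0 by (simp_all add: p_def)
    show "p i k < p i (Suc k)" if "i \<in> u" for i k using step[of i k] pos(1)[OF that] by linarith
  qed
  have tag: "corner u p k c \<in> cbox (corner u p k c) (corner u p (\<lambda>i. Suc (k i)) c)" for k
    unfolding mem_box
  proof
    fix i :: 'a assume i: "i \<in> Basis"
    show "corner u p k c \<bullet> i \<le> corner u p k c \<bullet> i \<and> corner u p k c \<bullet> i \<le> corner u p (\<lambda>i. Suc (k i)) c \<bullet> i"
      using i step[of i "k i"] pos[of i] by (cases "i \<in> u") (auto simp: corner_inner)
  qed
  have mesh: "p i (Suc k) - p i k < d" "p i (Suc k) - p i k < d'" if "i \<in> u" for i k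
    unfolding step using pos[OF that] nd by auto
  let ?S = "\<Sum>k\<in>cells u (\<lambda>_. n). f (corner u p k c) * alt_sum u g (corner u p k c) (corner u p (\<lambda>i. Suc (k i)) c)"
  have "\<bar>?S - I\<bar> < \<bar>I - I'\<bar> / 2" using lad tag mesh by (intro D) blast
  moreover have "\<bar>?S - I'\<bar> < \<bar>I - I'\<bar> / 2" using lad tag mesh by (intro D') blast
  moreover have False if "\<bar>S - I\<bar> < \<bar>I - I'\<bar> / 2" "\<bar>S - I'\<bar> < \<bar>I - I'\<bar> / 2" for S
    using that by (simp add: abs_if split: if_splits)
  ultimately show False by blast
qed

lemma rs_integral_prod:
  assumes "set l \<subseteq> Basis" "distinct l" "c \<in> cbox a b"
  shows "rs_integral (set l) a b c h (\<lambda>x. \<Prod>i\<in>Basis. G i (x \<bullet> i)) =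
    iter_integral G' a b l h c * (\<Prod>i\<in>Basis - set l. G i (c \<bullet> i))"
  unfolding rs_integral_def
  using has_rs_integral_prod[OF assms] has_rs_integral_unique[OF assms(1) _ has_rs_integral_prod[OF assms]]
  by (rule the_equality)

end

text \<open>The combination has the shape of an inner \<open>parts1\<close>, two boundary terms and
  an integral, so nested functionals can be expanded with it.\<close>

lemma parts1_linear:
  assumes g: "c1_bound C g g'" and s: "s \<in> {0..1}"
    and c: "continuous_on {0..1} x" "continuous_on {0..1} y" "continuous_on {0..1} z"
  shows "parts1 g g' s (\<lambda>t. \<alpha> * x t - \<beta> * y t - z t) = \<alpha> * parts1 g g' s x - \<beta> * parts1 g g' s y - parts1 g g' s z"
proof -
  have scale: "parts1 g g' s (\<lambda>t. r * u t) = r * parts1 g g' s u" for r u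
    by (simp add: parts1_def algebra_simps)
  show ?thesis
    unfolding scale[symmetric] by (subst parts1_diff[OF g s], (intro continuous_intros c)+)+ simp
qed

section \<open>The integral by parts in three dimensions as a nested functional\<close>

definition E1 :: "real \<times> real \<times> real" where "E1 = (1, 0, 0)"
definition E2 :: "real \<times> real \<times> real" where "E2 = (0, 1, 0)"
definition E3 :: "real \<times> real \<times> real" where "E3 = (0, 0, 1)"

lemma Basis_triple: "(Basis :: (real \<times> real \<times> real) set) = {E1, E2, E3}"
  unfolding E1_def E2_def E3_def by (auto simp: Basis_prod_def zero_prod_def)

lemma E_distinct [simp]: "E1 \<noteq> E2" "E1 \<noteq> E3" "E2 \<noteq> E3" "E2 \<noteq> E1" "E3 \<noteq> E1" "E3 \<noteq> E2"
  by (auto simp: E1_def E2_def E3_def)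

lemma E_inner [simp]: "(x1, x2, x3) \<bullet> E1 = x1" "(x1, x2, x3) \<bullet> E2 = x2" "(x1, x2, x3) \<bullet> E3 = x3"
  by (auto simp: E1_def E2_def E3_def)

lemma E_in_Basis [simp]: "E1 \<in> Basis" "E2 \<in> Basis" "E3 \<in> Basis"
  by (auto simp: Basis_triple)

lemma triple_eqI: "(\<And>i. i \<in> {E1, E2, E3} \<Longrightarrow> x \<bullet> i = y \<bullet> i) \<Longrightarrow> x = y"
  by (rule euclidean_eqI) (simp add: Basis_triple)

lemma glue_triple: "glue u (x1, x2, x3) (z1, z2, z3) =
    (if E1 \<in> u then x1 else z1, if E2 \<in> u then x2 else z2, if E3 \<in> u then x3 else z3)"
  by (rule triple_eqI) (elim insertE emptyE; simp add: glue_inner)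

lemma upd_triple [simp]:
  "upd E1 (c1, c2, c3) z = (z, c2, c3)" "upd E2 (c1, c2, c3) z = (c1, z, c3)" "upd E3 (c1, c2, c3) z = (c1, c2, z)"
  by (rule triple_eqI, elim insertE emptyE; simp add: upd_inner)+

lemma sum_Pow_insert:
  assumes "finite A" "x \<notin> A"
  shows "(\<Sum>v\<in>Pow (insert x A). F v) = (\<Sum>v\<in>Pow A. F v) + (\<Sum>v\<in>Pow A. F (insert x v))"
proof -
  have "(\<Sum>v\<in>Pow (insert x A). F v) = (\<Sum>v\<in>Pow A. F v) + (\<Sum>v\<in>insert x ` Pow A. F v)"
    unfolding Pow_insert using assms by (intro sum.union_disjoint) auto
  also have "(\<Sum>v\<in>insert x ` Pow A. F v) = (\<Sum>v\<in>Pow A. F (insert x v))"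
    using assms by (subst sum.reindex) (auto intro!: inj_onI)
  finally show ?thesis .
qed

lemma proper_subsets_triple:
  "{v. v \<subseteq> {E1, E2, E3} \<and> 1 \<le> card v \<and> card v \<le> 2} = {{E1}, {E2}, {E3}, {E1, E2}, {E1, E3}, {E2, E3}}"
    (is "?L = ?R")
proof (intro equalityI subsetI)
  fix v assume v: "v \<in> ?L"
  then have "v = (if E1 \<in> v then {E1} else {}) \<union> (if E2 \<in> v then {E2} else {}) \<union> (if E3 \<in> v then {E3} else {})"
    by auto
  then obtain p q r where "v = (if p then {E1} else {}) \<union> (if q then {E2} else {}) \<union> (if r then {E3} else {})"
    by blast
  then show "v \<in> ?R" using v by (cases p; cases q; cases r) auto
next
  fix v assume "v \<in> ?R"
  then show "v \<in> ?L" by (elim insertE emptyE; simp)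
qed

text \<open>Nested integration by parts produces \<open>27\<close> terms: each coordinate is
  evaluated at its upper end, at its lower end, or integrated. With \<open>v\<close> the set of
  integrated coordinates they match the definition, \<open>8\<close> for empty \<open>v\<close>,
  then \<open>12\<close>, \<open>6\<close> and \<open>1\<close> for one, two and three elements,
  with sign \<open>(-1) ^ card v\<close> from the minus sign of each integral. Both sides keep the
  first coordinate outermost, so the order of integration is never exchanged.\<close>

lemma parts_integral_triple:
  fixes h :: "real \<times> real \<times> real \<Rightarrow> real"
  assumes C: "1 \<le> C" and s: "0 < s" "s \<le> 1"
    and g: "c1_bound C g1 g1'" "c1_bound C g2 g2'" "c1_bound C g3 g3'"
    and h: "continuous_on ({0..1} \<times> {0..1} \<times> {0..1}) h"
  shows "parts_integral (0, 0, 0) (s, 1, 1) (\<lambda>(z1, z2, z3). g1 z1 * g2 z2 * g3 z3) h =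
    parts3 (g1, g1') (g2, g2') (g3, g3') s h"
proof -
  let ?I = "{0..1::real}"
  define G where "G i = (if i = E1 then g1 else if i = E2 then g2 else g3)" for i :: "real \<times> real \<times> real"
  define G' where "G' i = (if i = E1 then g1' else if i = E2 then g2' else g3')" for i :: "real \<times> real \<times> real"
  let ?a = "(0, 0, 0) :: real \<times> real \<times> real" and ?b = "(s, 1, 1) :: real \<times> real \<times> real"
  have G [simp]: "G E1 = g1" "G E2 = g2" "G E3 = g3" "G' E1 = g1'" "G' E2 = g2'" "G' E3 = g3'"
    unfolding G_def G'_def by auto
  have ab: "\<And>i. i \<in> Basis \<Longrightarrow> 0 \<le> ?a \<bullet> i \<and> ?a \<bullet> i < ?b \<bullet> i \<and> ?b \<bullet> i \<le> 1"
    using s by (auto simp: Basis_triple)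
  have GG: "\<And>i. i \<in> Basis \<Longrightarrow> c1_bound C (G i) (G' i)" using g by (auto simp: Basis_triple)
  have box: "cbox ?a ?b \<subseteq> ?I \<times> ?I \<times> ?I"
    using s by (auto simp: cbox_Pair_eq)
  have hb: "continuous_on (cbox ?a ?b) h" by (rule continuous_on_subset[OF h box])
  have gp: "(\<lambda>(z1, z2, z3). g1 z1 * g2 z2 * g3 z3) = (\<lambda>x. \<Prod>i\<in>Basis. G i (x \<bullet> i))"
    by (rule ext) (simp add: Basis_triple mult.assoc split: prod.split)
  let ?g = "\<lambda>x. \<Prod>i\<in>Basis. G i (x \<bullet> i)"
  have rs: "rs_integral v ?a ?b c h ?g = iter_integral G' ?a ?b l h c * (\<Prod>i\<in>Basis - v. G i (c \<bullet> i))"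
    if "set l = v" "distinct l" "c \<in> cbox ?a ?b" "v \<subseteq> Basis" for v l c
    using rs_integral_prod[OF C ab GG hb, where l = l and c = c] that by simp
  define R1 where "R1 y z = integral {0..s} (\<lambda>x. h (x, y, z) * g1' x)" for y z
  define R2 where "R2 x z = integral {0..1} (\<lambda>y. h (x, y, z) * g2' y)" for x z
  define R3 where "R3 x y = integral {0..1} (\<lambda>z. h (x, y, z) * g3' z)" for x y
  define R12 where "R12 z = integral {0..s} (\<lambda>x. R2 x z * g1' x)" for z
  define R13 where "R13 y = integral {0..s} (\<lambda>x. R3 x y * g1' x)" for y
  define R23 where "R23 x = integral {0..1} (\<lambda>y. R3 x y * g2' y)" for x
  define R123 where "R123 = integral {0..s} (\<lambda>x. R23 x * g1' x)"
  have D: "Basis - {E1} = {E2, E3}" "Basis - {E2} = {E1, E3}" "Basis - {E3} = {E1, E2}"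
    "Basis - {E1, E2} = {E3}" "Basis - {E1, E3} = {E2}" "Basis - {E2, E3} = {E1}"
    by (auto simp: Basis_triple)
  have Be: "Basis - {E1, E2, E3} = {}" by (simp add: Basis_triple)
  have rs1: "rs_integral {E1} ?a ?b (x, y, z) h ?g = R1 y z * (g2 y * g3 z)"
    "rs_integral {E2} ?a ?b (x, y, z) h ?g = R2 x z * (g1 x * g3 z)"
    "rs_integral {E3} ?a ?b (x, y, z) h ?g = R3 x y * (g1 x * g2 y)"
    "rs_integral {E1, E2} ?a ?b (x, y, z) h ?g = R12 z * g3 z"
    "rs_integral {E1, E3} ?a ?b (x, y, z) h ?g = R13 y * g2 y"
    "rs_integral {E2, E3} ?a ?b (x, y, z) h ?g = R23 x * g1 x"
    "rs_integral {E1, E2, E3} ?a ?b (x, y, z) h ?g = R123"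
    if "(x, y, z) \<in> cbox ?a ?b" for x y z
    by (simp_all add: rs[of "[E1]" "{E1}", OF _ _ that] rs[of "[E2]" "{E2}", OF _ _ that]
      rs[of "[E3]" "{E3}", OF _ _ that] rs[of "[E1, E2]" "{E1, E2}", OF _ _ that]
      rs[of "[E1, E3]" "{E1, E3}", OF _ _ that] rs[of "[E2, E3]" "{E2, E3}", OF _ _ that]
      rs[of "[E1, E2, E3]" "{E1, E2, E3}", OF _ _ that]
      Be D R1_def R2_def R3_def R12_def R13_def R23_def R123_def)
  have mem: "(0, 0, 0) \<in> cbox ?a ?b" "(0, 0, 1) \<in> cbox ?a ?b" "(0, 1, 0) \<in> cbox ?a ?b" "(0, 1, 1) \<in> cbox ?a ?b"
    "(s, 0, 0) \<in> cbox ?a ?b" "(s, 0, 1) \<in> cbox ?a ?b" "(s, 1, 0) \<in> cbox ?a ?b" "(s, 1, 1) \<in> cbox ?a ?b"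
    using s by (auto simp: cbox_Pair_eq)
  note S = sum_Pow_insert glue_triple D rs1[OF mem(1)] rs1[OF mem(2)] rs1[OF mem(3)] rs1[OF mem(4)]
    rs1[OF mem(5)] rs1[OF mem(6)] rs1[OF mem(7)] rs1[OF mem(8)]
  have S1: "(\<Sum>w\<in>Pow (Basis - {E1}). (- 1) ^ card w * rs_integral {E1} ?a ?b (glue w ?a ?b) h ?g) =
      R1 1 1 * (g2 1 * g3 1) - R1 0 1 * (g2 0 * g3 1) - R1 1 0 * (g2 1 * g3 0) + R1 0 0 * (g2 0 * g3 0)"
    by (simp add: S)
  have S2: "(\<Sum>w\<in>Pow (Basis - {E2}). (- 1) ^ card w * rs_integral {E2} ?a ?b (glue w ?a ?b) h ?g) =
      R2 s 1 * (g1 s * g3 1) - R2 0 1 * (g1 0 * g3 1) - R2 s 0 * (g1 s * g3 0) + R2 0 0 * (g1 0 * g3 0)"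
    by (simp add: S)
  have S3: "(\<Sum>w\<in>Pow (Basis - {E3}). (- 1) ^ card w * rs_integral {E3} ?a ?b (glue w ?a ?b) h ?g) =
      R3 s 1 * (g1 s * g2 1) - R3 0 1 * (g1 0 * g2 1) - R3 s 0 * (g1 s * g2 0) + R3 0 0 * (g1 0 * g2 0)"
    by (simp add: S)
  have S12: "(\<Sum>w\<in>Pow (Basis - {E1, E2}). (- 1) ^ card w * rs_integral {E1, E2} ?a ?b (glue w ?a ?b) h ?g) =
      R12 1 * g3 1 - R12 0 * g3 0"
    by (simp add: S)
  have S13: "(\<Sum>w\<in>Pow (Basis - {E1, E3}). (- 1) ^ card w * rs_integral {E1, E3} ?a ?b (glue w ?a ?b) h ?g) =
      R13 1 * g2 1 - R13 0 * g2 0"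
    by (simp add: S)
  have S23: "(\<Sum>w\<in>Pow (Basis - {E2, E3}). (- 1) ^ card w * rs_integral {E2, E3} ?a ?b (glue w ?a ?b) h ?g) =
      R23 s * g1 s - R23 0 * g1 0"
    by (simp add: S)
  have A: "alt_sum Basis (\<lambda>x. h x * ?g x) ?a ?b =
      h (s, 1, 1) * g1 s * g2 1 * g3 1 - h (0, 1, 1) * g1 0 * g2 1 * g3 1
      - h (s, 0, 1) * g1 s * g2 0 * g3 1 - h (s, 1, 0) * g1 s * g2 1 * g3 0
      + h (0, 0, 1) * g1 0 * g2 0 * g3 1 + h (0, 1, 0) * g1 0 * g2 1 * g3 0
      + h (s, 0, 0) * g1 s * g2 0 * g3 0 - h (0, 0, 0) * g1 0 * g2 0 * g3 0"
    unfolding alt_sum_def by (simp add: sum_Pow_insert glue_triple Basis_triple)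
  have L: "parts_integral ?a ?b (\<lambda>(z1, z2, z3). g1 z1 * g2 z2 * g3 z3) h =
      alt_sum Basis (\<lambda>x. h x * ?g x) ?a ?b - R123
      - (R1 1 1 * (g2 1 * g3 1) - R1 0 1 * (g2 0 * g3 1) - R1 1 0 * (g2 1 * g3 0) + R1 0 0 * (g2 0 * g3 0))
      - (R2 s 1 * (g1 s * g3 1) - R2 0 1 * (g1 0 * g3 1) - R2 s 0 * (g1 s * g3 0) + R2 0 0 * (g1 0 * g3 0))
      - (R3 s 1 * (g1 s * g2 1) - R3 0 1 * (g1 0 * g2 1) - R3 s 0 * (g1 s * g2 0) + R3 0 0 * (g1 0 * g2 0))
      + (R12 1 * g3 1 - R12 0 * g3 0) + (R13 1 * g2 1 - R13 0 * g2 0) + (R23 s * g1 s - R23 0 * g1 0)"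
  proof -
    have dist: "{E1} \<noteq> {E2}" "{E1} \<noteq> {E3}" "{E2} \<noteq> {E3}" "{E1, E2} \<noteq> {E1, E3}" "{E1, E2} \<noteq> {E2, E3}"
      "{E1, E3} \<noteq> {E2, E3}" "{x} \<noteq> {E1, E2}" "{x} \<noteq> {E1, E3}" "{x} \<noteq> {E2, E3}" for x
      by (auto simp: doubleton_eq_iff)
    have dim: "DIM(real \<times> real \<times> real) = 3" by simp
    have six: "(\<Sum>v\<in>{{E1}, {E2}, {E3}, {E1, E2}, {E1, E3}, {E2, E3}}. F v)
        = F {E1} + F {E2} + F {E3} + F {E1, E2} + F {E1, E3} + F {E2, E3}" for F :: "_ \<Rightarrow> real"
      using dist by simp
    have set_eq: "{v. v \<subseteq> (Basis :: (real \<times> real \<times> real) set) \<and> 1 \<le> card v \<and> card v \<le> 3 - 1} =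
        {{E1}, {E2}, {E3}, {E1, E2}, {E1, E3}, {E2, E3}}"
      unfolding Basis_triple using proper_subsets_triple by simp
    have rsB: "rs_integral Basis ?a ?b ?b h ?g = R123"
      using rs1(7)[OF mem(8)] by (subst (1) Basis_triple)
    show ?thesis
      unfolding parts_integral_def dim gp set_eq six S1 S2 S3 S12 S13 S23 rsB by simp
  qed
  have one: "1 \<in> ?I" and sI: "s \<in> ?I" using s by auto
  have c2: "continuous_on ?I (\<lambda>z. h (x, z, y))" and c1: "continuous_on ?I (\<lambda>z. h (z, x, y))"
    and c3: "continuous_on ?I (\<lambda>z. h (x, y, z))" if "x \<in> ?I" "y \<in> ?I" for x y
    using that by (intro continuous_on_compose2[OF h] continuous_intros; auto)+
  have c23: "continuous_on (?I \<times> cbox 0 1) (\<lambda>(y, z). h (x, y, z) * g3' z)" if "x \<in> ?I" for x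
    unfolding case_prod_unfold using that
    by (intro continuous_on_mult continuous_on_compose2[OF h] continuous_on_compose2[OF c1_bound_continuous(2)[OF g(3)]]
      continuous_intros) auto
  have cR3: "continuous_on (?I \<times> ?I) (\<lambda>(x, y). R3 x y)"
  proof -
    have "continuous_on ((?I \<times> ?I) \<times> cbox 0 1) (\<lambda>(p, z). h (fst p, snd p, z) * g3' z)"
      unfolding case_prod_unfold
      by (intro continuous_on_mult continuous_on_compose2[OF h] continuous_on_compose2[OF c1_bound_continuous(2)[OF g(3)]]
        continuous_intros) auto
    from integral_continuous_on_param[OF this] show ?thesis by (simp add: R3_def case_prod_unfold)
  qed
  have ch: "continuous_on (?I \<times> ?I) (\<lambda>(x, y). h (x, y, r))" if "r \<in> ?I" for r
    unfolding case_prod_unfold using that by (intro continuous_on_compose2[OF h] continuous_intros) auto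
  have expand1: "parts1 g1 g1' s x = g1 s * x s - g1 0 * x 0 - integral {0..s} (\<lambda>z. x z * g1' z)" for x
    by (simp add: parts1_def)
  have expand2: "parts1 g1 g1' s (\<lambda>x. parts1 g2 g2' 1 (\<lambda>y. f (x, y))) =
      g2 1 * parts1 g1 g1' s (\<lambda>x. f (x, 1)) - g2 0 * parts1 g1 g1' s (\<lambda>x. f (x, 0))
      - parts1 g1 g1' s (\<lambda>x. integral {0..1} (\<lambda>y. f (x, y) * g2' y))"
    if f: "continuous_on (?I \<times> ?I) f" for f
  proof -
    have "continuous_on (?I \<times> cbox 0 1) (\<lambda>(x, y). f (x, y) * g2' y)"
      unfolding case_prod_unfold
      by (intro continuous_on_mult continuous_on_compose2[OF f] continuous_on_compose2[OF c1_bound_continuous(2)[OF g(2)]]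
        continuous_intros) auto
    from integral_continuous_on_param[OF this]
    have "continuous_on ?I (\<lambda>x. integral {0..1} (\<lambda>y. f (x, y) * g2' y))" by simp
    then show ?thesis
      unfolding parts1_def[of g2]
      by (intro parts1_linear[OF g(1) sI] continuous_on_compose2[OF f] continuous_intros) auto
  qed
  have lin2: "parts1 g2 g2' 1 (\<lambda>y. parts1 g3 g3' 1 (\<lambda>z. h (x, y, z))) =
      g3 1 * parts1 g2 g2' 1 (\<lambda>y. h (x, y, 1)) - g3 0 * parts1 g2 g2' 1 (\<lambda>y. h (x, y, 0))
      - parts1 g2 g2' 1 (R3 x)" if x: "x \<in> ?I" for x
  proof -
    have "continuous_on ?I (\<lambda>y. (\<lambda>(x, y). R3 x y) (x, y))"
      using x by (intro continuous_on_compose2[OF cR3] continuous_intros) auto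
    then have "continuous_on ?I (R3 x)" by simp
    then show ?thesis
      unfolding parts1_def[of g3] R3_def[symmetric] using x
      by (intro parts1_linear[OF g(2) one] c2) auto
  qed
  \<comment> \<open>The expansion starts at the innermost coordinate and works outwards; at each
    level linearity of the outer functionals separates the two boundary terms and the
    integral.\<close>
  have "parts3 (g1, g1') (g2, g2') (g3, g3') s h = parts1 g1 g1' s (\<lambda>x. g3 1 * parts1 g2 g2' 1 (\<lambda>y. h (x, y, 1))
      - g3 0 * parts1 g2 g2' 1 (\<lambda>y. h (x, y, 0)) - parts1 g2 g2' 1 (R3 x))"
  proof -
    have "integral {0..s} (\<lambda>x. parts1 g2 g2' 1 (\<lambda>y. parts1 g3 g3' 1 (\<lambda>z. h (x, y, z))) * g1' x) =
      integral {0..s} (\<lambda>x. (g3 1 * parts1 g2 g2' 1 (\<lambda>y. h (x, y, 1)) - g3 0 * parts1 g2 g2' 1 (\<lambda>y. h (x, y, 0))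
        - parts1 g2 g2' 1 (R3 x)) * g1' x)"
      using s by (intro integral_cong) (auto simp: lin2)
    then show ?thesis
      unfolding parts3_def fst_conv snd_conv parts1_def[of g1] using lin2[OF sI] lin2[of 0] by simp
  qed
  also have "\<dots> = g3 1 * parts1 g1 g1' s (\<lambda>x. parts1 g2 g2' 1 (\<lambda>y. h (x, y, 1)))
      - g3 0 * parts1 g1 g1' s (\<lambda>x. parts1 g2 g2' 1 (\<lambda>y. h (x, y, 0)))
      - parts1 g1 g1' s (\<lambda>x. parts1 g2 g2' 1 (R3 x))"
  proof (rule parts1_linear[OF g(1) sI])
    show "continuous_on ?I (\<lambda>x. parts1 g2 g2' 1 (\<lambda>y. h (x, y, 1)))"
      "continuous_on ?I (\<lambda>x. parts1 g2 g2' 1 (\<lambda>y. h (x, y, 0)))"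
      "continuous_on ?I (\<lambda>x. parts1 g2 g2' 1 (R3 x))"
      using continuous_on_parts1_param[OF g(2) one ch[of 1]] continuous_on_parts1_param[OF g(2) one ch[of 0]]
        continuous_on_parts1_param[OF g(2) one cR3] by simp_all
  qed
  also have "parts1 g1 g1' s (\<lambda>x. parts1 g2 g2' 1 (\<lambda>y. h (x, y, 1))) =
      g2 1 * parts1 g1 g1' s (\<lambda>x. h (x, 1, 1)) - g2 0 * parts1 g1 g1' s (\<lambda>x. h (x, 0, 1)) - parts1 g1 g1' s (\<lambda>x. R2 x 1)"
    unfolding R2_def using expand2[OF ch[of 1]] by simp
  also have "parts1 g1 g1' s (\<lambda>x. parts1 g2 g2' 1 (\<lambda>y. h (x, y, 0))) =
      g2 1 * parts1 g1 g1' s (\<lambda>x. h (x, 1, 0)) - g2 0 * parts1 g1 g1' s (\<lambda>x. h (x, 0, 0)) - parts1 g1 g1' s (\<lambda>x. R2 x 0)"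
    unfolding R2_def using expand2[OF ch[of 0]] by simp
  also have "parts1 g1 g1' s (\<lambda>x. parts1 g2 g2' 1 (R3 x)) =
      g2 1 * parts1 g1 g1' s (\<lambda>x. R3 x 1) - g2 0 * parts1 g1 g1' s (\<lambda>x. R3 x 0) - parts1 g1 g1' s R23"
    using expand2[OF cR3] by (simp add: R23_def[abs_def])
  finally show ?thesis
    unfolding L A expand1 R1_def[symmetric] R12_def[symmetric] R13_def[symmetric] R123_def[symmetric]
    by (simp add: algebra_simps)
qed

section \<open>Riemann sums with a uniform rate\<close>

text \<open>Oscillation is measured by selecting two points in each cell rather than by suprema, so that
  the condition passes to integrals over a parameter without any measurability.\<close>

definition grid_osc :: "real \<Rightarrow> nat \<Rightarrow> real \<Rightarrow> (real \<Rightarrow> real) \<Rightarrow> bool" where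
  "grid_osc T n \<epsilon> x \<longleftrightarrow> (\<forall>z z'. (\<forall>k<n. z k \<in> {T * real k / real n..T * real (Suc k) / real n} \<and>
       z' k \<in> {T * real k / real n..T * real (Suc k) / real n}) \<longrightarrow>
     (\<Sum>k<n. \<bar>x (z k) - x (z' k)\<bar>) \<le> real n * \<epsilon>)"

text \<open>\<open>\<epsilon> n\<close> bounds the average oscillation per cell; a function of
  variation \<open>V\<close>, for instance, has rate \<open>V / n\<close>. One rate shared by all
  sections is what makes the Riemann sums converge uniformly.\<close>

definition riemann_rate :: "real \<Rightarrow> (nat \<Rightarrow> real) \<Rightarrow> real \<Rightarrow> (real \<Rightarrow> real) \<Rightarrow> bool" where
  "riemann_rate T \<epsilon> K x \<longleftrightarrow> (\<forall>n\<ge>1. grid_osc T n (\<epsilon> n) x) \<and> (\<forall>z\<in>{0..T}. \<bar>x z\<bar> \<le> K)"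

lemma riemann_rateD:
  assumes "riemann_rate T \<epsilon> K x"
  shows "1 \<le> n \<Longrightarrow> grid_osc T n (\<epsilon> n) x" "z \<in> {0..T} \<Longrightarrow> \<bar>x z\<bar> \<le> K"
  using assms unfolding riemann_rate_def by auto

lemma cell_subset:
  assumes "0 \<le> T" "k < n" "z \<in> {T * real k / real n..T * real (Suc k) / real n}"
  shows "z \<in> {0..T}"
proof -
  have "0 \<le> T * real k / real n" using assms by simp
  moreover have "T * real (Suc k) / real n \<le> T * real n / real n"
    using assms by (intro divide_right_mono mult_left_mono) auto
  moreover have "T * real n / real n = T" using assms by simp
  ultimately show ?thesis using assms(3) by simp
qed

text \<open>Nearly extremal pairs, each within \<open>e / n\<close> of the supremum of its cell, are
  selected in all cells simultaneously. The selection bound then controls the sum of the suprema up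
  to \<open>e\<close>, which is arbitrary.\<close>

lemma grid_osc_cell_bounds:
  assumes osc: "grid_osc T n \<epsilon> x" and n: "1 \<le> n" and T: "0 \<le> T" and K: "\<And>z. z \<in> {0..T} \<Longrightarrow> \<bar>x z\<bar> \<le> K"
  obtains d where "\<And>k z z'. k < n \<Longrightarrow> z \<in> {T * real k / real n..T * real (Suc k) / real n} \<Longrightarrow>
      z' \<in> {T * real k / real n..T * real (Suc k) / real n} \<Longrightarrow> \<bar>x z - x z'\<bar> \<le> d k"
    and "(\<Sum>k<n. d k) \<le> real n * \<epsilon>"
proof
  let ?J = "\<lambda>k. {T * real k / real n..T * real (Suc k) / real n}"
  define d where "d k = Sup ((\<lambda>(z, z'). \<bar>x z - x z'\<bar>) ` (?J k \<times> ?J k))" for k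
  have bdd: "bdd_above ((\<lambda>(z, z'). \<bar>x z - x z'\<bar>) ` (?J k \<times> ?J k))" if k: "k < n" for k
  proof (rule bdd_aboveI2, clarify)
    fix z z' assume z: "z \<in> ?J k" "z' \<in> ?J k"
    show "\<bar>x z - x z'\<bar> \<le> K + K"
      using K[OF cell_subset[OF T k z(1)]] K[OF cell_subset[OF T k z(2)]] by linarith
  qed
  show "\<bar>x z - x z'\<bar> \<le> d k" if "k < n" "z \<in> ?J k" "z' \<in> ?J k" for k z z'
    unfolding d_def using that by (intro cSup_upper[OF _ bdd]) auto
  have ne: "?J k \<times> ?J k \<noteq> {}" for k
    using T by (auto intro!: divide_right_mono mult_left_mono)
  show "(\<Sum>k<n. d k) \<le> real n * \<epsilon>"
  proof (rule field_le_epsilon)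
    fix e :: real assume e: "0 < e"
    have "\<exists>p. p \<in> ?J k \<times> ?J k \<and> d k - e / real n < \<bar>x (fst p) - x (snd p)\<bar>" if k: "k < n" for k
    proof -
      have "d k - e / real n < Sup ((\<lambda>(z, z'). \<bar>x z - x z'\<bar>) ` (?J k \<times> ?J k))"
        using e n by (simp add: d_def)
      then show ?thesis using less_cSup_iff[OF _ bdd[OF k]] ne by fastforce
    qed
    then obtain p where p: "\<And>k. k < n \<Longrightarrow> p k \<in> ?J k \<times> ?J k"
        "\<And>k. k < n \<Longrightarrow> d k - e / real n < \<bar>x (fst (p k)) - x (snd (p k))\<bar>"
      by metis
    have "(\<Sum>k<n. d k - e / real n) \<le> (\<Sum>k<n. \<bar>x (fst (p k)) - x (snd (p k))\<bar>)"
      using p(2) by (intro sum_mono less_imp_le) auto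
    also have "\<dots> \<le> real n * \<epsilon>"
    proof -
      have "fst (p k) \<in> ?J k \<and> snd (p k) \<in> ?J k" if "k < n" for k using p(1)[OF that] by (auto simp: mem_Times_iff)
      then show ?thesis
        using osc[unfolded grid_osc_def, rule_format, of "\<lambda>k. fst (p k)" "\<lambda>k. snd (p k)"] by blast
    qed
    finally show "(\<Sum>k<n. d k) \<le> real n * \<epsilon> + e" using n by (simp add: sum_subtractf)
  qed
qed

text \<open>Cells are open on the left and closed on the right, so that each contains the right
  endpoint used in the sums. At \<open>z = 0\<close> the truncation by \<open>nat\<close> gives
  index \<open>0\<close>.\<close>

definition cell_index :: "real \<Rightarrow> nat \<Rightarrow> real \<Rightarrow> nat" where
  "cell_index T n z = nat (\<lceil>real n * z / T\<rceil> - 1)"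

lemma cell_index_eq:
  assumes "0 < T" "1 \<le> n" "T * real k / real n < z" "z \<le> T * real (Suc k) / real n"
  shows "cell_index T n z = k"
proof -
  have "real k < real n * z / T" "real n * z / T \<le> real (Suc k)"
    using assms by (simp_all add: field_simps)
  then have "\<lceil>real n * z / T\<rceil> = int k + 1" by (intro ceiling_unique) auto
  then show ?thesis by (simp add: cell_index_def)
qed

lemma step_has_integral:
  assumes T: "0 < T" "1 \<le> n"
  shows "((\<lambda>z. c (cell_index T n z)) has_integral (T / real n * (\<Sum>k<m. c k))) {0..T * real m / real n}"
proof (induction m)
  case 0
  then show ?case by (simp add: has_integral_refl)
next
  case (Suc m)
  let ?u = "T * real m / real n" and ?v = "T * real (Suc m) / real n"
  have uv: "0 \<le> ?u" "?u \<le> ?v" using T by (auto intro!: divide_right_mono mult_left_mono)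
  have "((\<lambda>z. c m) has_integral ((?v - ?u) *\<^sub>R c m)) {?u..?v}"
    using has_integral_const_real[of "c m" ?u ?v] uv by simp
  \<comment> \<open>The left endpoint of a cell may be counted to the previous one; a single point
    does not affect the integral.\<close>
  then have "((\<lambda>z. c (cell_index T n z)) has_integral ((?v - ?u) *\<^sub>R c m)) {?u..?v}"
    by (rule has_integral_spike_finite[where S = "{?u}", rotated 2]) (use cell_index_eq[OF T, of m] in auto)
  from has_integral_combine[OF uv Suc.IH this] show ?case
    by (simp add: algebra_simps add_divide_distrib)
qed

text \<open>On each cell \<open>x\<close> lies between its value at the right node minus and plus
  the oscillation \<open>d k\<close>. The integrals of these two step functions differ by at most
  \<open>2 * T * \<epsilon> n\<close>, which gives both integrability, without any regularity
  assumption on \<open>x\<close>, and the rate.\<close>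

lemma riemann_rate_integrable_node:
  assumes T: "0 < T" and x: "riemann_rate T \<epsilon> K x" and \<epsilon>: "\<epsilon> \<longlonglongrightarrow> 0"
  shows "x integrable_on {0..T}"
    and "1 \<le> n \<Longrightarrow> m \<le> n \<Longrightarrow>
      \<bar>T / real n * (\<Sum>k<m. x (T * real (Suc k) / real n)) - integral {0..T * real m / real n} x\<bar> \<le> T * \<epsilon> n"
proof -
  have straddle: "\<exists>d. (\<Sum>k<n. d k) \<le> real n * \<epsilon> n \<and> (\<forall>k<n. 0 \<le> d k) \<and>
      (\<forall>z\<in>{0..T}. \<bar>x z - x (T * real (Suc (cell_index T n z)) / real n)\<bar> \<le> d (cell_index T n z))"
    if n: "1 \<le> n" for n
  proof -
    obtain d where d: "\<And>k z z'. k < n \<Longrightarrow> z \<in> {T * real k / real n..T * real (Suc k) / real n} \<Longrightarrow>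
        z' \<in> {T * real k / real n..T * real (Suc k) / real n} \<Longrightarrow> \<bar>x z - x z'\<bar> \<le> d k"
      and sd: "(\<Sum>k<n. d k) \<le> real n * \<epsilon> n"
      using grid_osc_cell_bounds[OF riemann_rateD(1)[OF x n] n less_imp_le[OF T] riemann_rateD(2)[OF x]] by metis
    have ord: "T * real k / real n \<le> T * real (Suc k) / real n" for k
      using T by (intro divide_right_mono mult_left_mono) auto
    have "0 \<le> d k" if "k < n" for k
      using d[OF that, of "T * real k / real n" "T * real k / real n"] ord by simp
    moreover have "\<bar>x z - x (T * real (Suc (cell_index T n z)) / real n)\<bar> \<le> d (cell_index T n z)" if z: "z \<in> {0..T}" for z
    proof (rule d)
      let ?k = "cell_index T n z"
      have "real n * z / T \<le> real n * T / T" using z T by (intro divide_right_mono mult_left_mono) auto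
      then have r: "0 \<le> real n * z / T" "real n * z / T \<le> real n" using z T by auto
      have "\<lceil>real n * z / T\<rceil> \<le> int n" using r(2) by (simp add: ceiling_le_iff)
      then show "?k < n" using n unfolding cell_index_def by linarith
      have "real ?k \<le> real n * z / T"
        using r(1) unfolding cell_index_def by linarith
      moreover have "real n * z / T \<le> real (Suc ?k)" unfolding cell_index_def by linarith
      ultimately show "z \<in> {T * real ?k / real n..T * real (Suc ?k) / real n}" using T n by (simp add: field_simps)
      show "T * real (Suc ?k) / real n \<in> {T * real ?k / real n..T * real (Suc ?k) / real n}" using ord by simp
    qed
    ultimately show ?thesis using sd by blast
  qed
  show int: "x integrable_on {0..T}"
    unfolding box_real(2)[symmetric]
  proof (rule integrable_straddle_interval)
    fix e :: real assume e: "0 < e"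
    have "\<forall>\<^sub>F n in sequentially. \<epsilon> n < e / (2 * T)" using \<epsilon> e T by (intro order_tendstoD(2)) auto
    then obtain N where "\<forall>n\<ge>N. \<epsilon> n < e / (2 * T)" by (auto simp: eventually_sequentially)
    then obtain n where n: "1 \<le> n" "\<epsilon> n < e / (2 * T)" by (meson max.cobounded1 max.cobounded2)
    obtain d where d: "(\<Sum>k<n. d k) \<le> real n * \<epsilon> n" "\<forall>k<n. 0 \<le> d k"
      "\<And>z. z \<in> {0..T} \<Longrightarrow> \<bar>x z - x (T * real (Suc (cell_index T n z)) / real n)\<bar> \<le> d (cell_index T n z)"
      using straddle[OF n(1)] by blast
    have Tn: "T * real n / real n = T" using n by simp
    let ?g = "\<lambda>k. x (T * real (Suc k) / real n) - d k" and ?h = "\<lambda>k. x (T * real (Suc k) / real n) + d k"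
    have gi: "((\<lambda>z. ?g (cell_index T n z)) has_integral (T / real n * (\<Sum>k<n. ?g k))) (cbox 0 T)"
      using step_has_integral[OF T n(1), of ?g n] unfolding Tn by simp
    have hi: "((\<lambda>z. ?h (cell_index T n z)) has_integral (T / real n * (\<Sum>k<n. ?h k))) (cbox 0 T)"
      using step_has_integral[OF T n(1), of ?h n] unfolding Tn by simp
    have "T / real n * (\<Sum>k<n. ?h k) - T / real n * (\<Sum>k<n. ?g k) = T / real n * (2 * (\<Sum>k<n. d k))"
      by (simp add: sum.distrib sum_subtractf algebra_simps)
    also have "\<dots> \<le> T / real n * (2 * (real n * \<epsilon> n))" using T d(1) by (intro mult_left_mono) auto
    also have "\<dots> < e" using n T by (simp add: field_simps)
    finally have small: "T / real n * (\<Sum>k<n. ?h k) - T / real n * (\<Sum>k<n. ?g k) < e" .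
    have "0 \<le> (\<Sum>k<n. d k)" using d(2) by (auto intro: sum_nonneg)
    then have "T / real n * (\<Sum>k<n. ?g k) \<le> T / real n * (\<Sum>k<n. ?h k)"
      using T by (intro mult_left_mono) (auto simp: sum.distrib sum_subtractf)
    then show "\<exists>g h i j. (g has_integral i) (cbox 0 T) \<and> (h has_integral j) (cbox 0 T) \<and> \<bar>i - j\<bar> < e \<and>
        (\<forall>z\<in>cbox 0 T. g z \<le> x z \<and> x z \<le> h z)"
      using gi hi small d(3)
      by (intro exI[of _ "\<lambda>z. ?g (cell_index T n z)"] exI[of _ "\<lambda>z. ?h (cell_index T n z)"]
          exI[of _ "T / real n * (\<Sum>k<n. ?g k)"] exI[of _ "T / real n * (\<Sum>k<n. ?h k)"])
        (auto simp: abs_le_iff algebra_simps)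
  qed
  show "\<bar>T / real n * (\<Sum>k<m. x (T * real (Suc k) / real n)) - integral {0..T * real m / real n} x\<bar> \<le> T * \<epsilon> n"
    if n: "1 \<le> n" "m \<le> n"
  proof -
    obtain d where d: "(\<Sum>k<n. d k) \<le> real n * \<epsilon> n" "\<forall>k<n. 0 \<le> d k"
      "\<And>z. z \<in> {0..T} \<Longrightarrow> \<bar>x z - x (T * real (Suc (cell_index T n z)) / real n)\<bar> \<le> d (cell_index T n z)"
      using straddle[OF n(1)] by blast
    have "T * real m / real n \<le> T * real n / real n" using n T by (intro divide_right_mono mult_left_mono) auto
    also have "\<dots> = T" using n by simp
    finally have sub: "{0..T * real m / real n} \<subseteq> {0..T}" by auto
    have ix: "(x has_integral integral {0..T * real m / real n} x) {0..T * real m / real n}"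
      using integrable_subinterval_real[OF int sub] by (rule integrable_integral)
    note st = step_has_integral[OF T n(1), of _ m]
    have dm: "T / real n * (\<Sum>k<m. d k) \<le> T * \<epsilon> n"
    proof -
      have "(\<Sum>k<m. d k) \<le> (\<Sum>k<n. d k)" using n d(2) by (intro sum_mono2) auto
      then have "T / real n * (\<Sum>k<m. d k) \<le> T / real n * (real n * \<epsilon> n)"
        using d(1) T by (intro mult_left_mono) auto
      then show ?thesis using n by simp
    qed
    have "integral {0..T * real m / real n} x \<le> T / real n * (\<Sum>k<m. x (T * real (Suc k) / real n) + d k)"
    proof (rule has_integral_le[OF ix st])
      show "x z \<le> x (T * real (Suc (cell_index T n z)) / real n) + d (cell_index T n z)"
        if "z \<in> {0..T * real m / real n}" for z using d(3)[of z] that sub by (auto simp: abs_le_iff)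
    qed
    moreover have "T / real n * (\<Sum>k<m. x (T * real (Suc k) / real n) - d k) \<le> integral {0..T * real m / real n} x"
    proof (rule has_integral_le[OF st ix])
      show "x (T * real (Suc (cell_index T n z)) / real n) - d (cell_index T n z) \<le> x z"
        if "z \<in> {0..T * real m / real n}" for z using d(3)[of z] that sub by (auto simp: abs_le_iff)
    qed
    ultimately show ?thesis using dm by (simp add: sum.distrib sum_subtractf right_diff_distrib distrib_left abs_le_iff)
  qed
qed

text \<open>The three terms are the perturbation of the summands, the error at the nodes, and the
  incomplete last cell, of length at most \<open>T / n\<close>, on which \<open>x\<close> is bounded
  by \<open>K\<close>.\<close>

lemma riemann_rate_step:
  assumes T: "0 < T" and x: "riemann_rate T \<epsilon> K x" and \<epsilon>: "\<epsilon> \<longlonglongrightarrow> 0" and n: "1 \<le> n"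
    and s: "s \<in> {0..1}" and m: "m = nat \<lfloor>real n * s\<rfloor>"
    and y: "\<And>z. z \<in> {0..T} \<Longrightarrow> \<bar>y z - x z\<bar> \<le> e"
  shows "\<bar>T / real n * (\<Sum>k<m. y (T * real (Suc k) / real n)) - integral {0..s * T} x\<bar>
    \<le> T * e + T * \<epsilon> n + T * K / real n"
proof -
  have m': "real m \<le> real n * s" "real n * s < real m + 1"
    using s m by (auto simp: of_nat_floor)
  have "real n * s \<le> real n" using s by (intro mult_left_le) auto
  then have "real m \<le> real n" using m'(1) by linarith
  then have mn: "m \<le> n" by simp
  have e0: "0 \<le> e" using y[of 0] T by auto
  have K0: "0 \<le> K" using riemann_rateD(2)[OF x, of 0] T by auto
  note int = riemann_rate_integrable_node(1)[OF T x \<epsilon>]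
  have u: "0 \<le> T * real m / real n" "T * real m / real n \<le> s * T" "s * T \<le> T"
    using T m' n s mult_right_mono[of "real m" "real n * s" T] by (auto simp: field_simps mult_left_le)
  have "s \<le> (real m + 1) / real n" using m' n by (simp add: field_simps)
  then have "s * T \<le> (real m + 1) / real n * T" using T by (intro mult_right_mono) auto
  then have u': "s * T - T * real m / real n \<le> T / real n" by (simp add: field_simps add_divide_distrib)
  have "\<bar>T / real n * (\<Sum>k<m. y (T * real (Suc k) / real n)) - T / real n * (\<Sum>k<m. x (T * real (Suc k) / real n))\<bar>
      = T / real n * \<bar>\<Sum>k<m. y (T * real (Suc k) / real n) - x (T * real (Suc k) / real n)\<bar>"
    unfolding right_diff_distrib[symmetric] sum_subtractf[symmetric] using T by (simp add: abs_mult)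
  also have "\<dots> \<le> T / real n * (\<Sum>k<m. e)"
  proof (intro mult_left_mono order_trans[OF sum_abs] sum_mono y)
    fix k assume k: "k \<in> {..<m}"
    then have "T * real (Suc k) / real n \<le> T * real n / real n"
      using mn T by (intro divide_right_mono mult_left_mono) auto
    then show "T * real (Suc k) / real n \<in> {0..T}" using T n by auto
  qed (use T in auto)
  also have "\<dots> = T * e * (real m / real n)" by simp
  also have "\<dots> \<le> T * e * 1" using mn n T e0 by (intro mult_left_mono) (auto simp: divide_le_eq)
  finally have 1: "\<bar>T / real n * (\<Sum>k<m. y (T * real (Suc k) / real n)) - T / real n * (\<Sum>k<m. x (T * real (Suc k) / real n))\<bar> \<le> T * e"
    by simp
  have 2: "\<bar>T / real n * (\<Sum>k<m. x (T * real (Suc k) / real n)) - integral {0..T * real m / real n} x\<bar> \<le> T * \<epsilon> n"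
    by (rule riemann_rate_integrable_node(2)[OF T x \<epsilon> n mn])
  have ii: "x integrable_on {a..b}" if "0 \<le> a" "b \<le> T" for a b
    using that by (intro integrable_subinterval_real[OF int]) auto
  have "integral {0..s * T} x = integral {0..T * real m / real n} x + integral {T * real m / real n..s * T} x"
    using u by (intro Henstock_Kurzweil_Integration.integral_combine[symmetric] ii) auto
  moreover have "norm (integral {T * real m / real n..s * T} x) \<le> K * (s * T - T * real m / real n)"
    using has_integral_bound_real[OF K0 finite.emptyI integrable_integral[OF ii[OF u(1,3)]]] u riemann_rateD(2)[OF x] by auto
  moreover have "K * (s * T - T * real m / real n) \<le> K * (T / real n)" using u' K0 by (intro mult_left_mono) auto
  ultimately have 3: "\<bar>integral {0..T * real m / real n} x - integral {0..s * T} x\<bar> \<le> T * K / real n"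
    by (simp add: mult.commute)
  show ?thesis using 1 2 3 by linarith
qed

lemma riemann_rate_integral:
  assumes T: "0 < T" and S: "0 < S" and \<epsilon>: "\<epsilon> \<longlonglongrightarrow> 0"
    and F1: "\<And>z. z \<in> {0..S} \<Longrightarrow> riemann_rate T \<epsilon> K (F z)"
    and F2: "\<And>w. w \<in> {0..T} \<Longrightarrow> riemann_rate S \<epsilon> K (\<lambda>z. F z w)"
  shows "riemann_rate S (\<lambda>n. T * \<epsilon> n) (T * K) (\<lambda>z. integral {0..T} (F z))"
  unfolding riemann_rate_def
proof (intro conjI allI impI ballI)
  have int: "F z integrable_on {0..T}" if "z \<in> {0..S}" for z
    by (rule riemann_rate_integrable_node(1)[OF T F1[OF that] \<epsilon>])
  fix n :: nat assume n: "1 \<le> n"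
  show "grid_osc S n (T * \<epsilon> n) (\<lambda>z. integral {0..T} (F z))"
    unfolding grid_osc_def
  proof (intro allI impI)
    fix z z' :: "nat \<Rightarrow> real"
    assume zz: "\<forall>k<n. z k \<in> {S * real k / real n..S * real (Suc k) / real n} \<and>
        z' k \<in> {S * real k / real n..S * real (Suc k) / real n}"
    have mem: "z k \<in> {0..S}" "z' k \<in> {0..S}" if "k < n" for k
      using cell_subset[OF less_imp_le[OF S] that] zz that by blast+
    \<comment> \<open>The signs turn a sum of absolute values of integrals into the integral of one
      finite combination, integrable by construction. For fixed \<open>w\<close> the selection bound
      applies to it, so the oscillation itself is never integrated.\<close>
    define \<sigma> where "\<sigma> k = sgn (integral {0..T} (F (z k)) - integral {0..T} (F (z' k)))" for k
    have "(\<Sum>k<n. \<bar>integral {0..T} (F (z k)) - integral {0..T} (F (z' k))\<bar>) =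
        (\<Sum>k<n. \<sigma> k * (integral {0..T} (F (z k)) - integral {0..T} (F (z' k))))"
      by (intro sum.cong) (auto simp: \<sigma>_def abs_sgn mult.commute)
    also have "\<dots> \<le> integral {0..T} (\<lambda>w. real n * \<epsilon> n)"
    proof (rule has_integral_le)
      show "((\<lambda>w. \<Sum>k<n. \<sigma> k * (F (z k) w - F (z' k) w)) has_integral
          (\<Sum>k<n. \<sigma> k * (integral {0..T} (F (z k)) - integral {0..T} (F (z' k))))) {0..T}"
        by (intro has_integral_sum has_integral_mult_right has_integral_diff integrable_integral int mem) auto
      show "((\<lambda>w. real n * \<epsilon> n) has_integral integral {0..T} (\<lambda>w. real n * \<epsilon> n)) {0..T}"
        by (intro integrable_integral integrable_const_ivl)
      fix w assume w: "w \<in> {0..T}"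
      have "(\<Sum>k<n. \<sigma> k * (F (z k) w - F (z' k) w)) \<le> (\<Sum>k<n. \<bar>F (z k) w - F (z' k) w\<bar>)"
        by (intro sum_mono) (auto simp: \<sigma>_def sgn_if abs_if)
      also have "\<dots> \<le> real n * \<epsilon> n"
        using riemann_rateD(1)[OF F2[OF w] n] zz unfolding grid_osc_def by blast
      finally show "(\<Sum>k<n. \<sigma> k * (F (z k) w - F (z' k) w)) \<le> real n * \<epsilon> n" .
    qed
    also have "\<dots> = real n * (T * \<epsilon> n)" using T by simp
    finally show "(\<Sum>k<n. \<bar>integral {0..T} (F (z k)) - integral {0..T} (F (z' k))\<bar>) \<le> real n * (T * \<epsilon> n)" .
  qed
next
  fix z assume z: "z \<in> {0..S}"
  have K0: "0 \<le> K" using riemann_rateD(2)[OF F1[OF z], of 0] T by auto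
  have "norm (integral {0..T} (F z)) \<le> K * (T - 0)"
    using has_integral_bound_real[OF K0 finite.emptyI integrable_integral[OF riemann_rate_integrable_node(1)[OF T F1[OF z] \<epsilon>]]]
      riemann_rateD(2)[OF F1[OF z]] T by auto
  then show "\<bar>integral {0..T} (F z)\<bar> \<le> T * K" by (simp add: mult.commute)
qed

text \<open>The partial integrals inherit a rate from the sections of \<open>F\<close>, while the
  inner sums enter the next coordinate as perturbations of these partial integrals.\<close>

lemma riemann_sum3:
  fixes F :: "real \<Rightarrow> real \<Rightarrow> real \<Rightarrow> real"
  assumes T: "0 < T1" "0 < T2" "0 < T3" and \<epsilon>: "\<epsilon> \<longlonglongrightarrow> 0"
    and F1: "\<And>z2 z3. z2 \<in> {0..T2} \<Longrightarrow> z3 \<in> {0..T3} \<Longrightarrow> riemann_rate T1 \<epsilon> K (\<lambda>z. F z z2 z3)"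
    and F2: "\<And>z1 z3. z1 \<in> {0..T1} \<Longrightarrow> z3 \<in> {0..T3} \<Longrightarrow> riemann_rate T2 \<epsilon> K (\<lambda>z. F z1 z z3)"
    and F3: "\<And>z1 z2. z1 \<in> {0..T1} \<Longrightarrow> z2 \<in> {0..T2} \<Longrightarrow> riemann_rate T3 \<epsilon> K (\<lambda>z. F z1 z2 z)"
    and n: "1 \<le> n1" "1 \<le> n2" "1 \<le> n3" and s: "s \<in> {0..1}" and m: "m = nat \<lfloor>real n1 * s\<rfloor>"
  shows "\<bar>T1 / real n1 * (\<Sum>k1<m. T2 / real n2 * (\<Sum>k2<n2. T3 / real n3 * (\<Sum>k3<n3.
       F (T1 * real (Suc k1) / real n1) (T2 * real (Suc k2) / real n2) (T3 * real (Suc k3) / real n3))))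
      - integral {0..s * T1} (\<lambda>z1. integral {0..T2} (\<lambda>z2. integral {0..T3} (F z1 z2)))\<bar>
    \<le> T1 * T2 * T3 * (\<epsilon> n1 + \<epsilon> n2 + \<epsilon> n3 + K / real n1 + K / real n2 + K / real n3)"
proof -
  define X3 where "X3 z1 z2 = integral {0..T3} (F z1 z2)" for z1 z2
  define X2 where "X2 z1 = integral {0..T2} (X3 z1)" for z1
  have lim: "(\<lambda>n. T3 * \<epsilon> n) \<longlonglongrightarrow> 0" "(\<lambda>n. T2 * (T3 * \<epsilon> n)) \<longlonglongrightarrow> 0"
    using tendsto_mult_right_zero[OF \<epsilon>, of T3] tendsto_mult_right_zero[OF tendsto_mult_right_zero[OF \<epsilon>, of T3], of T2] by auto
  have X32: "riemann_rate T2 (\<lambda>n. T3 * \<epsilon> n) (T3 * K) (X3 z1)" if "z1 \<in> {0..T1}" for z1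
    unfolding X3_def[abs_def] using that by (intro riemann_rate_integral T \<epsilon> F3 F2)
  have X31: "riemann_rate T1 (\<lambda>n. T3 * \<epsilon> n) (T3 * K) (\<lambda>z. X3 z z2)" if "z2 \<in> {0..T2}" for z2
    unfolding X3_def using that by (intro riemann_rate_integral T \<epsilon> F3 F1)
  have X21: "riemann_rate T1 (\<lambda>n. T2 * (T3 * \<epsilon> n)) (T2 * (T3 * K)) X2"
    unfolding X2_def[abs_def] using riemann_rate_integral[OF T(2,1) lim(1) X32 X31] .
  have one: "(1::real) \<in> {0..1}" by simp
  define e3 where "e3 = T3 * 0 + T3 * \<epsilon> n3 + T3 * K / real n3"
  define e2 where "e2 = T2 * e3 + T2 * (T3 * \<epsilon> n2) + T2 * (T3 * K) / real n2"
  have 3: "\<bar>T3 / real n3 * (\<Sum>k3<n3. F z1 z2 (T3 * real (Suc k3) / real n3)) - X3 z1 z2\<bar> \<le> e3"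
    if "z1 \<in> {0..T1}" "z2 \<in> {0..T2}" for z1 z2
    using riemann_rate_step[OF T(3) F3[OF that] \<epsilon> n(3) one, of n3 "F z1 z2" 0] by (simp add: e3_def X3_def)
  have 2: "\<bar>T2 / real n2 * (\<Sum>k2<n2. T3 / real n3 * (\<Sum>k3<n3. F z1 (T2 * real (Suc k2) / real n2) (T3 * real (Suc k3) / real n3)))
      - X2 z1\<bar> \<le> e2" if "z1 \<in> {0..T1}" for z1
    using riemann_rate_step[OF T(2) X32[OF that] lim(1) n(2) one _ 3[OF that], of n2] by (simp add: e2_def X2_def)
  have "\<bar>T1 / real n1 * (\<Sum>k1<m. T2 / real n2 * (\<Sum>k2<n2. T3 / real n3 * (\<Sum>k3<n3.
       F (T1 * real (Suc k1) / real n1) (T2 * real (Suc k2) / real n2) (T3 * real (Suc k3) / real n3))))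
      - integral {0..s * T1} X2\<bar> \<le> T1 * e2 + T1 * (T2 * (T3 * \<epsilon> n1)) + T1 * (T2 * (T3 * K)) / real n1"
    by (rule riemann_rate_step[OF T(1) X21 lim(2) n(1) s m 2])
  then show ?thesis
    unfolding e2_def e3_def X2_def[abs_def] X3_def[abs_def] by (simp add: algebra_simps)
qed

text \<open>In \<open>x * g\<close> the factor \<open>x\<close> contributes its own oscillation
  weighted by \<open>A\<close>; the kernel contributes at most its Lipschitz constant times the cell
  width \<open>T / n\<close>, weighted by the bound \<open>K\<close> of \<open>x\<close>.\<close>

lemma riemann_rate_mult_lipschitz:
  assumes T: "0 \<le> T" and x: "riemann_rate T \<epsilon> K x"
    and g: "\<And>z. \<bar>g z\<bar> \<le> A" "\<And>z z'. \<bar>g z - g z'\<bar> \<le> A * \<bar>z - z'\<bar>"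
  shows "riemann_rate T (\<lambda>n. A * \<epsilon> n + K * A * T / real n) (A * K) (\<lambda>z. x z * g z)"
  unfolding riemann_rate_def
proof (intro conjI allI impI ballI)
  have A0: "0 \<le> A" using order_trans[OF abs_ge_zero g(1)] .
  have K0: "0 \<le> K" using order_trans[OF abs_ge_zero riemann_rateD(2)[OF x, of 0]] T by simp
  fix n :: nat assume n: "1 \<le> n"
  show "grid_osc T n (A * \<epsilon> n + K * A * T / real n) (\<lambda>z. x z * g z)"
    unfolding grid_osc_def
  proof (intro allI impI)
    fix z z' :: "nat \<Rightarrow> real"
    assume zz: "\<forall>k<n. z k \<in> {T * real k / real n..T * real (Suc k) / real n} \<and>
        z' k \<in> {T * real k / real n..T * real (Suc k) / real n}"
    have "(\<Sum>k<n. \<bar>x (z k) * g (z k) - x (z' k) * g (z' k)\<bar>) \<le> (\<Sum>k<n. A * \<bar>x (z k) - x (z' k)\<bar> + K * (A * (T / real n)))"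
    proof (rule sum_mono)
      fix k assume "k \<in> {..<n}"
      then have k: "k < n" by simp
      have zk: "z k \<in> {T * real k / real n..T * real (Suc k) / real n}" "z' k \<in> {T * real k / real n..T * real (Suc k) / real n}"
        using zz k by auto
      have "T * real (Suc k) / real n - T * real k / real n = T / real n" by (simp add: algebra_simps add_divide_distrib)
      then have dz: "\<bar>z k - z' k\<bar> \<le> T / real n" using zk unfolding atLeastAtMost_iff by linarith
      have "x (z k) * g (z k) - x (z' k) * g (z' k) = (x (z k) - x (z' k)) * g (z k) + x (z' k) * (g (z k) - g (z' k))"
        by (simp add: algebra_simps)
      also have "\<bar>\<dots>\<bar> \<le> \<bar>(x (z k) - x (z' k)) * g (z k)\<bar> + \<bar>x (z' k) * (g (z k) - g (z' k))\<bar>" by (rule abs_triangle_ineq)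
      also have "\<dots> \<le> \<bar>x (z k) - x (z' k)\<bar> * A + K * (A * (T / real n))"
        unfolding abs_mult
      proof (intro add_mono mult_mono g(1) riemann_rateD(2)[OF x] cell_subset[OF T k zk(2)] K0)
        show "\<bar>g (z k) - g (z' k)\<bar> \<le> A * (T / real n)"
          using order_trans[OF g(2) mult_left_mono[OF dz A0]] .
      qed auto
      finally show "\<bar>x (z k) * g (z k) - x (z' k) * g (z' k)\<bar> \<le> A * \<bar>x (z k) - x (z' k)\<bar> + K * (A * (T / real n))"
        by (simp add: mult.commute)
    qed
    also have "\<dots> = A * (\<Sum>k<n. \<bar>x (z k) - x (z' k)\<bar>) + real n * (K * (A * (T / real n)))"
      by (simp add: sum.distrib sum_distrib_left)
    also have "\<dots> \<le> A * (real n * \<epsilon> n) + real n * (K * (A * (T / real n)))"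
      using riemann_rateD(1)[OF x n] zz A0 unfolding grid_osc_def by (intro add_right_mono mult_left_mono) blast+
    finally show "(\<Sum>k<n. \<bar>x (z k) * g (z k) - x (z' k) * g (z' k)\<bar>) \<le> real n * (A * \<epsilon> n + K * A * T / real n)"
      by (simp add: algebra_simps)
  qed
next
  fix z assume z: "z \<in> {0..T}"
  have "\<bar>x z\<bar> * \<bar>g z\<bar> \<le> K * A" using riemann_rateD(2)[OF x z] g(1)[of z] by (intro mult_mono) auto
  then show "\<bar>x z * g z\<bar> \<le> A * K" by (simp add: abs_mult mult.commute)
qed

section \<open>Functions of bounded Hardy--Krause variation\<close>

text \<open>The terms of the Hardy-Krause sum are nonnegative, so its finite total dominates every
  ladder sum on every face through \<open>b\<close>.\<close>

lemma bounded_variation_hk_ladders: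
  assumes "bounded_variation_hk a b f"
  obtains V where "0 \<le> V" "\<And>u m p. u \<subseteq> Basis \<Longrightarrow> u \<noteq> {} \<Longrightarrow> ladder u a b m p \<Longrightarrow>
    (\<Sum>k\<in>cells u m. \<bar>alt_sum u f (corner u p k b) (corner u p (\<lambda>i. Suc (k i)) b)\<bar>) \<le> V"
proof
  define V where "V = enn2real (hardy_krause_variation a b f)"
  show "0 \<le> V" unfolding V_def by simp
  fix u :: "'a set" and m p assume u: "u \<subseteq> Basis" "u \<noteq> {}" and lad: "ladder u a b m p"
  let ?s = "\<Sum>k\<in>cells u m. \<bar>alt_sum u f (corner u p k b) (corner u p (\<lambda>i. Suc (k i)) b)\<bar>"
  have "ennreal ?s \<le> vitali_variation u a b b f"
    unfolding vitali_variation_def using lad by (intro SUP_upper2[of "(m, p)"]) auto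
  also have "\<dots> \<le> hardy_krause_variation a b f"
    unfolding hardy_krause_variation_def using u
    by (intro member_le_sum) auto
  also have "\<dots> = ennreal V"
    using assms unfolding V_def bounded_variation_hk_def by simp
  finally show "?s \<le> V" unfolding V_def by (simp add: ennreal_le_iff)
qed

text \<open>A ladder on the face spanned by \<open>i\<close> and \<open>v\<close> is chosen so that
  one row of its cells runs in direction \<open>i\<close> and spans from
  \<open>z \<bullet> j\<close> to \<open>b \<bullet> j\<close> in each \<open>j \<in> v\<close>. The
  sum over this row is part of a Vitali sum.\<close>

lemma hk_face_variation:
  fixes f :: "'a::euclidean_space \<Rightarrow> real"
  assumes V: "\<And>u m p. u \<subseteq> Basis \<Longrightarrow> u \<noteq> {} \<Longrightarrow> ladder u a b m p \<Longrightarrow>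
      (\<Sum>k\<in>cells u m. \<bar>alt_sum u f (corner u p k b) (corner u p (\<lambda>i. Suc (k i)) b)\<bar>) \<le> V"
    and i: "i \<in> Basis" and v: "v \<subseteq> Basis - {i}" and z: "\<And>j. j \<in> v \<Longrightarrow> a \<bullet> j \<le> z \<bullet> j \<and> z \<bullet> j < b \<bullet> j"
    and q: "q 0 = a \<bullet> i" "q m = b \<bullet> i" "\<And>k. k < m \<Longrightarrow> q k < q (Suc k)"
  shows "(\<Sum>\<kappa><m. \<bar>\<Sum>w\<in>Pow v. (-1) ^ card w *
    (f (upd i (glue w z b) (q (Suc \<kappa>))) - f (upd i (glue w z b) (q \<kappa>)))\<bar>) \<le> V"
proof -
  define u where "u = insert i v"
  have vB: "v \<subseteq> Basis" and iv: "i \<notin> v" and u: "u \<subseteq> Basis" "u \<noteq> {}" and fin: "finite v"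
    using i v finite_subset[OF _ finite_Basis, of v] unfolding u_def by auto
  \<comment> \<open>For \<open>j \<in> v\<close> the ladder is \<open>a \<bullet> j\<close>,
    \<open>z \<bullet> j\<close>, \<open>b \<bullet> j\<close>. If
    \<open>z \<bullet> j = a \<bullet> j\<close> the first step must be dropped, because ladders
    increase strictly; \<open>c j\<close> below is the index of the cell that starts at
    \<open>z \<bullet> j\<close>.\<close>
  define M where "M j = (if j = i then m else if z \<bullet> j = a \<bullet> j then 1 else 2)" for j
  define p where "p j k = (if j = i then q k else if k = 0 then a \<bullet> j
      else if z \<bullet> j = a \<bullet> j \<or> k \<noteq> 1 then b \<bullet> j else z \<bullet> j)" for j k
  define c where "c j = (if z \<bullet> j = a \<bullet> j then 0 else 1 :: nat)" for j
  have lad: "ladder u a b M p"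
    unfolding ladder_def
  proof (intro ballI conjI allI impI)
    fix j assume j: "j \<in> u"
    show "p j 0 = a \<bullet> j" using q by (simp add: p_def)
    show "p j (M j) = b \<bullet> j" using q by (simp add: p_def M_def)
    show "p j k < p j (Suc k)" if "k < M j" for k
    proof (cases "j = i")
      case True
      then show ?thesis using q(3)[of k] that by (simp add: p_def M_def)
    next
      case False
      then have "j \<in> v" using j by (simp add: u_def)
      from z[OF this] show ?thesis using that False by (auto simp: p_def M_def less_Suc_eq numeral_2_eq_2 split: if_splits)
    qed
  qed
  define K where "K \<kappa> = restrict (\<lambda>j. if j = i then \<kappa> else c j) u" for \<kappa>
  have KM: "K \<kappa> \<in> cells u M" if "\<kappa> < m" for \<kappa>
    unfolding cells_def K_def using that by (auto simp: M_def c_def)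
  have inj: "inj_on K {..<m}"
    by (rule inj_onI) (auto simp: K_def u_def dest: fun_cong[of _ _ i])
  have glue_lo: "glue (insert i w) (corner u p (K \<kappa>) b) (corner u p (\<lambda>j. Suc (K \<kappa> j)) b) = upd i (glue w z b) (q \<kappa>)"
    "glue w (corner u p (K \<kappa>) b) (corner u p (\<lambda>j. Suc (K \<kappa> j)) b) = upd i (glue w z b) (q (Suc \<kappa>))"
    if w: "w \<subseteq> v" for w \<kappa>
    by (rule euclidean_eqI, use w iv i in \<open>auto simp: glue_inner upd_inner corner_inner K_def u_def p_def c_def subset_iff\<close>)+
  have "alt_sum u f (corner u p (K \<kappa>) b) (corner u p (\<lambda>j. Suc (K \<kappa> j)) b) =
      (\<Sum>w\<in>Pow v. (-1) ^ card w * (f (upd i (glue w z b) (q (Suc \<kappa>))) - f (upd i (glue w z b) (q \<kappa>))))" for \<kappa>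
  proof -
    have "card (insert i w) = Suc (card w)" if "w \<in> Pow v" for w
      using that iv fin finite_subset by (subst card_insert_disjoint) auto
    then have "(\<Sum>w\<in>Pow v. (-1) ^ card (insert i w) *
        f (glue (insert i w) (corner u p (K \<kappa>) b) (corner u p (\<lambda>j. Suc (K \<kappa> j)) b)))
      = (\<Sum>w\<in>Pow v. - ((-1) ^ card w * f (upd i (glue w z b) (q \<kappa>))))"
      by (intro sum.cong) (auto simp: glue_lo)
    moreover have "(\<Sum>w\<in>Pow v. (-1) ^ card w * f (glue w (corner u p (K \<kappa>) b) (corner u p (\<lambda>j. Suc (K \<kappa> j)) b)))
      = (\<Sum>w\<in>Pow v. (-1) ^ card w * f (upd i (glue w z b) (q (Suc \<kappa>))))"
      by (intro sum.cong) (auto simp: glue_lo)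
    moreover have "Pow u = Pow (insert i v)" by (simp add: u_def)
    ultimately show ?thesis
      unfolding alt_sum_def
      by (simp only: sum_Pow_insert[OF fin iv] right_diff_distrib sum_subtractf sum_negf)
  qed
  then have "(\<Sum>\<kappa><m. \<bar>\<Sum>w\<in>Pow v. (-1) ^ card w * (f (upd i (glue w z b) (q (Suc \<kappa>))) - f (upd i (glue w z b) (q \<kappa>)))\<bar>)
      = (\<Sum>k\<in>K ` {..<m}. \<bar>alt_sum u f (corner u p k b) (corner u p (\<lambda>i. Suc (k i)) b)\<bar>)"
    by (subst sum.reindex[OF inj]) simp
  also have "\<dots> \<le> (\<Sum>k\<in>cells u M. \<bar>alt_sum u f (corner u p k b) (corner u p (\<lambda>i. Suc (k i)) b)\<bar>)"
    using KM fin by (intro sum_mono2 finite_cells) (auto simp: u_def)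
  also have "\<dots> \<le> V" by (rule V[OF u lad])
  finally show ?thesis .
qed

text \<open>An increment along coordinate \<open>i\<close> at \<open>z\<close> is, by Moebius inversion over the remaining
  coordinates, a combination of increments over cells with one corner on the upper faces.\<close>

lemma hk_section_variation:
  fixes f :: "'a::euclidean_space \<Rightarrow> real"
  assumes V: "\<And>u m p. u \<subseteq> Basis \<Longrightarrow> u \<noteq> {} \<Longrightarrow> ladder u a b m p \<Longrightarrow>
      (\<Sum>k\<in>cells u m. \<bar>alt_sum u f (corner u p k b) (corner u p (\<lambda>i. Suc (k i)) b)\<bar>) \<le> V"
    and V0: "0 \<le> V" and i: "i \<in> Basis" and z: "z \<in> cbox a b"
    and q: "q 0 = a \<bullet> i" "q m = b \<bullet> i" "\<And>k. k < m \<Longrightarrow> q k < q (Suc k)"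
  shows "(\<Sum>\<kappa><m. \<bar>f (upd i z (q (Suc \<kappa>))) - f (upd i z (q \<kappa>))\<bar>) \<le> 2 ^ DIM('a) * V"
proof -
  define S where "S = Basis - {i}"
  have fS: "finite S" unfolding S_def by simp
  define D where "D \<kappa> w = f (upd i (glue w z b) (q (Suc \<kappa>))) - f (upd i (glue w z b) (q \<kappa>))" for \<kappa> w
  define E where "E \<kappa> v = (\<Sum>w\<in>Pow v. (-1) ^ card w * D \<kappa> w)" for \<kappa> v
  \<comment> \<open>For \<open>w = S\<close> all coordinates other than \<open>i\<close> are those
    of \<open>z\<close>, so \<open>D \<kappa> S\<close> is the wanted increment; inclusion-exclusion
    recovers it from the alternating sums \<open>E \<kappa> v\<close>.\<close>
  have DS: "D \<kappa> S = (\<Sum>v\<in>Pow S. (-1) ^ card v * E \<kappa> v)" for \<kappa>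
    by (rule inclusion_exclusion_symmetric[OF _ fS]) (simp add: E_def)
  have glueS: "upd i (glue S z b) r = upd i z r" for r
    by (rule euclidean_eqI) (use i in \<open>auto simp: upd_inner glue_inner S_def\<close>)
  have EV: "(\<Sum>\<kappa><m. \<bar>E \<kappa> v\<bar>) \<le> V" if v: "v \<in> Pow S" for v
  \<comment> \<open>If \<open>z \<bullet> j = b \<bullet> j\<close>, the face cell would be
    degenerate in direction \<open>j\<close>; the terms with and without \<open>j\<close> then
    cancel. Otherwise every edge is positive and the face bound applies.\<close>
  proof (cases "\<exists>j\<in>v. z \<bullet> j = b \<bullet> j")
    case True
    then obtain j where j: "j \<in> v" "z \<bullet> j = b \<bullet> j" by blast
    have fv: "finite (v - {j})" using v fS finite_subset by blast
    have "E \<kappa> v = 0" for \<kappa>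
    proof -
      have vj: "v = insert j (v - {j})" using j by auto
      have "D \<kappa> (insert j w) = D \<kappa> w" for w
      proof -
        have "glue (insert j w) z b = glue w z b"
          by (rule euclidean_eqI) (use j in \<open>auto simp: glue_inner\<close>)
        then show ?thesis unfolding D_def by simp
      qed
      moreover have "card (insert j w) = Suc (card w)" if "w \<in> Pow (v - {j})" for w
        using that fv finite_subset by (subst card_insert_disjoint) auto
      ultimately have "(\<Sum>w\<in>Pow (v - {j}). (-1) ^ card (insert j w) * D \<kappa> (insert j w))
          = (\<Sum>w\<in>Pow (v - {j}). - ((-1) ^ card w * D \<kappa> w))"
        by (intro sum.cong) auto
      then show ?thesis
        unfolding E_def by (subst vj, subst sum_Pow_insert[OF fv]) (simp_all add: sum_negf)
    qed
    then show ?thesis using V0 by simp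
  next
    case False
    have zj: "a \<bullet> j \<le> z \<bullet> j \<and> z \<bullet> j < b \<bullet> j" if "j \<in> v" for j
    proof -
      have "j \<in> Basis" using v that unfolding S_def by auto
      then have "a \<bullet> j \<le> z \<bullet> j" "z \<bullet> j \<le> b \<bullet> j" using z by (auto simp: mem_box)
      moreover have "z \<bullet> j \<noteq> b \<bullet> j" using False that by blast
      ultimately show ?thesis by simp
    qed
    show ?thesis
      unfolding E_def D_def using v unfolding S_def
      by (intro hk_face_variation[OF V i _ zj q]) auto
  qed
  have "(\<Sum>\<kappa><m. \<bar>D \<kappa> S\<bar>) \<le> (\<Sum>\<kappa><m. \<Sum>v\<in>Pow S. \<bar>E \<kappa> v\<bar>)"
    unfolding DS by (intro sum_mono order_trans[OF sum_abs]) (simp add: abs_mult power_abs)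
  also have "\<dots> = (\<Sum>v\<in>Pow S. \<Sum>\<kappa><m. \<bar>E \<kappa> v\<bar>)" by (rule sum.swap)
  also have "\<dots> \<le> (\<Sum>v\<in>Pow S. V)" by (intro sum_mono EV)
  also have "\<dots> = 2 ^ card S * V" using fS by (simp add: card_Pow)
  also have "\<dots> \<le> 2 ^ DIM('a) * V"
    using V0 by (intro mult_right_mono power_increasing) (auto simp: S_def card_Diff_subset i)
  finally show ?thesis unfolding D_def glueS .
qed

text \<open>A relation between endpoints and value lets chains be prolonged one point at a time;
  repeated points, which strict increase would forbid, add nothing and are skipped in
  \<open>chain_sum_extend\<close>.\<close>

definition chain_sum :: "(real \<Rightarrow> real) \<Rightarrow> real \<Rightarrow> real \<Rightarrow> real \<Rightarrow> bool" where
  "chain_sum x u v r \<longleftrightarrow> (\<exists>m p. p 0 = u \<and> p m = v \<and> (\<forall>k<m. p k < p (Suc k)) \<and>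
     r = (\<Sum>k<m. \<bar>x (p (Suc k)) - x (p k)\<bar>))"

lemma chain_sum_refl: "chain_sum x u u 0"
  unfolding chain_sum_def by (intro exI[of _ "0 :: nat"] exI[of _ "\<lambda>_. u"]) simp

lemma chain_sum_extend:
  assumes "chain_sum x u v r" "v \<le> w"
  shows "chain_sum x u w (r + \<bar>x w - x v\<bar>)"
proof (cases "v = w")
  case True
  then show ?thesis using assms by simp
next
  case False
  obtain m p where p: "p 0 = u" "p m = v" "\<And>k. k < m \<Longrightarrow> p k < p (Suc k)" "r = (\<Sum>k<m. \<bar>x (p (Suc k)) - x (p k)\<bar>)"
    using assms(1) unfolding chain_sum_def by blast
  show ?thesis
    unfolding chain_sum_def
  proof (intro exI conjI allI impI)
    show "(p(Suc m := w)) 0 = u" "(p(Suc m := w)) (Suc m) = w" using p by auto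
    show "(p(Suc m := w)) k < (p(Suc m := w)) (Suc k)" if "k < Suc m" for k
      using that p(2,3) assms(2) False by (cases "k = m") auto
    have "(\<Sum>k<m. \<bar>x ((p(Suc m := w)) (Suc k)) - x ((p(Suc m := w)) k)\<bar>) = r"
      unfolding p(4) by (intro sum.cong) auto
    then show "r + \<bar>x w - x v\<bar> = (\<Sum>k<Suc m. \<bar>x ((p(Suc m := w)) (Suc k)) - x ((p(Suc m := w)) k)\<bar>)"
      using p(2) by simp
  qed
qed

text \<open>A single chain passes through all nodes and, inside each cell, through the two selected
  points in increasing order; its sum dominates the selected oscillations.\<close>

lemma grid_osc_variation:
  assumes T: "0 < T" and V: "\<And>r. chain_sum x 0 T r \<Longrightarrow> r \<le> V" and n: "1 \<le> n"
  shows "grid_osc T n (V / real n) x"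
  unfolding grid_osc_def
proof (intro allI impI)
  fix z z' :: "nat \<Rightarrow> real"
  assume zz: "\<forall>k<n. z k \<in> {T * real k / real n..T * real (Suc k) / real n} \<and>
        z' k \<in> {T * real k / real n..T * real (Suc k) / real n}"
  have "\<exists>r. chain_sum x 0 (T * real m / real n) r \<and> (\<Sum>k<m. \<bar>x (z k) - x (z' k)\<bar>) \<le> r" if "m \<le> n" for m
    using that
  proof (induction m)
    case 0
    then show ?case using chain_sum_refl by auto
  next
    case (Suc m)
    then obtain r where r: "chain_sum x 0 (T * real m / real n) r" "(\<Sum>k<m. \<bar>x (z k) - x (z' k)\<bar>) \<le> r" by auto
    let ?lo = "min (z m) (z' m)" and ?hi = "max (z m) (z' m)"
    have o: "T * real m / real n \<le> ?lo" "?lo \<le> ?hi" "?hi \<le> T * real (Suc m) / real n" using zz Suc.prems by auto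
    have "\<bar>x (z m) - x (z' m)\<bar> = \<bar>x ?hi - x ?lo\<bar>" by (auto simp: min_def max_def)
    then have "(\<Sum>k<Suc m. \<bar>x (z k) - x (z' k)\<bar>) \<le> r + \<bar>x ?lo - x (T * real m / real n)\<bar>
        + \<bar>x ?hi - x ?lo\<bar> + \<bar>x (T * real (Suc m) / real n) - x ?hi\<bar>"
      using r(2) by simp
    with chain_sum_extend[OF chain_sum_extend[OF chain_sum_extend[OF r(1) o(1)] o(2)] o(3)]
    show ?case by blast
  qed
  from this[of n] obtain r where "chain_sum x 0 T r" "(\<Sum>k<n. \<bar>x (z k) - x (z' k)\<bar>) \<le> r" using n by auto
  then show "(\<Sum>k<n. \<bar>x (z k) - x (z' k)\<bar>) \<le> real n * (V / real n)" using V n by fastforce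
qed

lemma chain_sum_increment:
  assumes V: "\<And>r. chain_sum x 0 T r \<Longrightarrow> r \<le> V" and z: "z \<in> {0..T}"
  shows "\<bar>x T - x z\<bar> \<le> V"
proof -
  have "chain_sum x 0 T (0 + \<bar>x z - x 0\<bar> + \<bar>x T - x z\<bar>)"
    using z by (intro chain_sum_extend[OF chain_sum_extend[OF chain_sum_refl]]) auto
  from V[OF this] show ?thesis by simp
qed

lemma hk_riemann_rate:
  fixes \<delta> :: "real \<times> real \<times> real \<Rightarrow> real"
  assumes T: "0 < T1" "0 < T2" "0 < T3" and hk: "bounded_variation_hk (0, 0, 0) (T1, T2, T3) \<delta>"
  shows "\<exists>\<epsilon> K. \<epsilon> \<longlonglongrightarrow> 0 \<and>
    (\<forall>z2\<in>{0..T2}. \<forall>z3\<in>{0..T3}. riemann_rate T1 \<epsilon> K (\<lambda>z. \<delta> (z, z2, z3))) \<and>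
    (\<forall>z1\<in>{0..T1}. \<forall>z3\<in>{0..T3}. riemann_rate T2 \<epsilon> K (\<lambda>z. \<delta> (z1, z, z3))) \<and>
    (\<forall>z1\<in>{0..T1}. \<forall>z2\<in>{0..T2}. riemann_rate T3 \<epsilon> K (\<lambda>z. \<delta> (z1, z2, z)))"
proof -
  obtain V where V: "0 \<le> V" "\<And>u m p. u \<subseteq> Basis \<Longrightarrow> u \<noteq> {} \<Longrightarrow> ladder u (0, 0, 0) (T1, T2, T3) m p \<Longrightarrow>
    (\<Sum>k\<in>cells u m. \<bar>alt_sum u \<delta> (corner u p k (T1, T2, T3)) (corner u p (\<lambda>i. Suc (k i)) (T1, T2, T3))\<bar>) \<le> V"
    using bounded_variation_hk_ladders[OF hk] by blast
  \<comment> \<open>The factor \<open>8\<close> is \<open>2 ^ DIM('a)\<close> for triples, the cost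
    of the inclusion-exclusion over faces.\<close>
  define W where "W = 8 * V"
  have sec: "(\<Sum>\<kappa><m. \<bar>\<delta> (upd i z (q (Suc \<kappa>))) - \<delta> (upd i z (q \<kappa>))\<bar>) \<le> W"
    if "i \<in> Basis" "z \<in> cbox (0, 0, 0) (T1, T2, T3)" "q 0 = (0, 0, 0) \<bullet> i" "q m = (T1, T2, T3) \<bullet> i"
      "\<forall>k<m. q k < q (Suc k)" for i z q m
  proof -
    have "(\<Sum>\<kappa><m. \<bar>\<delta> (upd i z (q (Suc \<kappa>))) - \<delta> (upd i z (q \<kappa>))\<bar>) \<le> 2 ^ DIM(real \<times> real \<times> real) * V"
      by (rule hk_section_variation[OF _ V(1) that(1-4)]) (use V(2) that(5) in blast)+
    then show ?thesis by (simp add: W_def)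
  qed
  have box: "(z1, z2, z3) \<in> cbox (0, 0, 0) (T1, T2, T3)" if "z1 \<in> {0..T1}" "z2 \<in> {0..T2}" "z3 \<in> {0..T3}" for z1 z2 z3
    using that by (auto simp: cbox_Pair_eq)
  have c1: "r \<le> W" if ch: "chain_sum (\<lambda>z. \<delta> (z, z2, z3)) 0 T1 r" "z2 \<in> {0..T2}" "z3 \<in> {0..T3}" for z2 z3 r
  proof -
    obtain m p where p: "p 0 = 0" "p m = T1" "\<forall>k<m. p k < p (Suc k)"
      and r: "r = (\<Sum>k<m. \<bar>\<delta> (p (Suc k), z2, z3) - \<delta> (p k, z2, z3)\<bar>)"
      using ch unfolding chain_sum_def by blast
    have "(\<Sum>k<m. \<bar>\<delta> (upd E1 (0, z2, z3) (p (Suc k))) - \<delta> (upd E1 (0, z2, z3) (p k))\<bar>) \<le> W"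
    proof (rule sec)
      show "(0, z2, z3) \<in> cbox (0, 0, 0) (T1, T2, T3)" using T that(2,3) by (intro box) auto
    qed (use p in simp_all)
    then show ?thesis unfolding r by simp
  qed
  have c2: "r \<le> W" if ch: "chain_sum (\<lambda>z. \<delta> (z1, z, z3)) 0 T2 r" "z1 \<in> {0..T1}" "z3 \<in> {0..T3}" for z1 z3 r
  proof -
    obtain m p where p: "p 0 = 0" "p m = T2" "\<forall>k<m. p k < p (Suc k)"
      and r: "r = (\<Sum>k<m. \<bar>\<delta> (z1, p (Suc k), z3) - \<delta> (z1, p k, z3)\<bar>)"
      using ch unfolding chain_sum_def by blast
    have "(\<Sum>k<m. \<bar>\<delta> (upd E2 (z1, 0, z3) (p (Suc k))) - \<delta> (upd E2 (z1, 0, z3) (p k))\<bar>) \<le> W"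
    proof (rule sec)
      show "(z1, 0, z3) \<in> cbox (0, 0, 0) (T1, T2, T3)" using T that(2,3) by (intro box) auto
    qed (use p in simp_all)
    then show ?thesis unfolding r by simp
  qed
  have c3: "r \<le> W" if ch: "chain_sum (\<lambda>z. \<delta> (z1, z2, z)) 0 T3 r" "z1 \<in> {0..T1}" "z2 \<in> {0..T2}" for z1 z2 r
  proof -
    obtain m p where p: "p 0 = 0" "p m = T3" "\<forall>k<m. p k < p (Suc k)"
      and r: "r = (\<Sum>k<m. \<bar>\<delta> (z1, z2, p (Suc k)) - \<delta> (z1, z2, p k)\<bar>)"
      using ch unfolding chain_sum_def by blast
    have "(\<Sum>k<m. \<bar>\<delta> (upd E3 (z1, z2, 0) (p (Suc k))) - \<delta> (upd E3 (z1, z2, 0) (p k))\<bar>) \<le> W"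
    proof (rule sec)
      show "(z1, z2, 0) \<in> cbox (0, 0, 0) (T1, T2, T3)" using T that(2,3) by (intro box) auto
    qed (use p in simp_all)
    then show ?thesis unfolding r by simp
  qed
  \<comment> \<open>Any point is joined to the upper corner by moving one coordinate at a time, and
    each move costs at most \<open>W\<close>.\<close>
  define K where "K = \<bar>\<delta> (T1, T2, T3)\<bar> + 3 * W"
  have K: "\<bar>\<delta> (z1, z2, z3)\<bar> \<le> K" if z: "z1 \<in> {0..T1}" "z2 \<in> {0..T2}" "z3 \<in> {0..T3}" for z1 z2 z3
  proof -
    have "\<bar>\<delta> (T1, z2, z3) - \<delta> (z1, z2, z3)\<bar> \<le> W"
      by (rule chain_sum_increment[where x = "\<lambda>z. \<delta> (z, z2, z3)"]) (use c1 z in auto)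
    moreover have "\<bar>\<delta> (T1, T2, z3) - \<delta> (T1, z2, z3)\<bar> \<le> W"
      by (rule chain_sum_increment[where x = "\<lambda>z. \<delta> (T1, z, z3)"]) (use c2 z T in auto)
    moreover have "\<bar>\<delta> (T1, T2, T3) - \<delta> (T1, T2, z3)\<bar> \<le> W"
      by (rule chain_sum_increment[where x = "\<lambda>z. \<delta> (T1, T2, z)"]) (use c3 z T in auto)
    ultimately show ?thesis unfolding K_def by linarith
  qed
  have "(\<lambda>n. W / real n) \<longlonglongrightarrow> 0" by (rule lim_const_over_n)
  moreover have "riemann_rate T1 (\<lambda>n. W / real n) K (\<lambda>z. \<delta> (z, z2, z3))" if "z2 \<in> {0..T2}" "z3 \<in> {0..T3}" for z2 z3
    unfolding riemann_rate_def using that c1 K T by (auto intro!: grid_osc_variation)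
  moreover have "riemann_rate T2 (\<lambda>n. W / real n) K (\<lambda>z. \<delta> (z1, z, z3))" if "z1 \<in> {0..T1}" "z3 \<in> {0..T3}" for z1 z3
    unfolding riemann_rate_def using that c2 K T by (auto intro!: grid_osc_variation)
  moreover have "riemann_rate T3 (\<lambda>n. W / real n) K (\<lambda>z. \<delta> (z1, z2, z))" if "z1 \<in> {0..T1}" "z2 \<in> {0..T2}" for z1 z2
    unfolding riemann_rate_def using that c3 K T by (auto intro!: grid_osc_variation)
  ultimately show ?thesis by blast
qed

text \<open>The rate is the modulus of continuity of \<open>\<delta>\<close> at scale
  \<open>R / n\<close>; taking \<open>R\<close> as the longest edge makes one rate serve all three
  directions.\<close>

lemma continuous_riemann_rate:
  fixes \<delta> :: "real \<times> real \<times> real \<Rightarrow> real"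
  assumes T: "0 < T1" "0 < T2" "0 < T3" and cont: "continuous_on (cbox (0, 0, 0) (T1, T2, T3)) \<delta>"
  shows "\<exists>\<epsilon> K. \<epsilon> \<longlonglongrightarrow> 0 \<and>
    (\<forall>z2\<in>{0..T2}. \<forall>z3\<in>{0..T3}. riemann_rate T1 \<epsilon> K (\<lambda>z. \<delta> (z, z2, z3))) \<and>
    (\<forall>z1\<in>{0..T1}. \<forall>z3\<in>{0..T3}. riemann_rate T2 \<epsilon> K (\<lambda>z. \<delta> (z1, z, z3))) \<and>
    (\<forall>z1\<in>{0..T1}. \<forall>z2\<in>{0..T2}. riemann_rate T3 \<epsilon> K (\<lambda>z. \<delta> (z1, z2, z)))"
proof -
  let ?B = "cbox (0, 0, 0) (T1, T2, T3)"
  have box: "(z1, z2, z3) \<in> ?B" if "z1 \<in> {0..T1}" "z2 \<in> {0..T2}" "z3 \<in> {0..T3}" for z1 z2 z3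
    using that by (auto simp: cbox_Pair_eq)
  define R where "R = max T1 (max T2 T3)"
  have "bounded (\<delta> ` ?B)" by (intro compact_imp_bounded compact_continuous_image cont compact_cbox)
  then obtain K where K: "\<And>p. p \<in> ?B \<Longrightarrow> \<bar>\<delta> p\<bar> \<le> K" unfolding bounded_iff by auto
  define A where "A n = {\<bar>\<delta> p - \<delta> q\<bar> | p q. p \<in> ?B \<and> q \<in> ?B \<and> dist p q \<le> R / real n}" for n
  define \<epsilon> where "\<epsilon> n = Sup (A n)" for n
  have R: "0 < R" using T unfolding R_def by simp
  have bdd: "bdd_above (A n)" for n
  proof (rule bdd_aboveI)
    fix r assume "r \<in> A n"
    then obtain p q where "p \<in> ?B" "q \<in> ?B" "r = \<bar>\<delta> p - \<delta> q\<bar>" unfolding A_def by blast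
    then show "r \<le> K + K" using K[of p] K[of q] by linarith
  qed
  have zero: "(0, 0, 0) \<in> ?B" using box[of 0 0 0] T by simp
  have ne: "0 \<in> A n" for n
    unfolding A_def using zero R by (intro CollectI exI[of _ "(0, 0, 0)"]) auto
  have up: "\<bar>\<delta> p - \<delta> q\<bar> \<le> \<epsilon> n" if "p \<in> ?B" "q \<in> ?B" "dist p q \<le> R / real n" for p q n
    unfolding \<epsilon>_def using that by (intro cSup_upper[OF _ bdd]) (unfold A_def, blast)
  have lim: "\<epsilon> \<longlonglongrightarrow> 0"
  proof (rule tendstoI)
    fix e :: real assume e: "0 < e"
    obtain d where d: "d > 0" and dh: "\<And>x y. x \<in> ?B \<Longrightarrow> y \<in> ?B \<Longrightarrow> dist y x < d \<Longrightarrow> dist (\<delta> y) (\<delta> x) < e / 2"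
      using compact_uniformly_continuous[OF cont compact_cbox] half_gt_zero[OF e]
      unfolding uniformly_continuous_on_def by metis
    have "(\<lambda>n. R / real n) \<longlonglongrightarrow> 0" by (rule lim_const_over_n)
    then have "\<forall>\<^sub>F n in sequentially. R / real n < d" using d by (rule order_tendstoD(2))
    then show "\<forall>\<^sub>F n in sequentially. dist (\<epsilon> n) 0 < e"
    proof eventually_elim
      case (elim n)
      have "\<epsilon> n \<le> e / 2"
        unfolding \<epsilon>_def
      proof (rule cSup_least)
        fix r assume "r \<in> A n"
        then obtain p q where "p \<in> ?B" "q \<in> ?B" "r = \<bar>\<delta> p - \<delta> q\<bar>" "dist p q \<le> R / real n" unfolding A_def by blast
        then show "r \<le> e / 2" using dh[of q p] elim by (simp add: dist_real_def)
      qed (use ne in auto)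
      moreover have "0 \<le> \<epsilon> n" unfolding \<epsilon>_def using ne by (intro cSup_upper bdd)
      ultimately show ?case using e by simp
    qed
  qed
  have gr: "grid_osc T n (\<epsilon> n) (\<lambda>z. \<delta> (c z))"
    if n: "1 \<le> n" and "0 < T" "T \<le> R" and c: "\<And>z. z \<in> {0..T} \<Longrightarrow> c z \<in> ?B"
      "\<And>z z'. dist (c z) (c z') = \<bar>z - z'\<bar>" for n T and c :: "real \<Rightarrow> real \<times> real \<times> real"
    unfolding grid_osc_def
  proof (intro allI impI)
    fix z z' :: "nat \<Rightarrow> real"
    assume zz: "\<forall>k<n. z k \<in> {T * real k / real n..T * real (Suc k) / real n} \<and>
        z' k \<in> {T * real k / real n..T * real (Suc k) / real n}"
    have "(\<Sum>k<n. \<bar>\<delta> (c (z k)) - \<delta> (c (z' k))\<bar>) \<le> (\<Sum>k<n. \<epsilon> n)"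
    proof (intro sum_mono up)
      fix k assume "k \<in> {..<n}"
      then have k: "k < n" by simp
      have zk: "z k \<in> {T * real k / real n..T * real (Suc k) / real n}" "z' k \<in> {T * real k / real n..T * real (Suc k) / real n}"
        using zz k by auto
      show "c (z k) \<in> ?B" "c (z' k) \<in> ?B"
        using cell_subset[OF _ k zk(1)] cell_subset[OF _ k zk(2)] that by auto
      have "T * real (Suc k) / real n - T * real k / real n = T / real n" by (simp add: algebra_simps add_divide_distrib)
      then have "\<bar>z k - z' k\<bar> \<le> T / real n" using zk unfolding atLeastAtMost_iff by linarith
      also have "\<dots> \<le> R / real n" using that by (intro divide_right_mono) auto
      finally show "dist (c (z k)) (c (z' k)) \<le> R / real n" using c(2) by simp
    qed
    then show "(\<Sum>k<n. \<bar>\<delta> (c (z k)) - \<delta> (c (z' k))\<bar>) \<le> real n * \<epsilon> n" by simp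
  qed
  have d: "dist (z, z2, z3) (z', z2, z3) = \<bar>z - z'\<bar>" "dist (z1, z, z3) (z1, z', z3) = \<bar>z - z'\<bar>"
    "dist (z1, z2, z) (z1, z2, z') = \<bar>z - z'\<bar>" for z z' z1 z2 z3 :: real
    by (auto simp: dist_Pair_Pair dist_real_def)
  have TR: "T1 \<le> R" "T2 \<le> R" "T3 \<le> R" unfolding R_def by auto
  have "riemann_rate T1 \<epsilon> K (\<lambda>z. \<delta> (z, z2, z3))" if "z2 \<in> {0..T2}" "z3 \<in> {0..T3}" for z2 z3
    unfolding riemann_rate_def using that K box T TR d(1) by (auto intro!: gr)
  moreover have "riemann_rate T2 \<epsilon> K (\<lambda>z. \<delta> (z1, z, z3))" if "z1 \<in> {0..T1}" "z3 \<in> {0..T3}" for z1 z3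
    unfolding riemann_rate_def using that K box T TR d(2) by (auto intro!: gr)
  moreover have "riemann_rate T3 \<epsilon> K (\<lambda>z. \<delta> (z1, z2, z))" if "z1 \<in> {0..T1}" "z2 \<in> {0..T2}" for z1 z2
    unfolding riemann_rate_def using that K box T TR d(3) by (auto intro!: gr)
  ultimately show ?thesis using lim by blast
qed

section \<open>Convergence of the discretized functionals\<close>

text \<open>The Lipschitz bound on \<open>k'\<close> serves to compare the kernels rescaled by
  \<open>n * \<tau>\<close> with those rescaled by the limit \<open>T\<close>, derivatives
  included.\<close>

definition smooth_kernel :: "real \<Rightarrow> (real \<Rightarrow> real) \<Rightarrow> (real \<Rightarrow> real) \<Rightarrow> bool" where
  "smooth_kernel C k k' \<longleftrightarrow> (\<forall>x. (k has_real_derivative k' x) (at x) \<and> \<bar>k x\<bar> \<le> C \<and> \<bar>k' x\<bar> \<le> C \<and>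
     (\<forall>y. \<bar>k' x - k' y\<bar> \<le> C * \<bar>x - y\<bar>))"

lemma smooth_kernel_sinc:
  assumes "0 < \<Omega>" "\<Omega> / pi \<le> C" "\<Omega>\<^sup>2 / pi \<le> C" "\<Omega> ^ 3 / pi \<le> C"
  shows "smooth_kernel C (sinc_factor \<Omega>) (sinc_factor_deriv \<Omega>)"
  unfolding smooth_kernel_def
proof (intro allI conjI)
  fix x y
  show "(sinc_factor \<Omega> has_real_derivative sinc_factor_deriv \<Omega> x) (at x)"
    by (rule sinc_factor_has_derivative[OF assms(1)])
  show "\<bar>sinc_factor \<Omega> x\<bar> \<le> C" "\<bar>sinc_factor_deriv \<Omega> x\<bar> \<le> C"
    using sinc_factor_bounds(1,2)[OF assms(1), of x] assms by linarith+
  have "\<Omega> ^ 3 / pi * \<bar>x - y\<bar> \<le> C * \<bar>x - y\<bar>" using assms(4) by (intro mult_right_mono) auto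
  then show "\<bar>sinc_factor_deriv \<Omega> x - sinc_factor_deriv \<Omega> y\<bar> \<le> C * \<bar>x - y\<bar>"
    using sinc_factor_bounds(3)[OF assms(1), of x y] by linarith
qed

lemma smooth_kernelD:
  assumes "smooth_kernel C k k'"
  shows "(k has_real_derivative k' x) (at x)" "\<bar>k x\<bar> \<le> C" "\<bar>k' x\<bar> \<le> C" "\<bar>k' x - k' y\<bar> \<le> C * \<bar>x - y\<bar>"
    "\<bar>k x - k y\<bar> \<le> C * \<bar>x - y\<bar>"
proof -
  show d: "(k has_real_derivative k' x) (at x)" "\<bar>k x\<bar> \<le> C" "\<bar>k' x\<bar> \<le> C" "\<bar>k' x - k' y\<bar> \<le> C * \<bar>x - y\<bar>" for x y
    using assms unfolding smooth_kernel_def by blast+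
  have "norm (k x - k y) \<le> C * norm (x - y)"
    by (rule field_differentiable_bound[of UNIV k k']) (use d in \<open>auto intro: has_field_derivative_at_within\<close>)
  then show "\<bar>k x - k y\<bar> \<le> C * \<bar>x - y\<bar>" by simp
qed

lemma smooth_kernel_continuous:
  assumes "smooth_kernel C k k'"
  shows "continuous_on A k" "continuous_on A k'"
proof -
  show "continuous_on A k"
    using smooth_kernelD(1)[OF assms] by (meson DERIV_isCont continuous_at_imp_continuous_on)
  have "C-lipschitz_on A k'"
    using smooth_kernelD(3,4)[OF assms] by (intro lipschitz_onI) (auto simp: dist_real_def intro: order_trans[OF abs_ge_zero])
  then show "continuous_on A k'" by (rule lipschitz_on_continuous_on)
qed

text \<open>The chain rule brings a factor \<open>T \<le> R\<close> into the derivative;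
  \<open>1 + R\<close> covers the kernel and the derivative together.\<close>

lemma smooth_kernel_c1_bound:
  assumes k: "smooth_kernel C k k'" and T: "0 \<le> T" "T \<le> R"
  shows "c1_bound (C * (1 + R)) (\<lambda>z. k (t - T * z)) (\<lambda>z. - T * k' (t - T * z))"
  unfolding c1_bound_def
proof (intro conjI ballI)
  have C0: "0 \<le> C" using order_trans[OF abs_ge_zero smooth_kernelD(2)[OF k]] .
  show "continuous_on {0..1} (\<lambda>z. - T * k' (t - T * z))"
    by (intro continuous_intros continuous_on_compose2[OF smooth_kernel_continuous(2)[OF k, of UNIV]]) auto
  fix z :: real
  have "((\<lambda>z. k (t - T * z)) has_real_derivative k' (t - T * z) * (0 - T * 1)) (at z)"
    by (rule DERIV_chain2[OF smooth_kernelD(1)[OF k]]) (auto intro!: derivative_eq_intros)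
  then show "((\<lambda>z. k (t - T * z)) has_real_derivative - T * k' (t - T * z)) (at z within {0..1})"
    by (simp add: mult.commute has_field_derivative_at_within)
  have "C * 1 \<le> C * (1 + R)" using T C0 by (intro mult_left_mono) auto
  from order_trans[OF smooth_kernelD(2)[OF k] this[unfolded mult_1_right]]
  show "\<bar>k (t - T * z)\<bar> \<le> C * (1 + R)" .
  have "T * \<bar>k' (t - T * z)\<bar> \<le> (1 + R) * C"
    using T smooth_kernelD(3)[OF k] by (intro mult_mono) auto
  then show "\<bar>- T * k' (t - T * z)\<bar> \<le> C * (1 + R)" using T by (simp add: abs_mult mult.commute)
qed

text \<open>The derivatives differ in the outer factor, at cost
  \<open>C * \<bar>T - T'\<bar>\<close>, and in the argument, at cost
  \<open>R * C * \<bar>T - T'\<bar>\<close> by the Lipschitz bound on \<open>k'\<close>.\<close>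

lemma smooth_kernel_close:
  assumes k: "smooth_kernel C k k'" and T: "0 \<le> T" "T \<le> R" "0 \<le> T'" "T' \<le> R" and z: "z \<in> {0..1}"
  shows "\<bar>k (t - T * z) - k (t - T' * z)\<bar> \<le> C * (1 + R) * \<bar>T - T'\<bar> \<and>
    \<bar>- T * k' (t - T * z) - - T' * k' (t - T' * z)\<bar> \<le> C * (1 + R) * \<bar>T - T'\<bar>"
proof -
  have C0: "0 \<le> C" using order_trans[OF abs_ge_zero smooth_kernelD(2)[OF k]] .
  have "\<bar>(t - T * z) - (t - T' * z)\<bar> = \<bar>T' - T\<bar> * z"
    using z by (simp add: left_diff_distrib[symmetric] abs_mult)
  also have "\<dots> \<le> \<bar>T' - T\<bar> * 1" using z by (intro mult_left_mono) auto
  finally have d: "\<bar>(t - T * z) - (t - T' * z)\<bar> \<le> \<bar>T - T'\<bar>" by (simp add: abs_minus_commute)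
  have "\<bar>k (t - T * z) - k (t - T' * z)\<bar> \<le> C * \<bar>T - T'\<bar>"
    using order_trans[OF smooth_kernelD(5)[OF k] mult_left_mono[OF d C0]] .
  also have "\<dots> \<le> C * (1 + R) * \<bar>T - T'\<bar>" using T C0 by (intro mult_right_mono) (auto simp: mult_le_cancel_left1)
  finally have 1: "\<bar>k (t - T * z) - k (t - T' * z)\<bar> \<le> C * (1 + R) * \<bar>T - T'\<bar>" .
  have "- T * k' (t - T * z) - - T' * k' (t - T' * z) =
      (T' - T) * k' (t - T * z) + T' * (k' (t - T' * z) - k' (t - T * z))"
    by (simp add: algebra_simps)
  also have "\<bar>\<dots>\<bar> \<le> \<bar>T' - T\<bar> * C + R * (C * \<bar>T - T'\<bar>)"
  proof (rule order_trans[OF abs_triangle_ineq], unfold abs_mult, intro add_mono mult_mono smooth_kernelD(3)[OF k])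
    show "\<bar>k' (t - T' * z) - k' (t - T * z)\<bar> \<le> C * \<bar>T - T'\<bar>"
      using order_trans[OF smooth_kernelD(4)[OF k] mult_left_mono[OF d C0]] by (simp add: abs_minus_commute)
  qed (use T C0 in auto)
  also have "\<dots> = C * (1 + R) * \<bar>T - T'\<bar>" by (simp add: algebra_simps abs_minus_commute)
  finally show ?thesis using 1 by blast
qed

text \<open>Trades the variable range of summation for an indicator. The parameter \<open>s\<close>
  then occurs only in fixed coefficient functions over a finite grid, each of which is seen to lie
  in the Skorohod space.\<close>

lemma sum_floor_indicator:
  fixes f :: "nat \<Rightarrow> real"
  assumes s: "s \<in> {0..1}" and n: "1 \<le> n"
  shows "(\<Sum>l=1..n. (if real l / real n \<le> s then 1 else 0) * f l) = (\<Sum>l=1..nat \<lfloor>real n * s\<rfloor>. f l)"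
proof -
  have mn: "nat \<lfloor>real n * s\<rfloor> \<le> n"
  proof -
    have "real n * s \<le> real n" using s by (intro mult_left_le) auto
    then show ?thesis by linarith
  qed
  have iff: "real l / real n \<le> s \<longleftrightarrow> l \<le> nat \<lfloor>real n * s\<rfloor>" for l
  proof -
    have "real l / real n \<le> s \<longleftrightarrow> real l \<le> real n * s" using n by (simp add: field_simps)
    also have "\<dots> \<longleftrightarrow> int l \<le> \<lfloor>real n * s\<rfloor>" by (simp add: le_floor_iff)
    also have "\<dots> \<longleftrightarrow> l \<le> nat \<lfloor>real n * s\<rfloor>" using s by (simp add: le_nat_iff)
    finally show ?thesis .
  qed
  have e: "{l \<in> {1..n}. real l / real n \<le> s} = {1..nat \<lfloor>real n * s\<rfloor>}"
    unfolding iff using mn by auto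
  have "(\<Sum>l=1..n. (if real l / real n \<le> s then 1 else 0) * f l) = (\<Sum>l=1..n. if real l / real n \<le> s then f l else 0)"
    by (intro sum.cong) auto
  also have "\<dots> = (\<Sum>l\<in>{l \<in> {1..n}. real l / real n \<le> s}. f l)" by (rule sum.inter_filter[symmetric]) simp
  finally show ?thesis unfolding e .
qed

section \<open>The sampling scheme and its discretized functionals\<close>

definition unit_cube :: "(real \<times> real \<times> real) set" where
  "unit_cube = {0..1} \<times> {0..1} \<times> {0..1}"

text \<open>Collects what the two cases on \<open>\<delta>\<close> share. They differ only in how
  \<open>\<delta>_grid\<close>, which compares sampling points with the uniform grid, and
  \<open>\<delta>_rate\<close> are obtained.\<close>

locale sampling =
  fixes k1 k2 k3 k1' k2' k3' :: "real \<Rightarrow> real" and C T1 T2 T3 :: real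
    and \<tau>1 \<tau>2 \<tau>3 :: "nat \<Rightarrow> real" and \<delta> :: "real \<times> real \<times> real \<Rightarrow> real"
  assumes C: "1 \<le> C" and k: "smooth_kernel C k1 k1'" "smooth_kernel C k2 k2'" "smooth_kernel C k3 k3'"
    and T: "0 < T1" "0 < T2" "0 < T3"
    and \<tau>_range: "\<And>n. 1 \<le> n \<Longrightarrow> 0 < \<tau>1 n \<and> 0 < \<tau>2 n \<and> 0 < \<tau>3 n \<and>
      real n * \<tau>1 n \<le> T1 \<and> real n * \<tau>2 n \<le> T2 \<and> real n * \<tau>3 n \<le> T3"
    and \<tau>_lim: "(\<lambda>n. real n * \<tau>1 n) \<longlonglongrightarrow> T1" "(\<lambda>n. real n * \<tau>2 n) \<longlonglongrightarrow> T2" "(\<lambda>n. real n * \<tau>3 n) \<longlonglongrightarrow> T3"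
    and \<delta>_grid: "\<And>\<eta>. 0 < \<eta> \<Longrightarrow> \<exists>m0. \<forall>n1\<ge>m0. \<forall>n2\<ge>m0. \<forall>n3\<ge>m0. \<forall>l1\<in>{1..n1}. \<forall>l2\<in>{1..n2}. \<forall>l3\<in>{1..n3}.
      \<bar>\<delta> (real l1 * \<tau>1 n1, real l2 * \<tau>2 n2, real l3 * \<tau>3 n3)
        - \<delta> (T1 * real l1 / real n1, T2 * real l2 / real n2, T3 * real l3 / real n3)\<bar> \<le> \<eta>"
    and \<delta>_rate: "\<exists>\<epsilon> K. \<epsilon> \<longlonglongrightarrow> 0 \<and>
      (\<forall>z2\<in>{0..T2}. \<forall>z3\<in>{0..T3}. riemann_rate T1 \<epsilon> K (\<lambda>z. \<delta> (z, z2, z3))) \<and>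
      (\<forall>z1\<in>{0..T1}. \<forall>z3\<in>{0..T3}. riemann_rate T2 \<epsilon> K (\<lambda>z. \<delta> (z1, z, z3))) \<and>
      (\<forall>z1\<in>{0..T1}. \<forall>z2\<in>{0..T2}. riemann_rate T3 \<epsilon> K (\<lambda>z. \<delta> (z1, z2, z)))"
begin

definition a1 where "a1 n = real n * \<tau>1 n"
definition a2 where "a2 n = real n * \<tau>2 n"
definition a3 where "a3 n = real n * \<tau>3 n"

definition grid :: "nat \<times> nat \<times> nat \<Rightarrow> (nat \<times> nat \<times> nat) set" where
  "grid = (\<lambda>(n1, n2, n3). {1..n1} \<times> {1..n2} \<times> {1..n3})"

text \<open>The alternating sum of \<open>y\<close> over the grid cell with upper corner
  \<open>l / n\<close>, nested coordinate by coordinate to match \<open>disc3\<close>; for the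
  partial sum process it is a single normalized noise variable.\<close>

definition incr :: "nat \<times> nat \<times> nat \<Rightarrow> nat \<times> nat \<times> nat \<Rightarrow> (real \<times> real \<times> real \<Rightarrow> real) \<Rightarrow> real" where
  "incr = (\<lambda>(n1, n2, n3) (l1, l2, l3) y.
     (let u1 = real l1 / real n1; v1 = real (l1 - 1) / real n1; u2 = real l2 / real n2; v2 = real (l2 - 1) / real n2;
        u3 = real l3 / real n3; v3 = real (l3 - 1) / real n3 in
      ((y (u1, u2, u3) - y (u1, u2, v3)) - (y (u1, v2, u3) - y (u1, v2, v3)))
      - ((y (v1, u2, u3) - y (v1, u2, v3)) - (y (v1, v2, u3) - y (v1, v2, v3)))))"

definition coef :: "nat \<times> nat \<times> nat \<Rightarrow> nat \<times> nat \<times> nat \<Rightarrow> real \<times> real \<times> real \<times> real \<Rightarrow> real" where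
  "coef = (\<lambda>(n1, n2, n3) (l1, l2, l3) (s, t, r2, r3). (if real l1 / real n1 \<le> s then 1 else 0) *
     (k1 (t - real l1 * \<tau>1 n1) * k2 (r2 - real l2 * \<tau>2 n2) * k3 (r3 - real l3 * \<tau>3 n3)))"

text \<open>Equals \<open>sqrt (\<tau>1 n1 * \<tau>2 n2 * \<tau>3 n3)\<close> times
  \<open>sqrt (real n1 * real n2 * real n3)\<close>; the second factor undoes the normalization of
  the partial sums.\<close>

definition scale :: "nat \<times> nat \<times> nat \<Rightarrow> real" where
  "scale = (\<lambda>(n1, n2, n3). sqrt (a1 n1 * a2 n2 * a3 n3))"

text \<open>Defined for an arbitrary path \<open>y\<close> and reading it only at finitely many
  nodes, so it can be evaluated on every element of the Skorohod space near a Brownian path.\<close>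

definition noise :: "nat \<times> nat \<times> nat \<Rightarrow> (real \<times> real \<times> real \<Rightarrow> real) \<Rightarrow> real \<times> real \<times> real \<times> real \<Rightarrow> real" where
  "noise n y p = scale n * (\<Sum>l\<in>grid n. incr n l y * coef n l p)"

definition drift :: "nat \<times> nat \<times> nat \<Rightarrow> real \<times> real \<times> real \<times> real \<Rightarrow> real" where
  "drift = (\<lambda>(n1, n2, n3) p. sqrt (\<tau>1 n1 * \<tau>2 n2 * \<tau>3 n3) * (\<Sum>(l1, l2, l3)\<in>grid (n1, n2, n3).
     \<delta> (real l1 * \<tau>1 n1, real l2 * \<tau>2 n2, real l3 * \<tau>3 n3) / (sqrt n1 * sqrt n2 * sqrt n3) * coef (n1, n2, n3) (l1, l2, l3) p))"

definition noise_limit :: "(real \<times> real \<times> real \<Rightarrow> real) \<Rightarrow> real \<times> real \<times> real \<times> real \<Rightarrow> real" where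
  "noise_limit h = (\<lambda>(s, t, r2, r3). sqrt (T1 * T2 * T3) * parts3
     (\<lambda>z. k1 (t - T1 * z), \<lambda>z. - T1 * k1' (t - T1 * z)) (\<lambda>z. k2 (r2 - T2 * z), \<lambda>z. - T2 * k2' (r2 - T2 * z))
     (\<lambda>z. k3 (r3 - T3 * z), \<lambda>z. - T3 * k3' (r3 - T3 * z)) s h)"

definition drift_limit :: "real \<times> real \<times> real \<times> real \<Rightarrow> real" where
  "drift_limit = (\<lambda>(s, t, r2, r3). 1 / sqrt (T1 * T2 * T3) *
     integral {0..s * T1} (\<lambda>z1. integral {0..T2} (\<lambda>z2. integral {0..T3} (\<lambda>z3.
       k1 (t - z1) * k2 (r2 - z2) * k3 (r3 - z3) * \<delta> (z1, z2, z3)))))"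

lemma finite_grid: "finite (grid n)"
  unfolding grid_def by (simp add: split_beta)

lemma a_range:
  assumes "1 \<le> n"
  shows "0 < a1 n" "a1 n \<le> T1" "0 < a2 n" "a2 n \<le> T2" "0 < a3 n" "a3 n \<le> T3"
  using \<tau>_range[OF assms] assms by (auto simp: a1_def a2_def a3_def)

lemma a_lim: "a1 \<longlonglongrightarrow> T1" "a2 \<longlonglongrightarrow> T2" "a3 \<longlonglongrightarrow> T3"
  using \<tau>_lim unfolding a1_def[abs_def] a2_def[abs_def] a3_def[abs_def] .

lemma grid_sum:
  assumes n: "1 \<le> n1" and s: "s \<in> {0..1}"
  shows "(\<Sum>l\<in>grid (n1, n2, n3). h l * coef (n1, n2, n3) l (s, t, r2, r3)) =
    (\<Sum>l1=1..nat \<lfloor>real n1 * s\<rfloor>. \<Sum>l2=1..n2. \<Sum>l3=1..n3. h (l1, l2, l3) *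
      (k1 (t - real l1 * \<tau>1 n1) * k2 (r2 - real l2 * \<tau>2 n2) * k3 (r3 - real l3 * \<tau>3 n3)))"
proof -
  have "(\<Sum>l\<in>grid (n1, n2, n3). h l * coef (n1, n2, n3) l (s, t, r2, r3)) =
    (\<Sum>l1=1..n1. (if real l1 / real n1 \<le> s then 1 else 0) * (\<Sum>l2=1..n2. \<Sum>l3=1..n3. h (l1, l2, l3) *
      (k1 (t - real l1 * \<tau>1 n1) * k2 (r2 - real l2 * \<tau>2 n2) * k3 (r3 - real l3 * \<tau>3 n3))))"
    unfolding grid_def prod.case sum.cartesian_product'
    by (simp add: coef_def sum_distrib_left mult_ac)
  also note sum_floor_indicator[OF s n]
  finally show ?thesis .
qed

lemma noise_disc3:
  assumes n: "1 \<le> n1" "1 \<le> n2" "1 \<le> n3" and s: "s \<in> {0..1}"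
  shows "noise (n1, n2, n3) y (s, t, r2, r3) = scale (n1, n2, n3) *
    disc3 (n1, n2, n3) (nat \<lfloor>real n1 * s\<rfloor>) (\<lambda>z. k1 (t - a1 n1 * z)) (\<lambda>z. k2 (r2 - a2 n2 * z)) (\<lambda>z. k3 (r3 - a3 n3 * z)) y"
proof -
  define g1 g2 g3 where g: "g1 l = k1 (t - real l * \<tau>1 n1)" "g2 l = k2 (r2 - real l * \<tau>2 n2)" "g3 l = k3 (r3 - real l * \<tau>3 n3)" for l :: nat
  \<comment> \<open>Since \<open>a1 n = n * \<tau>1 n\<close>, the node \<open>l / n\<close> of the
    unit interval corresponds to the sampling point \<open>l * \<tau>1 n\<close>.\<close>
  have node: "k1 (t - a1 n1 * (real l / real n1)) = g1 l" "k2 (r2 - a2 n2 * (real l / real n2)) = g2 l"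
    "k3 (r3 - a3 n3 * (real l / real n3)) = g3 l" for l
    using n by (simp_all add: g a1_def a2_def a3_def mult.commute)
  have "(\<Sum>l\<in>grid (n1, n2, n3). incr (n1, n2, n3) l y * coef (n1, n2, n3) l (s, t, r2, r3)) =
    (\<Sum>l1=1..nat \<lfloor>real n1 * s\<rfloor>. \<Sum>l2=1..n2. \<Sum>l3=1..n3.
       incr (n1, n2, n3) (l1, l2, l3) y * (g1 l1 * g2 l2 * g3 l3))"
    unfolding grid_sum[OF n(1) s] g ..
  also have "\<dots> = disc3 (n1, n2, n3) (nat \<lfloor>real n1 * s\<rfloor>) (\<lambda>z. k1 (t - a1 n1 * z)) (\<lambda>z. k2 (r2 - a2 n2 * z)) (\<lambda>z. k3 (r3 - a3 n3 * z)) y"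
    unfolding disc3_def disc1_def node fst_conv snd_conv incr_def prod.case Let_def
    by (simp add: sum_distrib_left sum_subtractf[symmetric] right_diff_distrib left_diff_distrib mult_ac)
  finally show ?thesis unfolding noise_def by simp
qed

end

lemma eventually_min_at_top:
  "eventually P min_at_top \<longleftrightarrow> (\<exists>m. \<forall>n1\<ge>m. \<forall>n2\<ge>m. \<forall>n3\<ge>m. P (n1, n2, n3))"
proof
  assume "eventually P min_at_top"
  then obtain Q where Q: "eventually Q at_top" "\<And>n. Q (case n of (n1, n2, n3) \<Rightarrow> min n1 (min n2 n3)) \<Longrightarrow> P n"
    unfolding min_at_top_def eventually_filtercomap by blast
  then obtain m where m: "\<And>k. k \<ge> m \<Longrightarrow> Q k" unfolding eventually_at_top_linorder by blast
  show "\<exists>m. \<forall>n1\<ge>m. \<forall>n2\<ge>m. \<forall>n3\<ge>m. P (n1, n2, n3)"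
    using Q(2)[of "(_, _, _)"] m by (intro exI[of _ m]) auto
next
  assume "\<exists>m. \<forall>n1\<ge>m. \<forall>n2\<ge>m. \<forall>n3\<ge>m. P (n1, n2, n3)"
  then obtain m where m: "\<And>n1 n2 n3. n1 \<ge> m \<Longrightarrow> n2 \<ge> m \<Longrightarrow> n3 \<ge> m \<Longrightarrow> P (n1, n2, n3)" by blast
  show "eventually P min_at_top"
    unfolding min_at_top_def eventually_filtercomap
    using m by (intro exI[of _ "\<lambda>k. m \<le> k"] conjI eventually_ge_at_top) auto
qed

lemma filterlim_min_at_top:
  "filterlim fst at_top min_at_top" "filterlim (\<lambda>n. fst (snd n)) at_top min_at_top"
  "filterlim (\<lambda>n. snd (snd n)) at_top min_at_top"
  unfolding filterlim_at_top eventually_min_at_top by auto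

lemma tendsto_min_at_top:
  assumes "f \<longlonglongrightarrow> (L :: real)"
  shows "((\<lambda>n. f (fst n)) \<longlongrightarrow> L) min_at_top" "((\<lambda>n. f (fst (snd n))) \<longlongrightarrow> L) min_at_top"
    "((\<lambda>n. f (snd (snd n))) \<longlongrightarrow> L) min_at_top"
  using filterlim_compose[OF assms filterlim_min_at_top(1)] filterlim_compose[OF assms filterlim_min_at_top(2)]
    filterlim_compose[OF assms filterlim_min_at_top(3)] by auto

text \<open>An ordinary sequence inside the filter. It gives the one-index limits of
  \<open>n * \<tau>\<close> and, since measurability passes to limits of sequences, the
  measurability of the limit process.\<close>

lemma filterlim_diagonal: "filterlim (\<lambda>k. (k, k, k)) min_at_top sequentially"
  unfolding filterlim_iff eventually_min_at_top eventually_sequentially by blast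

lemma riemann_rate_mono:
  assumes "riemann_rate T \<epsilon> K x" "\<And>n. 1 \<le> n \<Longrightarrow> \<epsilon> n \<le> \<epsilon>' n"
  shows "riemann_rate T \<epsilon>' K x"
  unfolding riemann_rate_def
proof (intro conjI allI impI)
  fix n :: nat assume n: "1 \<le> n"
  have "real n * \<epsilon> n \<le> real n * \<epsilon>' n" using assms(2)[OF n] by (intro mult_left_mono) auto
  then show "grid_osc T n (\<epsilon>' n) x"
    using riemann_rateD(1)[OF assms(1) n] unfolding grid_osc_def by (meson order_trans)
qed (use riemann_rateD(2)[OF assms(1)] in blast)

context sampling
begin

lemma scale_lim: "(scale \<longlongrightarrow> sqrt (T1 * T2 * T3)) min_at_top"
proof -
  have "((\<lambda>n. sqrt (a1 (fst n) * a2 (fst (snd n)) * a3 (snd (snd n)))) \<longlongrightarrow> sqrt (T1 * T2 * T3)) min_at_top"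
    by (intro tendsto_intros tendsto_min_at_top a_lim)
  then show ?thesis by (simp add: scale_def case_prod_unfold)
qed

lemma scale_range:
  assumes n: "1 \<le> n1" "1 \<le> n2" "1 \<le> n3"
  shows "0 < scale (n1, n2, n3)" "scale (n1, n2, n3) \<le> sqrt (T1 * T2 * T3)"
proof -
  note r = a_range[OF n(1)] a_range[OF n(2)] a_range[OF n(3)]
  show "0 < scale (n1, n2, n3)" using r by (simp add: scale_def)
  have "a1 n1 * a2 n2 * a3 n3 \<le> T1 * T2 * T3"
    using r T by (intro mult_mono mult_nonneg_nonneg) (auto intro: less_imp_le)
  then show "scale (n1, n2, n3) \<le> sqrt (T1 * T2 * T3)" by (simp add: scale_def)
qed

text \<open>Uniform in \<open>t\<close>, \<open>r2\<close> and \<open>r3\<close>, because the kernel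
  bounds hold on the whole real line and so do not depend on the shift.\<close>

lemma noise_estimate:
  fixes h :: "real \<times> real \<times> real \<Rightarrow> real"
  assumes R: "T1 \<le> R" "T2 \<le> R" "T3 \<le> R" and n: "1 \<le> n1" "1 \<le> n2" "1 \<le> n3" and s: "s \<in> {0..1}"
    and h: "continuous_on ({0..1} \<times> {0..1} \<times> {0..1}) h"
    and K: "\<And>v. v \<in> {0..1} \<times> {0..1} \<times> {0..1} \<Longrightarrow> \<bar>h v\<bar> \<le> K"
    and w: "\<And>u v. u \<in> {0..1} \<times> {0..1} \<times> {0..1} \<Longrightarrow> v \<in> {0..1} \<times> {0..1} \<times> {0..1} \<Longrightarrow>
      dist u v \<le> max (1 / real n1) (max (1 / real n2) (1 / real n3)) \<Longrightarrow> \<bar>h u - h v\<bar> \<le> w"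
    and \<kappa>: "C * (1 + R) * \<bar>a1 n1 - T1\<bar> \<le> \<kappa>" "C * (1 + R) * \<bar>a2 n2 - T2\<bar> \<le> \<kappa>" "C * (1 + R) * \<bar>a3 n3 - T3\<bar> \<le> \<kappa>"
    and y: "\<And>v. v \<in> {0..1} \<times> {0..1} \<times> {0..1} \<Longrightarrow> \<bar>y v - h v\<bar> \<le> e"
  shows "\<bar>noise (n1, n2, n3) y (s, t, r2, r3) - noise_limit h (s, t, r2, r3)\<bar> \<le>
    81 * (C * (1 + R)) ^ 3 * (sqrt (T1 * T2 * T3) * (e + w + \<kappa> * K) + \<bar>scale (n1, n2, n3) - sqrt (T1 * T2 * T3)\<bar> * (K + e))"
proof -
  define L where "L = C * (1 + R)"
  have R0: "0 \<le> R" using R T by simp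
  have L1: "1 \<le> L" unfolding L_def using C R0 mult_mono[of 1 C 1 "1 + R"] by simp
  define S where "S = sqrt (T1 * T2 * T3)"
  have S0: "0 \<le> S" using T by (simp add: S_def)
  let ?g1 = "\<lambda>z. k1 (t - a1 n1 * z)" and ?g2 = "\<lambda>z. k2 (r2 - a2 n2 * z)" and ?g3 = "\<lambda>z. k3 (r3 - a3 n3 * z)"
  have a: "0 \<le> a1 n1" "a1 n1 \<le> R" "0 \<le> a2 n2" "a2 n2 \<le> R" "0 \<le> a3 n3" "a3 n3 \<le> R"
    using a_range[OF n(1)] a_range[OF n(2)] a_range[OF n(3)] R by auto
  note g = smooth_kernel_c1_bound[OF k(1) a(1,2), folded L_def] smooth_kernel_c1_bound[OF k(2) a(3,4), folded L_def]
    smooth_kernel_c1_bound[OF k(3) a(5,6), folded L_def]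
  note g' = smooth_kernel_c1_bound[OF k(1) less_imp_le[OF T(1)] R(1), folded L_def]
    smooth_kernel_c1_bound[OF k(2) less_imp_le[OF T(2)] R(2), folded L_def]
    smooth_kernel_c1_bound[OF k(3) less_imp_le[OF T(3)] R(3), folded L_def]
  define m where "m = nat \<lfloor>real n1 * s\<rfloor>"
  have mn: "m \<le> n1"
  proof -
    have "real n1 * s \<le> real n1" using s by (intro mult_left_le) auto
    then show ?thesis unfolding m_def by linarith
  qed
  define d where "d = disc3 (n1, n2, n3) m ?g1 ?g2 ?g3 y"
  define p where "p = parts3 (\<lambda>z. k1 (t - T1 * z), \<lambda>z. - T1 * k1' (t - T1 * z)) (\<lambda>z. k2 (r2 - T2 * z), \<lambda>z. - T2 * k2' (r2 - T2 * z))
     (\<lambda>z. k3 (r3 - T3 * z), \<lambda>z. - T3 * k3' (r3 - T3 * z)) s h"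
  have dist1: "dist (z, z2, z3) (z', z2, z3) = \<bar>z - z'\<bar>" "dist (z1, z, z3) (z1, z', z3) = \<bar>z - z'\<bar>"
    "dist (z1, z2, z) (z1, z2, z') = \<bar>z - z'\<bar>" for z z' z1 z2 z3 :: real
    by (auto simp: dist_Pair_Pair dist_real_def)
  have dp: "\<bar>d - p\<bar> \<le> 81 * L ^ 3 * (e + w + \<kappa> * K)"
    unfolding d_def p_def
  proof (rule disc3_parts3[OF L1 n s m_def g g' _ _ _ h])
    show "\<And>z. z \<in> {0..1} \<Longrightarrow> \<bar>k1 (t - a1 n1 * z) - k1 (t - T1 * z)\<bar> \<le> \<kappa> \<and> \<bar>- a1 n1 * k1' (t - a1 n1 * z) - - T1 * k1' (t - T1 * z)\<bar> \<le> \<kappa>"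
      using smooth_kernel_close[OF k(1) a(1,2) less_imp_le[OF T(1)] R(1)] \<kappa>(1) by (meson order_trans)
    show "\<And>z. z \<in> {0..1} \<Longrightarrow> \<bar>k2 (r2 - a2 n2 * z) - k2 (r2 - T2 * z)\<bar> \<le> \<kappa> \<and> \<bar>- a2 n2 * k2' (r2 - a2 n2 * z) - - T2 * k2' (r2 - T2 * z)\<bar> \<le> \<kappa>"
      using smooth_kernel_close[OF k(2) a(3,4) less_imp_le[OF T(2)] R(2)] \<kappa>(2) by (meson order_trans)
    show "\<And>z. z \<in> {0..1} \<Longrightarrow> \<bar>k3 (r3 - a3 n3 * z) - k3 (r3 - T3 * z)\<bar> \<le> \<kappa> \<and> \<bar>- a3 n3 * k3' (r3 - a3 n3 * z) - - T3 * k3' (r3 - T3 * z)\<bar> \<le> \<kappa>"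
      using smooth_kernel_close[OF k(3) a(5,6) less_imp_le[OF T(3)] R(3)] \<kappa>(3) by (meson order_trans)
  qed (auto intro!: K w y simp: dist1 le_max_iff_disj simp del: dist_Pair_Pair)
  have ye: "\<bar>y (z1, z2, z3)\<bar> \<le> K + e" if "z1 \<in> {0..1}" "z2 \<in> {0..1}" "z3 \<in> {0..1}" for z1 z2 z3
    using y[of "(z1, z2, z3)"] K[of "(z1, z2, z3)"] that by auto
  have "\<bar>d\<bar> \<le> 3 * L * (3 * L * (3 * L * (K + e)))"
    unfolding d_def disc3_def fst_conv snd_conv
    by (intro disc1_bound[OF g(1)] disc1_bound[OF g(2)] disc1_bound[OF g(3)] n mn order_refl ye)
  then have "\<bar>d\<bar> \<le> 27 * L ^ 3 * (K + e)" by (simp add: power3_eq_cube mult_ac)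
  moreover have "27 * L ^ 3 * (K + e) \<le> 81 * L ^ 3 * (K + e)"
    using L1 order_trans[OF abs_ge_zero ye[of 0 0 0]] by (intro mult_right_mono) auto
  ultimately have db: "\<bar>d\<bar> \<le> 81 * L ^ 3 * (K + e)" by linarith
  \<comment> \<open>The scale error is attached to the discrete value \<open>d\<close>, which is
    bounded through \<open>y\<close>; its constant was enlarged from \<open>27\<close> to
    \<open>81\<close> so that both errors share one prefactor.\<close>
  have "noise (n1, n2, n3) y (s, t, r2, r3) - noise_limit h (s, t, r2, r3) = S * (d - p) + (scale (n1, n2, n3) - S) * d"
    unfolding noise_disc3[OF n s] noise_limit_def prod.case d_def p_def S_def m_def by (simp add: algebra_simps)
  also have "\<bar>\<dots>\<bar> \<le> S * \<bar>d - p\<bar> + \<bar>scale (n1, n2, n3) - S\<bar> * \<bar>d\<bar>"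
    using S0 by (intro order_trans[OF abs_triangle_ineq]) (simp add: abs_mult)
  also have "\<dots> \<le> S * (81 * L ^ 3 * (e + w + \<kappa> * K)) + \<bar>scale (n1, n2, n3) - S\<bar> * (81 * L ^ 3 * (K + e))"
    using S0 dp db by (intro add_mono mult_left_mono) auto
  finally show ?thesis unfolding S_def[symmetric] L_def[symmetric] by (simp add: algebra_simps)
qed

lemma noise_converges:
  fixes h :: "real \<times> real \<times> real \<Rightarrow> real"
  assumes h: "continuous_on ({0..1} \<times> {0..1} \<times> {0..1}) h" and \<eta>: "0 < \<eta>"
  shows "\<exists>e>0. \<forall>\<^sub>F n in min_at_top. \<forall>y. (\<forall>v\<in>{0..1} \<times> {0..1} \<times> {0..1}. \<bar>y v - h v\<bar> \<le> e) \<longrightarrow>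
    (\<forall>s\<in>{0..1}. \<forall>t r2 r3. \<bar>noise n y (s, t, r2, r3) - noise_limit h (s, t, r2, r3)\<bar> < \<eta>)"
proof -
  let ?Q = "{0..1} \<times> {0..1} \<times> {0..1} :: (real \<times> real \<times> real) set"
  have cQ: "compact ?Q" by (intro compact_Times compact_Icc)
  define R where "R = max T1 (max T2 T3)"
  have R: "T1 \<le> R" "T2 \<le> R" "T3 \<le> R" unfolding R_def by auto
  have R0: "0 \<le> R" using R T by simp
  have "bounded (h ` ?Q)" by (intro compact_imp_bounded compact_continuous_image h cQ)
  then obtain K' where "\<And>v. v \<in> ?Q \<Longrightarrow> \<bar>h v\<bar> \<le> K'" unfolding bounded_iff by auto
  then obtain K where K0: "0 \<le> K" and K: "\<And>v. v \<in> ?Q \<Longrightarrow> \<bar>h v\<bar> \<le> K"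
    by (metis abs_ge_self abs_ge_zero order_trans)
  define S where "S = sqrt (T1 * T2 * T3)"
  define L where "L = C * (1 + R)"
  have L0: "0 < L" unfolding L_def using C R0 by (intro mult_pos_pos) auto
  define A where "A = 81 * L ^ 3"
  have A: "0 < A" using L0 by (simp add: A_def)
  have S: "0 < S" using T by (simp add: S_def)
  \<comment> \<open>The same \<open>e\<close> bounds the distance of the paths, the modulus of
    \<open>h\<close> and \<open>\<kappa> * K\<close>. These three cost at most
    \<open>3 * \<eta> / 8\<close> together and the change of scale less than
    \<open>\<eta> / 4\<close>; \<open>e \<le> 1\<close> allows \<open>K + e\<close> to be replaced
    by \<open>K + 1\<close>.\<close>
  define e where "e = min 1 (\<eta> / (8 * (A * S)))"
  have e: "0 < e" "e \<le> 1" "A * (S * e) \<le> \<eta> / 8"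
  proof -
    show "0 < e" "e \<le> 1" unfolding e_def using \<eta> A S by auto
    have "e \<le> \<eta> / (8 * (A * S))" unfolding e_def by simp
    then have "(A * S) * e \<le> (A * S) * (\<eta> / (8 * (A * S)))" using A S by (intro mult_left_mono) auto
    also have "\<dots> = \<eta> / 8" using A S by simp
    finally show "A * (S * e) \<le> \<eta> / 8" by (simp add: mult.assoc)
  qed
  obtain d where d: "d > 0" and dh: "\<And>x y. x \<in> ?Q \<Longrightarrow> y \<in> ?Q \<Longrightarrow> dist y x < d \<Longrightarrow> dist (h y) (h x) < e"
    using compact_uniformly_continuous[OF h cQ] e(1) unfolding uniformly_continuous_on_def by metis
  have inv: "(\<lambda>n. 1 / real n) \<longlonglongrightarrow> 0" by (rule lim_const_over_n)
  have small: "\<forall>\<^sub>F n in min_at_top. L * \<bar>f n - c\<bar> * (K + 1) < e" if "(f \<longlongrightarrow> c) min_at_top" for f :: "nat \<times> nat \<times> nat \<Rightarrow> real" and c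
  proof -
    have "((\<lambda>n. L * \<bar>f n - c\<bar> * (K + 1)) \<longlongrightarrow> L * \<bar>c - c\<bar> * (K + 1)) min_at_top"
      by (intro tendsto_intros that)
    then show ?thesis using e(1) by (intro order_tendstoD(2)) auto
  qed
  have "((\<lambda>n. A * (\<bar>scale n - S\<bar> * (K + 1))) \<longlongrightarrow> A * (\<bar>S - S\<bar> * (K + 1))) min_at_top"
    using scale_lim by (intro tendsto_intros) (simp add: S_def)
  then have sc: "\<forall>\<^sub>F n in min_at_top. A * (\<bar>scale n - S\<bar> * (K + 1)) < \<eta> / 4"
    using \<eta> by (intro order_tendstoD(2)) auto
  have ge1: "\<forall>\<^sub>F n in min_at_top. 1 \<le> fst n \<and> 1 \<le> fst (snd n) \<and> 1 \<le> snd (snd n)"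
    unfolding eventually_min_at_top by auto
  show ?thesis
  proof (intro exI[of _ e] conjI e)
    show "\<forall>\<^sub>F n in min_at_top. \<forall>y. (\<forall>v\<in>?Q. \<bar>y v - h v\<bar> \<le> e) \<longrightarrow>
        (\<forall>s\<in>{0..1}. \<forall>t r2 r3. \<bar>noise n y (s, t, r2, r3) - noise_limit h (s, t, r2, r3)\<bar> < \<eta>)"
      using small[OF tendsto_min_at_top(1)[OF a_lim(1)]] small[OF tendsto_min_at_top(2)[OF a_lim(2)]]
        small[OF tendsto_min_at_top(3)[OF a_lim(3)]] sc ge1
        order_tendstoD(2)[OF tendsto_min_at_top(1)[OF inv] d] order_tendstoD(2)[OF tendsto_min_at_top(2)[OF inv] d]
        order_tendstoD(2)[OF tendsto_min_at_top(3)[OF inv] d]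
    proof eventually_elim
      case (elim n)
      obtain n1 n2 n3 where n: "n = (n1, n2, n3)" by (cases n)
      show ?case
      proof (intro allI impI ballI)
        fix y s t r2 r3 assume y: "\<forall>v\<in>?Q. \<bar>y v - h v\<bar> \<le> e" and s: "s \<in> {0..1 :: real}"
        define \<kappa> where "\<kappa> = max (L * \<bar>a1 n1 - T1\<bar>) (max (L * \<bar>a2 n2 - T2\<bar>) (L * \<bar>a3 n3 - T3\<bar>))"
        have \<kappa>0: "0 \<le> \<kappa>" unfolding \<kappa>_def using L0 by (simp add: le_max_iff_disj)
        have \<kappa>: "\<kappa> * (K + 1) < e" unfolding \<kappa>_def using elim(1-3) n by (simp add: max_def)
        have "\<kappa> * K \<le> \<kappa> * (K + 1)" using \<kappa>0 by (intro mult_left_mono) auto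
        then have \<kappa>K: "\<kappa> * K \<le> e" using \<kappa> by linarith
        have "\<bar>noise (n1, n2, n3) y (s, t, r2, r3) - noise_limit h (s, t, r2, r3)\<bar> \<le>
          81 * (C * (1 + R)) ^ 3 * (sqrt (T1 * T2 * T3) * (e + e + \<kappa> * K) + \<bar>scale (n1, n2, n3) - sqrt (T1 * T2 * T3)\<bar> * (K + e))"
        proof (rule noise_estimate[OF R _ _ _ s h K])
          show "\<bar>h u - h v\<bar> \<le> e" if "u \<in> ?Q" "v \<in> ?Q" "dist u v \<le> max (1 / real n1) (max (1 / real n2) (1 / real n3))" for u v
          proof -
            have "dist u v < d" using that(3) elim(6-8) n by (auto simp: max_def split: if_splits)
            then show ?thesis using dh[OF that(2,1)] by (simp add: dist_real_def)
          qed
          show "C * (1 + R) * \<bar>a1 n1 - T1\<bar> \<le> \<kappa>" "C * (1 + R) * \<bar>a2 n2 - T2\<bar> \<le> \<kappa>" "C * (1 + R) * \<bar>a3 n3 - T3\<bar> \<le> \<kappa>"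
            unfolding \<kappa>_def L_def by auto
        qed (use elim(5) n y in auto)
        also have "\<dots> = A * (S * (e + e + \<kappa> * K)) + A * (\<bar>scale n - S\<bar> * (K + e))"
          unfolding A_def L_def S_def n by (simp add: algebra_simps)
        also have "\<dots> \<le> A * (S * (3 * e)) + A * (\<bar>scale n - S\<bar> * (K + 1))"
          using A S \<kappa>K e(2) K0 by (intro add_mono mult_left_mono) auto
        also have "\<dots> < \<eta>" using elim(4) e(3) \<eta> by (simp add: algebra_simps)
        finally show "\<bar>noise n y (s, t, r2, r3) - noise_limit h (s, t, r2, r3)\<bar> < \<eta>" unfolding n .
      qed
    qed
  qed
qed

end

section \<open>Convergence of the deterministic drift\<close>

lemma abs_prod3_diff_le:
  fixes x y z x' y' z' :: real
  assumes C: "\<bar>x\<bar> \<le> C" "\<bar>y'\<bar> \<le> C" "\<bar>z\<bar> \<le> C" "\<bar>z'\<bar> \<le> C" "\<bar>y\<bar> \<le> C" "\<bar>x'\<bar> \<le> C"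
    and d: "\<bar>x - x'\<bar> \<le> C * d1" "\<bar>y - y'\<bar> \<le> C * d2" "\<bar>z - z'\<bar> \<le> C * d3"
  shows "\<bar>x * y * z - x' * y' * z'\<bar> \<le> C ^ 3 * (d1 + d2 + d3)"
proof -
  have C0: "0 \<le> C" using C(1) by linarith
  note nn = mult_nonneg_nonneg[OF abs_ge_zero abs_ge_zero] and d0 = order_trans[OF abs_ge_zero d(1)] order_trans[OF abs_ge_zero d(2)]
  note p = mult_mono[OF C(1) mult_mono[OF C(5) d(3) C0 abs_ge_zero] C0 nn]
    and q = mult_mono[OF C(1) mult_mono[OF d(2) C(4) d0(2) abs_ge_zero] C0 nn]
    and r = mult_mono[OF d(1) mult_mono[OF C(2) C(4) C0 abs_ge_zero] d0(1) nn]
  have "x * y * z - x' * y' * z' = x * (y * (z - z')) + (x * ((y - y') * z') + (x - x') * (y' * z'))"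
    by (simp add: algebra_simps)
  also have "\<bar>\<dots>\<bar> \<le> \<bar>x * (y * (z - z'))\<bar> + (\<bar>x * ((y - y') * z')\<bar> + \<bar>(x - x') * (y' * z')\<bar>)"
    by (intro order_trans[OF abs_triangle_ineq] add_left_mono abs_triangle_ineq)
  also have "\<dots> \<le> C * (C * (C * d3)) + (C * ((C * d2) * C) + (C * d1) * (C * C))"
    unfolding abs_mult by (intro add_mono p q r)
  also have "\<dots> = C ^ 3 * (d1 + d2 + d3)" by (simp add: power3_eq_cube algebra_simps)
  finally show ?thesis .
qed

lemma abs_scaled_le:
  fixes x c :: real
  assumes "0 < N" "\<bar>c\<bar> \<le> S" "\<bar>x\<bar> \<le> N * b"
  shows "\<bar>c / N * x\<bar> \<le> S * b"
proof -
  have "\<bar>x\<bar> / N \<le> b" using assms(1,3) by (simp add: divide_le_eq mult.commute)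
  then have "\<bar>c\<bar> * (\<bar>x\<bar> / N) \<le> S * b"
    using assms(1,2) by (intro mult_mono) auto
  then show ?thesis using assms(1) by (simp add: abs_mult)
qed

lemma node_mem:
  assumes "0 < R" "1 \<le> n" "l \<in> {1..n}"
  shows "R * real l / real n \<in> {0..R}"
proof -
  have "R * real l / real n \<le> R * real n / real n"
    using assms by (intro divide_right_mono mult_left_mono) auto
  then show ?thesis using assms by simp
qed

text \<open>The deviation from the uniform grid grows linearly in \<open>l\<close>, so it is largest
  at the last node \<open>l = n\<close>.\<close>

lemma node_diff:
  assumes "1 \<le> n" "l \<in> {1..n}"
  shows "\<bar>real l * \<tau> - R * real l / real n\<bar> \<le> \<bar>real n * \<tau> - R\<bar>"
proof -
  have "real l * \<tau> - R * real l / real n = real l / real n * (real n * \<tau> - R)"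
    using assms by (simp add: field_simps)
  also have "\<bar>\<dots>\<bar> \<le> 1 * \<bar>real n * \<tau> - R\<bar>"
    unfolding abs_mult using assms by (intro mult_right_mono) auto
  finally show ?thesis by simp
qed

context sampling
begin

text \<open>One factor \<open>1 / q\<close> comes from the local alternative, the other from writing
  the square root of the sampling periods as \<open>scale / q\<close>; together they give the weight
  \<open>1 / (n1 n2 n3)\<close> of a Riemann sum.\<close>

lemma drift_sum:
  assumes n: "1 \<le> n1" "1 \<le> n2" "1 \<le> n3" and s: "s \<in> {0..1}"
  shows "drift (n1, n2, n3) (s, t, r2, r3) = scale (n1, n2, n3) / (real n1 * real n2 * real n3) *
    (\<Sum>l1=1..nat \<lfloor>real n1 * s\<rfloor>. \<Sum>l2=1..n2. \<Sum>l3=1..n3. \<delta> (real l1 * \<tau>1 n1, real l2 * \<tau>2 n2, real l3 * \<tau>3 n3) *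
      (k1 (t - real l1 * \<tau>1 n1) * k2 (r2 - real l2 * \<tau>2 n2) * k3 (r3 - real l3 * \<tau>3 n3)))"
proof -
  define D where "D l1 l2 l3 = \<delta> (real l1 * \<tau>1 n1, real l2 * \<tau>2 n2, real l3 * \<tau>3 n3) *
      (k1 (t - real l1 * \<tau>1 n1) * k2 (r2 - real l2 * \<tau>2 n2) * k3 (r3 - real l3 * \<tau>3 n3))" for l1 l2 l3 :: nat
  define q where "q = sqrt n1 * sqrt n2 * sqrt n3"
  have qq: "q * q = real n1 * real n2 * real n3"
    unfolding q_def by (simp add: real_sqrt_mult[symmetric])
  have q0: "q > 0" unfolding q_def using n by simp
  have sc: "scale (n1, n2, n3) = sqrt (\<tau>1 n1 * \<tau>2 n2 * \<tau>3 n3) * q"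
    by (simp add: scale_def a1_def a2_def a3_def q_def real_sqrt_mult[symmetric] mult_ac)
  have "(\<Sum>l\<in>grid (n1, n2, n3). (case l of (l1, l2, l3) \<Rightarrow> \<delta> (real l1 * \<tau>1 n1, real l2 * \<tau>2 n2, real l3 * \<tau>3 n3) / q)
      * coef (n1, n2, n3) l (s, t, r2, r3))
    = (\<Sum>l1=1..nat \<lfloor>real n1 * s\<rfloor>. \<Sum>l2=1..n2. \<Sum>l3=1..n3. D l1 l2 l3) / q"
    unfolding grid_sum[OF n(1) s] prod.case D_def sum_divide_distrib by simp
  then have "(\<Sum>(l1, l2, l3)\<in>grid (n1, n2, n3). \<delta> (real l1 * \<tau>1 n1, real l2 * \<tau>2 n2, real l3 * \<tau>3 n3) / q * coef (n1, n2, n3) (l1, l2, l3) (s, t, r2, r3))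
    = (\<Sum>l1=1..nat \<lfloor>real n1 * s\<rfloor>. \<Sum>l2=1..n2. \<Sum>l3=1..n3. D l1 l2 l3) / q"
    by (simp add: case_prod_unfold)
  then show ?thesis
    unfolding drift_def prod.case q_def[symmetric] D_def[symmetric] sc qq[symmetric] using q0 by simp
qed

lemma kernel_product_bound:
  "\<bar>k1 x * k2 y * k3 z\<bar> \<le> C ^ 3"
proof -
  have "\<bar>k1 x\<bar> * \<bar>k2 y\<bar> * \<bar>k3 z\<bar> \<le> C * C * C"
    using C by (intro mult_mono smooth_kernelD(2)[OF k(1)] smooth_kernelD(2)[OF k(2)] smooth_kernelD(2)[OF k(3)]) simp_all
  then show ?thesis by (simp add: abs_mult power3_eq_cube)
qed

lemma kernel_product_lipschitz:
  "\<bar>k1 x * k2 y * k3 z - k1 x' * k2 y' * k3 z'\<bar> \<le> C ^ 3 * (\<bar>x - x'\<bar> + \<bar>y - y'\<bar> + \<bar>z - z'\<bar>)"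
  by (intro abs_prod3_diff_le smooth_kernelD(2)[OF k(1)] smooth_kernelD(2)[OF k(2)] smooth_kernelD(2)[OF k(3)]
    smooth_kernelD(5)[OF k(1)] smooth_kernelD(5)[OF k(2)] smooth_kernelD(5)[OF k(3)])

text \<open>Three replacements, one per line of the bound: sampling points by the uniform grid in
  both \<open>\<delta>\<close> and the kernel, \<open>scale\<close> by its limit, and the Riemann
  sum by the integral, with \<open>\<rho>\<close> the rate of \<open>\<delta>\<close> times the
  kernel.\<close>

lemma drift_estimate:
  assumes \<epsilon>: "\<epsilon> \<longlonglongrightarrow> 0"
    and \<delta>1: "\<And>z2 z3. z2 \<in> {0..T2} \<Longrightarrow> z3 \<in> {0..T3} \<Longrightarrow> riemann_rate T1 \<epsilon> K (\<lambda>z. \<delta> (z, z2, z3))"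
    and \<delta>2: "\<And>z1 z3. z1 \<in> {0..T1} \<Longrightarrow> z3 \<in> {0..T3} \<Longrightarrow> riemann_rate T2 \<epsilon> K (\<lambda>z. \<delta> (z1, z, z3))"
    and \<delta>3: "\<And>z1 z2. z1 \<in> {0..T1} \<Longrightarrow> z2 \<in> {0..T2} \<Longrightarrow> riemann_rate T3 \<epsilon> K (\<lambda>z. \<delta> (z1, z2, z))"
    and R: "T1 \<le> R" "T2 \<le> R" "T3 \<le> R"
    and n: "1 \<le> n1" "1 \<le> n2" "1 \<le> n3" and s: "s \<in> {0..1}" and e: "0 \<le> e"
    and grid: "\<And>l1 l2 l3. l1 \<in> {1..n1} \<Longrightarrow> l2 \<in> {1..n2} \<Longrightarrow> l3 \<in> {1..n3} \<Longrightarrow>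
      \<bar>\<delta> (real l1 * \<tau>1 n1, real l2 * \<tau>2 n2, real l3 * \<tau>3 n3)
        - \<delta> (T1 * real l1 / real n1, T2 * real l2 / real n2, T3 * real l3 / real n3)\<bar> \<le> e"
  defines "\<rho> \<equiv> \<lambda>n. C ^ 3 * \<epsilon> n + K * C ^ 3 * R / real n"
  shows "\<bar>drift (n1, n2, n3) (s, t, r2, r3) - drift_limit (s, t, r2, r3)\<bar> \<le>
    sqrt (T1 * T2 * T3) * (C ^ 3 * e + K * C ^ 3 * (\<bar>a1 n1 - T1\<bar> + \<bar>a2 n2 - T2\<bar> + \<bar>a3 n3 - T3\<bar>))
    + \<bar>scale (n1, n2, n3) - sqrt (T1 * T2 * T3)\<bar> * (C ^ 3 * K)
    + sqrt (T1 * T2 * T3) * (\<rho> n1 + \<rho> n2 + \<rho> n3 + C ^ 3 * K / real n1 + C ^ 3 * K / real n2 + C ^ 3 * K / real n3)"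
proof -
  define S where "S = sqrt (T1 * T2 * T3)"
  have S: "0 < S" "S * S = T1 * T2 * T3" using T by (auto simp: S_def)
  define A where "A = C ^ 3"
  have A0: "0 \<le> A" unfolding A_def using C by simp
  have K: "\<bar>\<delta> (z1, z2, z3)\<bar> \<le> K" if "z1 \<in> {0..T1}" "z2 \<in> {0..T2}" "z3 \<in> {0..T3}" for z1 z2 z3
    using riemann_rateD(2)[OF \<delta>1[OF that(2,3)] that(1)] .
  have K0: "0 \<le> K" using order_trans[OF abs_ge_zero K[of 0 0 0]] T by simp
  define F where "F z1 z2 z3 = \<delta> (z1, z2, z3) * (k1 (t - z1) * k2 (r2 - z2) * k3 (r3 - z3))" for z1 z2 z3
  have \<rho>: "\<rho> \<longlonglongrightarrow> 0"
  proof -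
    have "(\<lambda>n. C ^ 3 * \<epsilon> n + K * C ^ 3 * R / real n) \<longlonglongrightarrow> C ^ 3 * 0 + 0"
      by (intro tendsto_intros \<epsilon> lim_const_over_n)
    then show ?thesis by (simp add: \<rho>_def)
  qed
  have mono: "riemann_rate T (\<lambda>n. A * \<epsilon> n + K * A * T / real n) B x \<Longrightarrow> T \<le> R \<Longrightarrow> riemann_rate T \<rho> B x" for T B x
    unfolding \<rho>_def A_def[symmetric]
    by (rule riemann_rate_mono) (use K0 A0 in \<open>auto intro!: divide_right_mono mult_left_mono\<close>)
  have F1: "riemann_rate T1 \<rho> (A * K) (\<lambda>z. F z z2 z3)" if "z2 \<in> {0..T2}" "z3 \<in> {0..T3}" for z2 z3
    unfolding F_def
  proof (rule mono[OF riemann_rate_mult_lipschitz R(1)])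
    show "\<bar>k1 (t - z) * k2 (r2 - z2) * k3 (r3 - z3) - k1 (t - z') * k2 (r2 - z2) * k3 (r3 - z3)\<bar> \<le> A * \<bar>z - z'\<bar>" for z z'
      using kernel_product_lipschitz[of "t - z" "r2 - z2" "r3 - z3" "t - z'" "r2 - z2" "r3 - z3"]
      by (simp add: A_def abs_minus_commute)
  qed (use T \<delta>1[OF that] kernel_product_bound in \<open>auto simp: A_def\<close>)
  have F2: "riemann_rate T2 \<rho> (A * K) (\<lambda>z. F z1 z z3)" if "z1 \<in> {0..T1}" "z3 \<in> {0..T3}" for z1 z3
    unfolding F_def
  proof (rule mono[OF riemann_rate_mult_lipschitz R(2)])
    show "\<bar>k1 (t - z1) * k2 (r2 - z) * k3 (r3 - z3) - k1 (t - z1) * k2 (r2 - z') * k3 (r3 - z3)\<bar> \<le> A * \<bar>z - z'\<bar>" for z z'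
      using kernel_product_lipschitz[of "t - z1" "r2 - z" "r3 - z3" "t - z1" "r2 - z'" "r3 - z3"]
      by (simp add: A_def abs_minus_commute)
  qed (use T \<delta>2[OF that] kernel_product_bound in \<open>auto simp: A_def\<close>)
  have F3: "riemann_rate T3 \<rho> (A * K) (\<lambda>z. F z1 z2 z)" if "z1 \<in> {0..T1}" "z2 \<in> {0..T2}" for z1 z2
    unfolding F_def
  proof (rule mono[OF riemann_rate_mult_lipschitz R(3)])
    show "\<bar>k1 (t - z1) * k2 (r2 - z2) * k3 (r3 - z) - k1 (t - z1) * k2 (r2 - z2) * k3 (r3 - z')\<bar> \<le> A * \<bar>z - z'\<bar>" for z z'
      using kernel_product_lipschitz[of "t - z1" "r2 - z2" "r3 - z" "t - z1" "r2 - z2" "r3 - z'"]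
      by (simp add: A_def abs_minus_commute)
  qed (use T \<delta>3[OF that] kernel_product_bound in \<open>auto simp: A_def\<close>)
  define m where "m = nat \<lfloor>real n1 * s\<rfloor>"
  have mn: "m \<le> n1"
  proof -
    have "real n1 * s \<le> real n1" using s by (intro mult_left_le) auto
    then show ?thesis unfolding m_def by linarith
  qed
  define N where "N = real n1 * real n2 * real n3"
  have N: "0 < N" using n by (simp add: N_def)
  define D where "D l1 l2 l3 = F (T1 * real l1 / real n1) (T2 * real l2 / real n2) (T3 * real l3 / real n3)" for l1 l2 l3 :: nat
  define E where "E l1 l2 l3 = \<delta> (real l1 * \<tau>1 n1, real l2 * \<tau>2 n2, real l3 * \<tau>3 n3) *
      (k1 (t - real l1 * \<tau>1 n1) * k2 (r2 - real l2 * \<tau>2 n2) * k3 (r3 - real l3 * \<tau>3 n3))" for l1 l2 l3 :: nat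
  let ?\<Sigma> = "\<lambda>f. \<Sum>l1=1..m. \<Sum>l2=1..n2. \<Sum>l3=1..n3. f l1 l2 l3"
  define I where "I = integral {0..s * T1} (\<lambda>z1. integral {0..T2} (\<lambda>z2. integral {0..T3} (F z1 z2)))"
  define \<mu> where "\<mu> = A * e + K * A * (\<bar>a1 n1 - T1\<bar> + \<bar>a2 n2 - T2\<bar> + \<bar>a3 n3 - T3\<bar>)"
  have sum_bound: "\<bar>?\<Sigma> f\<bar> \<le> N * B"
    if f: "\<And>l1 l2 l3. l1 \<in> {1..n1} \<Longrightarrow> l2 \<in> {1..n2} \<Longrightarrow> l3 \<in> {1..n3} \<Longrightarrow> \<bar>f l1 l2 l3\<bar> \<le> B" and B: "0 \<le> B" for f :: "nat \<Rightarrow> nat \<Rightarrow> nat \<Rightarrow> real" and B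
  proof -
    have "\<bar>?\<Sigma> f\<bar> \<le> (\<Sum>l1=1..m. \<Sum>l2=1..n2. \<Sum>l3=1..n3. B)"
      using mn by (intro order_trans[OF sum_abs] sum_mono f) auto
    also have "\<dots> = real m * (real n2 * real n3 * B)" by simp
    also have "\<dots> \<le> real n1 * (real n2 * real n3 * B)" using mn B by (intro mult_right_mono) auto
    finally show ?thesis by (simp add: N_def mult_ac)
  qed
  have mem: "T1 * real l1 / real n1 \<in> {0..T1}" "T2 * real l2 / real n2 \<in> {0..T2}" "T3 * real l3 / real n3 \<in> {0..T3}"
    if "l1 \<in> {1..n1}" "l2 \<in> {1..n2}" "l3 \<in> {1..n3}" for l1 l2 l3
    using that n T by (intro node_mem; simp)+
  have ED: "\<bar>E l1 l2 l3 - D l1 l2 l3\<bar> \<le> \<mu>" if l: "l1 \<in> {1..n1}" "l2 \<in> {1..n2}" "l3 \<in> {1..n3}" for l1 l2 l3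
  proof -
    let ?z1 = "T1 * real l1 / real n1" and ?z2 = "T2 * real l2 / real n2" and ?z3 = "T3 * real l3 / real n3"
    let ?p = "k1 (t - real l1 * \<tau>1 n1) * k2 (r2 - real l2 * \<tau>2 n2) * k3 (r3 - real l3 * \<tau>3 n3)"
    let ?q = "k1 (t - ?z1) * k2 (r2 - ?z2) * k3 (r3 - ?z3)"
    have "\<bar>?p - ?q\<bar> \<le> A * (\<bar>(t - real l1 * \<tau>1 n1) - (t - ?z1)\<bar> + \<bar>(r2 - real l2 * \<tau>2 n2) - (r2 - ?z2)\<bar> + \<bar>(r3 - real l3 * \<tau>3 n3) - (r3 - ?z3)\<bar>)"
      unfolding A_def by (rule kernel_product_lipschitz)
    also have "\<dots> \<le> A * (\<bar>a1 n1 - T1\<bar> + \<bar>a2 n2 - T2\<bar> + \<bar>a3 n3 - T3\<bar>)"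
      using node_diff[OF n(1) l(1), of "\<tau>1 n1" T1] node_diff[OF n(2) l(2), of "\<tau>2 n2" T2] node_diff[OF n(3) l(3), of "\<tau>3 n3" T3]
      unfolding a1_def a2_def a3_def by (intro mult_left_mono add_mono A0) (simp_all add: abs_minus_commute)
    finally have pq: "\<bar>?p - ?q\<bar> \<le> A * (\<bar>a1 n1 - T1\<bar> + \<bar>a2 n2 - T2\<bar> + \<bar>a3 n3 - T3\<bar>)" .
    have "E l1 l2 l3 - D l1 l2 l3 = (\<delta> (real l1 * \<tau>1 n1, real l2 * \<tau>2 n2, real l3 * \<tau>3 n3) - \<delta> (?z1, ?z2, ?z3)) * ?p + \<delta> (?z1, ?z2, ?z3) * (?p - ?q)"
      unfolding E_def D_def F_def by (simp add: algebra_simps)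
    also have "\<bar>\<dots>\<bar> \<le> e * A + K * (A * (\<bar>a1 n1 - T1\<bar> + \<bar>a2 n2 - T2\<bar> + \<bar>a3 n3 - T3\<bar>))"
      by (rule order_trans[OF abs_triangle_ineq], subst (1 2) abs_mult,
        rule add_mono[OF mult_mono[OF grid[OF l] kernel_product_bound[folded A_def] e abs_ge_zero]
          mult_mono[OF K[OF mem[OF l]] pq K0 abs_ge_zero]])
    finally show ?thesis by (simp add: \<mu>_def mult_ac)
  qed
  have \<mu>0: "0 \<le> \<mu>" unfolding \<mu>_def using A0 K0 e by simp
  have sED: "\<bar>?\<Sigma> E - ?\<Sigma> D\<bar> \<le> N * \<mu>"
    unfolding sum_subtractf[symmetric] by (rule sum_bound[OF ED \<mu>0])
  have sD: "\<bar>?\<Sigma> D\<bar> \<le> N * (A * K)"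
  proof (rule sum_bound)
    show "\<bar>D l1 l2 l3\<bar> \<le> A * K" if "l1 \<in> {1..n1}" "l2 \<in> {1..n2}" "l3 \<in> {1..n3}" for l1 l2 l3
      unfolding D_def using riemann_rateD(2)[OF F1[OF mem(2,3)[OF that]] mem(1)[OF that]] .
  qed (use A0 K0 in auto)
  define \<beta> where "\<beta> = \<rho> n1 + \<rho> n2 + \<rho> n3 + A * K / real n1 + A * K / real n2 + A * K / real n3"
  have "\<bar>T1 / real n1 * (\<Sum>k1<m. T2 / real n2 * (\<Sum>k2<n2. T3 / real n3 * (\<Sum>k3<n3.
       F (T1 * real (Suc k1) / real n1) (T2 * real (Suc k2) / real n2) (T3 * real (Suc k3) / real n3)))) - I\<bar> \<le> T1 * T2 * T3 * \<beta>"
    unfolding I_def \<beta>_def by (rule riemann_sum3[OF T \<rho> F1 F2 F3 n s m_def])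
  moreover have "T1 / real n1 * (\<Sum>k1<m. T2 / real n2 * (\<Sum>k2<n2. T3 / real n3 * (\<Sum>k3<n3.
       F (T1 * real (Suc k1) / real n1) (T2 * real (Suc k2) / real n2) (T3 * real (Suc k3) / real n3)))) = S * S / N * ?\<Sigma> D"
    unfolding D_def One_nat_def sum.atLeast1_atMost_eq S(2) N_def
    by (simp add: sum_distrib_left sum_divide_distrib mult_ac)
  ultimately have rie: "\<bar>S * S / N * ?\<Sigma> D - I\<bar> \<le> S * S * \<beta>" by (simp add: S(2))
  \<comment> \<open>The mesh volume is \<open>S * S / N\<close>, but the drift carries only the
    weight \<open>S / N\<close>; this leaves the factor \<open>1 / S\<close> in front of the
    limiting integral.\<close>
  have "S / N * ?\<Sigma> D - I / S = (S * S / N * ?\<Sigma> D - I) / S"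
    using S(1) by (simp add: diff_divide_distrib)
  then have "\<bar>S / N * ?\<Sigma> D - I / S\<bar> = \<bar>S * S / N * ?\<Sigma> D - I\<bar> / S"
    using S(1) by (simp only: abs_divide abs_of_pos)
  also have "\<dots> \<le> S * S * \<beta> / S" using rie S(1) by (intro divide_right_mono) auto
  finally have rie': "\<bar>S / N * ?\<Sigma> D - I / S\<bar> \<le> S * \<beta>" using S(1) by simp
  have dl: "drift_limit (s, t, r2, r3) = I / S"
    unfolding drift_limit_def I_def F_def S_def prod.case by (simp add: mult_ac)
  have de: "drift (n1, n2, n3) (s, t, r2, r3) = scale (n1, n2, n3) / N * ?\<Sigma> E"
    unfolding drift_sum[OF n s] m_def[symmetric] E_def N_def ..
  let ?c = "scale (n1, n2, n3)"
  have c: "0 < ?c" "?c \<le> S" using scale_range[OF n] unfolding S_def by auto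
  have cS: "\<bar>?c\<bar> \<le> S" using c by simp
  have "?c / N * ?\<Sigma> E - I / S = ?c / N * (?\<Sigma> E - ?\<Sigma> D) + ((?c - S) / N * ?\<Sigma> D + (S / N * ?\<Sigma> D - I / S))"
    by (simp add: algebra_simps diff_divide_distrib)
  then have "\<bar>?c / N * ?\<Sigma> E - I / S\<bar> \<le> \<bar>?c / N * (?\<Sigma> E - ?\<Sigma> D)\<bar> + (\<bar>(?c - S) / N * ?\<Sigma> D\<bar> + \<bar>S / N * ?\<Sigma> D - I / S\<bar>)"
    by (simp only:)
  from order_trans[OF this add_mono[OF abs_scaled_le[OF N cS sED] add_mono[OF abs_scaled_le[OF N order_refl sD] rie']]]
  have "\<bar>?c / N * ?\<Sigma> E - I / S\<bar> \<le> S * \<mu> + (\<bar>?c - S\<bar> * (A * K) + S * \<beta>)" .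
  then show ?thesis
    unfolding dl de \<mu>_def \<beta>_def A_def S_def[symmetric] by (simp only: add.assoc)
qed

lemma drift_converges:
  assumes \<eta>: "0 < \<eta>"
  shows "\<forall>\<^sub>F n in min_at_top. \<forall>s\<in>{0..1}. \<forall>t r2 r3. \<bar>drift n (s, t, r2, r3) - drift_limit (s, t, r2, r3)\<bar> < \<eta>"
proof -
  obtain \<epsilon> K where \<epsilon>: "\<epsilon> \<longlonglongrightarrow> 0"
    and \<delta>1: "\<And>z2 z3. z2 \<in> {0..T2} \<Longrightarrow> z3 \<in> {0..T3} \<Longrightarrow> riemann_rate T1 \<epsilon> K (\<lambda>z. \<delta> (z, z2, z3))"
    and \<delta>2: "\<And>z1 z3. z1 \<in> {0..T1} \<Longrightarrow> z3 \<in> {0..T3} \<Longrightarrow> riemann_rate T2 \<epsilon> K (\<lambda>z. \<delta> (z1, z, z3))"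
    and \<delta>3: "\<And>z1 z2. z1 \<in> {0..T1} \<Longrightarrow> z2 \<in> {0..T2} \<Longrightarrow> riemann_rate T3 \<epsilon> K (\<lambda>z. \<delta> (z1, z2, z))"
    using \<delta>_rate by blast
  define R where "R = max T1 (max T2 T3)"
  have R: "T1 \<le> R" "T2 \<le> R" "T3 \<le> R" unfolding R_def by auto
  define S where "S = sqrt (T1 * T2 * T3)"
  have S: "0 < S" using T by (simp add: S_def)
  have C3: "0 < C ^ 3" using C by simp
  define e where "e = \<eta> / (2 * S * C ^ 3)"
  have e: "0 < e" "S * (C ^ 3 * e) = \<eta> / 2" using \<eta> S C3 by (auto simp: e_def)
  define \<rho> where "\<rho> n = C ^ 3 * \<epsilon> n + K * C ^ 3 * R / real n" for n
  have \<rho>: "\<rho> \<longlonglongrightarrow> C ^ 3 * 0 + 0"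
    unfolding \<rho>_def by (intro tendsto_intros \<epsilon> lim_const_over_n)
  have inv: "(\<lambda>n. C ^ 3 * K / real n) \<longlonglongrightarrow> 0" by (rule lim_const_over_n)
  \<comment> \<open>All errors that vanish with the sample sizes; the grid error of
    \<open>\<delta>\<close> is kept apart as \<open>e\<close>, which takes up half of
    \<open>\<eta>\<close>.\<close>
  define f where "f n = S * (K * C ^ 3 * (\<bar>a1 (fst n) - T1\<bar> + \<bar>a2 (fst (snd n)) - T2\<bar> + \<bar>a3 (snd (snd n)) - T3\<bar>))
    + \<bar>scale n - S\<bar> * (C ^ 3 * K)
    + S * (\<rho> (fst n) + \<rho> (fst (snd n)) + \<rho> (snd (snd n)) + C ^ 3 * K / real (fst n) + C ^ 3 * K / real (fst (snd n)) + C ^ 3 * K / real (snd (snd n)))" for n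
  have "(f \<longlongrightarrow> S * (K * C ^ 3 * (\<bar>T1 - T1\<bar> + \<bar>T2 - T2\<bar> + \<bar>T3 - T3\<bar>)) + \<bar>S - S\<bar> * (C ^ 3 * K)
      + S * ((C ^ 3 * 0 + 0) + (C ^ 3 * 0 + 0) + (C ^ 3 * 0 + 0) + 0 + 0 + 0)) min_at_top"
    unfolding f_def using scale_lim
    by (intro tendsto_intros tendsto_min_at_top(1)[OF a_lim(1)] tendsto_min_at_top(2)[OF a_lim(2)] tendsto_min_at_top(3)[OF a_lim(3)]
      tendsto_min_at_top[OF \<rho>] tendsto_min_at_top[OF inv]) (simp add: S_def)
  then have "(f \<longlongrightarrow> 0) min_at_top" by simp
  then have small: "\<forall>\<^sub>F n in min_at_top. f n < \<eta> / 2" using \<eta> by (intro order_tendstoD(2)) auto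
  have gr: "\<forall>\<^sub>F n in min_at_top. \<forall>l1\<in>{1..fst n}. \<forall>l2\<in>{1..fst (snd n)}. \<forall>l3\<in>{1..snd (snd n)}.
      \<bar>\<delta> (real l1 * \<tau>1 (fst n), real l2 * \<tau>2 (fst (snd n)), real l3 * \<tau>3 (snd (snd n)))
        - \<delta> (T1 * real l1 / real (fst n), T2 * real l2 / real (fst (snd n)), T3 * real l3 / real (snd (snd n)))\<bar> \<le> e"
    unfolding eventually_min_at_top fst_conv snd_conv by (rule \<delta>_grid[OF e(1)])
  have ge1: "\<forall>\<^sub>F n in min_at_top. 1 \<le> fst n \<and> 1 \<le> fst (snd n) \<and> 1 \<le> snd (snd n)"
    unfolding eventually_min_at_top by auto
  show ?thesis
    using small gr ge1
  proof eventually_elim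
    case (elim n)
    obtain n1 n2 n3 where n: "n = (n1, n2, n3)" by (cases n)
    show ?case
    proof (intro allI ballI)
      fix s t r2 r3 :: real assume s: "s \<in> {0..1}"
      have "\<bar>drift (n1, n2, n3) (s, t, r2, r3) - drift_limit (s, t, r2, r3)\<bar> \<le>
        S * (C ^ 3 * e + K * C ^ 3 * (\<bar>a1 n1 - T1\<bar> + \<bar>a2 n2 - T2\<bar> + \<bar>a3 n3 - T3\<bar>))
        + \<bar>scale (n1, n2, n3) - S\<bar> * (C ^ 3 * K)
        + S * (\<rho> n1 + \<rho> n2 + \<rho> n3 + C ^ 3 * K / real n1 + C ^ 3 * K / real n2 + C ^ 3 * K / real n3)"
        unfolding S_def \<rho>_def using elim(2,3) n e(1)
        by (intro drift_estimate[OF \<epsilon> \<delta>1 \<delta>2 \<delta>3 R _ _ _ s]) auto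
      also have "\<dots> = S * (C ^ 3 * e) + f n" unfolding f_def n by (simp add: algebra_simps)
      also have "\<dots> < \<eta>" using e(2) elim(1) by linarith
      finally show "\<bar>drift n (s, t, r2, r3) - drift_limit (s, t, r2, r3)\<bar> < \<eta>" unfolding n .
    qed
  qed
qed

section \<open>Weak convergence of the discretized functionals\<close>

definition psi :: "nat \<times> nat \<times> nat \<Rightarrow> (real \<times> real \<times> real \<Rightarrow> real) \<Rightarrow> real \<times> real \<times> real \<times> real \<Rightarrow> real" where
  "psi n y p = noise n y p + drift n p"

definition psi_limit :: "(real \<times> real \<times> real \<Rightarrow> real) \<Rightarrow> real \<times> real \<times> real \<times> real \<Rightarrow> real" where
  "psi_limit h p = noise_limit h p + drift_limit p"

text \<open>The radius and the threshold for \<open>n\<close> depend on \<open>h\<close> but not on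
  \<open>y\<close>: this is the joint form of continuity that the extended mapping theorem
  consumes.\<close>

lemma psi_converges:
  assumes h: "continuous_on unit_cube h" and \<eta>: "0 < \<eta>"
  shows "\<exists>e>0. \<forall>\<^sub>F n in min_at_top. \<forall>y. (\<forall>v\<in>unit_cube. \<bar>y v - h v\<bar> \<le> e) \<longrightarrow>
    (\<forall>p. fst p \<in> {0..1} \<longrightarrow> \<bar>psi n y p - psi_limit h p\<bar> < \<eta>)"
proof -
  obtain e where e: "e > 0" "\<forall>\<^sub>F n in min_at_top. \<forall>y. (\<forall>v\<in>unit_cube. \<bar>y v - h v\<bar> \<le> e) \<longrightarrow>
    (\<forall>s\<in>{0..1}. \<forall>t r2 r3. \<bar>noise n y (s, t, r2, r3) - noise_limit h (s, t, r2, r3)\<bar> < \<eta> / 2)"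
    using noise_converges[OF h[unfolded unit_cube_def], of "\<eta> / 2"] \<eta> unfolding unit_cube_def by auto
  have "\<forall>\<^sub>F n in min_at_top. \<forall>y. (\<forall>v\<in>unit_cube. \<bar>y v - h v\<bar> \<le> e) \<longrightarrow>
    (\<forall>p. fst p \<in> {0..1} \<longrightarrow> \<bar>psi n y p - psi_limit h p\<bar> < \<eta>)"
    using e(2) drift_converges[of "\<eta> / 2", OF half_gt_zero[OF \<eta>]]
  proof eventually_elim
    case (elim n)
    show ?case
    proof (intro allI impI)
      fix y and p :: "real \<times> real \<times> real \<times> real"
      assume y: "\<forall>v\<in>unit_cube. \<bar>y v - h v\<bar> \<le> e" and p: "fst p \<in> {0..1}"
      obtain s t r2 r3 where p': "p = (s, t, r2, r3)" by (cases p)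
      have "\<bar>noise n y p - noise_limit h p\<bar> < \<eta> / 2" "\<bar>drift n p - drift_limit p\<bar> < \<eta> / 2"
        using elim y p unfolding p' by auto
      then show "\<bar>psi n y p - psi_limit h p\<bar> < \<eta>" unfolding psi_def psi_limit_def by linarith
    qed
  qed
  then show ?thesis using e(1) by blast
qed

lemma coef_bound: "\<bar>coef n l p\<bar> \<le> C ^ 3"
  using kernel_product_bound C by (auto simp: coef_def split: prod.split)

lemma coef_skorohod: "restrict (coef n l) (cbox a b) \<in> skorohod_space a b"
proof -
  obtain n1 n2 n3 l1 l2 l3 where n: "n = (n1, n2, n3)" and l: "l = (l1, l2, l3)" by (cases n, cases l)
  define i :: "real \<times> real \<times> real \<times> real" where "i = (1, 0, 0, 0)"
  have i: "i \<in> Basis" by (simp add: i_def Basis_prod_def zero_prod_def)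
  have in_i: "p \<bullet> i = fst p" for p by (cases p) (simp add: i_def)
  have "continuous_on (cbox a b) (\<lambda>p. k1 (fst (snd p) - real l1 * \<tau>1 n1) * k2 (fst (snd (snd p)) - real l2 * \<tau>2 n2)
      * k3 (snd (snd (snd p)) - real l3 * \<tau>3 n3))"
    by (intro continuous_intros continuous_on_compose2[OF smooth_kernel_continuous(1)[OF k(1), of UNIV]]
      continuous_on_compose2[OF smooth_kernel_continuous(1)[OF k(2), of UNIV]]
      continuous_on_compose2[OF smooth_kernel_continuous(1)[OF k(3), of UNIV]]) auto
  from skorohod_space_mult[OF skorohod_space_indicator_ge[OF i, of "real l1 / real n1"] skorohod_space_continuous[OF this]]
  show ?thesis unfolding in_i coef_def n l prod.case by (simp add: case_prod_unfold)
qed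

lemma skorohod_const: "restrict (\<lambda>x. r :: real) (cbox a b) \<in> skorohod_space a b"
  by (intro skorohod_space_continuous continuous_intros)

lemma drift_skorohod: "restrict (drift n) (cbox a b) \<in> skorohod_space a b"
proof -
  obtain n1 n2 n3 where n: "n = (n1, n2, n3)" by (cases n)
  show ?thesis
    unfolding n drift_def prod.case case_prod_unfold
    by (intro skorohod_space_mult skorohod_const skorohod_space_sum coef_skorohod)
qed

lemma psi_skorohod: "restrict (psi n y) (cbox a b) \<in> skorohod_space a b"
  unfolding psi_def[abs_def] noise_def
  by (intro skorohod_space_mult skorohod_space_add skorohod_const skorohod_space_sum coef_skorohod drift_skorohod)

text \<open>\<open>psi n\<close> is affine in finitely many real increments with deterministic
  coefficient functions, which is the situation of
  \<open>measurable_skorohod_affine\<close>.\<close>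

lemma psi_measurable:
  assumes "\<And>l. l \<in> grid n \<Longrightarrow> (\<lambda>\<omega>. incr n l (Z \<omega>)) \<in> borel_measurable M"
  shows "(\<lambda>\<omega>. restrict (psi n (Z \<omega>)) (cbox a b)) \<in> measurable M (skorohod_borel a b)"
proof -
  have "(\<lambda>\<omega>. restrict (\<lambda>p. (\<Sum>l\<in>grid n. incr n l (Z \<omega>) * (scale n * coef n l p)) + drift n p) (cbox a b))
      \<in> measurable M (skorohod_borel a b)"
  proof (rule measurable_skorohod_affine[OF finite_grid assms _ _ drift_skorohod, where K = "\<bar>scale n\<bar> * C ^ 3"])
    show "restrict (\<lambda>p. scale n * coef n l p) (cbox a b) \<in> skorohod_space a b" for l
      by (intro skorohod_space_mult skorohod_const coef_skorohod)
    show "\<bar>scale n * coef n l p\<bar> \<le> \<bar>scale n\<bar> * C ^ 3" for l p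
      unfolding abs_mult by (intro mult_left_mono coef_bound) simp
  qed
  moreover have "(\<Sum>l\<in>grid n. incr n l (Z \<omega>) * (scale n * coef n l p)) + drift n p = psi n (Z \<omega>) p" for \<omega> p
    by (simp add: psi_def noise_def sum_distrib_left mult_ac)
  ultimately show ?thesis by (simp add: eta_contract_eq)
qed

lemma incr_cong:
  assumes y: "\<And>v. v \<in> unit_cube \<Longrightarrow> y v = y' v" and l: "l \<in> grid n"
  shows "incr n l y = incr n l y'"
proof -
  obtain n1 n2 n3 l1 l2 l3 where n: "n = (n1, n2, n3)" and l': "l = (l1, l2, l3)" by (cases n, cases l)
  have lr: "l1 \<in> {1..n1}" "l2 \<in> {1..n2}" "l3 \<in> {1..n3}" using l unfolding grid_def n l' by auto
  have node: "real j / real m \<in> {0..1}" if "j \<le> m" for j m :: nat using that by (auto simp: divide_le_eq)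
  have "y (real j1 / real n1, real j2 / real n2, real j3 / real n3) = y' (real j1 / real n1, real j2 / real n2, real j3 / real n3)"
    if "j1 \<le> n1" "j2 \<le> n2" "j3 \<le> n3" for j1 j2 j3
    using that node by (intro y) (auto simp: unit_cube_def)
  note eq = this
  have le: "l1 \<le> n1" "l1 - 1 \<le> n1" "l2 \<le> n2" "l2 - 1 \<le> n2" "l3 \<le> n3" "l3 - 1 \<le> n3" using lr by auto
  show ?thesis
    unfolding incr_def n l' prod.case Let_def by (simp only: eq le)
qed

text \<open>A random element of the Skorohod space carries only the restriction of a path to the
  cube, and the functional reads nothing else.\<close>

lemma psi_cong:
  assumes "\<And>v. v \<in> unit_cube \<Longrightarrow> y v = y' v"
  shows "psi n y = psi n y'"
  unfolding psi_def noise_def using incr_cong[OF assms] by (intro ext) (simp cong: sum.cong)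

lemma psi_diagonal_converges:
  assumes h: "continuous_on unit_cube h" and \<eta>: "0 < \<eta>"
  shows "\<forall>\<^sub>F k in sequentially. \<forall>p. fst p \<in> {0..1} \<longrightarrow> \<bar>psi (k, k, k) h p - psi_limit h p\<bar> < \<eta>"
proof -
  obtain e where e: "e > 0" "\<forall>\<^sub>F n in min_at_top. \<forall>y. (\<forall>v\<in>unit_cube. \<bar>y v - h v\<bar> \<le> e) \<longrightarrow>
    (\<forall>p. fst p \<in> {0..1} \<longrightarrow> \<bar>psi n y p - psi_limit h p\<bar> < \<eta>)"
    using psi_converges[OF assms] by blast
  from eventually_compose_filterlim[OF e(2) filterlim_diagonal] show ?thesis
    by (rule eventually_mono) (use e(1) in auto)
qed

lemma psi_limit_skorohod:
  assumes h: "continuous_on unit_cube h" and box: "\<And>p. p \<in> cbox a b \<Longrightarrow> fst p \<in> {0..1}"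
  shows "restrict (psi_limit h) (cbox a b) \<in> skorohod_space a b"
proof (rule skorohod_space_uniform_limit[of "\<lambda>k. psi (k, k, k) h"])
  show "uniform_limit (cbox a b) (\<lambda>k. psi (k, k, k) h) (psi_limit h) sequentially"
    unfolding uniform_limit_iff
  proof (intro allI impI)
    fix e :: real assume e: "0 < e"
    show "\<forall>\<^sub>F k in sequentially. \<forall>p\<in>cbox a b. dist (psi (k, k, k) h p) (psi_limit h p) < e"
      using psi_diagonal_converges[OF h e]
    proof eventually_elim
      case (elim k)
      show ?case unfolding dist_real_def using elim box by blast
    qed
  qed
qed (rule psi_skorohod)

text \<open>A Borel version of the limit is needed although \<open>psi_limit\<close> is controlled
  only on continuous paths. It is set to \<open>0\<close> on a null set and is elsewhere the uniform
  limit of the discretizations along the diagonal, which are measurable finite sums.\<close>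

lemma functional_limit:
  fixes B :: "'w \<Rightarrow> real \<times> real \<times> real \<Rightarrow> real" and F :: "nat \<times> nat \<times> nat \<Rightarrow> 'm \<Rightarrow> real \<times> real \<times> real \<times> real \<Rightarrow> real"
  assumes M: "prob_space M" and N: "prob_space N"
    and B: "\<And>v. v \<in> unit_cube \<Longrightarrow> (\<lambda>\<omega>. B \<omega> v) \<in> borel_measurable N"
    and Bc: "AE \<omega> in N. continuous_on unit_cube (B \<omega>)"
    and fclt: "weak_conv_skorohod (0, 0, 0) (1, 1, 1) M S N B min_at_top"
    and S: "\<And>n l. l \<in> grid n \<Longrightarrow> (\<lambda>\<omega>. incr n l (S n \<omega>)) \<in> borel_measurable M"
    and box: "\<And>p. p \<in> cbox a b \<Longrightarrow> fst p \<in> {0..1}"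
    and F: "\<And>n \<omega> p. \<omega> \<in> space M \<Longrightarrow> p \<in> cbox a b \<Longrightarrow> F n \<omega> p = psi n (S n \<omega>) p"
    and Y: "AE \<omega> in N. \<forall>p\<in>cbox a b. Y \<omega> p = psi_limit (B \<omega>) p"
  shows "weak_conv_skorohod a b M F N Y min_at_top"
proof -
  interpret M: prob_space M by fact
  interpret N: prob_space N by fact
  have cube: "cbox (0, 0, 0) (1, 1, 1) = unit_cube" by (auto simp: unit_cube_def cbox_Pair_eq)
  obtain X0 Y0 where X0: "\<And>n. X0 n \<in> measurable M (skorohod_borel (0, 0, 0) (1, 1, 1))"
      "\<And>n. AE \<omega> in M. X0 n \<omega> = restrict (S n \<omega>) unit_cube"
    and Y0: "Y0 \<in> measurable N (skorohod_borel (0, 0, 0) (1, 1, 1))" "AE \<omega> in N. Y0 \<omega> = restrict (B \<omega>) unit_cube"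
    and conv: "weak_conv_measures (skorohod_topology (0, 0, 0) (1, 1, 1))
        (\<lambda>n. distr M (skorohod_borel (0, 0, 0) (1, 1, 1)) (X0 n)) (distr N (skorohod_borel (0, 0, 0) (1, 1, 1)) Y0) min_at_top"
    using fclt unfolding weak_conv_skorohod_def skorohod_version_def cube by blast
  define X' where "X' n \<omega> = restrict (psi n (S n \<omega>)) (cbox a b)" for n \<omega>
  have X': "X' n \<in> measurable M (skorohod_borel a b)" for n
    unfolding X'_def[abs_def] by (rule psi_measurable[OF S])
  \<comment> \<open>The set of discontinuous paths need not be measurable, so it is enclosed in a
    measurable null set.\<close>
  obtain Z where sub: "{\<omega> \<in> space N. \<not> continuous_on unit_cube (B \<omega>)} \<subseteq> Z" and Z: "emeasure N Z = 0" "Z \<in> sets N"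
    using AE_E[OF Bc] .
  have good: "continuous_on unit_cube (B \<omega>)" if "\<omega> \<in> space N" "\<omega> \<notin> Z" for \<omega>
    using sub that by blast
  define Y' where "Y' \<omega> = (if \<omega> \<in> Z then restrict (\<lambda>_. 0) (cbox a b) else restrict (psi_limit (B \<omega>)) (cbox a b))" for \<omega>
  define G where "G k \<omega> = (if \<omega> \<in> Z then restrict (\<lambda>_. 0) (cbox a b) else restrict (psi (k, k, k) (B \<omega>)) (cbox a b))" for k \<omega>
  have Y': "Y' \<in> measurable N (skorohod_borel a b)"
  proof (rule measurable_skorohod_limit[of G])
    show "G k \<in> measurable N (skorohod_borel a b)" for k
      unfolding G_def[abs_def]
    proof (rule measurable_If_set)
      show "(\<lambda>\<omega>. restrict (\<lambda>_. 0) (cbox a b)) \<in> measurable N (skorohod_borel a b)"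
        using skorohod_const[of 0 a b] by simp
      show "(\<lambda>\<omega>. restrict (psi (k, k, k) (B \<omega>)) (cbox a b)) \<in> measurable N (skorohod_borel a b)"
      proof (rule psi_measurable)
        fix l assume l: "l \<in> grid (k, k, k)"
        obtain l1 l2 l3 where l': "l = (l1, l2, l3)" by (cases l)
        have Bm: "(\<lambda>\<omega>. B \<omega> (real j1 / real k, real j2 / real k, real j3 / real k)) \<in> borel_measurable N"
          if "j1 \<le> k" "j2 \<le> k" "j3 \<le> k" for j1 j2 j3
          using that by (intro B) (auto simp: unit_cube_def divide_le_eq)
        have le: "l1 \<le> k" "l1 - 1 \<le> k" "l2 \<le> k" "l2 - 1 \<le> k" "l3 \<le> k" "l3 - 1 \<le> k"
          using l unfolding grid_def l' by auto
        show "(\<lambda>\<omega>. incr (k, k, k) l (B \<omega>)) \<in> borel_measurable N"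
          unfolding incr_def l' prod.case Let_def by (intro borel_measurable_diff Bm le)
      qed
      show "Z \<inter> space N \<in> sets N" using Z by auto
    qed
    show "Y' \<omega> \<in> skorohod_space a b" if "\<omega> \<in> space N" for \<omega>
      using psi_limit_skorohod[OF good box] skorohod_const[of 0 a b] that by (auto simp: Y'_def)
    show "\<forall>\<^sub>F k in sequentially. \<forall>t\<in>cbox a b. \<bar>G k \<omega> t - Y' \<omega> t\<bar> < e" if "\<omega> \<in> space N" "0 < e" for \<omega> e
    proof (cases "\<omega> \<in> Z")
      case False
      then have "continuous_on unit_cube (B \<omega>)" using good that by simp
      from psi_diagonal_converges[OF this that(2)] show ?thesis
      proof eventually_elim
        case (elim k)
        show ?case
        proof
          fix p assume p: "p \<in> cbox a b"
          then have "\<bar>psi (k, k, k) (B \<omega>) p - psi_limit (B \<omega>) p\<bar> < e" using elim box by blast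
          then show "\<bar>G k \<omega> p - Y' \<omega> p\<bar> < e" using False p by (simp add: G_def Y'_def)
        qed
      qed
    qed (simp add: G_def Y'_def that)
  qed
  have YZ: "AE \<omega> in N. \<omega> \<notin> Z" using Z by (intro AE_not_in) (auto simp: null_sets_def)
  have "weak_conv_measures (skorohod_topology a b)
      (\<lambda>n. distr M (skorohod_borel a b) (X' n)) (distr N (skorohod_borel a b) Y') min_at_top"
    unfolding weak_conv_measures_def
  proof (intro allI impI)
    fix H :: "(real \<times> real \<times> real \<times> real \<Rightarrow> real) \<Rightarrow> real"
    assume H: "continuous_map (skorohod_topology a b) euclideanreal H \<and> bounded (H ` topspace (skorohod_topology a b))"
    then obtain c where c: "\<And>f. f \<in> skorohod_space a b \<Longrightarrow> \<bar>H f\<bar> \<le> c" unfolding bounded_iff by auto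
    have Hm: "H \<in> borel_measurable (skorohod_borel a b)" using H by (intro borel_measurable_skorohod_continuous) simp
    define A where "A m = {n :: nat \<times> nat \<times> nat. m \<le> fst n \<and> m \<le> fst (snd n) \<and> m \<le> snd (snd n)}" for m :: nat
    have "((\<lambda>n. \<integral>\<omega>. H (X' n \<omega>) \<partial>M) \<longlongrightarrow> (\<integral>\<omega>. H (Y' \<omega>) \<partial>N)) min_at_top"
    proof (rule weak_conv_extended_mapping[OF M N X0(1) Y0(1) conv, where A = A and K = "\<lambda>n y. H (restrict (psi n y) (cbox a b))" and c = c])
      show "\<forall>\<^sub>F n in min_at_top. n \<in> A m" for m unfolding eventually_min_at_top A_def by auto
      show "A m \<noteq> {}" for m using A_def by (auto intro: exI[of _ "(m, m, m)"])
      show "decseq A" unfolding decseq_def A_def by auto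
      show "\<bar>H (restrict (psi n y) (cbox a b))\<bar> \<le> c" for n y by (intro c psi_skorohod)
      show "(\<lambda>\<omega>. H (X' n \<omega>)) \<in> borel_measurable M" for n using measurable_compose[OF X' Hm] .
      show "(\<lambda>\<omega>. H (Y' \<omega>)) \<in> borel_measurable N" using measurable_compose[OF Y' Hm] .
      show "AE \<omega> in M. H (X' n \<omega>) = H (restrict (psi n (X0 n \<omega>)) (cbox a b))" for n
        using X0(2)[of n]
      proof eventually_elim
        case (elim \<omega>)
        have "psi n (X0 n \<omega>) = psi n (S n \<omega>)" by (rule psi_cong) (simp add: elim)
        then show ?case by (simp add: X'_def)
      qed
      show "AE \<omega> in N. \<forall>\<eta>>0. \<exists>e>0. \<exists>m. \<forall>n\<in>A m. \<forall>y\<in>skorohod_space (0, 0, 0) (1, 1, 1).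
          skorohod_near (0, 0, 0) (1, 1, 1) e (Y0 \<omega>) y \<longrightarrow> \<bar>H (restrict (psi n y) (cbox a b)) - H (Y' \<omega>)\<bar> < \<eta>"
        using Y0(2) YZ AE_space
      proof eventually_elim
        case (elim \<omega>)
        have h: "continuous_on unit_cube (B \<omega>)" using good elim by simp
        have Yw: "Y' \<omega> = restrict (psi_limit (B \<omega>)) (cbox a b)" using elim by (simp add: Y'_def)
        show ?case
        proof (intro allI impI)
          fix \<eta> :: real assume \<eta>: "0 < \<eta>"
          obtain e2 where e2: "0 < e2" and near: "\<And>g. g \<in> skorohod_space a b \<Longrightarrow> skorohod_near a b e2 (Y' \<omega>) g \<Longrightarrow> \<bar>H g - H (Y' \<omega>)\<bar> < \<eta>"
            using continuous_map_skorohod_near[OF conjunct1[OF H] psi_limit_skorohod[OF h box] \<eta>] unfolding Yw by metis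
          obtain e1 where e1: "e1 > 0" and ev: "\<forall>\<^sub>F n in min_at_top. \<forall>y. (\<forall>v\<in>unit_cube. \<bar>y v - B \<omega> v\<bar> \<le> e1) \<longrightarrow>
              (\<forall>p. fst p \<in> {0..1} \<longrightarrow> \<bar>psi n y p - psi_limit (B \<omega>) p\<bar> < e2)"
            using psi_converges[OF h e2] by blast
          obtain m where m': "\<forall>n1\<ge>m. \<forall>n2\<ge>m. \<forall>n3\<ge>m. \<forall>y. (\<forall>v\<in>unit_cube. \<bar>y v - B \<omega> v\<bar> \<le> e1) \<longrightarrow>
              (\<forall>p. fst p \<in> {0..1} \<longrightarrow> \<bar>psi (n1, n2, n3) y p - psi_limit (B \<omega>) p\<bar> < e2)"
            using ev unfolding eventually_min_at_top by blast
          have m: "\<bar>psi n y p - psi_limit (B \<omega>) p\<bar> < e2"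
            if "n \<in> A m" "\<And>v. v \<in> unit_cube \<Longrightarrow> \<bar>y v - B \<omega> v\<bar> \<le> e1" "fst p \<in> {0..1}" for n y p
          proof -
            obtain n1 n2 n3 where n: "n = (n1, n2, n3)" by (cases n)
            have "n1 \<ge> m" "n2 \<ge> m" "n3 \<ge> m" using that(1) unfolding A_def n by auto
            then show ?thesis using m' that(2,3) unfolding n by blast
          qed
          have "compact unit_cube" unfolding cube[symmetric] by (rule compact_cbox)
          then obtain d where d: "d > 0" and dh: "\<And>u v. u \<in> unit_cube \<Longrightarrow> v \<in> unit_cube \<Longrightarrow> dist v u < d \<Longrightarrow> dist (B \<omega> v) (B \<omega> u) < e1 / 2"
            using compact_uniformly_continuous[OF h] half_gt_zero[OF e1] unfolding uniformly_continuous_on_def by metis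
          show "\<exists>e>0. \<exists>m. \<forall>n\<in>A m. \<forall>y\<in>skorohod_space (0, 0, 0) (1, 1, 1).
              skorohod_near (0, 0, 0) (1, 1, 1) e (Y0 \<omega>) y \<longrightarrow> \<bar>H (restrict (psi n y) (cbox a b)) - H (Y' \<omega>)\<bar> < \<eta>"
          \<comment> \<open>The time change moves points by less than \<open>d\<close>, hence the
            values of the continuous path by less than \<open>e1 / 2\<close>; the other half of
            \<open>e1\<close> is the distance between the values.\<close>
          proof (intro exI[of _ "min d (e1 / 2)"] exI[of _ m] conjI ballI impI)
            show "0 < min d (e1 / 2)" using d e1 by simp
            fix n y assume n: "n \<in> A m" and nr: "skorohod_near (0, 0, 0) (1, 1, 1) (min d (e1 / 2)) (Y0 \<omega>) y"
            obtain \<theta> where tc: "time_change (0, 0, 0) (1, 1, 1) \<theta>" and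
              \<theta>: "\<And>v. v \<in> unit_cube \<Longrightarrow> norm (\<theta> v - v) < min d (e1 / 2) \<and> \<bar>y v - Y0 \<omega> (\<theta> v)\<bar> < min d (e1 / 2)"
              using nr unfolding skorohod_near_def cube by blast
            have yB: "\<bar>y v - B \<omega> v\<bar> \<le> e1" if v: "v \<in> unit_cube" for v
            proof -
              have tv: "\<theta> v \<in> unit_cube" using time_change_in_cbox[OF tc] v unfolding cube by blast
              have "dist (B \<omega> (\<theta> v)) (B \<omega> v) < e1 / 2"
                using \<theta>[OF v] by (intro dh v tv) (simp add: dist_norm)
              moreover have "\<bar>y v - B \<omega> (\<theta> v)\<bar> < e1 / 2" using \<theta>[OF v] tv elim(1) by simp
              ultimately show ?thesis unfolding dist_real_def by linarith
            qed
            show "\<bar>H (restrict (psi n y) (cbox a b)) - H (Y' \<omega>)\<bar> < \<eta>"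
            proof (rule near[OF psi_skorohod skorohod_near_uniform[OF e2]])
              fix p assume p: "p \<in> cbox a b"
              show "\<bar>restrict (psi n y) (cbox a b) p - Y' \<omega> p\<bar> < e2"
                using m[OF n yB box[OF p]] p by (simp add: Yw)
            qed
          qed
        qed
      qed
    qed
    then show "((\<lambda>n. \<integral>f. H f \<partial>distr M (skorohod_borel a b) (X' n)) \<longlongrightarrow> (\<integral>f. H f \<partial>distr N (skorohod_borel a b) Y')) min_at_top"
      by (simp add: integral_distr[OF X' Hm] integral_distr[OF Y' Hm])
  qed
  moreover have "AE \<omega> in M. X' n \<omega> = restrict (F n \<omega>) (cbox a b)" for n
    using AE_space by eventually_elim (auto simp: X'_def F restrict_def)
  moreover have "AE \<omega> in N. Y' \<omega> = restrict (Y \<omega>) (cbox a b)"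
    using Y YZ by eventually_elim (auto simp: Y'_def restrict_def)
  ultimately show ?thesis
    unfolding weak_conv_skorohod_def skorohod_version_def using X' Y' by blast
qed

end

section \<open>Partial sums of the noise, the case of continuous \<open>\<delta>\<close>, and the
  observed process\<close>

lemma One_triple: "(One :: real \<times> real \<times> real) = (1, 1, 1)"
proof (rule euclidean_eqI)
  fix i :: "real \<times> real \<times> real" assume "i \<in> Basis"
  then show "One \<bullet> i = (1, 1, 1) \<bullet> i"
    by (simp add: inner_sum_left inner_Basis) (auto simp: Basis_prod_def)
qed

lemma sum_int_last:
  fixes f :: "int \<Rightarrow> real"
  assumes "1 \<le> l"
  shows "(\<Sum>i=1..l. f i) = (\<Sum>i=1..l - 1. f i) + f l"
proof -
  have "{1..l} = insert l {1..l - 1}" using assms by auto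
  then show ?thesis by simp
qed

lemma sum_int_nat: "(\<Sum>i=1..int m. f i) = (\<Sum>i=1..m. f (int i))"
proof -
  have "{1..int m} = int ` {1..m}" by (simp add: image_int_atLeastAtMost)
  then show ?thesis by (simp add: sum.reindex)
qed

definition partial_sum :: "(int \<times> int \<times> int \<Rightarrow> 'm \<Rightarrow> real) \<Rightarrow> nat \<times> nat \<times> nat \<Rightarrow> 'm \<Rightarrow> real \<times> real \<times> real \<Rightarrow> real" where
  "partial_sum \<epsilon> = (\<lambda>(n1, n2, n3) \<omega> (v1, v2, v3). (1 / sqrt (real n1 * real n2 * real n3)) *
     (\<Sum>i1 = 1..\<lfloor>real n1 * v1\<rfloor>. \<Sum>i2 = 1..\<lfloor>real n2 * v2\<rfloor>. \<Sum>i3 = 1..\<lfloor>real n3 * v3\<rfloor>. \<epsilon> (i1, i2, i3) \<omega>))"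

text \<open>At a node the floor is exact, and in each coordinate the difference of neighbouring
  partial sums leaves the last summand; after three coordinates only one noise variable
  remains.\<close>

lemma (in sampling) incr_partial_sum:
  assumes l: "(l1, l2, l3) \<in> grid (n1, n2, n3)"
  shows "incr (n1, n2, n3) (l1, l2, l3) (partial_sum \<epsilon> (n1, n2, n3) \<omega>) =
    \<epsilon> (int l1, int l2, int l3) \<omega> / sqrt (real n1 * real n2 * real n3)"
proof -
  have lr: "1 \<le> l1" "l1 \<le> n1" "1 \<le> l2" "l2 \<le> n2" "1 \<le> l3" "l3 \<le> n3" using l by (auto simp: grid_def)
  have fl: "\<lfloor>real n * (real j / real n)\<rfloor> = int j" if "1 \<le> n" for n j :: nat using that by simp
  have pred: "int (j - 1) = int j - 1" if "1 \<le> j" for j using that by simp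
  define q where "q = 1 / sqrt (real n1 * real n2 * real n3)"
  define G where "G a b c = (\<Sum>i1 = 1..a. \<Sum>i2 = 1..b. \<Sum>i3 = 1..c. \<epsilon> (i1, i2, i3) \<omega>)" for a b c :: int
  have P: "partial_sum \<epsilon> (n1, n2, n3) \<omega> (real j1 / real n1, real j2 / real n2, real j3 / real n3) = q * G (int j1) (int j2) (int j3)" for j1 j2 j3
    using lr unfolding partial_sum_def prod.case q_def G_def by (subst fl, simp)+ simp
  have i1: "1 \<le> int l1" "1 \<le> int l2" "1 \<le> int l3" using lr by auto
  have g3: "G a b (int l3) = G a b (int l3 - 1) + (\<Sum>i1 = 1..a. \<Sum>i2 = 1..b. \<epsilon> (i1, i2, int l3) \<omega>)" for a b
    unfolding G_def sum_int_last[OF i1(3)] by (simp add: sum.distrib)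
  have g2: "(\<Sum>i1 = 1..a. \<Sum>i2 = 1..int l2. \<epsilon> (i1, i2, int l3) \<omega>) =
      (\<Sum>i1 = 1..a. \<Sum>i2 = 1..int l2 - 1. \<epsilon> (i1, i2, int l3) \<omega>) + (\<Sum>i1 = 1..a. \<epsilon> (i1, int l2, int l3) \<omega>)" for a
    unfolding sum_int_last[OF i1(2)] by (simp add: sum.distrib)
  show ?thesis
    unfolding incr_def prod.case Let_def P pred[OF lr(1)] pred[OF lr(3)] pred[OF lr(5)] g3 g2 sum_int_last[OF i1(1)]
    by (simp add: q_def algebra_simps)
qed

lemma dist_Pair_le: "dist (u, v) (u', v') \<le> dist u u' + dist v v'"
  unfolding dist_Pair_Pair by (rule sqrt_sum_squares_le_sum) simp_all

lemma grid_continuous: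
  fixes \<delta> :: "real \<times> real \<times> real \<Rightarrow> real"
  assumes T: "0 < T1" "0 < T2" "0 < T3" and cont: "continuous_on (cbox (0, 0, 0) (T1, T2, T3)) \<delta>"
    and range: "\<And>n i. 1 \<le> i \<Longrightarrow> i \<le> n \<Longrightarrow> real i * \<tau>1 n \<in> {0..T1} \<and> real i * \<tau>2 n \<in> {0..T2} \<and> real i * \<tau>3 n \<in> {0..T3}"
    and lim: "(\<lambda>n. real n * \<tau>1 n) \<longlonglongrightarrow> T1" "(\<lambda>n. real n * \<tau>2 n) \<longlonglongrightarrow> T2" "(\<lambda>n. real n * \<tau>3 n) \<longlonglongrightarrow> T3"
    and \<eta>: "0 < \<eta>"
  shows "\<exists>m0. \<forall>n1\<ge>m0. \<forall>n2\<ge>m0. \<forall>n3\<ge>m0. \<forall>l1\<in>{1..n1}. \<forall>l2\<in>{1..n2}. \<forall>l3\<in>{1..n3}.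
      \<bar>\<delta> (real l1 * \<tau>1 n1, real l2 * \<tau>2 n2, real l3 * \<tau>3 n3)
        - \<delta> (T1 * real l1 / real n1, T2 * real l2 / real n2, T3 * real l3 / real n3)\<bar> \<le> \<eta>"
proof -
  let ?B = "cbox (0, 0, 0) (T1, T2, T3)"
  obtain d where d: "d > 0" and dh: "\<And>x y. x \<in> ?B \<Longrightarrow> y \<in> ?B \<Longrightarrow> dist y x < d \<Longrightarrow> dist (\<delta> y) (\<delta> x) < \<eta>"
    using compact_uniformly_continuous[OF cont compact_cbox] \<eta> unfolding uniformly_continuous_on_def by metis
  \<comment> \<open>Each coordinate may use up a third of \<open>d\<close>, as the distance of
    triples is at most the sum of the coordinate distances.\<close>
  have ev: "\<forall>\<^sub>F n in sequentially. \<bar>real n * \<tau> n - R\<bar> < d / 3" if "(\<lambda>n. real n * \<tau> n) \<longlonglongrightarrow> R" for \<tau> :: "nat \<Rightarrow> real" and R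
    using tendstoD[OF that, of "d / 3"] d by (simp add: dist_real_def)
  obtain m0 where m0: "\<And>n. n \<ge> m0 \<Longrightarrow> \<bar>real n * \<tau>1 n - T1\<bar> < d / 3 \<and> \<bar>real n * \<tau>2 n - T2\<bar> < d / 3 \<and> \<bar>real n * \<tau>3 n - T3\<bar> < d / 3"
    using eventually_conj[OF ev[OF lim(1)] eventually_conj[OF ev[OF lim(2)] ev[OF lim(3)]]]
    unfolding eventually_sequentially by blast
  have "\<bar>\<delta> (real l1 * \<tau>1 n1, real l2 * \<tau>2 n2, real l3 * \<tau>3 n3)
        - \<delta> (T1 * real l1 / real n1, T2 * real l2 / real n2, T3 * real l3 / real n3)\<bar> \<le> \<eta>"
    if n: "n1 \<ge> m0" "n2 \<ge> m0" "n3 \<ge> m0" and l: "l1 \<in> {1..n1}" "l2 \<in> {1..n2}" "l3 \<in> {1..n3}" for n1 n2 n3 l1 l2 l3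
  proof -
    have n1: "1 \<le> n1" "1 \<le> n2" "1 \<le> n3" using l by auto
    let ?x = "(real l1 * \<tau>1 n1, real l2 * \<tau>2 n2, real l3 * \<tau>3 n3)"
    let ?y = "(T1 * real l1 / real n1, T2 * real l2 / real n2, T3 * real l3 / real n3)"
    have "dist ?x ?y \<le> \<bar>real l1 * \<tau>1 n1 - T1 * real l1 / real n1\<bar> + (\<bar>real l2 * \<tau>2 n2 - T2 * real l2 / real n2\<bar> + \<bar>real l3 * \<tau>3 n3 - T3 * real l3 / real n3\<bar>)"
      unfolding dist_real_def[symmetric] by (rule order_trans[OF dist_Pair_le add_left_mono[OF dist_Pair_le]])
    also have "\<dots> < d / 3 + (d / 3 + d / 3)"
      by (intro add_strict_mono le_less_trans[OF node_diff] n1 l conjunct1[OF m0[OF n(1)]]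
          conjunct1[OF conjunct2[OF m0[OF n(2)]]] conjunct2[OF conjunct2[OF m0[OF n(3)]]])
    finally have dd: "dist ?x ?y < d" by simp
    have xB: "?x \<in> ?B" using range[of l1 n1] range[of l2 n2] range[of l3 n3] l by (auto simp: cbox_Pair_eq)
    have yB: "?y \<in> ?B" using node_mem[OF T(1) n1(1) l(1)] node_mem[OF T(2) n1(2) l(2)] node_mem[OF T(3) n1(3) l(3)] by (simp add: cbox_Pair_eq)
    show ?thesis using dh[OF yB xB dd] by (simp add: dist_real_def)
  qed
  then show ?thesis by blast
qed

theorem theorem3p2:
  fixes s0 \<Omega>1 \<Omega>2 \<Omega>3 \<tau>bar1 \<tau>bar2 \<tau>bar3 \<sigma> :: real
    and \<tau>1 \<tau>2 \<tau>3 :: "nat \<Rightarrow> real"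
    and f :: "nat \<times> nat \<times> nat \<Rightarrow> real \<times> real \<times> real \<Rightarrow> real"
    and f0 \<delta> :: "real \<times> real \<times> real \<Rightarrow> real"
    and M :: "'m measure"
    and \<epsilon> :: "int \<times> int \<times> int \<Rightarrow> 'm \<Rightarrow> real"
    and y :: "nat \<times> nat \<times> nat \<Rightarrow> int \<times> int \<times> int \<Rightarrow> 'm \<Rightarrow> real"
    and N :: "'w measure"
    and B :: "'w \<Rightarrow> real \<times> real \<times> real \<Rightarrow> real"
  defines "\<phi> \<equiv> sinc_kernel \<Omega>1 \<Omega>2 \<Omega>3"
  assumes s0: "0 < s0" "s0 < 1"
    and \<Omega>: "0 < \<Omega>1" "0 < \<Omega>2" "0 < \<Omega>3"
    and \<tau>bar: "0 < \<tau>bar1" "0 < \<tau>bar2" "0 < \<tau>bar3"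
    and \<tau>_pos: "\<And>n. 1 \<le> n \<Longrightarrow> 0 < \<tau>1 n \<and> 0 < \<tau>2 n \<and> 0 < \<tau>3 n"
    and sampling_points: "\<And>n i. 1 \<le> i \<Longrightarrow> i \<le> n \<Longrightarrow>
          real i * \<tau>1 n \<in> {0..\<tau>bar1} \<and> real i * \<tau>2 n \<in> {0..\<tau>bar2} \<and> real i * \<tau>3 n \<in> {0..\<tau>bar3}"
    and prob: "prob_space M"
    and observations: "\<And>n1 n2 n3 i1 i2 i3 \<omega>.
          1 \<le> i1 \<Longrightarrow> i1 \<le> int n1 \<Longrightarrow> 1 \<le> i2 \<Longrightarrow> i2 \<le> int n2 \<Longrightarrow> 1 \<le> i3 \<Longrightarrow> i3 \<le> int n3 \<Longrightarrow> \<omega> \<in> space M \<Longrightarrow>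
          y (n1, n2, n3) (i1, i2, i3) \<omega> =
            f (n1, n2, n3) (of_int i1 * \<tau>1 n1, of_int i2 * \<tau>2 n2, of_int i3 * \<tau>3 n3)
            + \<epsilon> (i1, i2, i3) \<omega>"
    and local_alternative: "\<And>n1 n2 n3 z.
          1 \<le> n1 \<Longrightarrow> 1 \<le> n2 \<Longrightarrow> 1 \<le> n3 \<Longrightarrow> z \<in> cbox (0, 0, 0) (\<tau>bar1, \<tau>bar2, \<tau>bar3) \<Longrightarrow>
          f (n1, n2, n3) z - f0 z = \<delta> z / (sqrt n1 * sqrt n2 * sqrt n3)"
    and \<delta>_nonzero: "\<exists>z\<in>cbox (0, 0, 0) (\<tau>bar1, \<tau>bar2, \<tau>bar3). \<delta> z \<noteq> 0"
    and stationary: "weakly_stationary M \<epsilon>"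
    and mean_zero: "\<And>i. (\<integral>\<omega>. \<epsilon> i \<omega> \<partial>M) = 0"
    and \<sigma>: "0 < \<sigma>"
    and brownian: "standard_brownian_motion N B"
    and fclt: "weak_conv_skorohod (0, 0, 0) (1, 1, 1)
          M (\<lambda>(n1, n2, n3) \<omega> (v1, v2, v3).
               (1 / sqrt (real n1 * real n2 * real n3)) *
               (\<Sum>i1 = 1..\<lfloor>real n1 * v1\<rfloor>. \<Sum>i2 = 1..\<lfloor>real n2 * v2\<rfloor>. \<Sum>i3 = 1..\<lfloor>real n3 * v3\<rfloor>.
                  \<epsilon> (i1, i2, i3) \<omega>))
          N (\<lambda>\<omega> v. \<sigma> * B \<omega> v) min_at_top"
    and cases_ab:
      "(continuous_on (cbox (0, 0, 0) (\<tau>bar1, \<tau>bar2, \<tau>bar3)) \<delta> \<and>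
        ((\<lambda>(n1, n2, n3). real n1 * \<tau>1 n1) \<longlongrightarrow> \<tau>bar1) min_at_top \<and>
        ((\<lambda>(n1, n2, n3). real n2 * \<tau>2 n2) \<longlongrightarrow> \<tau>bar2) min_at_top \<and>
        ((\<lambda>(n1, n2, n3). real n3 * \<tau>3 n3) \<longlongrightarrow> \<tau>bar3) min_at_top)
       \<or>
       (bounded_variation_hk (0, 0, 0) (\<tau>bar1, \<tau>bar2, \<tau>bar3) \<delta> \<and>
        (\<forall>n\<ge>1. real n * \<tau>1 n = \<tau>bar1 \<and> real n * \<tau>2 n = \<tau>bar2 \<and> real n * \<tau>3 n = \<tau>bar3))"
  shows "weak_conv_skorohod (s0, 0, 0, 0) (1, \<tau>bar1, \<tau>bar2, \<tau>bar3)
          M (\<lambda>(n1, n2, n3) \<omega> (s, t, r2, r3).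
               sqrt (\<tau>1 n1 * \<tau>2 n2 * \<tau>3 n3) *
               (\<Sum>l1 = 1..\<lfloor>real n1 * s\<rfloor>. \<Sum>l2 = 1..int n2. \<Sum>l3 = 1..int n3.
                  (y (n1, n2, n3) (l1, l2, l3) \<omega>
                     - f0 (of_int l1 * \<tau>1 n1, of_int l2 * \<tau>2 n2, of_int l3 * \<tau>3 n3))
                  * \<phi> (t - of_int l1 * \<tau>1 n1) (r2 - of_int l2 * \<tau>2 n2) (r3 - of_int l3 * \<tau>3 n3)))
          N (\<lambda>\<omega> (s, t, r2, r3).
               sqrt (\<tau>bar1 * \<tau>bar2 * \<tau>bar3) * \<sigma> *
                 parts_integral (0, 0, 0) (s, 1, 1)
                   (\<lambda>(z1, z2, z3). \<phi> (t - \<tau>bar1 * z1) (r2 - \<tau>bar2 * z2) (r3 - \<tau>bar3 * z3)) (B \<omega>)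
               + 1 / sqrt (\<tau>bar1 * \<tau>bar2 * \<tau>bar3) *
                 integral {0..s * \<tau>bar1} (\<lambda>z1. integral {0..\<tau>bar2} (\<lambda>z2. integral {0..\<tau>bar3} (\<lambda>z3.
                   \<phi> (t - z1) (r2 - z2) (r3 - z3) * \<delta> (z1, z2, z3)))))
          min_at_top"
proof -
  \<comment> \<open>One constant for all three kernels; the element \<open>1\<close> provides
    \<open>1 \<le> C\<close>, used to compare powers of \<open>C\<close>.\<close>
  define C where "C = Max {1, \<Omega>1 / pi, \<Omega>1\<^sup>2 / pi, \<Omega>1 ^ 3 / pi, \<Omega>2 / pi, \<Omega>2\<^sup>2 / pi, \<Omega>2 ^ 3 / pi, \<Omega>3 / pi, \<Omega>3\<^sup>2 / pi, \<Omega>3 ^ 3 / pi}"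
  have C: "1 \<le> C" and CC: "\<Omega>1 / pi \<le> C" "\<Omega>1\<^sup>2 / pi \<le> C" "\<Omega>1 ^ 3 / pi \<le> C" "\<Omega>2 / pi \<le> C" "\<Omega>2\<^sup>2 / pi \<le> C" "\<Omega>2 ^ 3 / pi \<le> C"
    "\<Omega>3 / pi \<le> C" "\<Omega>3\<^sup>2 / pi \<le> C" "\<Omega>3 ^ 3 / pi \<le> C"
    unfolding C_def by (intro Max_ge; simp)+
  note k = smooth_kernel_sinc[OF \<Omega>(1) CC(1-3)] smooth_kernel_sinc[OF \<Omega>(2) CC(4-6)] smooth_kernel_sinc[OF \<Omega>(3) CC(7-9)]
  have range: "0 < \<tau>1 n \<and> 0 < \<tau>2 n \<and> 0 < \<tau>3 n \<and> real n * \<tau>1 n \<le> \<tau>bar1 \<and> real n * \<tau>2 n \<le> \<tau>bar2 \<and> real n * \<tau>3 n \<le> \<tau>bar3"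
    if "1 \<le> n" for n using \<tau>_pos[OF that] sampling_points[OF that order_refl] by auto
  have "sampling (sinc_factor \<Omega>1) (sinc_factor \<Omega>2) (sinc_factor \<Omega>3) (sinc_factor_deriv \<Omega>1) (sinc_factor_deriv \<Omega>2)
      (sinc_factor_deriv \<Omega>3) C \<tau>bar1 \<tau>bar2 \<tau>bar3 \<tau>1 \<tau>2 \<tau>3 \<delta>"
    using cases_ab
  proof
    assume a: "continuous_on (cbox (0, 0, 0) (\<tau>bar1, \<tau>bar2, \<tau>bar3)) \<delta> \<and>
        ((\<lambda>(n1, n2, n3). real n1 * \<tau>1 n1) \<longlongrightarrow> \<tau>bar1) min_at_top \<and>
        ((\<lambda>(n1, n2, n3). real n2 * \<tau>2 n2) \<longlongrightarrow> \<tau>bar2) min_at_top \<and>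
        ((\<lambda>(n1, n2, n3). real n3 * \<tau>3 n3) \<longlongrightarrow> \<tau>bar3) min_at_top"
    \<comment> \<open>Each convergence involves a single index, so restricting to the diagonal turns
      it into an ordinary sequential limit.\<close>
    have lim: "(\<lambda>n. real n * \<tau>1 n) \<longlonglongrightarrow> \<tau>bar1" "(\<lambda>n. real n * \<tau>2 n) \<longlonglongrightarrow> \<tau>bar2" "(\<lambda>n. real n * \<tau>3 n) \<longlonglongrightarrow> \<tau>bar3"
      using filterlim_compose[OF _ filterlim_diagonal, of "\<lambda>(n1, n2, n3). real n1 * \<tau>1 n1"]
        filterlim_compose[OF _ filterlim_diagonal, of "\<lambda>(n1, n2, n3). real n2 * \<tau>2 n2"]
        filterlim_compose[OF _ filterlim_diagonal, of "\<lambda>(n1, n2, n3). real n3 * \<tau>3 n3"] a by auto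
    show ?thesis
      using C k \<tau>bar range lim grid_continuous[OF \<tau>bar conjunct1[OF a] sampling_points lim]
        continuous_riemann_rate[OF \<tau>bar conjunct1[OF a]]
      by (intro sampling.intro) blast+
  next
    assume b: "bounded_variation_hk (0, 0, 0) (\<tau>bar1, \<tau>bar2, \<tau>bar3) \<delta> \<and>
        (\<forall>n\<ge>1. real n * \<tau>1 n = \<tau>bar1 \<and> real n * \<tau>2 n = \<tau>bar2 \<and> real n * \<tau>3 n = \<tau>bar3)"
    have lim: "(\<lambda>n. real n * \<tau>1 n) \<longlonglongrightarrow> \<tau>bar1" "(\<lambda>n. real n * \<tau>2 n) \<longlonglongrightarrow> \<tau>bar2" "(\<lambda>n. real n * \<tau>3 n) \<longlonglongrightarrow> \<tau>bar3"
      by (intro tendsto_eventually eventually_mono[OF eventually_ge_at_top[of 1]]; use b in blast)+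
    have grid: "\<exists>m0. \<forall>n1\<ge>m0. \<forall>n2\<ge>m0. \<forall>n3\<ge>m0. \<forall>l1\<in>{1..n1}. \<forall>l2\<in>{1..n2}. \<forall>l3\<in>{1..n3}.
      \<bar>\<delta> (real l1 * \<tau>1 n1, real l2 * \<tau>2 n2, real l3 * \<tau>3 n3)
        - \<delta> (\<tau>bar1 * real l1 / real n1, \<tau>bar2 * real l2 / real n2, \<tau>bar3 * real l3 / real n3)\<bar> \<le> \<eta>" if "0 < \<eta>" for \<eta>
    \<comment> \<open>With \<open>n * \<tau>\<close> equal to the edge length the sampling points
      are the nodes of the uniform grid, so the difference vanishes and no continuity of
      \<open>\<delta>\<close> enters.\<close>
    proof (intro exI[of _ 1] allI impI ballI)
      fix n1 n2 n3 l1 l2 l3 :: nat assume n: "1 \<le> n1" "1 \<le> n2" "1 \<le> n3"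
      have "\<tau>bar1 = real n1 * \<tau>1 n1" "\<tau>bar2 = real n2 * \<tau>2 n2" "\<tau>bar3 = real n3 * \<tau>3 n3" using b n by simp_all
      then have "\<tau>bar1 * real l1 / real n1 = real l1 * \<tau>1 n1" "\<tau>bar2 * real l2 / real n2 = real l2 * \<tau>2 n2"
        "\<tau>bar3 * real l3 / real n3 = real l3 * \<tau>3 n3" using n by simp_all
      then show "\<bar>\<delta> (real l1 * \<tau>1 n1, real l2 * \<tau>2 n2, real l3 * \<tau>3 n3)
        - \<delta> (\<tau>bar1 * real l1 / real n1, \<tau>bar2 * real l2 / real n2, \<tau>bar3 * real l3 / real n3)\<bar> \<le> \<eta>"
        using that by simp
    qed
    show ?thesis
      using C k \<tau>bar range lim grid hk_riemann_rate[OF \<tau>bar conjunct1[OF b]]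
      by (intro sampling.intro) blast+
  qed
  then interpret sampling "sinc_factor \<Omega>1" "sinc_factor \<Omega>2" "sinc_factor \<Omega>3" "sinc_factor_deriv \<Omega>1" "sinc_factor_deriv \<Omega>2"
      "sinc_factor_deriv \<Omega>3" C \<tau>bar1 \<tau>bar2 \<tau>bar3 \<tau>1 \<tau>2 \<tau>3 \<delta> .
  have \<phi>: "\<phi> x y z = sinc_factor \<Omega>1 x * sinc_factor \<Omega>2 y * sinc_factor \<Omega>3 z" for x y z
    by (simp add: \<phi>_def sinc_kernel_def)
  have cube: "cbox 0 One = unit_cube"
    unfolding One_triple zero_prod_def by (auto simp: unit_cube_def cbox_Pair_eq)
  have N: "prob_space N" and Bm: "\<And>v. v \<in> unit_cube \<Longrightarrow> (\<lambda>\<omega>. B \<omega> v) \<in> borel_measurable N"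
    and Bc: "AE \<omega> in N. continuous_on unit_cube (B \<omega>)"
    using brownian unfolding standard_brownian_motion_def cube by blast+
  have \<epsilon>m: "\<epsilon> i \<in> borel_measurable M" for i using stationary unfolding weakly_stationary_def by blast
  show ?thesis
  proof (rule functional_limit[OF prob N, where S = "partial_sum \<epsilon>" and B = "\<lambda>\<omega> v. \<sigma> * B \<omega> v"])
    show "(\<lambda>\<omega>. \<sigma> * B \<omega> v) \<in> borel_measurable N" if "v \<in> unit_cube" for v
      using Bm[OF that] by simp
    show "AE \<omega> in N. continuous_on unit_cube (\<lambda>v. \<sigma> * B \<omega> v)"
      using Bc by eventually_elim (intro continuous_intros)
    show "weak_conv_skorohod (0, 0, 0) (1, 1, 1) M (partial_sum \<epsilon>) N (\<lambda>\<omega> v. \<sigma> * B \<omega> v) min_at_top"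
      using fclt unfolding partial_sum_def .
    show "(\<lambda>\<omega>. incr n l (partial_sum \<epsilon> n \<omega>)) \<in> borel_measurable M" if "l \<in> grid n" for n l
    proof -
      obtain n1 n2 n3 l1 l2 l3 where nl: "n = (n1, n2, n3)" "l = (l1, l2, l3)" by (cases n, cases l)
      show ?thesis
        unfolding nl incr_partial_sum[OF that[unfolded nl]] by (intro borel_measurable_divide \<epsilon>m borel_measurable_const)
    qed
    show "fst p \<in> {0..1}" if "p \<in> cbox (s0, 0, 0, 0) (1, \<tau>bar1, \<tau>bar2, \<tau>bar3)" for p
    proof -
      obtain s t r2 r3 where p: "p = (s, t, r2, r3)" by (cases p)
      show ?thesis using that s0(1) unfolding p by (simp add: cbox_Pair_eq)
    qed
  next
    fix n :: "nat \<times> nat \<times> nat" and \<omega> p assume \<omega>: "\<omega> \<in> space M" and p: "p \<in> cbox (s0, 0, 0, 0) (1, \<tau>bar1, \<tau>bar2, \<tau>bar3)"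
    obtain n1 n2 n3 where n: "n = (n1, n2, n3)" by (cases n)
    obtain s t r2 r3 where p': "p = (s, t, r2, r3)" by (cases p)
    have s: "s \<in> {0..1}" using p s0 unfolding p' by (auto simp: cbox_Pair_eq)
    show "(case n of (n1, n2, n3) \<Rightarrow> \<lambda>\<omega> (s, t, r2, r3).
        sqrt (\<tau>1 n1 * \<tau>2 n2 * \<tau>3 n3) *
               (\<Sum>l1 = 1..\<lfloor>real n1 * s\<rfloor>. \<Sum>l2 = 1..int n2. \<Sum>l3 = 1..int n3.
                  (y (n1, n2, n3) (l1, l2, l3) \<omega>
                     - f0 (of_int l1 * \<tau>1 n1, of_int l2 * \<tau>2 n2, of_int l3 * \<tau>3 n3))
                  * \<phi> (t - of_int l1 * \<tau>1 n1) (r2 - of_int l2 * \<tau>2 n2) (r3 - of_int l3 * \<tau>3 n3))) \<omega> p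
        = psi n (partial_sum \<epsilon> n \<omega>) p"
    \<comment> \<open>A version is required for every index, including sample sizes
      \<open>0\<close>, where the observation model gives nothing; there both sides are empty
      sums.\<close>
    proof (cases "n1 = 0 \<or> n2 = 0 \<or> n3 = 0")
      case True
      have "grid n = {}" using True by (auto simp: grid_def n)
      then have "psi n (partial_sum \<epsilon> n \<omega>) p = 0"
        unfolding psi_def noise_def drift_def n by simp
      then show ?thesis using True unfolding n p' by auto
    next
      case False
      then have n1: "1 \<le> n1" "1 \<le> n2" "1 \<le> n3" by auto
      define q where "q = sqrt n1 * sqrt n2 * sqrt n3"
      have q: "q > 0" "sqrt (real n1 * real n2 * real n3) = q" using n1 by (auto simp: q_def real_sqrt_mult)
      define m where "m = nat \<lfloor>real n1 * s\<rfloor>"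
      have fl: "\<lfloor>real n1 * s\<rfloor> = int m" using s by (simp add: m_def)
      have mn: "m \<le> n1"
      proof -
        have "real n1 * s \<le> real n1" using s by (intro mult_left_le) auto
        then show ?thesis unfolding m_def by linarith
      qed
      define D where "D l1 l2 l3 = \<delta> (real l1 * \<tau>1 n1, real l2 * \<tau>2 n2, real l3 * \<tau>3 n3) / q" for l1 l2 l3 :: nat
      define P where "P l1 l2 l3 = sinc_factor \<Omega>1 (t - real l1 * \<tau>1 n1) * sinc_factor \<Omega>2 (r2 - real l2 * \<tau>2 n2)
        * sinc_factor \<Omega>3 (r3 - real l3 * \<tau>3 n3)" for l1 l2 l3 :: nat
      have res: "y (n1, n2, n3) (int l1, int l2, int l3) \<omega> - f0 (real l1 * \<tau>1 n1, real l2 * \<tau>2 n2, real l3 * \<tau>3 n3)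
          = D l1 l2 l3 + \<epsilon> (int l1, int l2, int l3) \<omega>"
        if l: "l1 \<in> {1..m}" "l2 \<in> {1..n2}" "l3 \<in> {1..n3}" for l1 l2 l3
      proof -
        have lr: "1 \<le> l1" "l1 \<le> n1" "1 \<le> l2" "l2 \<le> n2" "1 \<le> l3" "l3 \<le> n3" using l mn by auto
        have z: "(real l1 * \<tau>1 n1, real l2 * \<tau>2 n2, real l3 * \<tau>3 n3) \<in> cbox (0, 0, 0) (\<tau>bar1, \<tau>bar2, \<tau>bar3)"
          using sampling_points[OF lr(1,2)] sampling_points[OF lr(3,4)] sampling_points[OF lr(5,6)]
          by (auto simp: cbox_Pair_eq)
        show ?thesis
          using observations[of "int l1" n1 "int l2" n2 "int l3" n3 \<omega>] lr \<omega> local_alternative[OF n1 z]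
          by (simp add: D_def q_def)
      qed
      have "(\<Sum>l1 = 1..\<lfloor>real n1 * s\<rfloor>. \<Sum>l2 = 1..int n2. \<Sum>l3 = 1..int n3.
          (y (n1, n2, n3) (l1, l2, l3) \<omega> - f0 (of_int l1 * \<tau>1 n1, of_int l2 * \<tau>2 n2, of_int l3 * \<tau>3 n3))
          * \<phi> (t - of_int l1 * \<tau>1 n1) (r2 - of_int l2 * \<tau>2 n2) (r3 - of_int l3 * \<tau>3 n3))
        = (\<Sum>l1=1..m. \<Sum>l2=1..n2. \<Sum>l3=1..n3. (D l1 l2 l3 + \<epsilon> (int l1, int l2, int l3) \<omega>) * P l1 l2 l3)"
        unfolding fl sum_int_nat of_int_of_nat_eq \<phi> P_def by (intro sum.cong refl arg_cong2[where f = "(*)"] res)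
      also have "\<dots> = (\<Sum>l1=1..m. \<Sum>l2=1..n2. \<Sum>l3=1..n3. \<epsilon> (int l1, int l2, int l3) \<omega> * P l1 l2 l3)
          + (\<Sum>l1=1..m. \<Sum>l2=1..n2. \<Sum>l3=1..n3. D l1 l2 l3 * P l1 l2 l3)"
        by (simp add: distrib_right sum.distrib add.commute)
      finally have L: "(\<Sum>l1 = 1..\<lfloor>real n1 * s\<rfloor>. \<Sum>l2 = 1..int n2. \<Sum>l3 = 1..int n3.
          (y (n1, n2, n3) (l1, l2, l3) \<omega> - f0 (of_int l1 * \<tau>1 n1, of_int l2 * \<tau>2 n2, of_int l3 * \<tau>3 n3))
          * \<phi> (t - of_int l1 * \<tau>1 n1) (r2 - of_int l2 * \<tau>2 n2) (r3 - of_int l3 * \<tau>3 n3)) = \<dots>" .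
      have sc: "scale (n1, n2, n3) = sqrt (\<tau>1 n1 * \<tau>2 n2 * \<tau>3 n3) * q"
        by (simp add: scale_def a1_def a2_def a3_def q_def real_sqrt_mult[symmetric] mult_ac)
      have "(\<Sum>l\<in>grid (n1, n2, n3). incr (n1, n2, n3) l (partial_sum \<epsilon> (n1, n2, n3) \<omega>) * coef (n1, n2, n3) l (s, t, r2, r3))
        = (\<Sum>l\<in>grid (n1, n2, n3). (case l of (l1, l2, l3) \<Rightarrow> \<epsilon> (int l1, int l2, int l3) \<omega> / q) * coef (n1, n2, n3) l (s, t, r2, r3))"
        by (intro sum.cong refl) (auto simp: incr_partial_sum q(2))
      also have "\<dots> = (\<Sum>l1=1..m. \<Sum>l2=1..n2. \<Sum>l3=1..n3. \<epsilon> (int l1, int l2, int l3) \<omega> * P l1 l2 l3) / q"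
        unfolding grid_sum[OF n1(1) s] m_def[symmetric] prod.case P_def sum_divide_distrib by simp
      finally have no: "noise (n1, n2, n3) (partial_sum \<epsilon> (n1, n2, n3) \<omega>) (s, t, r2, r3) = sqrt (\<tau>1 n1 * \<tau>2 n2 * \<tau>3 n3) *
          (\<Sum>l1=1..m. \<Sum>l2=1..n2. \<Sum>l3=1..n3. \<epsilon> (int l1, int l2, int l3) \<omega> * P l1 l2 l3)"
        unfolding noise_def sc using q(1) by simp
      have "(\<Sum>l\<in>grid (n1, n2, n3). (case l of (l1, l2, l3) \<Rightarrow> D l1 l2 l3) * coef (n1, n2, n3) l (s, t, r2, r3))
        = (\<Sum>l1=1..m. \<Sum>l2=1..n2. \<Sum>l3=1..n3. D l1 l2 l3 * P l1 l2 l3)"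
        unfolding grid_sum[OF n1(1) s] m_def[symmetric] prod.case P_def ..
      then have dr: "drift (n1, n2, n3) (s, t, r2, r3) = sqrt (\<tau>1 n1 * \<tau>2 n2 * \<tau>3 n3) *
          (\<Sum>l1=1..m. \<Sum>l2=1..n2. \<Sum>l3=1..n3. D l1 l2 l3 * P l1 l2 l3)"
        unfolding drift_def prod.case D_def q_def[symmetric] by (simp add: case_prod_unfold)
      show ?thesis
        unfolding n p' prod.case L psi_def no dr by (simp add: distrib_left)
    qed
  next
    show "AE \<omega> in N. \<forall>p\<in>cbox (s0, 0, 0, 0) (1, \<tau>bar1, \<tau>bar2, \<tau>bar3).
        (case p of (s, t, r2, r3) \<Rightarrow>
               sqrt (\<tau>bar1 * \<tau>bar2 * \<tau>bar3) * \<sigma> *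
                 parts_integral (0, 0, 0) (s, 1, 1)
                   (\<lambda>(z1, z2, z3). \<phi> (t - \<tau>bar1 * z1) (r2 - \<tau>bar2 * z2) (r3 - \<tau>bar3 * z3)) (B \<omega>)
               + 1 / sqrt (\<tau>bar1 * \<tau>bar2 * \<tau>bar3) *
                 integral {0..s * \<tau>bar1} (\<lambda>z1. integral {0..\<tau>bar2} (\<lambda>z2. integral {0..\<tau>bar3} (\<lambda>z3.
                   \<phi> (t - z1) (r2 - z2) (r3 - z3) * \<delta> (z1, z2, z3))))) = psi_limit (\<lambda>v. \<sigma> * B \<omega> v) p"
      using Bc
    proof eventually_elim
      case (elim \<omega>)
      define R where "R = max \<tau>bar1 (max \<tau>bar2 \<tau>bar3)"
      have R: "\<tau>bar1 \<le> R" "\<tau>bar2 \<le> R" "\<tau>bar3 \<le> R" unfolding R_def by auto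
      have L: "1 \<le> C * (1 + R)" using C \<tau>bar R mult_mono[of 1 C 1 "1 + R"] by simp
      note g = smooth_kernel_c1_bound[OF k(1) less_imp_le[OF \<tau>bar(1)] R(1)] smooth_kernel_c1_bound[OF k(2) less_imp_le[OF \<tau>bar(2)] R(2)]
        smooth_kernel_c1_bound[OF k(3) less_imp_le[OF \<tau>bar(3)] R(3)]
      \<comment> \<open>The invariance principle has limit \<open>\<sigma> * B\<close>, whereas the
        limit process carries \<open>\<sigma>\<close> in front of the integral; homogeneity of
        \<open>parts3\<close> in the path reconciles the two.\<close>
      have scaled: "parts3 u v w s (\<lambda>x. \<sigma> * h x) = \<sigma> * parts3 u v w s h" for u v w s h
      proof -
        have "parts1 a a' r (\<lambda>z. \<sigma> * x z) = \<sigma> * parts1 a a' r x" for a a' r x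
          by (simp add: parts1_def algebra_simps)
        then show ?thesis unfolding parts3_def by simp
      qed
      show ?case
      proof
        fix p assume p: "p \<in> cbox (s0, 0, 0, 0) (1, \<tau>bar1, \<tau>bar2, \<tau>bar3)"
        obtain s t r2 r3 where p': "p = (s, t, r2, r3)" by (cases p)
        \<comment> \<open>Positivity, inherited from \<open>s0\<close>, makes the box from
          \<open>(0, 0, 0)\<close> to \<open>(s, 1, 1)\<close> nondegenerate, as
          \<open>parts_integral_triple\<close> requires.\<close>
        have s: "0 < s" "s \<le> 1" using p s0 unfolding p' by (auto simp: cbox_Pair_eq)
        show "(case p of (s, t, r2, r3) \<Rightarrow>
               sqrt (\<tau>bar1 * \<tau>bar2 * \<tau>bar3) * \<sigma> *
                 parts_integral (0, 0, 0) (s, 1, 1)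
                   (\<lambda>(z1, z2, z3). \<phi> (t - \<tau>bar1 * z1) (r2 - \<tau>bar2 * z2) (r3 - \<tau>bar3 * z3)) (B \<omega>)
               + 1 / sqrt (\<tau>bar1 * \<tau>bar2 * \<tau>bar3) *
                 integral {0..s * \<tau>bar1} (\<lambda>z1. integral {0..\<tau>bar2} (\<lambda>z2. integral {0..\<tau>bar3} (\<lambda>z3.
                   \<phi> (t - z1) (r2 - z2) (r3 - z3) * \<delta> (z1, z2, z3))))) = psi_limit (\<lambda>v. \<sigma> * B \<omega> v) p"
          unfolding p' prod.case psi_limit_def noise_limit_def drift_limit_def scaled \<phi>
            parts_integral_triple[OF L s g elim[unfolded unit_cube_def]] by simp
      qed
    qed
  qed
qed

end
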